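(* Let $k,\ell,d$ be positive integers satisfying at least one of the following two conditions: (i) $k\ge 3$, $k-\ell\le d<2\ell\le k-1$ and $2k-2\ell\ge \left(2(2k-2\ell-d)^2+1\right)(k-d-1)+1$; (ii) $k$ is odd, $k\ge 7$, $\ell=(k-1)/2$ and $d=k-3$. Then $$h_d^\ell(k)=1-\left(1-\frac{1}{2(k-\ell)}\right)^{k-d}.$$
   Context: A $k$-graph $H=(V,E)$ consists of a finite vertex set $V$ and a family $E$ of $k$-element subsets of $V$. For a $d$-set $S\subseteq V$, $\deg_H(S)$ is the number of $(k-d)$-sets $T\subseteq V$ with $T\cup S\in E$, and $\delta_d(H)$ is the minimum of $\deg_H(S)$ over all $d$-sets $S\subseteq V$. For $1\le \ell<k$, a $k$-graph is an $\ell$-cycle if there is a cyclic ordering of its vertices such that every edge consists of $k$ consecutive vertices and any two consecutive edges share exactly $\ell$ vertices (so an $\ell$-cycle on $n$ vertices has exactly $n/(k-\ell)$ edges, and every vertex is in an edge). A $k$-graph on $n$ vertices contains a Hamilton $\ell$-cycle if it contains an $\ell$-cycle as a spanning subhypergraph; this requires $(k-\ell)\mid n$. $h_d^\ell(k,n)$ is the smallest integer $h$ such that every $n$-vertex $k$-graph $H$ with $\delta_d(H)\ge h$ contains a Hamilton $\ell$-cycle, and $$h_d^\ell(k):=\limsup_{n\to\infty}\frac{h_d^\ell(k,n)}{\binom{n}{k-d}},$$ where $n$ ranges over multiples of $k-\ell$. *)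

theory Defs
  imports Complex_Main "HOL-Library.Ramsey" "HOL-Library.Extended_Real"
begin

text \<open>A \<open>k\<close>-graph is given by its vertex set and its edge set; \<^term>\<open>nsets V k\<close> is the
  family of \<open>k\<close>-element subsets of \<open>V\<close>.\<close>

definition kgraph :: "nat \<Rightarrow> 'a set \<Rightarrow> 'a set set \<Rightarrow> bool" where
  "kgraph k V E \<longleftrightarrow> finite V \<and> E \<subseteq> nsets V k"

definition hdeg :: "nat \<Rightarrow> 'a set \<Rightarrow> 'a set set \<Rightarrow> 'a set \<Rightarrow> nat" where
  "hdeg k V E S = card {T \<in> nsets V (k - card S). T \<union> S \<in> E}"

text \<open>Only meaningful if \<open>V\<close> is finite with at least \<open>d\<close> vertices; the minimum is unspecified
  otherwise.\<close>

definition min_deg :: "nat \<Rightarrow> nat \<Rightarrow> 'a set \<Rightarrow> 'a set set \<Rightarrow> nat" where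
  "min_deg k d V E = Min (hdeg k V E ` nsets V d)"

text \<open>The \<open>k\<close> consecutive vertices starting at position \<open>i\<close> in the cyclic ordering
  \<open>v 0, \<dots>, v (n - 1)\<close>.\<close>

definition cyclic_window :: "nat \<Rightarrow> nat \<Rightarrow> (nat \<Rightarrow> 'a) \<Rightarrow> nat \<Rightarrow> 'a set" where
  "cyclic_window k n v i = (\<lambda>j. v ((i + j) mod n)) ` {..<k}"

text \<open>The edges are listed in cyclic order by their starting positions \<open>s 0 < \<dots> < s (m - 1)\<close>,
  the last edge being followed by the first. The number of edges and the covering of all vertices
  are stated explicitly, since otherwise two edges with \<open>l\<close> common vertices (possibly with
  further isolated vertices) would also qualify.\<close>

definition is_ell_cycle :: "nat \<Rightarrow> nat \<Rightarrow> 'a set \<Rightarrow> 'a set set \<Rightarrow> bool" where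
  "is_ell_cycle k l V C \<longleftrightarrow> kgraph k V C \<and>
     (\<exists>v s m. bij_betw v {..<card V} V \<and>
        strict_mono_on {..<m} s \<and> s ` {..<m} \<subseteq> {..<card V} \<and>
        C = (\<lambda>i. cyclic_window k (card V) v (s i)) ` {..<m} \<and>
        (\<forall>i<m. card (cyclic_window k (card V) v (s i) \<inter>
                     cyclic_window k (card V) v (s (Suc i mod m))) = l) \<and>
        m * (k - l) = card V \<and> \<Union>C = V)"

definition has_ham_ell_cycle :: "nat \<Rightarrow> nat \<Rightarrow> 'a set \<Rightarrow> 'a set set \<Rightarrow> bool" where
  "has_ham_ell_cycle k l V E \<longleftrightarrow> (\<exists>C\<subseteq>E. is_ell_cycle k l V C)"

text \<open>As all notions are invariant under isomorphism, it suffices to let the vertex sets range over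
  finite sets of natural numbers. The defining set of thresholds is never empty, because every
  sufficiently large \<open>h\<close> exceeds all minimum degrees of \<open>n\<close>-vertex \<open>k\<close>-graphs.\<close>

definition ham_threshold :: "nat \<Rightarrow> nat \<Rightarrow> nat \<Rightarrow> nat \<Rightarrow> nat" where
  "ham_threshold d l k n =
     (LEAST h. \<forall>(V::nat set) E. kgraph k V E \<and> card V = n \<and> min_deg k d V E \<ge> h
        \<longrightarrow> has_ham_ell_cycle k l V E)"

text \<open>The limit superior over the multiples \<open>n = (k - l) m\<close> of \<open>k - l\<close>, where \<open>l < k\<close>.\<close>

definition ham_threshold_density :: "nat \<Rightarrow> nat \<Rightarrow> nat \<Rightarrow> ereal" where
  "ham_threshold_density d l k =
     limsup (\<lambda>m. ereal (real (ham_threshold d l k ((k - l) * m)) /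
                        real (((k - l) * m) choose (k - d))))"

end

theory Submission imports Defs begin

text \<open>Write \<open>t = 2 (k - l)\<close>, \<open>s = k - d\<close> and \<open>\<delta> = 1 - (1 - 1 / t) ^ s\<close>.

  Lower bound: as \<open>2 l < k\<close>, a vertex lies in at most two edges of an \<open>l\<close>-cycle, so a set \<open>A\<close> with
  fewer than \<open>n / t\<close> vertices cannot meet all \<open>n / (k - l)\<close> edges of a Hamilton \<open>l\<close>-cycle. In the
  \<open>k\<close>-graph of all \<open>k\<close>-sets that meet \<open>A\<close>, the relative minimum \<open>d\<close>-degree tends to \<open>\<delta>\<close>.

  Upper bound, by the absorption method. If nonnegative weights on \<open>U\<close> have mean at most \<open>1\<close>, then an
  \<open>s\<close>-tuple has total weight at least \<open>t\<close> in at most a proportion \<open>\<delta>\<close> of all cases. Hence a degree above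
  \<open>\<delta>\<close> forces edges that are light when the vertices in the overlaps are counted with weight one half, and
  walking in a blow-up of such an edge gives a long \<open>l\<close>-path whose weight hardly exceeds its number of
  vertices. With weights taken from an exponential potential over all \<open>d\<close>-sets, such paths can
  be removed greedily without destroying the degree condition in the remaining set, so a path covers
  almost everything. The few vertices that are left over are swallowed by an absorbing path, built
  beforehand from gadgets that were chosen greedily by the method of conditional expectations.\<close>

section \<open>Tuples and blow-ups\<close>

text \<open>A long path in the blow-up of an edge uses a class outside its overlaps once per edge,
  and an overlap class about once per two edges. So if the weights have mean one, a path of average
  weight needs edges of weighted total about \<open>k - l\<close>, half of \<open>t\<close>. Since
  \<open>d \<ge> k - l\<close>, the \<open>k - 2 * l\<close> positions of full weight are among
  \<open>d\<close> positions that may be filled with vertices of small weight; the other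
  \<open>k - d \<le> l\<close> positions have weight one half, so their weights may add up to
  \<open>t\<close>. Here the tail estimate enters. It is sharp for weight \<open>t\<close> on a
  proportion \<open>1 / t\<close> of the vertices, which is the extremal set \<open>A\<close>. Every
  connection between two paths uses boundedly many vertices of uncontrolled weight. The paths are
  therefore taken long, with an excess weight that stays bounded as their length grows. Roughly
  \<open>n ^ d\<close> degrees must survive linearly many removals; the potential does the work of a
  union bound over concentration inequalities. Its parameter \<open>sqrt n\<close> is large against
  \<open>ln n\<close>, but small enough for the quadratic error terms to stay bounded in
  total.\<close>

definition tup :: "'a set \<Rightarrow> nat \<Rightarrow> 'a list set" where
  "tup U q = {xs. set xs \<subseteq> U \<and> length xs = q}"

lemma finite_tup [simp]: "finite U \<Longrightarrow> finite (tup U q)"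
  unfolding tup_def by (rule finite_lists_length_eq)

lemma card_tup: "finite U \<Longrightarrow> card (tup U q) = card U ^ q"
  unfolding tup_def by (rule card_lists_length_eq)

lemma tup_0 [simp]: "tup U 0 = {[]}"
  by (auto simp: tup_def)

lemma card_tup_Suc:
  assumes "finite U"
  shows "card {xs \<in> tup U (Suc q). P xs} = (\<Sum>x\<in>U. card {ys \<in> tup U q. P (x # ys)})"
proof -
  have "{xs \<in> tup U (Suc q). P xs} = (\<lambda>(x, ys). x # ys) ` (SIGMA x:U. {ys \<in> tup U q. P (x # ys)})"
    by (auto simp: tup_def image_iff length_Suc_conv)
  moreover have "inj_on (\<lambda>(x, ys). x # ys) (SIGMA x:U. {ys \<in> tup U q. P (x # ys)})"
    by (auto simp: inj_on_def)
  ultimately have "card {xs \<in> tup U (Suc q). P xs} = card (SIGMA x:U. {ys \<in> tup U q. P (x # ys)})"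
    by (simp add: card_image)
  also have "\<dots> = (\<Sum>x\<in>U. card {ys \<in> tup U q. P (x # ys)})"
    using assms by (intro card_SigmaI) auto
  finally show ?thesis .
qed

lemma card_filter_eq_sum:
  "finite A \<Longrightarrow> real (card {x \<in> A. P x}) = (\<Sum>x\<in>A. of_bool (P x))"
  by (simp add: of_bool_def sum.If_cases Int_def)

lemma sum_card_swap:
  assumes "finite A" "finite B"
  shows "(\<Sum>x\<in>A. card {y \<in> B. P x y}) = (\<Sum>y\<in>B. card {x \<in> A. P x y})"
proof -
  have "real (\<Sum>x\<in>A. card {y \<in> B. P x y}) = real (\<Sum>y\<in>B. card {x \<in> A. P x y})"
    unfolding of_nat_sum card_filter_eq_sum[OF assms(1)] card_filter_eq_sum[OF assms(2)]
    by (rule sum.swap)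
  then show ?thesis by linarith
qed

text \<open>The tangent at \<open>a\<close> lies below a convex power; in the inductive step the
  slack is the square term \<open>real (Suc p) * a ^ p * (x - a)\<^sup>2\<close>.\<close>

lemma power_tangent:
  fixes x a :: real
  assumes "x \<ge> 0" "a \<ge> 0"
  shows "x ^ Suc p \<ge> a ^ Suc p + real (Suc p) * a ^ p * (x - a)"
proof (induction p)
  case (Suc p)
  have "x * (a ^ Suc p + real (Suc p) * a ^ p * (x - a)) - (a ^ Suc (Suc p) + real (Suc (Suc p)) * a ^ Suc p * (x - a))
      = real (Suc p) * a ^ p * (x - a)\<^sup>2"
    by (simp add: algebra_simps power2_eq_square)
  moreover have "real (Suc p) * a ^ p * (x - a)\<^sup>2 \<ge> 0" using assms by simp
  moreover have "x * (a ^ Suc p + real (Suc p) * a ^ p * (x - a)) \<le> x ^ Suc (Suc p)"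
    using mult_left_mono[OF Suc.IH assms(1)] by simp
  ultimately show ?case by linarith
qed simp

text \<open>Jensen's inequality by summing tangents. They are taken at a lower bound
  \<open>a\<close> of the mean instead of the mean itself, so that the linear terms leave a
  nonnegative remainder and no division by \<open>card I\<close> occurs.\<close>

lemma sum_power_ge:
  fixes x :: "'a \<Rightarrow> real" and a :: real
  assumes "\<And>i. i \<in> I \<Longrightarrow> x i \<ge> 0" "a \<ge> 0" "a * card I \<le> sum x I"
  shows "real (card I) * a ^ p \<le> (\<Sum>i\<in>I. x i ^ p)"
proof (cases p)
  case (Suc r)
  have "(\<Sum>i\<in>I. a ^ Suc r + real (Suc r) * a ^ r * (x i - a)) \<le> (\<Sum>i\<in>I. x i ^ Suc r)"
    using assms by (intro sum_mono power_tangent) auto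
  moreover have "(\<Sum>i\<in>I. a ^ Suc r + real (Suc r) * a ^ r * (x i - a))
     = card I * a ^ Suc r + real (Suc r) * a ^ r * (sum x I - a * card I)"
    by (simp only: sum.distrib sum_distrib_left[symmetric] sum_subtractf sum_constant) (simp add: mult.commute)
  moreover have "real (Suc r) * a ^ r * (sum x I - a * card I) \<ge> 0"
    using assms by simp
  ultimately show ?thesis using Suc by simp
qed simp

text \<open>If every transversal of a list of \<open>q\<close> lists lies in \<open>F\<close>, these
  lists are the parts of a complete \<open>q\<close>-partite blow-up inside
  \<open>F\<close>.\<close>

definition transv :: "'a list list \<Rightarrow> 'a list set" where
  "transv xss = {ys. list_all2 (\<lambda>y xs. y \<in> set xs) ys xss}"

lemma transv_Nil [simp]: "transv [] = {[]}"
  by (auto simp: transv_def)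

lemma ball_transv_Cons:
  "(\<forall>ys\<in>transv (xs # xss). P ys) \<longleftrightarrow> (\<forall>ys\<in>transv xss. \<forall>x\<in>set xs. P (x # ys))"
  by (auto simp: transv_def list_all2_Cons2)

text \<open>Supersaturation for complete \<open>q\<close>-partite hypergraphs, counted with
  repetition. One coordinate is blown up at a time, at the cost of two applications of Jensen:
  density \<open>c\<close> becomes \<open>c ^ B\<close> on average for the tails common to a
  \<open>B\<close>-tuple of heads, and the induction hypothesis raises this to the power
  \<open>B ^ q\<close>.\<close>

lemma blow_up_count:
  fixes U :: "'a set" and c :: real
  assumes "finite U" "U \<noteq> {}"
  shows "\<lbrakk>c \<ge> 0; c * card U ^ q \<le> card {xs \<in> tup U q. P xs}\<rbrakk> \<Longrightarrow>
     c ^ (B ^ q) * card U ^ (B * q) \<le> card {xss \<in> tup (tup U B) q. \<forall>ys\<in>transv xss. P ys}"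
proof (induction q arbitrary: P c)
  case 0
  have "{xs \<in> tup U 0. P xs} = (if P [] then {[]} else {})" by auto
  moreover have "{xss \<in> tup (tup U B) 0. \<forall>ys\<in>transv xss. P ys} = (if P [] then {[]} else {})" by auto
  ultimately show ?case using 0 by (auto split: if_splits)
next
  case (Suc q)
  let ?u = "real (card U)"
  have u: "?u > 0" using assms by (simp add: card_gt_0_iff)
  define N where "N hs = card {ys \<in> tup U q. \<forall>h\<in>set hs. P (h # ys)}" for hs
  define e where "e hs = real (N hs) / ?u ^ q" for hs
  define deg where "deg ys = card {x \<in> U. P (x # ys)}" for ys
  have "real (\<Sum>ys\<in>tup U q. deg ys) = card {xs \<in> tup U (Suc q). P xs}"
    unfolding deg_def card_tup_Suc[OF assms(1)]
    using sum_card_swap[of U "tup U q" "\<lambda>x ys. P (x # ys)"] assms by simp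
  then have "(c * ?u) * card (tup U q) \<le> (\<Sum>ys\<in>tup U q. real (deg ys))"
    using Suc.prems by (simp add: card_tup assms algebra_simps)
  \<comment> \<open>First Jensen, for the degrees of the tails. The sum of their \<open>B\<close>-th
    powers counts pairs of a tail and a \<open>B\<close>-tuple of heads that all fit it.\<close>
  then have 1: "real (card (tup U q)) * (c * ?u) ^ B \<le> (\<Sum>ys\<in>tup U q. real (deg ys) ^ B)"
    using Suc.prems by (intro sum_power_ge) auto
  have "(\<Sum>hs\<in>tup U B. N hs) = (\<Sum>ys\<in>tup U q. card {hs \<in> tup U B. \<forall>h\<in>set hs. P (h # ys)})"
    unfolding N_def using assms by (intro sum_card_swap) auto
  also have "\<dots> = (\<Sum>ys\<in>tup U q. deg ys ^ B)"
  proof (intro sum.cong refl)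
    fix ys assume "ys \<in> tup U q"
    have "{hs \<in> tup U B. \<forall>h\<in>set hs. P (h # ys)} = tup {x \<in> U. P (x # ys)} B"
      by (auto simp: tup_def)
    then show "card {hs \<in> tup U B. \<forall>h\<in>set hs. P (h # ys)} = deg ys ^ B"
      using assms by (simp add: card_tup deg_def)
  qed
  finally have "real (\<Sum>hs\<in>tup U B. N hs) = (\<Sum>ys\<in>tup U q. real (deg ys) ^ B)"
    by simp
  with 1 have "?u ^ q * (c * ?u) ^ B \<le> (\<Sum>hs\<in>tup U B. real (N hs))"
    by (simp add: card_tup assms)
  then have "(c * ?u) ^ B \<le> (\<Sum>hs\<in>tup U B. e hs)"
    unfolding e_def sum_divide_distrib[symmetric] using u by (simp add: field_simps)
  then have "c ^ B * card (tup U B) \<le> (\<Sum>hs\<in>tup U B. e hs)"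
    by (simp add: card_tup assms power_mult_distrib)
  \<comment> \<open>Second Jensen: the induction hypothesis is applied to each \<open>hs\<close>
    with its own density \<open>e hs\<close>, so a lower bound for the sum of the powers
    \<open>e hs ^ (B ^ q)\<close> is needed.\<close>
  then have 2: "real (card (tup U B)) * (c ^ B) ^ (B ^ q) \<le> (\<Sum>hs\<in>tup U B. e hs ^ (B ^ q))"
    using Suc.prems by (intro sum_power_ge) (auto simp: e_def)
  have "c ^ (B ^ Suc q) * ?u ^ (B * Suc q) = (card (tup U B) * (c ^ B) ^ (B ^ q)) * ?u ^ (B * q)"
    by (simp add: card_tup assms power_add power_mult)
  also have "\<dots> \<le> (\<Sum>hs\<in>tup U B. e hs ^ (B ^ q)) * ?u ^ (B * q)"
    using 2 u by (intro mult_right_mono) auto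
  also have "\<dots> = (\<Sum>hs\<in>tup U B. e hs ^ (B ^ q) * ?u ^ (B * q))"
    by (simp add: sum_distrib_right)
  also have "\<dots> \<le> (\<Sum>hs\<in>tup U B. real (card {xss \<in> tup (tup U B) q. \<forall>ys\<in>transv xss. \<forall>h\<in>set hs. P (h # ys)}))"
  proof (intro sum_mono)
    fix hs
    show "e hs ^ (B ^ q) * ?u ^ (B * q) \<le> real (card {xss \<in> tup (tup U B) q. \<forall>ys\<in>transv xss. \<forall>h\<in>set hs. P (h # ys)})"
      using Suc.IH[of "e hs" "\<lambda>ys. \<forall>h\<in>set hs. P (h # ys)"] u by (simp add: e_def N_def)
  qed
  also have "\<dots> = real (card {xss \<in> tup (tup U B) (Suc q). \<forall>ys\<in>transv xss. P ys})"
    by (simp add: card_tup_Suc assms ball_transv_Cons)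
  finally show ?case by simp
qed

text \<open>A union bound: an entry goes wrong by hitting \<open>R\<close> or one of fewer than
  \<open>q\<close> others. Both sides are multiplied by \<open>card U\<close>, which keeps the bound
  valid for empty \<open>U\<close>.\<close>

lemma card_bad_tup:
  assumes "finite U" "finite R"
  shows "card {xs \<in> tup U q. \<not> (distinct xs \<and> set xs \<inter> R = {})} * card U \<le> q * (q + card R) * card U ^ q"
proof (induction q)
  case (Suc q)
  let ?bad = "{ys \<in> tup U q. \<not> (distinct ys \<and> set ys \<inter> R = {})}"
  have "card {xs \<in> tup U (Suc q). \<not> (distinct xs \<and> set xs \<inter> R = {})}
      = (\<Sum>ys\<in>tup U q. card {x \<in> U. \<not> (distinct (x # ys) \<and> set (x # ys) \<inter> R = {})})"
    unfolding card_tup_Suc[OF assms(1)] using assms by (intro sum_card_swap) auto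
  also have "\<dots> \<le> (\<Sum>ys\<in>tup U q. card U * of_bool (ys \<in> ?bad) + (q + card R))"
  proof (intro sum_mono)
    fix ys assume ys: "ys \<in> tup U q"
    show "card {x \<in> U. \<not> (distinct (x # ys) \<and> set (x # ys) \<inter> R = {})}
        \<le> card U * of_bool (ys \<in> ?bad) + (q + card R)"
    proof (cases "ys \<in> ?bad")
      case True
      then show ?thesis using assms by (auto intro: trans_le_add1 card_mono)
    next
      case False
      then have "{x \<in> U. \<not> (distinct (x # ys) \<and> set (x # ys) \<inter> R = {})} \<subseteq> set ys \<union> R"
        using ys by auto
      then have "card {x \<in> U. \<not> (distinct (x # ys) \<and> set (x # ys) \<inter> R = {})} \<le> card (set ys \<union> R)"
        using assms by (intro card_mono) auto
      also have "\<dots> \<le> card (set ys) + card R" by (rule card_Un_le)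
      also have "card (set ys) \<le> q" using ys card_length[of ys] by (auto simp: tup_def)
      finally show ?thesis by simp
    qed
  qed
  also have "\<dots> = card U * card ?bad + (q + card R) * card U ^ q"
    using assms by (simp add: sum.distrib card_tup flip: sum_distrib_left)
      (simp add: of_bool_def sum.If_cases Int_def)
  finally have "card {xs \<in> tup U (Suc q). \<not> (distinct xs \<and> set xs \<inter> R = {})} * card U
     \<le> (card U * card ?bad + (q + card R) * card U ^ q) * card U" by (rule mult_le_mono1)
  also have "\<dots> = card U * (card ?bad * card U) + (q + card R) * card U ^ Suc q"
    by (simp add: algebra_simps)
  also have "\<dots> \<le> card U * (q * (q + card R) * card U ^ q) + (q + card R) * card U ^ Suc q"
    using Suc.IH by (intro add_right_mono mult_le_mono2)
  also have "\<dots> = (q * (q + card R) + (q + card R)) * card U ^ Suc q"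
    by (simp add: algebra_simps)
  also have "\<dots> \<le> Suc q * (Suc q + card R) * card U ^ Suc q"
    by (intro mult_le_mono) (auto simp: algebra_simps)
  finally show ?case .
qed simp

lemma dense_filter:
  fixes c :: real
  assumes "finite U" "finite R" "U \<noteq> {}" "F \<subseteq> tup U q"
    and "c * card U ^ q \<le> card F"
  shows "(c - q * (q + card R) / card U) * card U ^ q
       \<le> card {xs \<in> F. distinct xs \<and> set xs \<inter> R = {}}"
proof -
  let ?bad = "{xs \<in> tup U q. \<not> (distinct xs \<and> set xs \<inter> R = {})}"
  have u: "real (card U) > 0" using assms by (simp add: card_gt_0_iff)
  have "F \<subseteq> {xs \<in> F. distinct xs \<and> set xs \<inter> R = {}} \<union> ?bad" using assms by auto
  then have "card F \<le> card ({xs \<in> F. distinct xs \<and> set xs \<inter> R = {}} \<union> ?bad)"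
    using assms finite_subset[OF assms(4)] by (intro card_mono) auto
  also have "\<dots> \<le> card {xs \<in> F. distinct xs \<and> set xs \<inter> R = {}} + card ?bad" by (rule card_Un_le)
  finally have 1: "real (card F) \<le> card {xs \<in> F. distinct xs \<and> set xs \<inter> R = {}} + real (card ?bad)" by linarith
  have "real (card ?bad * card U) \<le> real (q * (q + card R) * card U ^ q)"
    using card_bad_tup[OF assms(1,2), of q] by (simp only: of_nat_le_iff)
  then have "real (card ?bad) \<le> q * (q + card R) / card U * card U ^ q"
    using u by (simp add: field_simps)
  then show ?thesis using 1 assms(5) by (simp add: algebra_simps)
qed

lemma dense_pick:
  fixes c :: real
  assumes "finite U" "finite R" "F \<subseteq> tup U q"
    and "c * card U ^ q \<le> card F" "q * (q + card R) < c * card U" 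
  obtains xs where "xs \<in> F" "distinct xs" "set xs \<inter> R = {}"
proof -
  have "0 \<le> real (q * (q + card R))" by simp
  then have "0 < c * card U" using assms(5) by linarith
  then have u: "real (card U) > 0" by (cases "card U = 0") auto
  then have ne: "U \<noteq> {}" by auto
  have "(c - q * (q + card R) / card U) > 0" using u assms(5) by (simp add: field_simps)
  then have "(c - q * (q + card R) / card U) * card U ^ q > 0" using u by simp
  then have "card {xs \<in> F. distinct xs \<and> set xs \<inter> R = {}} > 0"
    using dense_filter[OF assms(1,2) ne assms(3,4)] by linarith
  then have "{xs \<in> F. distinct xs \<and> set xs \<inter> R = {}} \<noteq> {}"
    by (metis card.empty less_numeral_extra(3))
  then show ?thesis using that by blast
qed

lemma dense_append:
  fixes a b :: real
  assumes "finite U" "F \<subseteq> tup U p" "a * card U ^ p \<le> card F" "b \<ge> 0"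
    and "\<And>ys. ys \<in> F \<Longrightarrow> G ys \<subseteq> tup U q \<and> b * card U ^ q \<le> card (G ys)"
  shows "a * b * card U ^ (p + q) \<le> card {ys @ zs |ys zs. ys \<in> F \<and> zs \<in> G ys}"
    and "{ys @ zs |ys zs. ys \<in> F \<and> zs \<in> G ys} \<subseteq> tup U (p + q)"
proof -
  let ?H = "{ys @ zs |ys zs. ys \<in> F \<and> zs \<in> G ys}"
  show sub: "?H \<subseteq> tup U (p + q)" using assms(2,5) unfolding tup_def by fastforce
  have finF: "finite F" using finite_subset[OF assms(2)] assms(1) by simp
  have finG: "finite (G ys)" if "ys \<in> F" for ys
    using assms(5)[OF that] finite_subset assms(1) finite_tup by blast
  have "?H = (\<lambda>(ys, zs). ys @ zs) ` (SIGMA ys:F. G ys)" by auto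
  moreover have "inj_on (\<lambda>(ys, zs). ys @ zs) (SIGMA ys:F. G ys)"
  proof (clarsimp simp: inj_on_def)
    fix ys zs ys' zs' assume "ys \<in> F" "ys' \<in> F" "ys @ zs = ys' @ zs'"
    moreover from this have "length ys = length ys'" using assms(2) by (auto simp: tup_def)
    ultimately show "ys = ys' \<and> zs = zs'" by auto
  qed
  ultimately have "card ?H = (\<Sum>ys\<in>F. card (G ys))"
    using finF finG by (simp add: card_image)
  then have "real (card ?H) = (\<Sum>ys\<in>F. real (card (G ys)))" by simp
  also have "\<dots> \<ge> (\<Sum>ys\<in>F. b * real (card U ^ q))" using assms(5) by (intro sum_mono) auto
  finally have 1: "card F * (b * card U ^ q) \<le> real (card ?H)" by simp
  have "(a * card U ^ p) * (b * card U ^ q) \<le> card F * (b * card U ^ q)"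
    using assms(3,4) by (intro mult_right_mono) auto
  with 1 show "a * b * card U ^ (p + q) \<le> card ?H" by (simp add: power_add algebra_simps)
qed

section \<open>Paths and cycles\<close>

lemma inj_on_add_mod: "inj_on (\<lambda>x. (a + x) mod n) {..<n::nat}"
proof -
  have "x = y" if "x \<le> y" "y < n" "(a + x) mod n = (a + y) mod n" for x y
  proof -
    have "n dvd (a + y) - (a + x)" using that by (metis mod_eq_dvd_iff_nat add_le_mono1 add.commute)
    then have "n dvd y - x" by simp
    then show ?thesis using that by (metis diff_diff_cancel diff_is_0_eq dvd_imp_le less_imp_diff_less
        linorder_not_less nat_neq_iff zero_less_diff)
  qed
  then show ?thesis unfolding inj_on_def by (metis lessThan_iff nle_le)
qed

text \<open>The range shared by the two cases of the theorem. \<open>2 * l < k\<close> leaves each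
  vertex of an \<open>l\<close>-cycle in at most two edges. \<open>k - l \<le> d\<close> makes the
  degree condition apply to every set of at most \<open>k - l\<close> vertices, in particular to the
  union of two overlaps that differ in one vertex, and it gives
  \<open>k - d \<le> l\<close>.\<close>

locale loose =
  fixes k l d :: nat
  assumes l_pos: "0 < l" and two_l: "2 * l < k" and kl_d: "k - l \<le> d" and d_k: "d < k"
begin

text \<open>The \<open>l\<close>-paths with \<open>m\<close> edges; only the two end sets \<open>L\<close>, \<open>L'\<close> of size \<open>l\<close> and the set \<open>W\<close> of the
  remaining vertices are recorded. The order inside an end is irrelevant for gluing.\<close>

inductive pth :: "'a set set \<Rightarrow> 'a set \<Rightarrow> nat \<Rightarrow> 'a set \<Rightarrow> 'a set \<Rightarrow> bool" for E where
  edge: "\<lbrakk>L \<union> W \<union> L' \<in> E; finite L; finite W; finite L'; card L = l; card W = k - 2 * l; card L' = l;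
     L \<inter> W = {}; L \<inter> L' = {}; W \<inter> L' = {}\<rbrakk> \<Longrightarrow> pth E L 1 W L'"
| comp: "\<lbrakk>pth E L m W M; pth E M m' W' L'; (L \<union> W) \<inter> (W' \<union> L') = {}\<rbrakk>
     \<Longrightarrow> pth E L (m + m') (W \<union> M \<union> W') L'"

lemma pth_facts:
  assumes "pth E L m W L'"
  shows "finite L" "finite W" "finite L'" "card L = l" "card L' = l"
    "L \<inter> W = {}" "L \<inter> L' = {}" "W \<inter> L' = {}" "m \<ge> 1" "card W + l = m * (k - l)"
proof -
  have "finite L \<and> finite W \<and> finite L' \<and> card L = l \<and> card L' = l \<and>
    L \<inter> W = {} \<and> L \<inter> L' = {} \<and> W \<inter> L' = {} \<and> m \<ge> 1 \<and> card W + l = m * (k - l)"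
    using assms
  proof induction
    case (edge L W L')
    then show ?case using two_l by auto
  next
    case (comp L m W M m' W' L')
    then have "card (W \<union> M \<union> W') = card W + l + card W'"
      by (subst card_Un_disjoint; (subst card_Un_disjoint)?) auto
    then show ?case using comp by (auto simp: algebra_simps)
  qed
  then show "finite L" "finite W" "finite L'" "card L = l" "card L' = l"
    "L \<inter> W = {}" "L \<inter> L' = {}" "W \<inter> L' = {}" "m \<ge> 1" "card W + l = m * (k - l)" by auto
qed

text \<open>Both ends may be listed in any order prescribed in advance; this is what lets two lists
  be glued along one listing \<open>zs\<close> of the common end.\<close>

lemma pth_list:
  assumes "pth E L m W L'" "set xs = L" "distinct xs" "set ys = L'" "distinct ys"
  shows "\<exists>ws. set ws = W \<and> distinct ws \<and>
     (\<forall>i<m. set (take k (drop (i * (k - l)) (xs @ ws @ ys))) \<in> E)"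
  using assms
proof (induction arbitrary: xs ys)
  case (edge L W L')
  obtain ws where ws: "set ws = W" "distinct ws"
    using finite_distinct_list edge.hyps(3) by blast
  have "length (xs @ ws @ ys) = k"
    using edge.prems edge.hyps ws two_l distinct_card[of xs] distinct_card[of ys] distinct_card[of ws]
    by simp
  then have "take k (xs @ ws @ ys) = xs @ ws @ ys" by simp
  then have "set (take k (xs @ ws @ ys)) \<in> E"
    using edge.prems edge.hyps(1) ws by (simp add: Un_assoc)
  then show ?case using ws by (intro exI[of _ ws]) simp
next
  case (comp L m W M m' W' L')
  note f1 = pth_facts[OF comp.hyps(1)] and f2 = pth_facts[OF comp.hyps(2)]
  obtain zs where zs: "set zs = M" "distinct zs" using finite_distinct_list f2(1) by blast
  obtain ws where ws: "set ws = W" "distinct ws"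
    "\<And>i. i < m \<Longrightarrow> set (take k (drop (i * (k - l)) (xs @ ws @ zs))) \<in> E"
    using comp.IH(1)[OF comp.prems(1,2) zs] by blast
  obtain ws' where ws': "set ws' = W'" "distinct ws'"
    "\<And>i. i < m' \<Longrightarrow> set (take k (drop (i * (k - l)) (zs @ ws' @ ys))) \<in> E"
    using comp.IH(2)[OF zs comp.prems(3,4)] by blast
  have lxs: "length xs = l" using distinct_card[OF comp.prems(2)] comp.prems(1) f1(4) by simp
  have lws: "length ws + l = m * (k - l)" using distinct_card[OF ws(2)] ws(1) f1(10) by simp
  have lzs: "length zs = l" using distinct_card[OF zs(2)] zs(1) f1(5) by simp
  show ?case
  proof (intro exI[of _ "ws @ zs @ ws'"] conjI allI impI)
    show "set (ws @ zs @ ws') = W \<union> M \<union> W'" using ws(1) ws'(1) zs by auto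
    show "distinct (ws @ zs @ ws')"
      using ws(1,2) ws'(1,2) zs f1(8) f2(6) comp.hyps(3) by auto
    fix i assume i: "i < m + m'"
    show "set (take k (drop (i * (k - l)) (xs @ (ws @ zs @ ws') @ ys))) \<in> E"
    \<comment> \<open>Both halves contain the listing \<open>zs\<close> of the common end, so every
      window lies completely in one of the halves.\<close>
    proof (cases "i < m")
      case True
      then obtain r where r: "m = Suc i + r" using less_iff_Suc_add[of i m] by auto
      have "length (xs @ ws @ zs) = m * (k - l) + l" using lxs lws lzs by simp
      also have "\<dots> = i * (k - l) + ((k - l) + l) + r * (k - l)"
        unfolding r by (simp only: add_mult_distrib add_mult_distrib2 mult_Suc mult_Suc_right ac_simps)
      also have "(k - l) + l = k" using two_l by simp
      finally have len: "length (xs @ ws @ zs) = i * (k - l) + k + r * (k - l)" .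
      have "take k (drop (i * (k - l)) ((xs @ ws @ zs) @ (ws' @ ys)))
          = take k (drop (i * (k - l)) (xs @ ws @ zs))"
        unfolding drop_append take_append using len by simp
      moreover have "xs @ (ws @ zs @ ws') @ ys = (xs @ ws @ zs) @ (ws' @ ys)" by simp
      ultimately show ?thesis using ws(3)[OF True] by (simp only:)
    next
      case False
      then obtain r where r: "i = m + r" using le_Suc_ex[of m i] by auto
      have "length (xs @ ws) = m * (k - l)" using lxs lws by simp
      then have "drop (i * (k - l)) ((xs @ ws) @ (zs @ ws' @ ys)) = drop (r * (k - l)) (zs @ ws' @ ys)"
        unfolding drop_append using r by (simp add: algebra_simps)
      moreover have "xs @ (ws @ zs @ ws') @ ys = (xs @ ws) @ (zs @ ws' @ ys)" by simp
      moreover have "r < m'" using r i by simp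
      ultimately show ?thesis using ws'(3)[of r] by (simp only:)
    qed
  qed
qed

text \<open>Two paths between the same ends in opposite directions close to a cycle. With at least
  three edges, a window and its successor cannot meet on both sides, so they share exactly
  \<open>l\<close> vertices.\<close>

lemma ham_cycle_of_pths:
  assumes p: "pth E L m W L'" and p': "pth E L' m' W' L"
    and dis: "W \<inter> W' = {}" and V: "V = L \<union> W \<union> L' \<union> W'" and E: "E \<subseteq> nsets V k"
    and m3: "m + m' \<ge> 3"
  shows "has_ham_ell_cycle k l V E"
proof -
  note f1 = pth_facts[OF p] and f2 = pth_facts[OF p']
  obtain xs where xs: "set xs = L" "distinct xs" using finite_distinct_list f1(1) by blast
  obtain ys where ys: "set ys = L'" "distinct ys" using finite_distinct_list f1(3) by blast
  obtain ws where ws: "set ws = W" "distinct ws"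
    "\<And>i. i < m \<Longrightarrow> set (take k (drop (i * (k - l)) (xs @ ws @ ys))) \<in> E"
    using pth_list[OF p xs ys] by blast
  obtain ws' where ws': "set ws' = W'" "distinct ws'"
    "\<And>i. i < m' \<Longrightarrow> set (take k (drop (i * (k - l)) (ys @ ws' @ xs))) \<in> E"
    using pth_list[OF p' ys xs] by blast
  have lxs: "length xs = l" using distinct_card[OF xs(2)] xs(1) f1(4) by simp
  have lys: "length ys = l" using distinct_card[OF ys(2)] ys(1) f1(5) by simp
  have lws: "length ws + l = m * (k - l)" using distinct_card[OF ws(2)] ws(1) f1(10) by simp
  have lws': "length ws' + l = m' * (k - l)" using distinct_card[OF ws'(2)] ws'(1) f2(10) by simp
  define vs where "vs = xs @ ws @ ys @ ws'"
  define g where "g = k - l"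
  define n where "n = card V"
  define M where "M = m + m'"
  have dvs: "distinct vs" and svs: "set vs = V"
    using xs ys ws(1,2) ws'(1,2) f1(6-8) f2(6-8) dis V by (auto simp: vs_def)
  have n: "n = length vs" using distinct_card[OF dvs] svs n_def by simp
  have nM: "n = M * g" using n lxs lys lws lws' by (simp add: vs_def M_def g_def algebra_simps)
  have finV: "finite V" using svs by auto
  have gk: "g < k" "l < g" "g + l = k" "k < 2 * g" using two_l l_pos by (auto simp: g_def)
  \<comment> \<open>A window and its successor occupy \<open>g + k\<close> consecutive positions;
    these are then distinct modulo \<open>n\<close>.\<close>
  have ng: "g + k \<le> n"
  proof -
    have "3 * g \<le> M * g" using m3 by (simp add: M_def)
    then show ?thesis using gk nM by linarith
  qed
  define v where "v i = vs ! i" for i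
  define s where "s i = i * g" for i
  have bij: "bij_betw v {..<n} V"
    unfolding v_def n using bij_betw_nth[OF dvs refl svs[symmetric]] .
  \<comment> \<open>Only the last window wraps around, and only by the \<open>l\<close> vertices of
    \<open>xs\<close>; repeating \<open>xs\<close> at the end of \<open>vs\<close> makes all windows
    linear.\<close>
  have win: "cyclic_window k n v (s i) = set (take k (drop (i * g) (vs @ xs)))" if "i < M" for i
  proof -
    have "Suc i * g \<le> M * g" using that by (intro mult_le_mono1) auto
    then have le: "i * g + k \<le> n + l" using nM gk(3) by simp
    have "set (take k (drop (i * g) (vs @ xs))) = (\<lambda>j. (vs @ xs) ! (i * g + j)) ` {..<k}"
    proof -
      have "take k (drop (i * g) (vs @ xs)) = map (\<lambda>j. (vs @ xs) ! (i * g + j)) [0..<k]"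
        using le n lxs by (intro nth_equalityI) (auto simp del: take_append drop_append)
      then show ?thesis by (simp add: atLeast0LessThan)
    qed
    also have "\<dots> = (\<lambda>j. v ((i * g + j) mod n)) ` {..<k}"
    proof (intro image_cong refl)
      fix j assume "j \<in> {..<k}"
      then have lt: "i * g + j < n + l" using le by auto
      show "(vs @ xs) ! (i * g + j) = v ((i * g + j) mod n)"
      proof (cases "i * g + j < n")
        case True
        then show ?thesis using n by (simp add: v_def nth_append)
      next
        case False
        then have "(i * g + j) mod n = i * g + j - n"
          using lt ng gk by (simp add: mod_if)
        moreover have "vs ! (i * g + j - n) = xs ! (i * g + j - n)"
        proof -
          have "i * g + j - n < length xs" using lt False lxs l_pos by linarith
          then show ?thesis by (simp add: vs_def nth_append)
        qed
        ultimately show ?thesis using False n by (simp add: v_def nth_append)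
      qed
    qed
    finally show ?thesis by (simp add: cyclic_window_def s_def)
  qed
  have edge: "cyclic_window k n v (s i) \<in> E" if i: "i < M" for i
  proof (cases "i < m")
    case True
    then obtain r where r: "m = Suc i + r" using less_iff_Suc_add[of i m] by auto
    have "length (xs @ ws @ ys) = m * g + l" using lxs lws lys by (simp add: g_def)
    also have "\<dots> = i * g + k + r * g"
      unfolding r gk(3)[symmetric] by (simp only: add_mult_distrib add_mult_distrib2 mult_Suc mult_Suc_right ac_simps)
    finally have len: "length (xs @ ws @ ys) = i * g + k + r * g" .
    have "take k (drop (i * g) ((xs @ ws @ ys) @ (ws' @ xs))) = take k (drop (i * g) (xs @ ws @ ys))"
      unfolding drop_append take_append using len by simp
    moreover have "vs @ xs = (xs @ ws @ ys) @ (ws' @ xs)" by (simp add: vs_def)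
    ultimately show ?thesis using ws(3)[OF True] win[OF i] by (simp only: g_def)
  next
    case False
    then obtain r where r: "i = m + r" using le_Suc_ex[of m i] by auto
    have "length (xs @ ws) = m * g" using lxs lws by (simp add: g_def)
    then have "drop (i * g) ((xs @ ws) @ (ys @ ws' @ xs)) = drop (r * g) (ys @ ws' @ xs)"
      unfolding drop_append using r by (simp add: algebra_simps)
    moreover have "vs @ xs = (xs @ ws) @ (ys @ ws' @ xs)" by (simp add: vs_def)
    moreover have "r < m'" using r i by (simp add: M_def)
    ultimately show ?thesis using ws'(3)[of r] win[OF i] by (simp only: g_def)
  qed
  have cardint: "card (cyclic_window k n v (s i) \<inter> cyclic_window k n v (s (Suc i mod M))) = l"
    if i: "i < M" for i
  proof -
    define h where "h x = v ((s i + x) mod n)" for x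
    have injh: "inj_on h {..<n}"
    proof -
      have "inj_on v ((\<lambda>x. (s i + x) mod n) ` {..<n})"
        using bij ng gk by (intro inj_on_subset[OF bij_betw_imp_inj_on[OF bij]]) auto
      then have "inj_on (v \<circ> (\<lambda>x. (s i + x) mod n)) {..<n}"
        using inj_on_add_mod by (intro comp_inj_on) auto
      then show ?thesis by (simp add: h_def[abs_def] comp_def)
    qed
    have 1: "cyclic_window k n v (s i) = h ` {..<k}"
      by (simp add: cyclic_window_def h_def)
    have sm: "s (Suc i mod M) mod n = (s i + g) mod n"
    proof (cases "Suc i = M")
      case True
      then have "s i + g = n" using nM by (auto simp: s_def)
      then show ?thesis using True by (simp add: s_def)
    next
      case False
      then show ?thesis using i by (simp add: s_def add.commute)
    qed
    have 2: "cyclic_window k n v (s (Suc i mod M)) = h ` {g..<g + k}"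
    proof -
      have "(s (Suc i mod M) + j) mod n = (s i + (g + j)) mod n" for j
        using sm by (metis add.assoc mod_add_left_eq)
      then have "cyclic_window k n v (s (Suc i mod M)) = (\<lambda>j. h (g + j)) ` {..<k}"
        by (simp add: cyclic_window_def h_def)
      also have "\<dots> = h ` ((+) g ` {..<k})" by (simp add: image_image)
      also have "(+) g ` {..<k} = {g..<g + k}"
        by (simp add: lessThan_atLeast0 add.commute)
      finally show ?thesis .
    qed
    have sub: "{..<k} \<subseteq> {..<n}" "{g..<g + k} \<subseteq> {..<n}" "{g..<k} \<subseteq> {..<n}"
      using ng by auto
    have "h ` {..<k} \<inter> h ` {g..<g + k} = h ` ({..<k} \<inter> {g..<g + k})"
      by (rule inj_on_image_Int[OF injh sub(1,2), symmetric])
    also have "{..<k} \<inter> {g..<g + k} = {g..<k}" using gk by auto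
    also have "card (h ` {g..<k}) = k - g"
      by (simp add: card_image[OF inj_on_subset[OF injh sub(3)]])
    finally show ?thesis using 1 2 gk by simp
  qed
  define C where "C = (\<lambda>i. cyclic_window k n v (s i)) ` {..<M}"
  have CE: "C \<subseteq> E" using edge by (auto simp: C_def)
  have UC: "\<Union>C = V"
  proof
    show "\<Union>C \<subseteq> V" using CE E by (auto simp: nsets_def)
    show "V \<subseteq> \<Union>C"
    proof
      fix x assume "x \<in> V"
      then obtain p where p: "p < n" "x = v p" using bij by (auto simp: bij_betw_def)
      have "p div g < M" using p nM gk by (simp add: less_mult_imp_div_less)
      moreover have "x \<in> cyclic_window k n v (s (p div g))"
      proof -
        have "s (p div g) + p mod g = p" by (simp add: s_def)
        moreover have "p mod g < k" using gk mod_less_divisor[of g p] by linarith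
        ultimately show ?thesis using p unfolding cyclic_window_def
          by (intro image_eqI[of _ _ "p mod g"]) auto
      qed
      ultimately show "x \<in> \<Union>C" by (auto simp: C_def)
    qed
  qed
  have "is_ell_cycle k l V C"
    unfolding is_ell_cycle_def
  proof (intro conjI exI[of _ v] exI[of _ s] exI[of _ M])
    show "kgraph k V C" using CE E finV by (auto simp: kgraph_def)
    show "bij_betw v {..<card V} V" using bij n_def by simp
    show "strict_mono_on {..<M} s" using gk by (auto simp: strict_mono_on_def s_def)
    show "s ` {..<M} \<subseteq> {..<card V}" using nM gk by (auto simp: s_def simp flip: n_def)
    show "C = (\<lambda>i. cyclic_window k (card V) v (s i)) ` {..<M}" by (simp add: C_def n_def)
    show "\<forall>i<M. card (cyclic_window k (card V) v (s i) \<inter> cyclic_window k (card V) v (s (Suc i mod M))) = l"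
      using cardint by (simp add: n_def)
    show "M * (k - l) = card V" using nM by (simp add: g_def n_def)
  qed (rule UC)
  then show ?thesis using CE by (auto simp: has_ham_ell_cycle_def)
qed

end

section \<open>Extending and blowing up dense families of tuples\<close>

lemma dense_extend:
  fixes c b :: real
  assumes "finite U" "finite R" "U \<noteq> {}" "F \<subseteq> tup U p" "c * card U ^ p \<le> card F" "c \<ge> 0" "b \<ge> 0"
    and G: "\<And>ys. ys \<in> F \<Longrightarrow> b * card U ^ q \<le> card {zs \<in> tup U q. Q ys zs}"
    and big: "(p + q) * (p + q + card R) \<le> c * b / 2 * card U"
  shows "c * b / 2 * card U ^ (p + q) \<le> card {xs \<in> tup U (p + q). take p xs \<in> F \<and>
     Q (take p xs) (drop p xs) \<and> distinct xs \<and> set xs \<inter> R = {}}"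
proof -
  let ?H = "{ys @ zs |ys zs. ys \<in> F \<and> zs \<in> {zs \<in> tup U q. Q ys zs}}"
  have u: "real (card U) > 0" using assms by (simp add: card_gt_0_iff)
  have H: "c * b * card U ^ (p + q) \<le> card ?H" "?H \<subseteq> tup U (p + q)"
    using dense_append[of U F p c b "\<lambda>ys. {zs \<in> tup U q. Q ys zs}" q] assms by auto
  \<comment> \<open>Half of the density pays for the tuples that repeat an entry or meet
    \<open>R\<close>.\<close>
  have "c * b / 2 \<le> c * b - (p + q) * (p + q + card R) / card U"
    using big u by (simp add: field_simps)
  then have "c * b / 2 * card U ^ (p + q) \<le> (c * b - (p + q) * (p + q + card R) / card U) * card U ^ (p + q)"
    by (intro mult_right_mono) auto
  also have "\<dots> \<le> card {xs \<in> ?H. distinct xs \<and> set xs \<inter> R = {}}"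
    using dense_filter[OF assms(1-3) H(2,1)] by simp
  also have "\<dots> \<le> card {xs \<in> tup U (p + q). take p xs \<in> F \<and>
     Q (take p xs) (drop p xs) \<and> distinct xs \<and> set xs \<inter> R = {}}"
  proof -
    have "{xs \<in> ?H. distinct xs \<and> set xs \<inter> R = {}} \<subseteq> {xs \<in> tup U (p + q). take p xs \<in> F \<and>
     Q (take p xs) (drop p xs) \<and> distinct xs \<and> set xs \<inter> R = {}}"
    proof (intro subsetI)
      fix xs assume "xs \<in> {xs \<in> ?H. distinct xs \<and> set xs \<inter> R = {}}"
      then obtain ys zs where a: "xs = ys @ zs" "ys \<in> F" "zs \<in> tup U q" "Q ys zs"
        "distinct xs" "set xs \<inter> R = {}" by blast
      then have "length ys = p" "set ys \<subseteq> U" using assms(4) by (auto simp: tup_def)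
      then show "xs \<in> {xs \<in> tup U (p + q). take p xs \<in> F \<and>
         Q (take p xs) (drop p xs) \<and> distinct xs \<and> set xs \<inter> R = {}}"
        using a by (auto simp: tup_def)
    qed
    then show ?thesis using assms(1) by (simp add: card_mono)
  qed
  finally show ?thesis .
qed

lemma length_concat_tup: "xss \<in> tup (tup U B) q \<Longrightarrow> length (concat xss) = B * q"
proof -
  assume a: "xss \<in> tup (tup U B) q"
  then have "map length xss = map (\<lambda>_. B) xss" by (intro map_cong) (auto simp: tup_def)
  then show ?thesis using a by (simp add: length_concat tup_def map_replicate_const sum_list_replicate)
qed

text \<open>Flattening by \<open>concat\<close> is injective on lists of one shape, so the estimate
  \<open>dense_filter\<close> for flat tuples also applies to blow-ups.\<close>

lemma blow_up_distinct_count: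
  fixes c :: real
  assumes "finite U" "finite R" "U \<noteq> {}" "F \<subseteq> tup U q" "c * card U ^ q \<le> card F" "c \<ge> 0"
  shows "(c ^ (B ^ q) - (B * q) * (B * q + card R) / card U) * card U ^ (B * q)
     \<le> card {xss \<in> tup (tup U B) q. transv xss \<subseteq> F \<and> distinct (concat xss) \<and> set (concat xss) \<inter> R = {}}"
proof -
  let ?X = "{xss \<in> tup (tup U B) q. transv xss \<subseteq> F}"
  have "{xs \<in> tup U q. xs \<in> F} = F" using assms(4) by auto
  then have "c ^ (B ^ q) * card U ^ (B * q) \<le> card {xss \<in> tup (tup U B) q. \<forall>ys\<in>transv xss. ys \<in> F}"
    using blow_up_count[OF assms(1,3,6), of q "\<lambda>xs. xs \<in> F" B] assms(5) by simp
  then have 1: "c ^ (B ^ q) * card U ^ (B * q) \<le> card ?X" by (simp add: subset_iff Ball_def)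
  have inj: "inj_on concat (tup (tup U B) q)"
  proof (rule inj_onI)
    fix xss yss :: "'a list list" 
    assume a: "xss \<in> tup (tup U B) q" "yss \<in> tup (tup U B) q" "concat xss = concat yss"
    have "length x = length y" if "(x, y) \<in> set (zip xss yss)" for x y
      using set_zip_leftD[OF that] set_zip_rightD[OF that] a(1,2) by (auto simp: tup_def)
    then show "xss = yss" using a by (intro concat_injective) (auto simp: tup_def)
  qed
  have sub: "concat ` ?X \<subseteq> tup U (B * q)"
  proof (intro image_subsetI)
    fix xss assume "xss \<in> ?X"
    then have x: "xss \<in> tup (tup U B) q" by simp
    then have "\<And>ys. ys \<in> set xss \<Longrightarrow> set ys \<subseteq> U" unfolding tup_def by blast
    then have "set (concat xss) \<subseteq> U" by auto
    with length_concat_tup[OF x] show "concat xss \<in> tup U (B * q)" by (simp add: tup_def)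
  qed
  have "card (concat ` ?X) = card ?X" using inj by (intro card_image) (auto simp: inj_on_def)
  then have "(c ^ (B ^ q) - (B * q) * (B * q + card R) / card U) * card U ^ (B * q)
      \<le> card {xs \<in> concat ` ?X. distinct xs \<and> set xs \<inter> R = {}}"
    using dense_filter[OF assms(1-3) sub, of "c ^ (B ^ q)"] 1 by simp
  also have "{xs \<in> concat ` ?X. distinct xs \<and> set xs \<inter> R = {}} = concat `
    {xss \<in> tup (tup U B) q. transv xss \<subseteq> F \<and> distinct (concat xss) \<and> set (concat xss) \<inter> R = {}}"
    by auto
  also have "card \<dots> = card {xss \<in> tup (tup U B) q. transv xss \<subseteq> F \<and> distinct (concat xss) \<and> set (concat xss) \<inter> R = {}}"
    using inj by (intro card_image) (auto simp: inj_on_def)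
  finally show ?thesis .
qed

lemma blow_up_nth:
  assumes "xss \<in> tup (tup U B) q" "distinct (concat xss)" "transv xss \<subseteq> F"
  shows "\<And>i j. \<lbrakk>i < q; j < B\<rbrakk> \<Longrightarrow> xss ! i ! j \<in> set (concat xss)"
    and "\<And>i j. \<lbrakk>i < q; j < B\<rbrakk> \<Longrightarrow> xss ! i ! j \<in> U"
    and "\<And>i j i' j'. \<lbrakk>i < q; j < B; i' < q; j' < B; xss ! i ! j = xss ! i' ! j'\<rbrakk> \<Longrightarrow> i = i' \<and> j = j'"
    and "\<And>\<sigma>. (\<And>i. i < q \<Longrightarrow> \<sigma> i < B) \<Longrightarrow> map (\<lambda>i. xss ! i ! \<sigma> i) [0..<q] \<in> F"
proof -
  have len: "length xss = q" "\<And>i. i < q \<Longrightarrow> length (xss ! i) = B"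
    using assms(1) by (auto simp: tup_def subset_iff)
  have U: "set (xss ! i) \<subseteq> U" if "i < q" for i
    using assms(1) nth_mem[of i xss] that unfolding tup_def by blast
  show c: "xss ! i ! j \<in> set (concat xss)" if "i < q" "j < B" for i j
    using that len by (auto intro!: bexI[of _ "xss ! i"])
  show "xss ! i ! j \<in> U" if "i < q" "j < B" for i j
    using that len U by (metis nth_mem subsetD)
  show "i = i' \<and> j = j'" if *: "i < q" "j < B" "i' < q" "j' < B" "xss ! i ! j = xss ! i' ! j'" for i j i' j'
  proof -
    have "B > 0" using * by auto
    then have "[] \<notin> set xss" using len by (metis in_set_conv_nth length_0_conv less_numeral_extra(3))
    then have dis: "distinct xss" "\<And>ys. ys \<in> set xss \<Longrightarrow> distinct ys"
      "\<And>ys zs. \<lbrakk>ys \<in> set xss; zs \<in> set xss; ys \<noteq> zs\<rbrakk> \<Longrightarrow> set ys \<inter> set zs = {}"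
      using assms(2) by (auto simp: distinct_concat_iff)
    have in1: "xss ! i \<in> set xss" "xss ! i' \<in> set xss" using * len by auto
    have "xss ! i ! j \<in> set (xss ! i)" "xss ! i' ! j' \<in> set (xss ! i')"
      using nth_mem[of j "xss ! i"] nth_mem[of j' "xss ! i'"] len(2)[OF *(1)] len(2)[OF *(3)] *(2,4)
      by simp_all
    then have "xss ! i = xss ! i'" using dis(3)[OF in1] *(5) by auto
    then have ii: "i = i'" using dis(1) * len by (simp add: nth_eq_iff_index_eq)
    moreover have "j = j'" using *(5) ii dis(2)[OF in1(1)] * len by (simp add: nth_eq_iff_index_eq)
    ultimately show ?thesis by simp
  qed
  show "map (\<lambda>i. xss ! i ! \<sigma> i) [0..<q] \<in> F" if "\<And>i. i < q \<Longrightarrow> \<sigma> i < B" for \<sigma>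
  proof -
    have "map (\<lambda>i. xss ! i ! \<sigma> i) [0..<q] \<in> transv xss"
      using that len by (auto simp: transv_def list_all2_conv_all_nth)
    then show ?thesis using assms(3) by auto
  qed
qed

text \<open>Later constructions are described on the positions of a template and then carried out
  with the copies \<open>g i j\<close> of position \<open>i\<close>. Any choice of one copy per
  position is again a member of \<open>F\<close>, and taking new copies keeps the parts of a
  construction disjoint.\<close>

lemma blow_up_pick:
  fixes c :: real
  assumes "finite U" "finite R" "F \<subseteq> tup U q" "c * card U ^ q \<le> card F" "c \<ge> 0"
    "(B * q) * (B * q + card R) < c ^ (B ^ q) * card U"
  obtains g where "\<And>i j. \<lbrakk>i < q; j < B\<rbrakk> \<Longrightarrow> g i j \<in> U - R"
    and "\<And>i j i' j'. \<lbrakk>i < q; j < B; i' < q; j' < B; g i j = g i' j'\<rbrakk> \<Longrightarrow> i = i' \<and> j = j'"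
    and "\<And>\<sigma>. (\<And>i. i < q \<Longrightarrow> \<sigma> i < B) \<Longrightarrow> map (\<lambda>i. g i (\<sigma> i)) [0..<q] \<in> F"
proof -
  have "0 \<le> real ((B * q) * (B * q + card R))" by simp
  then have "0 < c ^ (B ^ q) * card U" using assms(6) by linarith
  then have u: "real (card U) > 0" by (cases "card U = 0") auto
  then have ne: "U \<noteq> {}" by auto
  let ?X = "{xss \<in> tup (tup U B) q. transv xss \<subseteq> F \<and> distinct (concat xss) \<and> set (concat xss) \<inter> R = {}}"
  have "(c ^ (B ^ q) - (B * q) * (B * q + card R) / card U) > 0" using u assms(6) by (simp add: field_simps)
  then have "(c ^ (B ^ q) - (B * q) * (B * q + card R) / card U) * card U ^ (B * q) > 0" using u by simp
  then have "card ?X > 0"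
    using blow_up_distinct_count[OF assms(1,2) ne assms(3-5), of B] by linarith
  then have "?X \<noteq> {}" by (metis card.empty less_numeral_extra(3))
  then obtain xss where xss: "xss \<in> tup (tup U B) q" "distinct (concat xss)" "transv xss \<subseteq> F"
    "set (concat xss) \<inter> R = {}" by blast
  show ?thesis
  proof (rule that[of "\<lambda>i j. xss ! i ! j"])
    show "xss ! i ! j \<in> U - R" if "i < q" "j < B" for i j
      using blow_up_nth(1,2)[OF xss(1-3) that] xss(4) by auto
  qed (use blow_up_nth(3,4)[OF xss(1-3)] in blast)+
qed

section \<open>Degree condition and connections\<close>

context loose
begin

text \<open>The degree condition, with ordered \<open>(k - d)\<close>-tuples counted instead of sets, and with the extensions
  restricted to \<open>U\<close>.\<close>

definition cond :: "'a set set \<Rightarrow> 'a set \<Rightarrow> 'a set \<Rightarrow> real \<Rightarrow> bool" where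
  "cond E V U \<alpha> \<longleftrightarrow> (\<forall>S\<subseteq>V. card S = d \<longrightarrow> \<alpha> * card U ^ (k - d) \<le> card {xs \<in> tup U (k - d). S \<union> set xs \<in> E})"

text \<open>The set is completed to a \<open>d\<close>-set by vertices of \<open>U\<close> before
  the degree condition is applied. For \<open>card U \<ge> 2 * d * d\<close> at least half of the
  completing tuples are free of repetitions and avoid \<open>S\<close>, whence the factor one
  half.\<close>

lemma cond_lower:
  assumes "finite V" "U \<subseteq> V" "cond E V U \<alpha>" "\<alpha> \<ge> 0" "card U \<ge> 2 * d * d" "S \<subseteq> V" "card S = j" "j \<le> d"
  shows "\<alpha> / 2 * card U ^ (k - j) \<le> card {xs \<in> tup U (k - j). S \<union> set xs \<in> E}"
proof -
  have finU: "finite U" and finS: "finite S" using assms finite_subset by auto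
  have "d > 0" using kl_d two_l by linarith
  then have u: "card U > 0" using assms(5) by (cases "card U = 0") auto
  then have ne: "U \<noteq> {}" by auto
  let ?F = "{ys \<in> tup U (d - j). distinct ys \<and> set ys \<inter> S = {}}"
  have "(d - j) * (d - j + card S) \<le> d * d" using assms(7,8) by (intro mult_le_mono) auto
  then have "real ((d - j) * (d - j + card S)) \<le> real (card U) / 2" using assms(5) by linarith
  then have "1 / 2 \<le> 1 - real ((d - j) * (d - j + card S)) / card U" using u by (simp add: field_simps)
  then have "1 / 2 * card U ^ (d - j) \<le> (1 - real ((d - j) * (d - j + card S)) / card U) * card U ^ (d - j)"
    by (intro mult_right_mono) auto
  also have "\<dots> \<le> card ?F"
    using dense_filter[OF finU finS ne order_refl, of 1 "d - j"] by (simp add: card_tup finU)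
  finally have F: "1 / 2 * card U ^ (d - j) \<le> card ?F" .
  have G: "{zs \<in> tup U (k - d). (S \<union> set ys) \<union> set zs \<in> E} \<subseteq> tup U (k - d) \<and>
     \<alpha> * card U ^ (k - d) \<le> card {zs \<in> tup U (k - d). (S \<union> set ys) \<union> set zs \<in> E}" if "ys \<in> ?F" for ys
  proof -
    have "card (S \<union> set ys) = d" using that finS assms(7,8) distinct_card[of ys]
      by (subst card_Un_disjoint) (auto simp: tup_def)
    moreover have "S \<union> set ys \<subseteq> V" using that assms(2,6) by (auto simp: tup_def)
    ultimately show ?thesis using assms(3) by (auto simp: cond_def)
  qed
  let ?H = "{ys @ zs |ys zs. ys \<in> ?F \<and> zs \<in> {zs \<in> tup U (k - d). (S \<union> set ys) \<union> set zs \<in> E}}"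
  have eq: "(d - j) + (k - d) = k - j" using assms(8) d_k by simp
  have H: "1 / 2 * \<alpha> * card U ^ (k - j) \<le> card ?H" "?H \<subseteq> tup U (k - j)"
    using dense_append[OF finU _ F assms(4), of "\<lambda>ys. {zs \<in> tup U (k - d). (S \<union> set ys) \<union> set zs \<in> E}" "k - d"] G
    unfolding eq by auto
  have "?H \<subseteq> {xs \<in> tup U (k - j). S \<union> set xs \<in> E}" using H(2) by (auto simp: Un_assoc)
  then have "card ?H \<le> card {xs \<in> tup U (k - j). S \<union> set xs \<in> E}"
    using finU by (intro card_mono) auto
  then show ?thesis using H(1) by simp
qed


text \<open>Two edges on copies of \<open>e\<close>, overlapping in copy \<open>c1\<close> of an
  \<open>l\<close>-set \<open>P\<close>. The first takes \<open>N\<close> in copy \<open>a\<close>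
  and all else in \<open>c1\<close>; the second takes \<open>N'\<close> in copy \<open>b\<close>,
  \<open>P\<close> in \<open>c1\<close> and all else in \<open>c2\<close>. The position sets
  \<open>N\<close> and \<open>N'\<close> may intersect, as they sit in different copies.\<close>

lemma two_step:
  fixes g :: "nat \<Rightarrow> nat \<Rightarrow> 'a"
  assumes inj: "\<And>i j i' j'. \<lbrakk>i < q; j < B; i' < q; j' < B; g i j = g i' j'\<rbrakk> \<Longrightarrow> i = i' \<and> j = j'"
    and E: "\<And>\<sigma>. (\<And>i. i < q \<Longrightarrow> \<sigma> i < B) \<Longrightarrow> (\<lambda>i. g i (\<sigma> i)) ` e \<in> E"
    and e: "e \<subseteq> {..<q}" "card e = k" and N: "N \<subseteq> e" "card N = l" and N': "N' \<subseteq> e" "card N' = l"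
    and NN: "card (N \<union> N') \<le> k - l"
    and c: "a < B" "b < B" "c1 < B" "c2 < B" "a \<noteq> b" "a \<noteq> c1" "a \<noteq> c2" "b \<noteq> c1" "b \<noteq> c2" "c1 \<noteq> c2"
  shows "\<exists>W. pth E ((\<lambda>i. g i a) ` N) 2 W ((\<lambda>i. g i b) ` N') \<and> W \<subseteq> (\<lambda>i. g i c1) ` {..<q} \<union> (\<lambda>i. g i c2) ` {..<q}"
proof -
  have fin: "finite e" using e finite_subset by blast
  have finN: "finite N" "finite N'" using N N' fin finite_subset by auto
  \<comment> \<open>Each edge uses every position once, so the positions of the middle overlap must
    avoid those of both ends; this is the reason for the bound \<open>NN\<close>.\<close>
  have "l \<le> card (e - (N \<union> N'))"
    using NN e finN N N' two_l by (subst card_Diff_subset) auto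
  then obtain P where P: "P \<subseteq> e - (N \<union> N')" "card P = l"
    by (meson obtain_subset_with_card_n)
  have finP: "finite P" using P fin finite_subset by (metis finite_Diff)
  have inj1: "inj_on (\<lambda>i. g i x) A" if "A \<subseteq> {..<q}" "x < B" for A x
    using that inj by (auto simp: inj_on_def subset_iff)
  have dis: "(\<lambda>i. g i x) ` A \<inter> (\<lambda>i. g i y) ` A' = {}" 
    if "A \<subseteq> {..<q}" "A' \<subseteq> {..<q}" "x < B" "y < B" "x \<noteq> y \<or> A \<inter> A' = {}" for A A' x y
  proof -
    have False if "i \<in> A" "i' \<in> A'" "g i x = g i' y" for i i'
      using that \<open>A \<subseteq> {..<q}\<close> \<open>A' \<subseteq> {..<q}\<close> \<open>x < B\<close> \<open>y < B\<close> \<open>x \<noteq> y \<or> A \<inter> A' = {}\<close>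
        inj[of i x i' y] by auto
    then show ?thesis by blast
  qed
  have sub: "N \<subseteq> {..<q}" "N' \<subseteq> {..<q}" "P \<subseteq> {..<q}" "e - N - P \<subseteq> {..<q}" "e - N' - P \<subseteq> {..<q}"
    using e N N' P by auto
  have card': "card ((\<lambda>i. g i x) ` A) = card A" if "A \<subseteq> {..<q}" "x < B" for A x
    using inj1[OF that] by (simp add: card_image)
  have cardr: "card (e - N - P) = k - 2 * l" "card (e - N' - P) = k - 2 * l"
  proof -
    have "e - N - P = e - (N \<union> P)" "e - N' - P = e - (N' \<union> P)" by auto
    moreover have "card (N \<union> P) = 2 * l" "card (N' \<union> P) = 2 * l"
      using N N' P finN finP by (subst card_Un_disjoint; auto)+
    moreover have "card (e - (N \<union> P)) = card e - card (N \<union> P)" "card (e - (N' \<union> P)) = card e - card (N' \<union> P)"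
      using finN finP N N' P by (intro card_Diff_subset; auto)+
    ultimately show "card (e - N - P) = k - 2 * l" "card (e - N' - P) = k - 2 * l" using e by simp_all
  qed
  let ?N = "(\<lambda>i. g i a) ` N" and ?N' = "(\<lambda>i. g i b) ` N'" and ?P = "(\<lambda>i. g i c1) ` P"
  let ?W = "(\<lambda>i. g i c1) ` (e - N - P)" and ?W' = "(\<lambda>i. g i c2) ` (e - N' - P)"
  have "(\<lambda>i. g i (if i \<in> N then a else c1)) ` e \<in> E" using c by (intro E) auto
  also have "(\<lambda>i. g i (if i \<in> N then a else c1)) ` e = (\<lambda>i. g i (if i \<in> N then a else c1)) ` (N \<union> (e - N - P) \<union> P)"
    using N P by (intro arg_cong2[where f = image]) auto
  also have "\<dots> = ?N \<union> ?W \<union> ?P"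
    unfolding image_Un using P by (intro arg_cong2[where f = union] image_cong) auto
  finally have E1: "?N \<union> ?W \<union> ?P \<in> E" .
  have "(\<lambda>i. g i (if i \<in> N' then b else if i \<in> P then c1 else c2)) ` e \<in> E" using c by (intro E) auto
  also have "(\<lambda>i. g i (if i \<in> N' then b else if i \<in> P then c1 else c2)) ` e
      = (\<lambda>i. g i (if i \<in> N' then b else if i \<in> P then c1 else c2)) ` (P \<union> (e - N' - P) \<union> N')"
    using N' P by (intro arg_cong2[where f = image]) auto
  also have "\<dots> = ?P \<union> ?W' \<union> ?N'"
    unfolding image_Un using P by (intro arg_cong2[where f = union] image_cong) auto
  finally have E2: "?P \<union> ?W' \<union> ?N' \<in> E" .
  have p1: "pth E ?N 1 ?W ?P"
  proof (rule edge[OF E1])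
    show "card ?N = l" "card ?W = k - 2 * l" "card ?P = l"
      using card' sub N(2) N'(2) P(2) c cardr by simp_all
    show "?N \<inter> ?W = {}" "?N \<inter> ?P = {}" "?W \<inter> ?P = {}"
      using sub c P(1) by (intro dis; auto)+
  qed (use fin finN finP in auto)
  have p2: "pth E ?P 1 ?W' ?N'"
  proof (rule edge[OF E2])
    show "card ?P = l" "card ?W' = k - 2 * l" "card ?N' = l"
      using card' sub N(2) N'(2) P(2) c cardr by simp_all
    show "?P \<inter> ?W' = {}" "?P \<inter> ?N' = {}" "?W' \<inter> ?N' = {}"
      using sub c P(1) by (intro dis; auto)+
  qed (use fin finN finP in auto)
  have "pth E ?N 2 (?W \<union> ?P \<union> ?W') ?N'"
  proof (rule comp[OF p1 p2, unfolded one_add_one])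
    show "(?N \<union> ?W) \<inter> (?W' \<union> ?N') = {}"
      using dis[OF sub(1) sub(5), of a c2] dis[OF sub(1) sub(2), of a b]
        dis[OF sub(4) sub(5), of c1 c2] dis[OF sub(4) sub(2), of c1 b] c by auto
  qed
  moreover have "?W \<union> ?P \<union> ?W' \<subseteq> (\<lambda>i. g i c1) ` {..<q} \<union> (\<lambda>i. g i c2) ` {..<q}"
    using sub by auto
  ultimately show ?thesis by blast
qed

text \<open>Template for a connection: the positions \<open>{..<k - l}\<close> complete \<open>L\<close> to an edge, the positions
  \<open>{k - l..<2 * (k - l)}\<close> complete \<open>L'\<close>. The \<open>l\<close>-sets \<open>conN i\<close> move from the first to the second by
  exchanging one position at a time, and the edge \<open>cone i\<close> contains \<open>conN i\<close> and \<open>conN (Suc i)\<close>. In a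
  blow-up of the template, copies of these two sets are the ends of a path with two edges.\<close>

definition conN :: "nat \<Rightarrow> nat set" where
  "conN i = {k - l..<k - l + i} \<union> {i..<l}"

definition cone :: "nat \<Rightarrow> nat set" where
  "cone i = conN i \<union> conN (Suc i) \<union> {2 * (k - l) + i * (k - l - 1)..<2 * (k - l) + Suc i * (k - l - 1)}"

definition conF :: "'a set set \<Rightarrow> 'a set \<Rightarrow> 'a set \<Rightarrow> 'a set \<Rightarrow> nat \<Rightarrow> 'a list set" where
  "conF E U L L' j = {xs \<in> tup U (2 * (k - l) + j * (k - l - 1)). distinct xs \<and> set xs \<inter> (L \<union> L') = {} \<and>
     L \<union> (!) xs ` {..<k - l} \<in> E \<and> L' \<union> (!) xs ` {k - l..<2 * (k - l)} \<in> E \<and> (\<forall>i<j. (!) xs ` cone i \<in> E)}"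

lemma card_conN: "i \<le> l \<Longrightarrow> card (conN i) = l"
  unfolding conN_def using two_l by (subst card_Un_disjoint) auto

lemma card_conN_Un: "i < l \<Longrightarrow> card (conN i \<union> conN (Suc i)) = Suc l"
proof -
  assume i: "i < l"
  have "conN i \<union> conN (Suc i) = {k - l..<k - l + Suc i} \<union> {i..<l}" by (auto simp: conN_def)
  also have "card \<dots> = Suc l" using i two_l by (subst card_Un_disjoint) auto
  finally show ?thesis .
qed

lemma conN_sub: "i \<le> l \<Longrightarrow> conN i \<subseteq> {..<k}"
  using two_l by (auto simp: conN_def)

lemma conN_sub': "i \<le> l \<Longrightarrow> conN i \<subseteq> {..<2 * (k - l) + j}"
  using two_l by (auto simp: conN_def)

lemma cone_sub: "i < j \<Longrightarrow> i < l \<Longrightarrow> cone i \<subseteq> {..<2 * (k - l) + j * (k - l - 1)}"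
proof -
  assume i: "i < j" "i < l"
  have "Suc i * (k - l - 1) \<le> j * (k - l - 1)" using i by (intro mult_le_mono1) auto
  then show ?thesis using conN_sub'[of i "j * (k - l - 1)"] conN_sub'[of "Suc i" "j * (k - l - 1)"] i
    by (auto simp: cone_def)
qed

lemma card_cone: assumes "i < l" shows "card (cone i) = k"
proof -
  have "conN i \<union> conN (Suc i) \<subseteq> {..<2 * (k - l)}"
    using conN_sub'[of i 0] conN_sub'[of "Suc i" 0] assms by auto
  then have "(conN i \<union> conN (Suc i)) \<inter> {2 * (k - l) + i * (k - l - 1)..<2 * (k - l) + Suc i * (k - l - 1)} = {}"
    by auto
  moreover have "finite (conN i \<union> conN (Suc i))" by (auto simp: conN_def)
  ultimately have "card (cone i) = Suc l + (k - l - 1)"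
    unfolding cone_def by (subst card_Un_disjoint) (auto simp: card_conN_Un[OF assms])
  then show ?thesis using two_l by simp
qed

lemma nth_image_take:
  assumes "I \<subseteq> {..<p}" shows "(!) (take p xs) ` I = (!) xs ` I"
  using assms by (intro image_cong) auto

lemma nth_image_lessThan: "length xs = p \<Longrightarrow> (!) xs ` {..<p} = set xs"
  by (auto simp: set_conv_nth)

lemma set_drop_nth: "length xs = p + q \<Longrightarrow> set (drop p xs) = (!) xs ` {p..<p + q}"
proof -
  assume l: "length xs = p + q"
  have "set (drop p xs) = (!) (drop p xs) ` {..<q}"
    by (rule nth_image_lessThan[symmetric]) (simp add: l)
  also have "\<dots> = (\<lambda>i. xs ! (p + i)) ` {..<q}" using l by (intro image_cong) auto
  also have "\<dots> = (!) xs ` ((+) p ` {..<q})" by (simp add: image_image)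
  also have "(+) p ` {..<q} = {p..<p + q}" by (simp add: lessThan_atLeast0 add.commute)
  finally show ?thesis .
qed

text \<open>The template is built edge by edge, each time by the degree of a set already chosen:
  \<open>L\<close> and \<open>L'\<close> in the base case, and in each step the union of two
  neighbouring \<open>l\<close>-sets. They differ in one position, so the union has only
  \<open>l + 1 \<le> d\<close> vertices.\<close>

lemma conF_dense:
  assumes "\<alpha> > 0" "j \<le> l"
  shows "\<exists>c>0::real. \<exists>n0::nat. \<forall>(E::'a set set) V U L L'. finite V \<and> U \<subseteq> V \<and> cond E V U \<alpha> \<and> card U \<ge> n0 \<and>
     L \<subseteq> V \<and> L' \<subseteq> V \<and> card L = l \<and> card L' = l \<longrightarrow>
     c * card U ^ (2 * (k - l) + j * (k - l - 1)) \<le> card (conF E U L L' j)"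
  using assms(2)
proof (induction j)
  case 0
  let ?b = "\<alpha> / 2"
  let ?g = "k - l"
  let ?c = "1 * ?b / 2 * ?b / 2"
  show ?case
  \<comment> \<open>The summands are for \<open>cond_lower\<close>, for the second and the first use
    of \<open>dense_extend\<close>, and for \<open>U\<close> to be nonempty.\<close>
  proof (intro exI[of _ ?c] conjI exI[of _ "2 * d * d + nat \<lceil>2 * (2 * ?g * (2 * ?g + 2 * l)) / ?c\<rceil> + nat \<lceil>2 * (2 * ?g * (2 * ?g + 2 * l)) / ?b\<rceil> + 1"] allI impI)
    show cp: "?c > 0" using assms by simp
    fix E :: "'a set set" and V U L L'
    assume a: "finite V \<and> U \<subseteq> V \<and> cond E V U \<alpha> \<and> 2 * d * d + nat \<lceil>2 * (2 * ?g * (2 * ?g + 2 * l)) / ?c\<rceil> + nat \<lceil>2 * (2 * ?g * (2 * ?g + 2 * l)) / ?b\<rceil> + 1 \<le> card U \<and>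
     L \<subseteq> V \<and> L' \<subseteq> V \<and> card L = l \<and> card L' = l"
    have fin: "finite U" "finite L" "finite L'" using a finite_subset by auto
    have ne: "U \<noteq> {}" using a by auto
    have du: "2 * d * d \<le> card U" using a by simp
    have big1: "2 * (2 * ?g * (2 * ?g + 2 * l)) \<le> ?c * card U" and big2: "2 * (2 * ?g * (2 * ?g + 2 * l)) \<le> ?b * card U"
    proof -
      have "2 * (2 * ?g * (2 * ?g + 2 * l)) / ?c \<le> card U" "2 * (2 * ?g * (2 * ?g + 2 * l)) / ?b \<le> card U"
        using a by linarith+
      then show "2 * (2 * ?g * (2 * ?g + 2 * l)) \<le> ?c * card U" "2 * (2 * ?g * (2 * ?g + 2 * l)) \<le> ?b * card U"
        using cp assms by (simp_all add: field_simps)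
    qed
    have cLL: "card (L \<union> L') \<le> 2 * l" using card_Un_le[of L L'] a by simp
    have low: "?b * card U ^ ?g \<le> card {zs \<in> tup U ?g. S \<union> set zs \<in> E}" if "S \<subseteq> V" "card S = l" for S
      using cond_lower[of V U E \<alpha> S l] a assms that du two_l kl_d by simp
    let ?F1 = "{xs \<in> tup U (0 + ?g). take 0 xs \<in> {[]} \<and> L \<union> set (drop 0 xs) \<in> E \<and> distinct xs \<and> set xs \<inter> (L \<union> L') = {}}"
    have s1: "0 + ?g + card (L \<union> L') \<le> 2 * ?g + 2 * l" "?g + ?g + card (L \<union> L') \<le> 2 * ?g + 2 * l" using cLL by auto
    have "(0 + ?g) * (0 + ?g + card (L \<union> L')) \<le> 2 * ?g * (2 * ?g + 2 * l)"
      using s1 by (intro mult_le_mono) auto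
    then have "real ((0 + ?g) * (0 + ?g + card (L \<union> L'))) \<le> real (2 * ?g * (2 * ?g + 2 * l))" by (rule of_nat_mono)
    then have "real ((0 + ?g) * (0 + ?g + card (L \<union> L'))) \<le> 1 * ?b / 2 * card U" using big2 by simp
    then have F1: "1 * ?b / 2 * card U ^ (0 + ?g) \<le> card ?F1"
      using a fin ne assms low[of L] by (intro dense_extend[where F = "{[]}" and Q = "\<lambda>_ zs. L \<union> set zs \<in> E"]) auto
    let ?F2 = "{xs \<in> tup U (?g + ?g). take ?g xs \<in> ?F1 \<and> L' \<union> set (drop ?g xs) \<in> E \<and> distinct xs \<and> set xs \<inter> (L \<union> L') = {}}"
    have "(?g + ?g) * (?g + ?g + card (L \<union> L')) \<le> 2 * ?g * (2 * ?g + 2 * l)"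
      using s1 by (intro mult_le_mono) auto
    then have "(?g + ?g) * (?g + ?g + card (L \<union> L')) \<le> 2 * (2 * ?g * (2 * ?g + 2 * l))" by linarith
    then have "real ((?g + ?g) * (?g + ?g + card (L \<union> L'))) \<le> real (2 * (2 * ?g * (2 * ?g + 2 * l)))" by (rule of_nat_mono)
    then have "real ((?g + ?g) * (?g + ?g + card (L \<union> L'))) \<le> (1 * ?b / 2) * ?b / 2 * card U" using big1 by simp
    then have "(1 * ?b / 2) * ?b / 2 * card U ^ (?g + ?g) \<le> card ?F2"
      using a fin ne assms low[of L'] F1
      by (intro dense_extend[where F = ?F1 and Q = "\<lambda>_ zs. L' \<union> set zs \<in> E"]) auto
    also have "?F2 \<subseteq> conF E U L L' 0"
    proof
      fix xs assume xs: "xs \<in> ?F2"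
      then have len: "length xs = ?g + ?g" by (simp add: tup_def)
      have "set (take ?g xs) = (!) xs ` {..<?g}"
        using nth_image_lessThan[of "take ?g xs" ?g] nth_image_take[of "{..<?g}" ?g xs] len by simp
      moreover have "set (drop ?g xs) = (!) xs ` {?g..<2 * ?g}" using set_drop_nth[OF len] by (simp add: mult_2)
      ultimately show "xs \<in> conF E U L L' 0" using xs by (simp add: conF_def mult_2)
    qed
    then have "card ?F2 \<le> card (conF E U L L' 0)"
      using fin by (intro card_mono) (auto simp: conF_def)
    finally show "?c * card U ^ (2 * ?g + 0 * (?g - 1)) \<le> card (conF E U L L' 0)" by (simp add: mult_2)
  qed
next
  case (Suc j)
  then obtain c :: real and n0 :: nat where c: "c > 0" and IH: "\<And>(E::'a set set) V U L L'. finite V \<and> U \<subseteq> V \<and> cond E V U \<alpha> \<and> card U \<ge> n0 \<and>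
     L \<subseteq> V \<and> L' \<subseteq> V \<and> card L = l \<and> card L' = l \<Longrightarrow>
     c * card U ^ (2 * (k - l) + j * (k - l - 1)) \<le> card (conF E U L L' j)" by (meson Suc_leD)
  let ?b = "\<alpha> / 2"
  let ?g = "k - l"
  let ?p = "2 * ?g + j * (?g - 1)"
  let ?c = "c * ?b / 2"
  define K where "K = real ((?p + (?g - 1)) * (?p + (?g - 1) + 2 * l))"
  show ?case
  proof (intro exI[of _ ?c] conjI exI[of _ "2 * d * d + nat \<lceil>K / ?c\<rceil> + n0 + 1"] allI impI)
    show cp: "?c > 0" using assms c by simp
    fix E :: "'a set set" and V U L L'
    assume a: "finite V \<and> U \<subseteq> V \<and> cond E V U \<alpha> \<and> 2 * d * d + nat \<lceil>K / ?c\<rceil> + n0 + 1 \<le> card U \<and>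
     L \<subseteq> V \<and> L' \<subseteq> V \<and> card L = l \<and> card L' = l"
    have fin: "finite U" "finite L" "finite L'" using a finite_subset by auto
    have ne: "U \<noteq> {}" using a by auto
    have du: "2 * d * d \<le> card U" using a by simp
    have "K / ?c \<le> card U" using a by linarith
    then have big: "K \<le> ?c * card U" using cp by (simp add: field_simps)
    have cLL: "card (L \<union> L') \<le> 2 * l" using card_Un_le[of L L'] a by simp
    let ?F = "conF E U L L' j"
    have F: "c * card U ^ ?p \<le> card ?F" by (rule IH[of V]) (use a in auto)
    let ?NN = "conN j \<union> conN (Suc j)"
    let ?H = "{xs \<in> tup U (?p + (?g - 1)). take ?p xs \<in> ?F \<and> (!) (take ?p xs) ` ?NN \<union> set (drop ?p xs) \<in> E
      \<and> distinct xs \<and> set xs \<inter> (L \<union> L') = {}}"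
    have "(?p + (?g - 1)) * (?p + (?g - 1) + card (L \<union> L')) \<le> (?p + (?g - 1)) * (?p + (?g - 1) + 2 * l)"
      using cLL by (intro mult_le_mono) auto
    then have "real ((?p + (?g - 1)) * (?p + (?g - 1) + card (L \<union> L'))) \<le> K" unfolding K_def by (rule of_nat_mono)
    then have K: "real ((?p + (?g - 1)) * (?p + (?g - 1) + card (L \<union> L'))) \<le> ?c * card U" using big by simp
    have NNsub: "?NN \<subseteq> {..<?p}" using conN_sub'[of j] conN_sub'[of "Suc j"] Suc.prems by auto
    have G: "?b * card U ^ (?g - 1) \<le> card {zs \<in> tup U (?g - 1). (!) ys ` ?NN \<union> set zs \<in> E}" if ys: "ys \<in> ?F" for ys
    proof -
      have ys': "length ys = ?p" "distinct ys" "set ys \<subseteq> U" using ys by (auto simp: conF_def tup_def)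
      have "inj_on ((!) ys) ?NN" using ys' NNsub inj_on_nth[of ys ?NN] by auto
      then have "card ((!) ys ` ?NN) = Suc l" using card_conN_Un[of j] Suc.prems by (simp add: card_image)
      moreover have "(!) ys ` ?NN \<subseteq> V" using image_mono[OF NNsub, of "(!) ys"] nth_image_lessThan[OF ys'(1)] ys'(3) a by blast
      moreover have "k - Suc l = ?g - 1" by simp
      ultimately show ?thesis
        using cond_lower[of V U E \<alpha> "(!) ys ` ?NN" "Suc l"] a assms du two_l kl_d by simp
    qed
    have "?c * card U ^ (?p + (?g - 1)) \<le> card ?H"
      by (rule dense_extend[where F = ?F and Q = "\<lambda>ys zs. (!) ys ` ?NN \<union> set zs \<in> E"])
        (use a fin ne assms c F G K in \<open>auto simp: conF_def\<close>)
    also have "?H \<subseteq> conF E U L L' (Suc j)"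
    proof
      fix xs assume xs: "xs \<in> ?H"
      then have len: "length xs = ?p + (?g - 1)" by (simp add: tup_def)
      have F': "take ?p xs \<in> ?F" using xs by simp
      have 1: "L \<union> (!) xs ` {..<?g} \<in> E" "L' \<union> (!) xs ` {?g..<2 * ?g} \<in> E"
        using F' nth_image_take[of "{..<?g}" ?p xs] nth_image_take[of "{?g..<2 * ?g}" ?p xs]
        by (auto simp: conF_def)
      have 2: "(!) xs ` cone i \<in> E" if "i < j" for i
      proof -
        have "(!) (take ?p xs) ` cone i \<in> E" using F' that by (simp add: conF_def)
        moreover have "cone i \<subseteq> {..<?p}" using cone_sub[of i j] that Suc.prems by simp
        ultimately show ?thesis using nth_image_take by metis
      qed
      have "(!) (take ?p xs) ` ?NN \<union> set (drop ?p xs) \<in> E" using xs by simp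
      also have "(!) (take ?p xs) ` ?NN \<union> set (drop ?p xs) = (!) xs ` cone j"
        unfolding nth_image_take[OF NNsub] set_drop_nth[OF len] cone_def
        by (simp add: image_Un add.commute add.left_commute)
      finally have "(!) xs ` cone i \<in> E" if "i < Suc j" for i using 2 that less_Suc_eq by auto
      then show "xs \<in> conF E U L L' (Suc j)" using xs 1 by (simp add: conF_def add.commute add.left_commute)
    qed
    then have "card ?H \<le> card (conF E U L L' (Suc j))"
      using fin by (intro card_mono) (auto simp: conF_def)
    finally show "?c * card U ^ (2 * ?g + Suc j * (?g - 1)) \<le> card (conF E U L L' (Suc j))"
      by (simp add: add.commute add.left_commute)
  qed
qed


text \<open>The completions of \<open>L\<close> and of \<open>L'\<close> take one edge each and each
  of the \<open>l\<close> exchanges takes a path with two edges, in total \<open>2 * l + 2\<close>.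
  The number of edges is the same for all ends, so every connection removes the same number of
  vertices.\<close>

lemma connector:
  assumes "\<alpha> > 0"
  shows "\<exists>n0::nat. \<forall>(E::'a set set) V U L L'. finite V \<and> U \<subseteq> V \<and> cond E V U \<alpha> \<and> card U \<ge> n0 \<and>
     L \<subseteq> V \<and> L' \<subseteq> V \<and> card L = l \<and> card L' = l \<and> L \<inter> L' = {} \<longrightarrow>
     (\<exists>W\<subseteq>U - (L \<union> L'). pth E L (2 * l + 2) W L')"
proof -
  obtain c :: real and n1 :: nat where c: "c > 0" and n1: "\<And>(E::'a set set) V U L L'. finite V \<and> U \<subseteq> V \<and> cond E V U \<alpha> \<and> card U \<ge> n1 \<and>
     L \<subseteq> V \<and> L' \<subseteq> V \<and> card L = l \<and> card L' = l \<Longrightarrow>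
     c * card U ^ (2 * (k - l) + l * (k - l - 1)) \<le> card (conF E U L L' l)"
    using conF_dense[OF assms order_refl] by meson
  define q where "q = 2 * (k - l) + l * (k - l - 1)"
  \<comment> \<open>The \<open>l\<close>-set reached after \<open>i\<close> exchanges is placed in
    copy \<open>3 * i\<close>; the two copies between \<open>3 * i\<close> and
    \<open>3 * Suc i\<close> are for the interior of the next two edges.\<close>
  define B where "B = 3 * l + 1"
  define K where "K = real ((B * q) * (B * q + 2 * l))"
  show ?thesis
  proof (intro exI[of _ "n1 + nat \<lceil>K / c ^ (B ^ q)\<rceil> + 1"] allI impI)
    fix E :: "'a set set" and V U L L'
    assume a: "finite V \<and> U \<subseteq> V \<and> cond E V U \<alpha> \<and> n1 + nat \<lceil>K / c ^ (B ^ q)\<rceil> + 1 \<le> card U \<and>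
     L \<subseteq> V \<and> L' \<subseteq> V \<and> card L = l \<and> card L' = l \<and> L \<inter> L' = {}"
    have fin: "finite U" "finite L" "finite L'" using a finite_subset by auto
    have "K / c ^ (B ^ q) < card U" using a by linarith
    then have K: "K < c ^ (B ^ q) * card U" using c by (simp add: field_simps)
    have cLL: "card (L \<union> L') \<le> 2 * l" using card_Un_le[of L L'] a by simp
    have "(B * q) * (B * q + card (L \<union> L')) \<le> (B * q) * (B * q + 2 * l)"
      using cLL by (intro mult_le_mono) auto
    then have "real ((B * q) * (B * q + card (L \<union> L'))) \<le> K" unfolding K_def by (rule of_nat_mono)
    with K have big: "real ((B * q) * (B * q + card (L \<union> L'))) < c ^ (B ^ q) * card U" by linarith
    have F: "c * card U ^ q \<le> card (conF E U L L' l)" unfolding q_def by (rule n1[of V]) (use a in auto)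
    have Fsub: "conF E U L L' l \<subseteq> tup U q" by (auto simp: conF_def q_def)
    have finLL: "finite (L \<union> L')" using fin by simp
    obtain g where g: "\<And>i j. \<lbrakk>i < q; j < B\<rbrakk> \<Longrightarrow> g i j \<in> U - (L \<union> L')"
      and inj: "\<And>i j i' j'. \<lbrakk>i < q; j < B; i' < q; j' < B; g i j = g i' j'\<rbrakk> \<Longrightarrow> i = i' \<and> j = j'"
      and tr: "\<And>\<sigma>. (\<And>i. i < q \<Longrightarrow> \<sigma> i < B) \<Longrightarrow> map (\<lambda>i. g i (\<sigma> i)) [0..<q] \<in> conF E U L L' l"
      using blow_up_pick[OF fin(1) finLL Fsub F less_imp_le[OF c] big] by blast
    have nth: "(!) (map (\<lambda>i. g i (\<sigma> i)) [0..<q]) ` I = (\<lambda>i. g i (\<sigma> i)) ` I" if "I \<subseteq> {..<q}" for I \<sigma>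
      using that by (intro image_cong) auto
    have l_lt: "l < k - l" using two_l by simp
    have qs: "{..<k - l} \<subseteq> {..<q}" "{k - l..<2 * (k - l)} \<subseteq> {..<q}" by (auto simp: q_def)
    have E0: "L \<union> (\<lambda>i. g i 0) ` {..<k - l} \<in> E"
      using tr[of "\<lambda>_. 0"] nth[OF qs(1), of "\<lambda>_. 0"] by (simp add: conF_def B_def)
    have E1: "L' \<union> (\<lambda>i. g i (3 * l)) ` {k - l..<2 * (k - l)} \<in> E"
      using tr[of "\<lambda>_. 3 * l"] nth[OF qs(2), of "\<lambda>_. 3 * l"] by (simp add: conF_def B_def)
    have Ei: "(\<lambda>i. g i (\<sigma> i)) ` cone j \<in> E" if "j < l" "\<And>i. i < q \<Longrightarrow> \<sigma> i < B" for j \<sigma>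
    proof -
      have "map (\<lambda>i. g i (\<sigma> i)) [0..<q] \<in> conF E U L L' l" using tr that(2) by blast
      then have "(!) (map (\<lambda>i. g i (\<sigma> i)) [0..<q]) ` cone j \<in> E" using that(1) unfolding conF_def by blast
      moreover have "cone j \<subseteq> {..<q}" using cone_sub[of j l] that(1) by (simp add: q_def)
      ultimately show ?thesis using nth by simp
    qed
    \<comment> \<open>The interior stays strictly between the copies of its two ends, which makes
      consecutive parts disjoint. \<open>i = 0\<close> is excluded because a path has at least one
      edge.\<close>
    have chain: "i \<ge> 1 \<Longrightarrow> i \<le> l \<Longrightarrow> \<exists>W. pth E ((\<lambda>j. g j 0) ` conN 0) (2 * i) W ((\<lambda>j. g j (3 * i)) ` conN i) \<and>
       W \<subseteq> (\<Union>c\<in>{0<..<3 * i}. (\<lambda>j. g j c) ` {..<q})" for i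
    proof (induction i)
      case (Suc i)
      have step: "\<exists>W. pth E ((\<lambda>j. g j (3 * i)) ` conN i) 2 W ((\<lambda>j. g j (3 * Suc i)) ` conN (Suc i)) \<and>
        W \<subseteq> (\<lambda>j. g j (3 * i + 1)) ` {..<q} \<union> (\<lambda>j. g j (3 * i + 2)) ` {..<q}"
      proof (rule two_step[where q = q and B = B and e = "cone i", OF inj])
        show "(\<lambda>j. g j (\<sigma> j)) ` cone i \<in> E" if "\<And>j. j < q \<Longrightarrow> \<sigma> j < B" for \<sigma>
          using Ei[of i \<sigma>] that Suc.prems by simp
        show "cone i \<subseteq> {..<q}" using cone_sub[of i l] Suc.prems by (simp add: q_def)
        show "card (cone i) = k" using card_cone[of i] Suc.prems by simp
        show "conN i \<subseteq> cone i" "conN (Suc i) \<subseteq> cone i" by (auto simp: cone_def)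
        show "card (conN i) = l" "card (conN (Suc i)) = l" using card_conN Suc.prems by auto
        show "card (conN i \<union> conN (Suc i)) \<le> k - l" using card_conN_Un[of i] Suc.prems l_lt by simp
      qed (use Suc.prems in \<open>auto simp: B_def\<close>)
      then obtain W where W: "pth E ((\<lambda>j. g j (3 * i)) ` conN i) 2 W ((\<lambda>j. g j (3 * Suc i)) ` conN (Suc i))"
        "W \<subseteq> (\<lambda>j. g j (3 * i + 1)) ` {..<q} \<union> (\<lambda>j. g j (3 * i + 2)) ` {..<q}" by blast
      show ?case
      proof (cases "i = 0")
        case True
        have "W \<subseteq> (\<Union>c\<in>{0<..<3 * Suc i}. (\<lambda>j. g j c) ` {..<q})" 
          by (rule order_trans[OF W(2)], intro Un_least UN_upper) auto
        then show ?thesis using W(1) True by auto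
      next
        case False
        then obtain W' where W': "pth E ((\<lambda>j. g j 0) ` conN 0) (2 * i) W' ((\<lambda>j. g j (3 * i)) ` conN i)"
          "W' \<subseteq> (\<Union>c\<in>{0<..<3 * i}. (\<lambda>j. g j c) ` {..<q})" using Suc by auto
        have "k \<le> q" using two_l by (auto simp: q_def)
        then have cq: "conN j \<subseteq> {..<q}" if "j \<le> l" for j using conN_sub[OF that] by auto
        have 1: "(\<lambda>j. g j 0) ` conN 0 \<union> W' \<subseteq> (\<Union>c\<in>{..<3 * i}. (\<lambda>j. g j c) ` {..<q})"
        proof (rule Un_least)
          have "(\<lambda>j. g j 0) ` conN 0 \<subseteq> (\<lambda>j. g j 0) ` {..<q}" using cq[of 0] by (intro image_mono) auto
          also have "\<dots> \<subseteq> (\<Union>c\<in>{..<3 * i}. (\<lambda>j. g j c) ` {..<q})" using False by (intro UN_upper) auto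
          finally show "(\<lambda>j. g j 0) ` conN 0 \<subseteq> (\<Union>c\<in>{..<3 * i}. (\<lambda>j. g j c) ` {..<q})" .
          show "W' \<subseteq> (\<Union>c\<in>{..<3 * i}. (\<lambda>j. g j c) ` {..<q})"
            by (rule order_trans[OF W'(2)], rule UN_mono) auto
        qed
        have 2: "W \<union> (\<lambda>j. g j (3 * Suc i)) ` conN (Suc i) \<subseteq> (\<Union>c\<in>{3 * i<..<B}. (\<lambda>j. g j c) ` {..<q})"
        proof (rule Un_least)
          have "(\<lambda>j. g j (3 * Suc i)) ` conN (Suc i) \<subseteq> (\<lambda>j. g j (3 * Suc i)) ` {..<q}"
            using cq[of "Suc i"] Suc.prems by (intro image_mono) auto
          also have "\<dots> \<subseteq> (\<Union>c\<in>{3 * i<..<B}. (\<lambda>j. g j c) ` {..<q})"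
            using Suc.prems by (intro UN_upper) (auto simp: B_def)
          finally show "(\<lambda>j. g j (3 * Suc i)) ` conN (Suc i) \<subseteq> (\<Union>c\<in>{3 * i<..<B}. (\<lambda>j. g j c) ` {..<q})" .
          show "W \<subseteq> (\<Union>c\<in>{3 * i<..<B}. (\<lambda>j. g j c) ` {..<q})"
            using Suc.prems by (intro order_trans[OF W(2)] Un_least UN_upper) (auto simp: B_def)
        qed
        have 3: "(\<Union>c\<in>{..<3 * i}. (\<lambda>j. g j c) ` {..<q}) \<inter> (\<Union>c\<in>{3 * i<..<B}. (\<lambda>j. g j c) ` {..<q}) = {}"
        proof (rule ccontr)
          assume "\<not> ?thesis"
          then obtain c c' j j' where x: "c < 3 * i" "c' > 3 * i" "c' < B" "j < q" "j' < q" "g j c = g j' c'" by auto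
          then have "c = c'" using inj[of j c j' c'] by simp
          then show False using x by simp
        qed
        have "pth E ((\<lambda>j. g j 0) ` conN 0) (2 * i + 2) (W' \<union> (\<lambda>j. g j (3 * i)) ` conN i \<union> W) ((\<lambda>j. g j (3 * Suc i)) ` conN (Suc i))"
          using 1 2 3 by (intro comp[OF W'(1) W(1)]) blast
        moreover have "W' \<union> (\<lambda>j. g j (3 * i)) ` conN i \<union> W \<subseteq> (\<Union>c\<in>{0<..<3 * Suc i}. (\<lambda>j. g j c) ` {..<q})"
        proof (intro Un_least)
          have "(\<lambda>j. g j (3 * i)) ` conN i \<subseteq> (\<lambda>j. g j (3 * i)) ` {..<q}"
            using cq[of i] Suc.prems by (intro image_mono) auto
          also have "\<dots> \<subseteq> (\<Union>c\<in>{0<..<3 * Suc i}. (\<lambda>j. g j c) ` {..<q})"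
            using False by (intro UN_upper) auto
          finally show "(\<lambda>j. g j (3 * i)) ` conN i \<subseteq> (\<Union>c\<in>{0<..<3 * Suc i}. (\<lambda>j. g j c) ` {..<q})" .
          show "W' \<subseteq> (\<Union>c\<in>{0<..<3 * Suc i}. (\<lambda>j. g j c) ` {..<q})"
            by (rule order_trans[OF W'(2)], rule UN_mono) auto
          show "W \<subseteq> (\<Union>c\<in>{0<..<3 * Suc i}. (\<lambda>j. g j c) ` {..<q})"
            by (intro order_trans[OF W(2)] Un_least UN_upper) auto
        qed
        moreover have "2 * Suc i = 2 * i + 2" by simp
        ultimately show ?thesis by metis
      qed
    qed simp
    obtain W where W: "pth E ((\<lambda>j. g j 0) ` conN 0) (2 * l) W ((\<lambda>j. g j (3 * l)) ` conN l)"
       "W \<subseteq> (\<Union>c\<in>{0<..<3 * l}. (\<lambda>j. g j c) ` {..<q})"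
      using chain[of l] l_pos by auto
    have c0: "conN 0 = {..<l}" "conN l = {k - l..<k}" using two_l by (auto simp: conN_def)
    have kq: "k \<le> q" "2 * (k - l) \<le> q" using two_l by (auto simp: q_def)
    have inj1: "inj_on (\<lambda>i. g i x) A" if "A \<subseteq> {..<q}" "x < B" for A x
      using that inj by (auto simp: inj_on_def subset_iff)
    let ?W0 = "(\<lambda>j. g j 0) ` {l..<k - l}" and ?N0 = "(\<lambda>j. g j 0) ` {..<l}"
    let ?W1 = "(\<lambda>j. g j (3 * l)) ` {k..<2 * (k - l)}" and ?N1 = "(\<lambda>j. g j (3 * l)) ` {k - l..<k}"
    have gL: "(\<lambda>j. g j x) ` A \<inter> (L \<union> L') = {}" "(\<lambda>j. g j x) ` A \<subseteq> U" if "A \<subseteq> {..<q}" "x < B" for A x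
      using that g by (auto simp: subset_iff)
    have dis: "(\<lambda>i. g i x) ` A \<inter> (\<lambda>i. g i y) ` A' = {}" 
      if "A \<subseteq> {..<q}" "A' \<subseteq> {..<q}" "x < B" "y < B" "x \<noteq> y \<or> A \<inter> A' = {}" for A A' x y
    proof -
      have False if "i \<in> A" "i' \<in> A'" "g i x = g i' y" for i i'
        using that \<open>A \<subseteq> {..<q}\<close> \<open>A' \<subseteq> {..<q}\<close> \<open>x < B\<close> \<open>y < B\<close> \<open>x \<noteq> y \<or> A \<inter> A' = {}\<close>
          inj[of i x i' y] by auto
      then show ?thesis by blast
    qed
    have sub: "{l..<k - l} \<subseteq> {..<q}" "{..<l} \<subseteq> {..<q}" "{k..<2 * (k - l)} \<subseteq> {..<q}" "{k - l..<k} \<subseteq> {..<q}"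
      using kq two_l by auto
    have B: "0 < B" "3 * l < B" by (auto simp: B_def)
    have p0: "pth E L 1 ?W0 ?N0"
    proof (rule edge)
      have eq: "{..<k - l} = {l..<k - l} \<union> {..<l}" using l_lt by auto
      show "L \<union> ?W0 \<union> ?N0 \<in> E" using E0 unfolding eq image_Un Un_assoc .
      show "card ?W0 = k - 2 * l" "card ?N0 = l"
        using inj1[OF sub(1) B(1)] inj1[OF sub(2) B(1)] by (simp_all add: card_image)
      show "L \<inter> ?W0 = {}" "L \<inter> ?N0 = {}" using gL(1)[OF sub(1) B(1)] gL(1)[OF sub(2) B(1)]
        by (simp_all add: Int_commute Int_Un_distrib Int_Un_distrib2)
      show "?W0 \<inter> ?N0 = {}" using sub B by (intro dis) auto
    qed (use a fin in simp_all)
    have p1: "pth E ?N1 1 ?W1 L'"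
    proof (rule edge)
      have eq: "{k - l..<2 * (k - l)} = {k - l..<k} \<union> {k..<2 * (k - l)}" using two_l by auto
      have "L' \<union> (?N1 \<union> ?W1) \<in> E" using E1 unfolding eq image_Un .
      then show "?N1 \<union> ?W1 \<union> L' \<in> E" by (simp only: Un_commute)
      show "card ?W1 = k - 2 * l" "card ?N1 = l"
        using inj1[OF sub(3) B(2)] inj1[OF sub(4) B(2)] two_l by (simp_all add: card_image)
      show "?W1 \<inter> L' = {}" "?N1 \<inter> L' = {}" using gL(1)[OF sub(3) B(2)] gL(1)[OF sub(4) B(2)]
        by (simp_all add: Int_commute Int_Un_distrib Int_Un_distrib2)
      show "?N1 \<inter> ?W1 = {}" using sub B by (intro dis) auto
    qed (use a fin in simp_all)
    have WB: "W \<subseteq> (\<Union>c\<in>{0<..<B}. (\<lambda>j. g j c) ` {..<q})" 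
      by (rule order_trans[OF W(2)], rule UN_mono) (auto simp: B_def)
    have WL: "W \<inter> (L \<union> L') = {}" "W \<subseteq> U"
    proof -
      have "x \<in> U - (L \<union> L')" if x: "x \<in> W" for x
      proof -
        have "x \<in> (\<Union>c\<in>{0<..<B}. (\<lambda>j. g j c) ` {..<q})" using x WB by (rule rev_subsetD)
        then obtain c j where "c < B" "j < q" "x = g j c" by auto
        then show ?thesis using g by simp
      qed
      then show "W \<inter> (L \<union> L') = {}" "W \<subseteq> U" by auto
    qed
    have disW: "W \<inter> (\<lambda>j. g j x) ` A = {}" if "A \<subseteq> {..<q}" "x = 0 \<or> x = 3 * l" for x A
    proof (rule ccontr)
      assume "\<not> ?thesis"
      then obtain w where w: "w \<in> W" "w \<in> (\<lambda>i. g i x) ` A" by auto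
      from w(2) obtain j' where "w = g j' x" "j' \<in> A" by (rule imageE)
      with w(1) have j': "j' \<in> A" "g j' x \<in> W" by simp_all
      have "g j' x \<in> (\<Union>c\<in>{0<..<3 * l}. (\<lambda>j. g j c) ` {..<q})" using j'(2) W(2) by (rule rev_subsetD)
      then obtain c where c: "c \<in> {0<..<3 * l}" "g j' x \<in> (\<lambda>j. g j c) ` {..<q}" by (rule UN_E)
      from c(2) obtain j where j: "g j' x = g j c" "j \<in> {..<q}" by (rule imageE)
      have x: "0 < c" "c < 3 * l" "j < q" "g j c = g j' x" using c(1) j by simp_all
      have xB: "j' < q" "x < B" "c < B" using subsetD[OF that(1) j'(1)] that(2) x(2) B by auto
      have "c = x" using inj[OF x(3) xB(3,1,2) x(4)] by simp
      then show False using x(1,2) that(2) by simp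
    qed
    have "pth E L (1 + 2 * l) (?W0 \<union> ?N0 \<union> W) ?N1"
    proof (rule comp[OF p0])
      show "pth E ?N0 (2 * l) W ?N1" using W(1) by (simp add: c0)
      show "(L \<union> ?W0) \<inter> (W \<union> ?N1) = {}"
        unfolding Int_Un_distrib Int_Un_distrib2
        using WL(1) disW[OF sub(1), of 0] gL(1)[OF sub(4) B(2)] dis[OF sub(1) sub(4) B] l_pos
        by (simp add: Int_commute Int_Un_distrib Int_Un_distrib2)
    qed
    then have "pth E L (1 + 2 * l + 1) (?W0 \<union> ?N0 \<union> W \<union> ?N1 \<union> ?W1) L'"
    proof (rule comp[OF _ p1])
      show "(L \<union> (?W0 \<union> ?N0 \<union> W)) \<inter> (?W1 \<union> L') = {}"
        using WL(1) disW[OF sub(3), of "3 * l"] gL(1)[OF sub(1) B(1)] gL(1)[OF sub(2) B(1)] gL(1)[OF sub(3) B(2)]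
         dis[OF sub(1) sub(3) B] dis[OF sub(2) sub(3) B] l_pos a
        by (simp add: Int_commute Int_Un_distrib Int_Un_distrib2)
    qed
    moreover have eq: "1 + 2 * l + 1 = 2 * l + 2" by simp
    ultimately have "pth E L (2 * l + 2) (?W0 \<union> ?N0 \<union> W \<union> ?N1 \<union> ?W1) L'" by (simp only: eq)
    moreover have "A \<subseteq> U - (L \<union> L')" if "A \<inter> (L \<union> L') = {}" "A \<subseteq> U" for A using that by blast
    then have "?W0 \<union> ?N0 \<union> W \<union> ?N1 \<union> ?W1 \<subseteq> U - (L \<union> L')"
      using WL gL[OF sub(1) B(1)] gL[OF sub(2) B(1)] gL[OF sub(3) B(2)] gL[OF sub(4) B(2)] by (metis Un_least)
    ultimately show "\<exists>W\<subseteq>U - (L \<union> L'). pth E L (2 * l + 2) W L'" by (intro exI conjI)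
  qed
qed

end

section \<open>A tail estimate\<close>

lemma top_set:
  fixes z :: "'a \<Rightarrow> real"
  assumes "finite V" "m \<le> card V"
  shows "\<exists>A\<subseteq>V. card A = m \<and> (\<forall>a\<in>A. \<forall>b\<in>V - A. z b \<le> z a)"
  using assms(2)
proof (induction m)
  case (Suc m)
  then obtain A where A: "A \<subseteq> V" "card A = m" "\<forall>a\<in>A. \<forall>b\<in>V - A. z b \<le> z a" by auto
  have fin: "finite (V - A)" using assms by simp
  have "card (V - A) > 0" using A Suc.prems assms finite_subset[OF A(1)] by (simp add: card_Diff_subset)
  then have ne: "V - A \<noteq> {}" using card_gt_0_iff by blast
  have "Max (z ` (V - A)) \<in> z ` (V - A)" using fin ne by (intro Max_in) auto
  then obtain x where x: "x \<in> V - A" "z x = Max (z ` (V - A))" by auto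
  have mx: "z b \<le> z x" if "b \<in> V - A" for b using that fin x(2) by simp
  have "card (insert x A) = Suc m" using x A assms finite_subset[OF A(1)] by simp
  moreover have "\<forall>a\<in>insert x A. \<forall>b\<in>V - insert x A. z b \<le> z a" using A(3) mx by auto
  ultimately show ?case using A(1) x(1) by (intro exI[of _ "insert x A"]) auto
qed (auto intro: exI[of _ "{}"])

text \<open>Singles out the entry at position \<open>i\<close>, for sums over tuples with one
  distinguished entry.\<close>

definition ins :: "nat \<Rightarrow> 'a \<Rightarrow> 'a list \<Rightarrow> 'a list" where
  "ins i x ys = take i ys @ x # drop i ys"

lemma set_ins: "set (ins i x ys) = insert x (set ys)"
  unfolding ins_def by (metis append_take_drop_id insert_is_Un list.simps(15) set_append sup_left_commute)

lemma length_ins: "length (ins i x ys) = Suc (length ys)"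
  by (simp add: ins_def)

lemma sum_list_ins: "sum_list (map z (ins i x ys)) = (z x :: real) + sum_list (map z ys)"
proof -
  have "sum_list (map z ys) = sum_list (map z (take i ys @ drop i ys))" by simp
  also have "\<dots> = sum_list (map z (take i ys)) + sum_list (map z (drop i ys))" by (simp only: map_append sum_list_append)
  finally show ?thesis by (simp add: ins_def)
qed

lemma ins_inj:
  assumes "ins i x ys = ins i x' ys'" "i \<le> length ys" "i \<le> length ys'"
  shows "x = x' \<and> ys = ys'"
  using assms unfolding ins_def
  by (metis (no_types, lifting) append_eq_append_conv append_take_drop_id length_take list.inject min.absorb2)

lemma ins_surj:
  assumes "i < length xs"
  shows "xs = ins i (xs ! i) (take i xs @ drop (Suc i) xs)"
  using assms id_take_nth_drop[of i xs] by (simp add: ins_def)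

lemma sum_tup_ins:
  assumes "finite U" "i \<le> q"
  shows "(\<Sum>xs\<in>tup U (Suc q). f xs) = (\<Sum>x\<in>U. \<Sum>ys\<in>tup U q. f (ins i x ys))"
proof -
  have "(\<Sum>x\<in>U. \<Sum>ys\<in>tup U q. f (ins i x ys)) = (\<Sum>(x, ys)\<in>U \<times> tup U q. f (ins i x ys))"
    using assms by (simp add: sum.cartesian_product)
  also have "\<dots> = (\<Sum>xs\<in>(\<lambda>(x, ys). ins i x ys) ` (U \<times> tup U q). f xs)"
  proof (subst sum.reindex)
    show "inj_on (\<lambda>(x, ys). ins i x ys) (U \<times> tup U q)"
      using assms(2) by (auto simp: inj_on_def tup_def dest: ins_inj)
  qed (simp add: case_prod_unfold)
  also have "(\<lambda>(x, ys). ins i x ys) ` (U \<times> tup U q) = tup U (Suc q)"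
  proof
    show "(\<lambda>(x, ys). ins i x ys) ` (U \<times> tup U q) \<subseteq> tup U (Suc q)"
      by (auto simp: tup_def set_ins length_ins)
    show "tup U (Suc q) \<subseteq> (\<lambda>(x, ys). ins i x ys) ` (U \<times> tup U q)"
    proof
      fix xs assume xs: "xs \<in> tup U (Suc q)"
      then have "i < length xs" using assms(2) by (simp add: tup_def)
      moreover from this have "xs ! i \<in> U" "take i xs @ drop (Suc i) xs \<in> tup U q"
        using xs set_take_subset[of i xs] set_drop_subset[of "Suc i" xs] nth_mem[of i xs]
        by (auto simp: tup_def)
      ultimately show "xs \<in> (\<lambda>(x, ys). ins i x ys) ` (U \<times> tup U q)"
        using ins_surj[of i xs] by (intro image_eqI[of _ _ "(xs ! i, take i xs @ drop (Suc i) xs)"]) auto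
    qed
  qed
  finally show ?thesis by simp
qed

lemma sum_tup_sum_list:
  fixes z :: "'a \<Rightarrow> real"
  assumes "finite U"
  shows "card U * (\<Sum>xs\<in>tup U q. sum_list (map z xs)) = real q * card U ^ q * sum z U"
proof (induction q)
  case (Suc q)
  have "(\<Sum>xs\<in>tup U (Suc q). sum_list (map z xs)) = (\<Sum>x\<in>U. \<Sum>ys\<in>tup U q. z x + sum_list (map z ys))"
    using sum_tup_ins[OF assms, of 0 q "\<lambda>xs. sum_list (map z xs)"] by (simp add: sum_list_ins)
  also have "\<dots> = card U ^ q * sum z U + card U * (\<Sum>ys\<in>tup U q. sum_list (map z ys))"
    by (simp add: sum.distrib card_tup assms sum_distrib_left)
  finally have "card U * (\<Sum>xs\<in>tup U (Suc q). sum_list (map z xs)) =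
     card U ^ Suc q * sum z U + card U * (card U * (\<Sum>ys\<in>tup U q. sum_list (map z ys)))"
    by (simp add: algebra_simps)
  then show ?case unfolding Suc.IH by (simp add: algebra_simps)
qed simp

lemma tup_markov:
  fixes z :: "'a \<Rightarrow> real"
  assumes "finite U" "\<And>x. x \<in> U \<Longrightarrow> z x \<ge> 0" "c \<ge> 0"
  shows "t * card {xs \<in> tup U q. c + sum_list (map z xs) \<ge> t} \<le> c * card U ^ q + (\<Sum>xs\<in>tup U q. sum_list (map z xs))"
proof -
  have nn: "sum_list (map z xs) \<ge> 0" if "xs \<in> tup U q" for xs
    using that assms(2) by (auto simp: tup_def subset_iff intro!: sum_list_nonneg)
  have "t * card {xs \<in> tup U q. c + sum_list (map z xs) \<ge> t} = (\<Sum>xs\<in>{xs \<in> tup U q. c + sum_list (map z xs) \<ge> t}. t)"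
    by simp
  also have "\<dots> \<le> (\<Sum>xs\<in>{xs \<in> tup U q. c + sum_list (map z xs) \<ge> t}. c + sum_list (map z xs))"
    by (intro sum_mono) auto
  also have "\<dots> \<le> (\<Sum>xs\<in>tup U q. c + sum_list (map z xs))"
    using nn assms by (intro sum_mono2) (auto simp: add_nonneg_nonneg)
  also have "\<dots> = c * card U ^ q + (\<Sum>xs\<in>tup U q. sum_list (map z xs))"
    using assms by (simp add: sum.distrib card_tup)
  finally show ?thesis .
qed

lemma card_tup_compl:
  "finite U \<Longrightarrow> real (card {xs \<in> tup U q. P xs}) + card {xs \<in> tup U q. \<not> P xs} = real (card U ^ q)"
proof -
  assume f: "finite U"
  have "card {xs \<in> tup U q. P xs} + card {xs \<in> tup U q. \<not> P xs} = card ({xs \<in> tup U q. P xs} \<union> {xs \<in> tup U q. \<not> P xs})"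
    using f by (intro card_Un_disjoint[symmetric]) auto
  also have "{xs \<in> tup U q. P xs} \<union> {xs \<in> tup U q. \<not> P xs} = tup U q" by auto
  finally show ?thesis using f by (simp add: card_tup flip: of_nat_add)
qed

text \<open>\<open>A\<close> consists of the \<open>m\<close> largest weights. Tuples with exactly one entry in \<open>A\<close> are compared with tuples
  that avoid \<open>A\<close>: by Markov's inequality, the light ones of the first kind outweigh the heavy
  ones of the second kind.\<close>

lemma tail_core:
  fixes z :: "'a \<Rightarrow> real"
  assumes fin: "finite V" and cV: "card V = m * t" and z0: "\<And>x. x \<in> V \<Longrightarrow> z x \<ge> 0"
    and zs: "sum z V \<le> m * t" and t: "t \<ge> 2" "t \<ge> 2 * q + 1" and m: "m > 0"
  shows "card {xs \<in> tup V (Suc q). sum_list (map z xs) < t} \<ge> (m * (t - 1)) ^ Suc q"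
proof -
  have "m \<le> card V" using cV t by simp
  then obtain A where A: "A \<subseteq> V" "card A = m" "\<forall>a\<in>A. \<forall>b\<in>V - A. z b \<le> z a"
    using top_set[OF fin, of m z] by blast
  define X where "X = V - A"
  have finA: "finite A" and finX: "finite X" using A fin finite_subset by (auto simp: X_def)
  \<comment> \<open>The claimed bound is \<open>N ^ Suc q\<close>, the number of all tuples that
    avoid \<open>A\<close>. So it suffices to make up for each heavy tuple among these by a light
    one with exactly one entry in \<open>A\<close>, that is, to show
    \<open>nb \<le> g1\<close>.\<close>
  define N where "N = m * (t - 1)"
  have cX: "card X = N" using A cV finA by (simp add: X_def card_Diff_subset N_def algebra_simps diff_mult_distrib2)
  have N0: "N > 0" using m t by (simp add: N_def)
  have rN: "real N = m * (real t - 1)" using t by (simp add: N_def of_nat_diff)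
  define y where "y = sum z X / N"
  have y0: "y \<ge> 0" using z0 by (auto simp: y_def X_def intro!: sum_nonneg divide_nonneg_nonneg)
  have sX: "sum z X = N * y" using N0 by (simp add: y_def)
  have sA: "sum z A \<le> m * t - N * y"
  proof -
    have "sum z V = sum z A + sum z X" using A fin finA by (simp add: X_def sum_diff)
    then show ?thesis using zs sX by simp
  qed
  have S: "(\<Sum>xs\<in>tup X p. sum_list (map z xs)) = real p * real N ^ p * y" for p
    using sum_tup_sum_list[OF finX, of z p] N0 by (simp add: cX sX field_simps)
  have zX: "\<And>x. x \<in> X \<Longrightarrow> z x \<ge> 0" using z0 by (simp add: X_def)
  define bad where "bad c = card {ys \<in> tup X q. c + sum_list (map z ys) \<ge> t}" for c
  define good where "good c = card {ys \<in> tup X q. c + sum_list (map z ys) < t}" for c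
  have gb: "real (good c) = real N ^ q - bad c" for c
    using card_tup_compl[OF finX, of q "\<lambda>ys. c + sum_list (map z ys) < t"] by (simp add: good_def bad_def cX not_less)
  have bad: "real t * bad c \<le> c * real N ^ q + real q * real N ^ q * y" if "c \<ge> 0" for c
    using tup_markov[where U = X and z = z and t = "real t" and q = q, OF finX zX that] by (simp add: bad_def S cX)
  define g1 where "g1 = (\<Sum>i<Suc q. \<Sum>a\<in>A. good (z a))"
  have g1: "real t * real g1 \<ge> real (Suc q) * real N ^ q * (m * (real t - real (Suc q)) * y)"
  proof -
    have "real t * (\<Sum>a\<in>A. real (bad (z a))) = (\<Sum>a\<in>A. real t * bad (z a))" by (simp add: sum_distrib_left)
    also have "\<dots> \<le> (\<Sum>a\<in>A. z a * real N ^ q + real q * real N ^ q * y)"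
      using z0 A(1) by (intro sum_mono bad) auto
    also have "\<dots> = sum z A * real N ^ q + m * (real q * real N ^ q * y)"
      by (simp add: sum.distrib sum_distrib_right A)
    also have "\<dots> \<le> (m * t - N * y) * real N ^ q + m * (real q * real N ^ q * y)"
      using sA by (intro add_right_mono mult_right_mono) auto
    finally have 1: "real t * (\<Sum>a\<in>A. real (bad (z a))) \<le> (m * t - N * y) * real N ^ q + m * (real q * real N ^ q * y)" .
    have "(\<Sum>a\<in>A. real (good (z a))) = m * real N ^ q - (\<Sum>a\<in>A. real (bad (z a)))"
      by (simp add: gb sum_subtractf A)
    then have "real t * (\<Sum>a\<in>A. real (good (z a))) = real t * (m * real N ^ q) - real t * (\<Sum>a\<in>A. real (bad (z a)))"
      by (simp only: right_diff_distrib)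
    also have "\<dots> \<ge> real t * (m * real N ^ q) - ((m * t - N * y) * real N ^ q + m * (real q * real N ^ q * y))"
      using 1 by linarith
    finally have "real t * (m * real N ^ q) - ((m * t - N * y) * real N ^ q + m * (real q * real N ^ q * y))
      \<le> real t * (\<Sum>a\<in>A. real (good (z a)))" .
    \<comment> \<open>The terms without \<open>y\<close> cancel, and \<open>N = m * (t - 1)\<close>
      leaves \<open>m * (t - 1 - q) * y\<close>: the more weight \<open>X\<close> carries, the
      lighter \<open>A\<close> must be.\<close>
    moreover have "real t * (m * real N ^ q) - ((m * t - N * y) * real N ^ q + m * (real q * real N ^ q * y))
       = real N ^ q * (m * (real t - real (Suc q)) * y)"
      unfolding rN by (simp add: algebra_simps)
    ultimately have 2: "real N ^ q * (m * (real t - real (Suc q)) * y) \<le> real t * (\<Sum>a\<in>A. real (good (z a)))"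
      by (simp only:)
    have "g1 = Suc q * (\<Sum>a\<in>A. good (z a))" by (simp add: g1_def)
    then have "real g1 = real (Suc q) * (\<Sum>a\<in>A. real (good (z a)))" by (simp only: of_nat_mult of_nat_sum)
    then have "real t * real g1 = real (Suc q) * (real t * (\<Sum>a\<in>A. real (good (z a))))"
      by (simp only: mult.left_commute)
    moreover have "real (Suc q) * (real N ^ q * (m * (real t - real (Suc q)) * y))
       \<le> real (Suc q) * (real t * (\<Sum>a\<in>A. real (good (z a))))"
      by (rule mult_left_mono[OF 2]) simp
    ultimately show ?thesis by (simp only: mult.assoc)
  qed
  define nb where "nb = card {xs \<in> tup X (Suc q). sum_list (map z xs) \<ge> t}"
  have nb: "real t * nb \<le> real (Suc q) * (m * real N ^ q * q * y)"
  proof (cases "y = 0")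
    case True
    have "real t * nb \<le> 0 * real (card X) ^ Suc q + (\<Sum>xs\<in>tup X (Suc q). sum_list (map z xs))"
      using tup_markov[where U = X and z = z and t = "real t" and q = "Suc q", OF finX zX order_refl] by (simp add: nb_def)
    then show ?thesis using True by (simp add: S)
  next
    case False
    then have yp: "y > 0" using y0 by simp
    have "A \<noteq> {}" using A m by auto
    then have "Min (z ` A) \<in> z ` A" using finA by (intro Min_in) auto
    \<comment> \<open>The lightest member of \<open>A\<close> bounds every weight in
      \<open>X\<close>. By the bound on \<open>sum z A\<close> it leaves at least
      \<open>(t - 1) * y\<close> for the other \<open>q\<close> entries of a heavy tuple. Their mean
      total is \<open>q * y\<close>, so \<open>y\<close> cancels in Markov's inequality; therefore
      \<open>y = 0\<close> is treated apart.\<close>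
    then obtain b where b: "b \<in> A" "z b = Min (z ` A)" by auto
    have "m * z b \<le> sum z A" using sum_bounded_below[of A "z b" z] b finA A(2) by simp
    also have "\<dots> \<le> m * t - m * (real t - 1) * y" using sA rN by simp
    finally have "m * z b \<le> m * (t - (real t - 1) * y)" by (simp add: algebra_simps)
    then have zb: "z b \<le> t - (real t - 1) * y" using m by simp
    have Xb: "z x \<le> z b" if "x \<in> X" for x using A(3) b that by (auto simp: X_def)
    define r where "r = card {ys \<in> tup X q. 0 + sum_list (map z ys) \<ge> t - z b}"
    have "(real t - 1) * y * r \<le> (t - z b) * r" using zb by (intro mult_right_mono) auto
    also have "\<dots> \<le> real q * real N ^ q * y"
      using tup_markov[where U = X and z = z and t = "t - z b" and q = q, OF finX zX order_refl] by (simp add: r_def S)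
    finally have r: "(real t - 1) * r \<le> real q * real N ^ q"
      using yp by (simp add: mult.commute mult.left_commute)
    \<comment> \<open>Heavy tuples are counted with the weight of one entry; summed over all entries
      this gives at least \<open>t\<close> per heavy tuple. For a fixed entry, the condition on the
      others is relaxed to one that does not involve it, and the sum factorises.\<close>
    have one: "(\<Sum>xs\<in>tup X (Suc q). of_bool (sum_list (map z xs) \<ge> t) * z (xs ! i)) \<le> m * real N ^ q * q * y"
      if i: "i < Suc q" for i
    proof -
      have "(\<Sum>xs\<in>tup X (Suc q). of_bool (sum_list (map z xs) \<ge> t) * z (xs ! i))
        = (\<Sum>x\<in>X. \<Sum>ys\<in>tup X q. of_bool (z x + sum_list (map z ys) \<ge> t) * z (ins i x ys ! i))"
        using sum_tup_ins[OF finX, of i q "\<lambda>xs. of_bool (sum_list (map z xs) \<ge> t) * z (xs ! i)"] i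
        by (simp add: sum_list_ins)
      also have "\<dots> = (\<Sum>x\<in>X. \<Sum>ys\<in>tup X q. of_bool (z x + sum_list (map z ys) \<ge> t) * z x)"
        using i by (intro sum.cong refl) (auto simp: ins_def nth_append tup_def)
      also have "\<dots> \<le> (\<Sum>x\<in>X. \<Sum>ys\<in>tup X q. of_bool (0 + sum_list (map z ys) \<ge> t - z b) * z x)"
      proof (intro sum_mono mult_right_mono)
        fix x ys assume "x \<in> X"
        then show "of_bool (z x + sum_list (map z ys) \<ge> t) \<le> (of_bool (0 + sum_list (map z ys) \<ge> t - z b) :: real)" "z x \<ge> 0"
          using Xb[of x] zX[of x] by auto
      qed
      also have "\<dots> = (\<Sum>x\<in>X. (\<Sum>ys\<in>tup X q. of_bool (0 + sum_list (map z ys) \<ge> t - z b)) * z x)"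
        by (simp add: sum_distrib_right)
      also have "\<dots> = r * (N * y)"
        using card_filter_eq_sum[of "tup X q" "\<lambda>ys. 0 + sum_list (map z ys) \<ge> t - z b"] finX
        by (simp add: r_def sX flip: sum_distrib_left)
      also have "\<dots> = m * y * ((real t - 1) * r)" by (simp add: rN)
      also have "\<dots> \<le> m * y * (real q * real N ^ q)" using y0 by (intro mult_left_mono r) auto
      finally show ?thesis by (simp add: mult_ac)
    qed
    have "real t * nb = (\<Sum>xs\<in>tup X (Suc q). of_bool (sum_list (map z xs) \<ge> t) * real t)"
      using card_filter_eq_sum[of "tup X (Suc q)" "\<lambda>xs. sum_list (map z xs) \<ge> t"] finX
      by (simp add: nb_def sum_distrib_left mult.commute)
    also have "\<dots> \<le> (\<Sum>xs\<in>tup X (Suc q). \<Sum>i<Suc q. of_bool (sum_list (map z xs) \<ge> t) * z (xs ! i))"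
    proof (intro sum_mono)
      fix xs assume "xs \<in> tup X (Suc q)"
      then have "sum_list (map z xs) = (\<Sum>i<Suc q. z (xs ! i))"
        by (simp add: sum_list_sum_nth tup_def atLeast0LessThan)
      then show "of_bool (sum_list (map z xs) \<ge> t) * real t \<le> (\<Sum>i<Suc q. of_bool (sum_list (map z xs) \<ge> t) * z (xs ! i))"
        by (simp only: sum_distrib_left[symmetric]) simp
    qed
    also have "\<dots> = (\<Sum>i<Suc q. \<Sum>xs\<in>tup X (Suc q). of_bool (sum_list (map z xs) \<ge> t) * z (xs ! i))"
      by (rule sum.swap)
    also have "\<dots> \<le> (\<Sum>i<Suc q. m * real N ^ q * q * y)" by (intro sum_mono one) auto
    finally show ?thesis by simp
  qed
  have "real t * nb \<le> real t * g1"
  proof -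
    have "real (Suc q) * (m * real N ^ q * q * y) \<le> real (Suc q) * real N ^ q * (m * (real t - real (Suc q)) * y)"
    proof -
      \<comment> \<open>The comparison of the two counts comes down to
        \<open>t \<ge> 2 * q + 1\<close>.\<close>
      have "real q \<le> real t - real (Suc q)" using t by simp
      then have "(real (Suc q) * m * real N ^ q * y) * q \<le> (real (Suc q) * m * real N ^ q * y) * (real t - real (Suc q))"
        using y0 by (intro mult_left_mono) auto
      then show ?thesis by (simp add: mult_ac)
    qed
    then show ?thesis using nb g1 by linarith
  qed
  then have le: "nb \<le> g1" using t by simp
  define G0 where "G0 = {xs \<in> tup X (Suc q). sum_list (map z xs) < t}"
  define I where "I = (SIGMA i:{..<Suc q}. SIGMA a:A. {ys \<in> tup X q. z a + sum_list (map z ys) < t})"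
  define h where "h = (\<lambda>(i::nat, a::'a, ys). ins i a ys)"
  have c0: "real (card G0) = real N ^ Suc q - nb"
    using card_tup_compl[OF finX, of "Suc q" "\<lambda>ys. sum_list (map z ys) < t"] by (simp add: G0_def nb_def cX not_less)
  \<comment> \<open>The position of the only entry in \<open>A\<close> can be read off from the
    tuple, so different triples in \<open>I\<close> give different tuples.\<close>
  have tw: "takeWhile (\<lambda>x. x \<notin> A) (ins i a ys) = take i ys" if "a \<in> A" "set ys \<subseteq> X" for i a ys
  proof -
    have "\<And>x. x \<in> set (take i ys) \<Longrightarrow> x \<notin> A" using that set_take_subset[of i ys] by (auto simp: X_def)
    then show ?thesis using that by (simp add: ins_def)
  qed
  have inj: "inj_on h I"
  proof (rule inj_onI)
    fix p p' assume p: "p \<in> I" "p' \<in> I" "h p = h p'"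
    obtain i a ys where [simp]: "p = (i, a, ys)" by (metis prod_cases3)
    obtain i' a' ys' where [simp]: "p' = (i', a', ys')" by (metis prod_cases3)
    have a: "i < Suc q" "i' < Suc q" "a \<in> A" "a' \<in> A" "set ys \<subseteq> X" "set ys' \<subseteq> X" "length ys = q" "length ys' = q"
      "ins i a ys = ins i' a' ys'"
      using p by (auto simp: I_def tup_def h_def)
    have "take i ys = take i' ys'" using tw[OF a(3,5), of i] tw[OF a(4,6), of i'] a(9) by simp
    then have "length (take i ys) = length (take i' ys')" by simp
    then have "i = i'" using a by simp
    then show "p = p'" using a ins_inj[of i a ys a' ys'] by simp
  qed
  have "card (h ` I) = g1"
    using inj finA finX by (simp add: card_image I_def g1_def good_def)
  moreover have "h ` I \<inter> G0 = {}"
    by (auto simp: I_def h_def G0_def tup_def set_ins X_def)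
  moreover have "finite (h ` I)" using finA finX by (auto simp: I_def)
  moreover have "finite G0" using finX by (simp add: G0_def)
  ultimately have "card (h ` I \<union> G0) = g1 + card G0"
    by (subst card_Un_disjoint) auto
  moreover have "h ` I \<union> G0 \<subseteq> {xs \<in> tup V (Suc q). sum_list (map z xs) < t}"
    using A(1) by (auto simp: I_def h_def G0_def tup_def set_ins length_ins sum_list_ins X_def)
  then have "card (h ` I \<union> G0) \<le> card {xs \<in> tup V (Suc q). sum_list (map z xs) < t}"
    using fin by (intro card_mono) auto
  ultimately have "real (card {xs \<in> tup V (Suc q). sum_list (map z xs) < t}) \<ge> real N ^ Suc q"
    using c0 le by linarith
  then show ?thesis unfolding N_def by (metis of_nat_le_iff of_nat_power)
qed

text \<open>Divisibility of the number of vertices by \<open>t\<close> is achieved below by taking \<open>t\<close> copies of each vertex.\<close>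

lemma card_tup_fst:
  assumes "finite U"
  shows "card {xs \<in> tup (U \<times> {..<t}) s. P (map fst xs)} = t ^ s * card {xs \<in> tup U s. P xs}"
proof (induction s arbitrary: P)
  case 0
  have "{xs \<in> tup U 0. P xs} = (if P [] then {[]} else {})" by auto
  moreover have "{xs \<in> tup (U \<times> {..<t}) 0. P (map fst xs)} = (if P [] then {[]} else {})" by auto
  ultimately show ?case by simp
next
  case (Suc s)
  have "card {xs \<in> tup (U \<times> {..<t}) (Suc s). P (map fst xs)}
      = (\<Sum>x\<in>U \<times> {..<t}. card {ys \<in> tup (U \<times> {..<t}) s. P (fst x # map fst ys)})"
    using assms by (simp add: card_tup_Suc)
  also have "\<dots> = (\<Sum>x\<in>U \<times> {..<t}. t ^ s * card {ys \<in> tup U s. P (fst x # ys)})"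
    using Suc.IH[of "\<lambda>ys. P (_ # ys)"] by simp
  also have "\<dots> = (\<Sum>x\<in>U. \<Sum>j<t. t ^ s * card {ys \<in> tup U s. P (x # ys)})"
    unfolding sum.cartesian_product by (simp add: case_prod_unfold)
  also have "\<dots> = t ^ Suc s * (\<Sum>x\<in>U. card {ys \<in> tup U s. P (x # ys)})"
    by (simp add: sum_distrib_left mult.assoc)
  finally show ?case using assms by (simp add: card_tup_Suc)
qed

text \<open>Equality holds for weight \<open>t\<close> on a proportion \<open>1 / t\<close> of
  \<open>U\<close> and weight zero elsewhere, since then the light tuples are those that avoid the
  weight. This is the bound of Samuels' conjecture on sums of independent nonnegative variables, for
  identically distributed summands and large \<open>t\<close>.\<close>

lemma tail_bound:
  fixes z :: "'a \<Rightarrow> real"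
  assumes fin: "finite U" and z0: "\<And>x. x \<in> U \<Longrightarrow> z x \<ge> 0"
    and zs: "sum z U \<le> card U" and t: "t \<ge> 2" "t + 1 \<ge> 2 * s" and s: "s \<ge> 1"
  shows "card {xs \<in> tup U s. sum_list (map z xs) < t} \<ge> (1 - 1 / real t) ^ s * card U ^ s"
proof (cases "U = {}")
  case True
  then show ?thesis using s by (simp add: power_0_left)
next
  case False
  then have m: "card U > 0" using fin by (simp add: card_gt_0_iff)
  obtain q where q: "s = Suc q" using s by (cases s) auto
  have "sum (z \<circ> fst) (U \<times> {..<t}) = (\<Sum>x\<in>U. \<Sum>j<t. z x)"
    unfolding sum.cartesian_product by (simp add: case_prod_unfold)
  also have "\<dots> = t * sum z U" by (simp add: sum_distrib_left)
  also have "\<dots> \<le> real t * card U" using zs by (intro mult_left_mono) auto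
  finally have "(card U * (t - 1)) ^ Suc q \<le> card {xs \<in> tup (U \<times> {..<t}) (Suc q). sum_list (map (z \<circ> fst) xs) < t}"
    using fin z0 t q m by (intro tail_core) (auto simp: mult.commute)
  also have "\<dots> = t ^ Suc q * card {xs \<in> tup U (Suc q). sum_list (map z xs) < t}"
    using card_tup_fst[OF fin, of t "Suc q" "\<lambda>xs. sum_list (map z xs) < t"] by simp
  finally have "real ((card U * (t - 1)) ^ s) \<le> real (t ^ s * card {xs \<in> tup U s. sum_list (map z xs) < t})"
    unfolding q by (simp only: of_nat_le_iff)
  moreover have "real ((card U * (t - 1)) ^ s) = real t ^ s * ((1 - 1 / real t) ^ s * card U ^ s)"
  proof -
    have "real (card U * (t - 1)) = t * ((1 - 1 / real t) * card U)" using t by (simp add: of_nat_diff field_simps)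
    then have "real ((card U * (t - 1)) ^ s) = (t * ((1 - 1 / real t) * card U)) ^ s" by (simp only: of_nat_power)
    then show ?thesis by (simp only: power_mult_distrib of_nat_power)
  qed
  ultimately have "real t ^ s * ((1 - 1 / real t) ^ s * card U ^ s) \<le> real t ^ s * card {xs \<in> tup U s. sum_list (map z xs) < t}"
    by simp
  moreover have "real t ^ s > 0" using t by simp
  ultimately show ?thesis by (simp only: mult_le_cancel_left_pos)
qed

section \<open>Light paths\<close>

definition cnt :: "nat \<Rightarrow> nat set list \<Rightarrow> nat" where
  "cnt j Qs = length (filter (\<lambda>Q. j \<in> Q) Qs)"

lemma cnt_simps [simp]: "cnt j [] = 0" "cnt j (Q # Qs) = of_bool (j \<in> Q) + cnt j Qs"
  by (auto simp: cnt_def)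

lemma cnt_le: "cnt j Qs \<le> length Qs"
  by (simp add: cnt_def)

lemma cnt_append [simp]: "cnt j (Qs @ Rs) = cnt j Qs + cnt j Rs"
  by (simp add: cnt_def)

lemma bij_betw_of_counts:
  assumes "finite Z" "cls ` Z \<subseteq> {..<k::nat}" "\<And>j. j < k \<Longrightarrow> card {z \<in> Z. cls z = j} = of_bool (j \<in> J)" "J \<subseteq> {..<k}"
  shows "bij_betw cls Z J"
proof -
  have a: "cls z \<in> J" if "z \<in> Z" for z
  proof (rule ccontr)
    assume "cls z \<notin> J"
    moreover have "cls z < k" using that assms(2) by auto
    ultimately have "card {z' \<in> Z. cls z' = cls z} = 0" using assms(3)[of "cls z"] by simp
    then have "{z' \<in> Z. cls z' = cls z} = {}" using assms(1) by simp
    then show False using that by auto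
  qed
  have b: "\<exists>z. {z' \<in> Z. cls z' = j} = {z}" if "j \<in> J" for j
  proof -
    have "card {z' \<in> Z. cls z' = j} = 1" using assms(3)[of j] assms(4) that by auto
    then show ?thesis by (rule card_1_singletonE) blast
  qed
  have "inj_on cls Z"
  proof (rule inj_onI)
    fix x y assume xy: "x \<in> Z" "y \<in> Z" "cls x = cls y"
    obtain z where "{z' \<in> Z. cls z' = cls x} = {z}" using b[OF a[OF xy(1)]] by blast
    then show "x = y" using xy by (metis (mono_tags, lifting) mem_Collect_eq singletonD)
  qed
  moreover have "cls ` Z = J" using a b by (auto simp: image_iff) (metis (mono_tags, lifting) insertI1 mem_Collect_eq)
  ultimately show ?thesis by (simp add: bij_betw_def)
qed

context loose
begin

lemma transversal_edge:
  assumes kp: "\<And>e. \<lbrakk>e \<subseteq> K; bij_betw cls e {..<k}\<rbrakk> \<Longrightarrow> e \<in> E"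
    and Q: "Q0 \<subseteq> {..<k}" "card Q0 = l" "Q1 \<subseteq> {..<k}" "card Q1 = l" "Q0 \<inter> Q1 = {}"
    and sets: "E0 \<subseteq> K" "bij_betw cls E0 Q0" "E1 \<subseteq> K" "bij_betw cls E1 Q1" "X \<subseteq> K" "bij_betw cls X ({..<k} - Q0 - Q1)"
  shows "pth E E0 1 X E1"
proof (rule edge)
  have fQ: "finite Q0" "finite Q1" using finite_subset[OF Q(1)] finite_subset[OF Q(3)] by auto
  have i1: "(Q0 \<inter> ({..<k} - Q0 - Q1)) = {}" and i2: "(Q0 \<union> ({..<k} - Q0 - Q1)) \<inter> Q1 = {}"
    using Q(5) by auto
  have "bij_betw cls (E0 \<union> X \<union> E1) (Q0 \<union> ({..<k} - Q0 - Q1) \<union> Q1)"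
    by (intro bij_betw_combine sets i1 i2)
  also have "Q0 \<union> ({..<k} - Q0 - Q1) \<union> Q1 = {..<k}" using Q by auto
  finally show "E0 \<union> X \<union> E1 \<in> E" using sets by (intro kp) auto
  show "finite E0" "finite X" "finite E1"
    using sets fQ bij_betw_finite by (metis finite_Diff finite_lessThan)+
  show "card E0 = l" "card E1 = l" using sets Q bij_betw_same_card by metis+
  have "card X = card ({..<k} - Q0 - Q1)" using sets bij_betw_same_card by metis
  also have "{..<k} - Q0 - Q1 = {..<k} - (Q0 \<union> Q1)" by auto
  also have "card \<dots> = k - 2 * l" using Q fQ by (simp add: card_Diff_subset card_Un_disjoint)
  finally show "card X = k - 2 * l" .
  have im: "cls ` E0 = Q0" "cls ` E1 = Q1" "cls ` X = {..<k} - Q0 - Q1"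
    using sets by (auto simp: bij_betw_def)
  show "E0 \<inter> X = {}" "E0 \<inter> E1 = {}" "X \<inter> E1 = {}"
    using im Q(5) by (blast, blast, blast)
qed

text \<open>The vertices are divided into \<open>k\<close> classes such that every transversal is an edge. A sequence of \<open>l\<close>-sets
  of classes, consecutive ones disjoint, becomes a path whose successive overlaps lie in these
  classes; each class meets each of the \<open>m\<close> edges once, whence the counting condition.\<close>

lemma walk_pth:
  assumes kp: "\<And>e. \<lbrakk>e \<subseteq> K; bij_betw cls e {..<k}\<rbrakk> \<Longrightarrow> e \<in> E"
  shows "\<lbrakk>length Qs = Suc m; m \<ge> 1; \<forall>Q\<in>set Qs. Q \<subseteq> {..<k} \<and> card Q = l;
     successively (\<lambda>Q Q'. Q \<inter> Q' = {}) Qs; E0 \<subseteq> K; bij_betw cls E0 (hd Qs); E1 \<subseteq> K; bij_betw cls E1 (last Qs);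
     Z \<subseteq> K; finite Z; cls ` Z \<subseteq> {..<k}; E0 \<inter> E1 = {}; Z \<inter> E0 = {}; Z \<inter> E1 = {};
     \<And>j. j < k \<Longrightarrow> card {z \<in> Z. cls z = j} + cnt j Qs = m\<rbrakk> \<Longrightarrow> pth E E0 m Z E1"
proof (induction m arbitrary: Qs E0 Z)
  case (Suc m)
  obtain Q0 Q1 Rs where Qs: "Qs = Q0 # Q1 # Rs" and lR: "length Rs = m"
    using Suc.prems(1) by (auto simp: length_Suc_conv)
  have Q: "Q0 \<subseteq> {..<k}" "card Q0 = l" "Q1 \<subseteq> {..<k}" "card Q1 = l" "Q0 \<inter> Q1 = {}"
    using Suc.prems(3,4) Qs by auto
  show ?case
  proof (cases "Rs = []")
    case True
    have "card {z \<in> Z. cls z = j} = of_bool (j \<in> {..<k} - Q0 - Q1)" if "j < k" for j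
      using Suc.prems(15)[OF that] Q(5) that True lR by (auto simp: Qs split: if_splits)
    then have "bij_betw cls Z ({..<k} - Q0 - Q1)"
      using Suc.prems by (intro bij_betw_of_counts[where k = k]) auto
    then show ?thesis using transversal_edge[OF kp Q Suc.prems(5) _ Suc.prems(7) _ Suc.prems(9)]
      Suc.prems True lR by (simp add: Qs)
  next
    case False
    then obtain Q2 Rs' where Rs: "Rs = Q2 # Rs'" by (cases Rs) auto
    have d12: "Q1 \<inter> Q2 = {}" using Suc.prems(4) Qs Rs by simp
    \<comment> \<open>The interior has a vertex in each class that the next edge needs. Otherwise
      \<open>j\<close> would lie in all of the remaining \<open>m + 1\<close> sets, but
      \<open>Q1\<close> and \<open>Q2\<close> are disjoint.\<close>
    have "\<exists>z. z \<in> Z \<and> cls z = j" if j: "j < k" "j \<notin> Q0" for j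
    proof (rule ccontr)
      assume "\<nexists>z. z \<in> Z \<and> cls z = j"
      then have e: "{z \<in> Z. cls z = j} = {}" by auto
      have "cnt j Qs = Suc m" using Suc.prems(15)[OF j(1)] unfolding e by simp
      then have "of_bool (j \<in> Q1) + of_bool (j \<in> Q2) + cnt j Rs' = Suc m" using j Qs Rs by simp
      moreover have "of_bool (j \<in> Q1) + of_bool (j \<in> Q2) \<le> (1 :: nat)" using d12 by auto
      moreover have "cnt j Rs' \<le> m - 1" using cnt_le[of j Rs'] lR Rs by simp
      moreover have "m \<ge> 1" using lR Rs by simp
      ultimately show False by linarith
    qed
    then obtain f where f: "\<And>j. \<lbrakk>j < k; j \<notin> Q0\<rbrakk> \<Longrightarrow> f j \<in> Z \<and> cls (f j) = j" by metis
    define M where "M = f ` Q1"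
    define X where "X = f ` ({..<k} - Q0 - Q1)"
    have Q1k: "j < k \<and> j \<notin> Q0" if "j \<in> Q1" for j using that Q by auto
    have bM: "bij_betw cls M Q1"
      unfolding bij_betw_def M_def using f Q1k by (auto simp: inj_on_def image_image)
    have bX: "bij_betw cls X ({..<k} - Q0 - Q1)"
      unfolding bij_betw_def X_def using f by (auto simp: inj_on_def image_image)
    have MZ: "M \<subseteq> Z" "X \<subseteq> Z" using f Q1k by (auto simp: M_def X_def)
    have p1: "pth E E0 1 X M"
      using transversal_edge[OF kp Q Suc.prems(5) _ _ bM _ bX] Suc.prems(6,9) MZ Qs by auto
    have cc: "card {z \<in> Z - M - X. cls z = j} + cnt j (Q1 # Rs) = m" if j: "j < k" for j
    proof -
      have finZ: "finite {z \<in> Z. cls z = j}" using Suc.prems(10) by simp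
      show ?thesis
      proof (cases "j \<in> Q0")
        case True
        then have "{z \<in> Z - M - X. cls z = j} = {z \<in> Z. cls z = j}"
          using bM bX Q(5) by (auto simp: bij_betw_def)
        then show ?thesis using Suc.prems(15)[OF j] True Qs by simp
      next
        case False
        have "z = f j" if "z \<in> M \<union> X" "cls z = j" for z
          using that f Q1k by (auto simp: M_def X_def)
        moreover have "f j \<in> M \<union> X" using False j by (auto simp: M_def X_def)
        ultimately have "{z \<in> Z - M - X. cls z = j} = {z \<in> Z. cls z = j} - {f j}" by auto
        moreover have "f j \<in> {z \<in> Z. cls z = j}" using f[OF j False] by simp
        ultimately have "card {z \<in> Z - M - X. cls z = j} + 1 = card {z \<in> Z. cls z = j}"
          using finZ by (metis Suc_eq_plus1 card.remove)
        then show ?thesis using Suc.prems(15)[OF j] False Qs by simp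
      qed
    qed
    have p2: "pth E M m (Z - M - X) E1"
    proof (rule Suc.IH[of "Q1 # Rs"])
      show "length (Q1 # Rs) = Suc m" "1 \<le> m" using lR Rs by auto
      show "\<forall>Q\<in>set (Q1 # Rs). Q \<subseteq> {..<k} \<and> card Q = l" using Suc.prems(3) Qs by simp
      show "successively (\<lambda>Q Q'. Q \<inter> Q' = {}) (Q1 # Rs)" using Suc.prems(4) Qs by simp
      show "bij_betw cls M (hd (Q1 # Rs))" using bM by simp
      show "bij_betw cls E1 (last (Q1 # Rs))" using Suc.prems(8) Qs by simp
      show "M \<inter> E1 = {}" "(Z - M - X) \<inter> E1 = {}" using MZ Suc.prems(14) by auto
    qed (use Suc.prems MZ cc in auto)
    have "pth E E0 (1 + m) (X \<union> M \<union> (Z - M - X)) E1"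
    proof (rule comp[OF p1 p2])
      show "(E0 \<union> X) \<inter> (Z - M - X \<union> E1) = {}" using Suc.prems(12,13,14) MZ by blast
    qed
    moreover have "X \<union> M \<union> (Z - M - X) = Z" using MZ by blast
    ultimately show ?thesis by simp
  qed
qed simp

text \<open>The classes of \<open>walk_pth\<close> are now the positions of an edge, a vertex
  belonging to the position that it copies. \<open>Ix j\<close> holds the copies of position
  \<open>j\<close> spent in the interior; \<open>a0\<close> and \<open>a1\<close> are the copies
  used for the ends.\<close>

lemma blow_walk_pth:
  fixes g :: "nat \<Rightarrow> nat \<Rightarrow> 'a"
  assumes inj: "\<And>i j i' j'. \<lbrakk>i < k; j < B; i' < k; j' < B; g i j = g i' j'\<rbrakk> \<Longrightarrow> i = i' \<and> j = j'"
    and E: "\<And>\<sigma>. (\<And>i. i < k \<Longrightarrow> \<sigma> i < B) \<Longrightarrow> (\<lambda>i. g i (\<sigma> i)) ` {..<k} \<in> E"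
    and Qs: "length Qs = Suc m" "m \<ge> 1" "\<forall>Q\<in>set Qs. Q \<subseteq> {..<k} \<and> card Q = l"
      "successively (\<lambda>Q Q'. Q \<inter> Q' = {}) Qs" "hd Qs = Q0" "last Qs = Q1"
    and a: "a0 < B" "a1 < B" "Q0 \<inter> Q1 = {} \<or> a0 \<noteq> a1"
    and Ix: "\<And>j. j < k \<Longrightarrow> Ix j \<subseteq> {..<B}" "\<And>j. j < k \<Longrightarrow> card (Ix j) + cnt j Qs = m"
      "\<And>j. j \<in> Q0 \<Longrightarrow> a0 \<notin> Ix j" "\<And>j. j \<in> Q1 \<Longrightarrow> a1 \<notin> Ix j"
  shows "pth E ((\<lambda>j. g j a0) ` Q0) m (\<Union>j<k. g j ` Ix j) ((\<lambda>j. g j a1) ` Q1)"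
proof -
  define K where "K = (\<Union>j<k. g j ` {..<B})"
  define cls where "cls v = (SOME i. i < k \<and> v \<in> g i ` {..<B})" for v
  have cls: "cls (g i j) = i" if "i < k" "j < B" for i j
  proof -
    have "\<exists>i'. i' < k \<and> g i j \<in> g i' ` {..<B}" using that by auto
    then have "cls (g i j) < k \<and> g i j \<in> g (cls (g i j)) ` {..<B}" unfolding cls_def by (rule someI_ex)
    then obtain j' where j': "cls (g i j) < k" "j' < B" "g i j = g (cls (g i j)) j'" by auto
    show ?thesis using inj[OF that j'] by (elim conjE) (erule sym)
  qed
  have Qne: "Qs \<noteq> []" using Qs by auto
  have Q01: "Q0 \<subseteq> {..<k}" "Q1 \<subseteq> {..<k}" using Qs(3,5,6) Qne by auto
  have kp: "e \<in> E" if e: "e \<subseteq> K" "bij_betw cls e {..<k}" for e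
  proof -
    have "\<exists>j<B. g i j \<in> e" if i: "i < k" for i
    proof -
      have "i \<in> cls ` e" using e(2) i by (simp add: bij_betw_def)
      then obtain v where v: "v \<in> e" "cls v = i" by blast
      then have "v \<in> K" using e by auto
      then obtain i' j where "i' < k" "j < B" "v = g i' j" by (auto simp: K_def)
      then show ?thesis using v cls by auto
    qed
    then obtain \<sigma> where s: "\<And>i. i < k \<Longrightarrow> \<sigma> i < B \<and> g i (\<sigma> i) \<in> e" by metis
    have "e = (\<lambda>i. g i (\<sigma> i)) ` {..<k}"
    proof
      show "(\<lambda>i. g i (\<sigma> i)) ` {..<k} \<subseteq> e" using s by auto
      show "e \<subseteq> (\<lambda>i. g i (\<sigma> i)) ` {..<k}"
      proof
        fix v assume v: "v \<in> e"
        then have c: "cls v < k" using e by (auto simp: bij_betw_def)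
        have "cls (g (cls v) (\<sigma> (cls v))) = cls v" using cls c s by simp
        then have "g (cls v) (\<sigma> (cls v)) = v" using e(2) s[OF c] v by (auto simp: bij_betw_def inj_on_def)
        then show "v \<in> (\<lambda>i. g i (\<sigma> i)) ` {..<k}" using c by (intro image_eqI[of _ _ "cls v"]) auto
      qed
    qed
    then show ?thesis using E[of \<sigma>] s by simp
  qed
  have bij: "bij_betw cls ((\<lambda>j. g j x) ` Q) Q" if "Q \<subseteq> {..<k}" "x < B" for Q x
    unfolding bij_betw_def using that cls by (auto simp: inj_on_def image_image subset_iff)
  have sub: "(\<lambda>j. g j x) ` Q \<subseteq> K" if "Q \<subseteq> {..<k}" "x < B" for Q x
    using that by (auto simp: K_def)
  have disZ: "(\<Union>j<k. g j ` Ix j) \<inter> (\<lambda>j. g j x) ` Q = {}" if Q: "Q \<subseteq> {..<k}" and x: "x < B" "\<And>j. j \<in> Q \<Longrightarrow> x \<notin> Ix j" for Q x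
  proof (rule ccontr)
    assume "\<not> ?thesis"
    then obtain v where v: "v \<in> (\<Union>j<k. g j ` Ix j)" "v \<in> (\<lambda>j. g j x) ` Q" by auto
    from v(1) obtain j i where ji: "j < k" "i \<in> Ix j" "v = g j i" by auto
    from v(2) obtain j' where j': "v = g j' x" "j' \<in> Q" by (rule imageE)
    have "i < B" using ji(1,2) Ix(1) by auto
    moreover have "j' < k" using j' Q by auto
    ultimately have "j = j' \<and> i = x" using inj[of j i j' x] ji j' x by simp
    then show False using x(2)[OF j'(2)] ji by simp
  qed
  show ?thesis
  proof (rule walk_pth[OF kp Qs(1-4)])
    show "bij_betw cls ((\<lambda>j. g j a0) ` Q0) (hd Qs)" "bij_betw cls ((\<lambda>j. g j a1) ` Q1) (last Qs)"
      using bij Q01 a Qs(5,6) by auto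
    show "(\<lambda>j. g j a0) ` Q0 \<subseteq> K" "(\<lambda>j. g j a1) ` Q1 \<subseteq> K" using sub Q01 a by auto
    show "(\<Union>j<k. g j ` Ix j) \<subseteq> K" using Ix(1) unfolding K_def by (intro UN_mono image_mono) auto
    show "finite (\<Union>j<k. g j ` Ix j)" using Ix(1) by (auto intro!: finite_imageI intro: finite_subset)
    show "cls ` (\<Union>j<k. g j ` Ix j) \<subseteq> {..<k}" using Ix(1) cls by (auto simp: subset_iff)
    show "(\<lambda>j. g j a0) ` Q0 \<inter> (\<lambda>j. g j a1) ` Q1 = {}"
    proof (rule ccontr)
      assume "\<not> ?thesis"
      then obtain v where v: "v \<in> (\<lambda>j. g j a0) ` Q0" "v \<in> (\<lambda>j. g j a1) ` Q1" by auto
      from v(1) obtain j where j: "v = g j a0" "j \<in> Q0" by (rule imageE)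
      from v(2) obtain j' where j': "v = g j' a1" "j' \<in> Q1" by (rule imageE)
      have "j = j' \<and> a0 = a1" using inj[of j a0 j' a1] j j' a Q01 by auto
      then show False using a(3) j j' by auto
    qed
    show "(\<Union>j<k. g j ` Ix j) \<inter> (\<lambda>j. g j a0) ` Q0 = {}" "(\<Union>j<k. g j ` Ix j) \<inter> (\<lambda>j. g j a1) ` Q1 = {}"
      using disZ[OF Q01(1) a(1) Ix(3)] disZ[OF Q01(2) a(2) Ix(4)] by auto
    fix j assume j: "j < k"
    have "{z \<in> (\<Union>j<k. g j ` Ix j). cls z = j} = g j ` Ix j"
      using j cls Ix(1) by (auto simp: subset_iff)
    moreover have "card (g j ` Ix j) = card (Ix j)"
      using inj[OF j _ j] Ix(1)[OF j] by (intro card_image inj_onI) (auto simp: subset_iff)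
    ultimately show "card {z \<in> (\<Union>j<k. g j ` Ix j). cls z = j} + cnt j Qs = m" using Ix(2)[OF j] by simp
  qed
qed

end

fun altw :: "'a \<Rightarrow> 'a \<Rightarrow> nat \<Rightarrow> 'a list" where
  "altw A B 0 = [A]"
| "altw A B (Suc h) = A # B # altw A B h"

lemma altw_simps [simp]:
  "length (altw A B h) = Suc (2 * h)" "hd (altw A B h) = A" "last (altw A B h) = A"
  "set (altw A B h) \<subseteq> {A, B}"
proof -
  have "altw A B h \<noteq> []" for h by (cases h) auto
  then show "length (altw A B h) = Suc (2 * h)" "hd (altw A B h) = A" "last (altw A B h) = A"
    "set (altw A B h) \<subseteq> {A, B}"
    by (induction h) auto
qed

lemma cnt_altw: "cnt j (altw A B h) = (h + 1) * of_bool (j \<in> A) + h * of_bool (j \<in> B)"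
  by (induction h) auto

lemma successively_altw:
  "A \<inter> B = {} \<Longrightarrow> successively (\<lambda>Q Q'. Q \<inter> Q' = {}) (altw A B h)"
proof (induction h)
  case (Suc h)
  then show ?case by (cases h) auto
qed simp

context loose
begin

text \<open>The last \<open>2 l\<close> positions will lie in two edges of the path, hence their weight one half.\<close>

definition light :: "'a set set \<Rightarrow> 'a set \<Rightarrow> ('a \<Rightarrow> real) \<Rightarrow> real \<Rightarrow> 'a list set" where
  "light E U y w = {xs \<in> tup U k. set xs \<in> E \<and>
     (\<Sum>i<k - 2 * l. y (xs ! i)) + (\<Sum>i=k - 2 * l..<k. y (xs ! i)) / 2 \<le> w}"

definition \<delta> :: real where
  "\<delta> = 1 - (1 - 1 / (2 * (k - l))) ^ (k - d)"

text \<open>The first \<open>d\<close> entries come from the set \<open>B\<close> of the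
  \<open>b\<close> lightest vertices and have weight at most \<open>a\<close> each; as
  \<open>k - 2 * l \<le> d\<close>, they fill all positions of full weight. For the last
  \<open>k - d\<close> entries the excess over \<open>a\<close> is rescaled to mean at most one, so
  that by \<open>tail_bound\<close> at most a proportion \<open>\<delta>\<close> of the tuples is
  too heavy.\<close>

lemma light_dense:
  fixes E :: "'a set set" and y :: "'a \<Rightarrow> real" and \<epsilon> \<gamma> :: real
  assumes \<epsilon>: "0 < \<epsilon>" "\<epsilon> \<le> 1" and \<gamma>: "\<gamma> > 0" and fin: "finite U" and cond: "cond E U U (\<delta> + \<gamma>)"
    and y: "\<And>x. x \<in> U \<Longrightarrow> y x \<ge> 0" "sum y U \<le> card U"
    and big: "card U \<ge> 16 * (d * d + 1) / \<epsilon>"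
  shows "(\<epsilon> / 8) ^ d / 2 * \<gamma> * card U ^ k \<le> card (light E U y ((k - l) * (1 + \<epsilon>)))"
proof -
  define u where "u = real (card U)"
  \<comment> \<open>\<open>B\<close> is to be a positive proportion of \<open>U\<close>, so that its
    tuples are still dense, but so small that the lost weight \<open>a * b\<close> is at most
    \<open>\<epsilon> * u / 2\<close>.\<close>
  define b where "b = nat \<lfloor>\<epsilon> * u / 4\<rfloor>"
  define s where "s = k - d"
  have ub: "\<epsilon> * u \<ge> 16 * (d * d + 1)" using big \<epsilon> by (simp add: u_def field_simps)
  have u1: "\<epsilon> * u \<le> u" using \<epsilon> by (simp add: u_def mult_left_le_one_le)
  have b1: "real b \<le> \<epsilon> * u / 4" and b2: "real b \<ge> \<epsilon> * u / 8" and b3: "b \<ge> 2 * d * d" "b \<ge> 1"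
  proof -
    have "0 \<le> real d * real d" by simp
    moreover have "16 + 16 * (real d * real d) \<le> \<epsilon> * u" using ub by simp
    ultimately have eu: "\<epsilon> * u \<ge> 16" by linarith
    then show b1: "real b \<le> \<epsilon> * u / 4" unfolding b_def by (intro of_nat_floor) simp
    have "real b \<ge> \<epsilon> * u / 4 - 1" unfolding b_def by linarith
    with eu show "real b \<ge> \<epsilon> * u / 8" by linarith
    then have "real b \<ge> 2 * (d * d + 1)" using ub by linarith
    then have "b \<ge> 2 * (d * d + 1)" by (simp only: of_nat_le_iff)
    then show "b \<ge> 2 * d * d" "b \<ge> 1" by auto
  qed
  have u0: "u > 0" using b1 b3 u1 by linarith
  have bu: "real b \<le> u / 4" using b1 u1 by linarith
  then have bc: "b \<le> card U" using u0 by (simp add: u_def)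
  have "card U - b \<le> card U" by simp
  then obtain A where A: "A \<subseteq> U" "card A = card U - b" "\<forall>a\<in>A. \<forall>x\<in>U - A. y x \<le> y a"
    using top_set[OF fin, of "card U - b" y] by blast
  define B where "B = U - A"
  have finA: "finite A" and finB: "finite B" using A fin finite_subset by (auto simp: B_def)
  have cB: "card B = b" using A finA bc by (simp add: B_def card_Diff_subset)
  have Bne: "B \<noteq> {}" using cB b3 by auto
  define a where "a = Max (y ` B)"
  have aB: "y x \<le> a" if "x \<in> B" for x using that finB by (simp add: a_def)
  have "a \<in> y ` B" unfolding a_def using finB Bne by (intro Max_in) auto
  then obtain x0 where x0: "x0 \<in> B" "a = y x0" by auto
  have aA: "a \<le> y x" if "x \<in> A" for x using that A(3) x0 by (auto simp: B_def)
  have a0: "a \<ge> 0" using x0 y(1) by (simp add: B_def)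
  have cA: "real (card A) = u - b" using A bc by (simp add: u_def of_nat_diff)
  have sA: "sum y A \<le> u"
  proof -
    have "sum y A \<le> sum y U" using A fin y by (intro sum_mono2) auto
    then show ?thesis using y(2) by (simp add: u_def)
  qed
  have "(u - b) * a \<le> sum y A" using sum_bounded_below[of A a y] aA cA by simp
  then have aub: "a * (u - b) \<le> u" using sA by (simp add: mult.commute)
  have "a * (u * 3 / 4) \<le> a * (u - b)" using bu a0 by (intro mult_left_mono) auto
  then have "a * 3 / 4 * u \<le> 1 * u" using aub by simp
  then have a2: "a \<le> 2" using u0 by (simp only: mult_le_cancel_right_pos)
  have ab: "a * b \<le> \<epsilon> * u / 2"
  proof -
    have "a * b \<le> 2 * (\<epsilon> * u / 4)" using a2 b1 a0 by (intro mult_mono) auto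
    then show ?thesis by simp
  qed
  \<comment> \<open>Outside \<open>B\<close> every weight is at least \<open>a\<close>, so the
    excess has total at most \<open>u - a * (u - b)\<close>, hence at most \<open>gg * u\<close>:
    rescaling by \<open>gg\<close> gives mean at most one. In the final sum \<open>a\<close> and
    \<open>gg\<close> add up to \<open>1 + \<epsilon>\<close>.\<close>
  define gg where "gg = 1 + \<epsilon> - a"
  have gg: "gg > 0"
  proof -
    have "a * u \<le> u + \<epsilon> * u / 2" using aub ab by (simp add: algebra_simps)
    also have "\<dots> < (1 + \<epsilon>) * u" using u0 \<epsilon> by (simp add: algebra_simps)
    finally show ?thesis using u0 by (simp add: gg_def mult_less_cancel_right_pos)
  qed
  define z where "z x = max (y x - a) 0 / gg" for x
  have z0: "z x \<ge> 0" for x using gg by (simp add: z_def)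
  have zs: "sum z U \<le> card U"
  proof -
    have "sum z U = sum z A + sum z B" using A fin finA by (simp add: B_def sum_diff)
    also have "sum z B = 0" using aB by (intro sum.neutral) (auto simp: z_def)
    also have "sum z A = (\<Sum>x\<in>A. y x - a) / gg"
      unfolding sum_divide_distrib z_def using aA by (intro sum.cong) auto
    also have "(\<Sum>x\<in>A. y x - a) = sum y A - a * (u - b)" by (simp add: sum_subtractf cA)
    also have "(sum y A - a * (u - b)) / gg + 0 \<le> (gg * u) / gg"
    proof -
      have "\<epsilon> * u / 2 \<le> \<epsilon> * u" using \<epsilon> u0 by simp
      then have "sum y A - a * (u - b) \<le> gg * u" using sA ab by (simp add: gg_def algebra_simps)
      then show ?thesis using gg by (simp add: pos_divide_le_eq mult.commute)
    qed
    also have "\<dots> = card U" using gg by (simp add: u_def)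
    finally show ?thesis .
  qed
  define t where "t = 2 * (k - l)"
  have t: "t \<ge> 2" "t + 1 \<ge> 2 * s" "s \<ge> 1" "s \<le> 2 * l" using two_l kl_d d_k by (auto simp: t_def s_def)
  have tail: "card {xs \<in> tup U s. sum_list (map z xs) < t} \<ge> (1 - \<delta>) * card U ^ s"
    using tail_bound[OF fin z0 zs t(1,2,3)] by (simp add: \<delta>_def s_def t_def)
  let ?F = "{ys \<in> tup B d. distinct ys \<and> set ys \<inter> {} = {}}"
  let ?G = "\<lambda>ys. {zs \<in> tup U s. set ys \<union> set zs \<in> E \<and> sum_list (map z zs) < t}"
  have Fd: "1 / 2 * (\<epsilon> / 8) ^ d * card U ^ d \<le> card ?F"
  proof -
    have "real (d * d) \<le> real b / 2" using b3(1) by linarith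
    then have "1 / 2 \<le> 1 - real (d * (d + card ({}::'a set))) / card B" using b3 cB by (simp add: field_simps)
    then have "1 / 2 * real (card B ^ d) \<le> (1 - real (d * (d + card ({}::'a set))) / card B) * card B ^ d"
      by (rule mult_right_mono) simp
    also have "\<dots> \<le> card ?F"
      using dense_filter[OF finB finite.emptyI Bne order_refl, of 1 d] by (simp add: card_tup finB)
    finally have 1: "1 / 2 * real b ^ d \<le> card ?F" using cB by simp
    have "(\<epsilon> * u / 8) ^ d \<le> real b ^ d" using b2 \<epsilon> u0 by (intro power_mono) auto
    then show ?thesis using 1 by (simp add: u_def power_mult_distrib power_divide)
  qed
  \<comment> \<open>A proportion \<open>\<delta> + \<gamma>\<close> of the tuples completes
    \<open>ys\<close> to an edge and at most \<open>\<delta>\<close> is heavy, so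
    \<open>\<gamma>\<close> remains. This is the place where the degree has to exceed
    \<open>\<delta>\<close>.\<close>
  have G: "?G ys \<subseteq> tup U s \<and> \<gamma> * card U ^ s \<le> card (?G ys)" if ys: "ys \<in> ?F" for ys
  proof -
    have "card (set ys) = d" "set ys \<subseteq> U" using ys distinct_card[of ys] by (auto simp: tup_def B_def)
    then have 1: "(\<delta> + \<gamma>) * card U ^ s \<le> card {zs \<in> tup U s. set ys \<union> set zs \<in> E}"
      using cond by (simp add: cond_def s_def)
    have "{zs \<in> tup U s. set ys \<union> set zs \<in> E} \<subseteq> ?G ys \<union> {zs \<in> tup U s. \<not> sum_list (map z zs) < t}" by auto
    then have "card {zs \<in> tup U s. set ys \<union> set zs \<in> E} \<le> card (?G ys \<union> {zs \<in> tup U s. \<not> sum_list (map z zs) < t})"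
      using fin by (intro card_mono) auto
    also have "\<dots> \<le> card (?G ys) + card {zs \<in> tup U s. \<not> sum_list (map z zs) < t}" by (rule card_Un_le)
    finally have 2: "real (card {zs \<in> tup U s. set ys \<union> set zs \<in> E}) \<le> card (?G ys) + real (card {zs \<in> tup U s. \<not> sum_list (map z zs) < t})"
      by linarith
    have 3: "real (card {zs \<in> tup U s. \<not> sum_list (map z zs) < t}) \<le> \<delta> * card U ^ s"
      using tail card_tup_compl[OF fin, of s "\<lambda>zs. sum_list (map z zs) < t"] by (simp add: algebra_simps)
    show ?thesis using 1 2 3 by (auto simp: algebra_simps)
  qed
  let ?H = "{ys @ zs |ys zs. ys \<in> ?F \<and> zs \<in> ?G ys}"
  have FU: "?F \<subseteq> tup U d" by (auto simp: tup_def B_def)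
  have ds: "d + s = k" using d_k by (simp add: s_def)
  have "1 / 2 * (\<epsilon> / 8) ^ d * \<gamma> * card U ^ (d + s) \<le> card ?H"
    using dense_append(1)[OF fin FU Fd less_imp_le[OF \<gamma>] G] .
  also have "?H \<subseteq> light E U y ((k - l) * (1 + \<epsilon>))"
  proof
    fix xs assume "xs \<in> ?H"
    then obtain ys zs where xs: "xs = ys @ zs" "ys \<in> ?F" "zs \<in> ?G ys" by blast
    have len: "length ys = d" "length zs = s" using xs by (auto simp: tup_def)
    have yb: "y (xs ! i) \<le> a" if "i < d" for i
    proof -
      have "ys ! i \<in> set ys" "set ys \<subseteq> B" using that xs(2) len by (auto simp: tup_def)
      then have "ys ! i \<in> B" by blast
      then show ?thesis using that len aB[of "ys ! i"] by (simp add: xs(1) nth_append)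
    qed
    have zb: "y (xs ! i) \<le> gg * z (xs ! i) + a" for i using gg by (simp add: z_def)
    have kd: "k - 2 * l \<le> d" using kl_d by simp
    have "(\<Sum>i<k - 2 * l. y (xs ! i)) \<le> (\<Sum>i<k - 2 * l. a)" using yb kd by (intro sum_mono) auto
    then have s1: "(\<Sum>i<k - 2 * l. y (xs ! i)) \<le> (k - 2 * l) * a" by simp
    have "(\<Sum>i=k - 2 * l..<k. y (xs ! i)) = (\<Sum>i=k - 2 * l..<d. y (xs ! i)) + (\<Sum>i=d..<k. y (xs ! i))"
      using kd d_k by (simp add: sum.atLeastLessThan_concat)
    also have "\<dots> \<le> (\<Sum>i=k - 2 * l..<d. a) + (\<Sum>i=d..<k. gg * z (xs ! i) + a)"
      using yb zb by (intro add_mono sum_mono) auto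
    also have "\<dots> = (\<Sum>i=k - 2 * l..<k. a) + gg * (\<Sum>i=d..<k. z (xs ! i))"
      using kd d_k sum.atLeastLessThan_concat[of "k - 2 * l" d k "\<lambda>_. a"] by (simp add: sum.distrib sum_distrib_left)
    also have "(\<Sum>i=d..<k. z (xs ! i)) = (\<Sum>i<s. z (zs ! i))"
      using sum.shift_bounds_nat_ivl[of "\<lambda>i. z (xs ! i)" 0 d s] len ds
      by (simp add: xs(1) nth_append atLeast0LessThan add.commute)
    also have "\<dots> = sum_list (map z zs)" using len by (simp add: sum_list_sum_nth atLeast0LessThan)
    also have "(\<Sum>i=k - 2 * l..<k. a) = 2 * l * a" using two_l by simp
    finally have s2: "(\<Sum>i=k - 2 * l..<k. y (xs ! i)) \<le> 2 * l * a + gg * sum_list (map z zs)" .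
    have "gg * sum_list (map z zs) \<le> gg * t" using xs(3) gg by (intro mult_left_mono) auto
    then have s3: "(\<Sum>i=k - 2 * l..<k. y (xs ! i)) \<le> 2 * l * a + gg * t"
      by (rule order_trans[OF s2 add_left_mono])
    have "(\<Sum>i<k - 2 * l. y (xs ! i)) + (\<Sum>i=k - 2 * l..<k. y (xs ! i)) / 2
       \<le> (k - 2 * l) * a + (2 * l * a + gg * t) / 2"
      by (rule add_mono[OF s1 divide_right_mono[OF s3]]) simp
    also have "\<dots> = (k - l) * (1 + \<epsilon>)"
      using two_l by (simp add: gg_def t_def of_nat_diff field_simps)
    finally have w: "(\<Sum>i<k - 2 * l. y (xs ! i)) + (\<Sum>i=k - 2 * l..<k. y (xs ! i)) / 2 \<le> (k - l) * (1 + \<epsilon>)" .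
    have "xs \<in> tup U k" using xs ds FU by (auto simp: tup_def)
    then show "xs \<in> light E U y ((k - l) * (1 + \<epsilon>))" using w xs by (simp add: light_def)
  qed
  then have "card ?H \<le> card (light E U y ((k - l) * (1 + \<epsilon>)))"
    using fin by (intro card_mono) (auto simp: light_def)
  finally show ?thesis by (simp add: ds)
qed

text \<open>A path with \<open>2 * h\<close> edges in the blow-up of a light edge, its overlaps
  alternating between \<open>Q\<close> and \<open>Q'\<close>. It uses \<open>2 * h\<close> copies of
  each of the first \<open>k - 2 * l\<close> positions, but only \<open>h + 1\<close> and
  \<open>h\<close> copies of those in \<open>Q\<close> and \<open>Q'\<close>, which realises the
  weight one half.\<close>

lemma tile:
  fixes \<epsilon> \<gamma> :: real
  assumes \<epsilon>: "0 < \<epsilon>" "\<epsilon> \<le> 1" and \<gamma>: "\<gamma> > 0" and h: "h \<ge> 1"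
  shows "\<exists>n0::nat. \<forall>(E::'a set set) U (y::'a \<Rightarrow> real). finite U \<and> cond E U U (\<delta> + \<gamma>) \<and> card U \<ge> n0 \<and>
     (\<forall>x\<in>U. y x \<ge> 0) \<and> sum y U \<le> card U \<longrightarrow>
     (\<exists>L W L'. pth E L (2 * h) W L' \<and> L \<union> W \<union> L' \<subseteq> U \<and>
        sum y (L \<union> W \<union> L') \<le> (2 * real h + 2) * (real (k - l) * (1 + \<epsilon>)))"
proof -
  define c where "c = (\<epsilon> / 8) ^ d / 2 * \<gamma>"
  have c: "c > 0" using \<epsilon> \<gamma> by (simp add: c_def)
  define B where "B = 2 * h"
  define K where "K = real ((B * k) * (B * k + 0))"
  have B: "0 < B" "1 < B" "h < B \<or> h = 1" using h by (auto simp: B_def)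
  show ?thesis
  proof (intro exI[of _ "nat \<lceil>16 * (d * d + 1) / \<epsilon>\<rceil> + nat \<lceil>K / c ^ (B ^ k)\<rceil> + 1"] allI impI)
    fix E :: "'a set set" and U :: "'a set" and y :: "'a \<Rightarrow> real"
    assume a: "finite U \<and> cond E U U (\<delta> + \<gamma>) \<and> nat \<lceil>16 * (d * d + 1) / \<epsilon>\<rceil> + nat \<lceil>K / c ^ (B ^ k)\<rceil> + 1 \<le> card U \<and>
     (\<forall>x\<in>U. y x \<ge> 0) \<and> sum y U \<le> real (card U)"
    define w :: real where "w = real (k - l) * (1 + \<epsilon>)"
    have fin: "finite U" using a by simp
    have F: "c * card U ^ k \<le> card (light E U y w)"
      unfolding c_def w_def 
    proof (rule light_dense)
      show "16 * (d * d + 1) / \<epsilon> \<le> card U" using a by linarith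
    qed (use a \<epsilon> \<gamma> in auto)
    have "K / c ^ (B ^ k) < card U" using a by linarith
    then have big: "real ((B * k) * (B * k + card ({}::'a set))) < c ^ (B ^ k) * card U"
      using c by (simp add: K_def field_simps)
    have Fsub: "light E U y w \<subseteq> tup U k" by (auto simp: light_def)
    obtain g where g: "\<And>i j. \<lbrakk>i < k; j < B\<rbrakk> \<Longrightarrow> g i j \<in> U - {}"
      and inj: "\<And>i j i' j'. \<lbrakk>i < k; j < B; i' < k; j' < B; g i j = g i' j'\<rbrakk> \<Longrightarrow> i = i' \<and> j = j'"
      and tr: "\<And>\<sigma>. (\<And>i. i < k \<Longrightarrow> \<sigma> i < B) \<Longrightarrow> map (\<lambda>i. g i (\<sigma> i)) [0..<k] \<in> light E U y w"
      using blow_up_pick[OF fin finite.emptyI Fsub F less_imp_le[OF c] big] by blast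
    have trE: "(\<lambda>i. g i (\<sigma> i)) ` {..<k} \<in> E" if "\<And>i. i < k \<Longrightarrow> \<sigma> i < B" for \<sigma>
      using tr[of \<sigma>] that by (simp add: light_def atLeast0LessThan)
    have trw: "(\<Sum>i<k - 2 * l. y (g i (\<sigma> i))) + (\<Sum>i=k - 2 * l..<k. y (g i (\<sigma> i))) / 2 \<le> w"
      if "\<And>i. i < k \<Longrightarrow> \<sigma> i < B" for \<sigma>
      using tr[of \<sigma>] that by (simp add: light_def)
    define Q where "Q = {k - 2 * l..<k - l}"
    define Q' where "Q' = {k - l..<k}"
    define Qs where "Qs = altw Q Q' h"
    define Ix where "Ix j = (if j \<in> Q then {2..<h + 1} else if j \<in> Q' then {..<h} else {..<B})" for j
    \<comment> \<open>\<open>Jx\<close> also counts the ends, which are the copies 0 and 1 of the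
      positions in \<open>Q\<close>.\<close>
    define Jx where "Jx j = (if j \<in> Q then {..<h + 1} else if j \<in> Q' then {..<h} else {..<B})" for j
    have Qd: "Q \<inter> Q' = {}" by (auto simp: Q_def Q'_def)
    have Jx: "Jx j = (if j \<in> Q then {0, 1} \<union> Ix j else Ix j)" for j
      using h by (auto simp: Jx_def Ix_def)
    let ?V = "\<Union>j<k. g j ` Jx j"
    have Qk: "Q \<subseteq> {..<k}" "Q' \<subseteq> {..<k}" "card Q = l" "card Q' = l" using two_l by (auto simp: Q_def Q'_def)
    have p: "pth E ((\<lambda>j. g j 0) ` Q) (2 * h) (\<Union>j<k. g j ` Ix j) ((\<lambda>j. g j 1) ` Q)"
    proof (rule blow_walk_pth[where B = B and Qs = Qs, OF inj])
      show "(\<lambda>i. g i (\<sigma> i)) ` {..<k} \<in> E" if "\<And>i. i < k \<Longrightarrow> \<sigma> i < B" for \<sigma> using trE that by simp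
      show "length Qs = Suc (2 * h)" "hd Qs = Q" "last Qs = Q" by (simp_all add: Qs_def)
      show "\<forall>P\<in>set Qs. P \<subseteq> {..<k} \<and> card P = l"
      proof -
        have "set Qs \<subseteq> {Q, Q'}" unfolding Qs_def by (rule altw_simps)
        then show ?thesis using Qk by blast
      qed
      show "successively (\<lambda>Q Q'. Q \<inter> Q' = {}) Qs" unfolding Qs_def using successively_altw[OF Qd] .
      show "Ix j \<subseteq> {..<B}" for j using h by (auto simp: Ix_def B_def)
      show "card (Ix j) + cnt j Qs = 2 * h" for j
        using h Qd by (auto simp: Ix_def Qs_def cnt_altw B_def)
      show "0 \<notin> Ix j" "1 \<notin> Ix j" if "j \<in> Q" for j using that by (auto simp: Ix_def)
    qed (use h in \<open>auto simp: B_def\<close>)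
    have V: "(\<lambda>j. g j 0) ` Q \<union> (\<Union>j<k. g j ` Ix j) \<union> (\<lambda>j. g j 1) ` Q = ?V"
    proof -
      have "g j ` Jx j = (if j \<in> Q then {g j 0, g j 1} else {}) \<union> g j ` Ix j" for j by (simp add: Jx)
      then have "?V = (\<Union>j<k. (if j \<in> Q then {g j 0, g j 1} else {})) \<union> (\<Union>j<k. g j ` Ix j)" by (simp add: UN_Un_distrib)
      also have "(\<Union>j<k. (if j \<in> Q then {g j 0, g j 1} else {})) = (\<lambda>j. g j 0) ` Q \<union> (\<lambda>j. g j 1) ` Q"
        using Qk(1) by (auto split: if_splits)
      finally show ?thesis by (simp add: Un_ac)
    qed
    have JB: "Jx j \<subseteq> {..<B}" for j using h by (auto simp: Jx_def B_def)
    have VU: "?V \<subseteq> U"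
    proof (intro UN_least image_subsetI)
      fix j i assume "j \<in> {..<k}" "i \<in> Jx j"
      then show "g j i \<in> U" using g[of j i] JB[of j] by auto
    qed
    have sumV: "sum y ?V = (\<Sum>j<k. \<Sum>i\<in>Jx j. y (g j i))"
    proof -
      have "sum y ?V = (\<Sum>j<k. sum y (g j ` Jx j))"
      proof (rule sum.UNION_disjoint)
        show "\<forall>j\<in>{..<k}. finite (g j ` Jx j)" using finite_subset[OF JB] by simp
        show "\<forall>i\<in>{..<k}. \<forall>j\<in>{..<k}. i \<noteq> j \<longrightarrow> g i ` Jx i \<inter> g j ` Jx j = {}"
        proof (intro ballI impI)
          fix i j assume ij: "i \<in> {..<k}" "j \<in> {..<k}" "i \<noteq> j"
          have "g i x \<noteq> g j x'" if "x \<in> Jx i" "x' \<in> Jx j" for x x'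
          proof
            assume eq: "g i x = g j x'"
            have "x < B" "x' < B" using that JB by auto
            then show False using inj[of i x j x'] ij eq by simp
          qed
          then show "g i ` Jx i \<inter> g j ` Jx j = {}" by blast
        qed
      qed simp
      also have "\<dots> = (\<Sum>j<k. \<Sum>i\<in>Jx j. y (g j i))"
      proof (intro sum.cong refl)
        fix j assume j: "j \<in> {..<k}"
        have "inj_on (g j) (Jx j)"
        proof (rule inj_onI)
          fix x x' assume x: "x \<in> Jx j" "x' \<in> Jx j" "g j x = g j x'"
          then have "x < B" "x' < B" using JB by auto
          then show "x = x'" using inj[of j x j x'] j x by simp
        qed
        then show "sum y (g j ` Jx j) = (\<Sum>i\<in>Jx j. y (g j i))" by (simp add: sum.reindex)
      qed
      finally show ?thesis .
    qed
    have k3: "{..<k} = {..<k - 2 * l} \<union> Q \<union> Q'" using two_l by (auto simp: Q_def Q'_def)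
    have QQ: "{k - 2 * l..<k} = Q \<union> Q'" using two_l by (auto simp: Q_def Q'_def)
    have d3: "({..<k - 2 * l} \<union> Q) \<inter> Q' = {}" "{..<k - 2 * l} \<inter> Q = {}" by (auto simp: Q_def Q'_def)
    have finQ: "finite Q" "finite Q'" by (auto simp: Q_def Q'_def)
    define S0 :: "nat \<Rightarrow> real" where "S0 i = (\<Sum>j<k - 2 * l. y (g j i))" for i
    define S1 :: "nat \<Rightarrow> real" where "S1 i = (\<Sum>j\<in>Q. y (g j i))" for i
    define S2 :: "nat \<Rightarrow> real" where "S2 i = (\<Sum>j\<in>Q'. y (g j i))" for i
    have "(\<Sum>j<k. \<Sum>i\<in>Jx j. y (g j i)) = (\<Sum>j<k - 2 * l. \<Sum>i\<in>Jx j. y (g j i)) + (\<Sum>j\<in>Q. \<Sum>i\<in>Jx j. y (g j i)) + (\<Sum>j\<in>Q'. \<Sum>i\<in>Jx j. y (g j i))"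
      unfolding k3 using d3 finQ by (simp add: sum.union_disjoint)
    then have "sum y ?V = (\<Sum>j<k - 2 * l. \<Sum>i\<in>Jx j. y (g j i)) + (\<Sum>j\<in>Q. \<Sum>i\<in>Jx j. y (g j i)) + (\<Sum>j\<in>Q'. \<Sum>i\<in>Jx j. y (g j i))"
      by (rule trans[OF sumV])
    also have "(\<Sum>j<k - 2 * l. \<Sum>i\<in>Jx j. y (g j i)) = (\<Sum>j<k - 2 * l. \<Sum>i<B. y (g j i))"
      by (intro sum.cong refl) (auto simp: Jx_def Q_def Q'_def)
    also have "\<dots> = (\<Sum>i<B. S0 i)" unfolding S0_def by (rule sum.swap)
    also have "(\<Sum>j\<in>Q. \<Sum>i\<in>Jx j. y (g j i)) = (\<Sum>j\<in>Q. \<Sum>i<h + 1. y (g j i))"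
      by (intro sum.cong refl) (auto simp: Jx_def)
    also have "\<dots> = (\<Sum>i<h + 1. S1 i)" unfolding S1_def by (rule sum.swap)
    also have "(\<Sum>j\<in>Q'. \<Sum>i\<in>Jx j. y (g j i)) = (\<Sum>j\<in>Q'. \<Sum>i<h. y (g j i))"
      using Qd by (intro sum.cong refl) (auto simp: Jx_def)
    also have "\<dots> = (\<Sum>i<h. S2 i)" unfolding S2_def by (rule sum.swap)
    also have "(\<Sum>i<B. S0 i) = (\<Sum>i<h. S0 i + S0 (h + i))"
      using sum.atLeastLessThan_concat[of 0 h B S0] sum.shift_bounds_nat_ivl[of S0 0 h h]
      by (simp add: B_def atLeast0LessThan sum.distrib mult_2 add.commute)
    finally have total: "sum y ?V = (\<Sum>i<h. S0 i + S0 (h + i) + S1 i + S2 i) + S1 h"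
      by (simp add: sum.distrib)
    have half: "(\<Sum>i=k - 2 * l..<k. y (g i x)) = S1 x + S2 x" for x
      unfolding QQ S1_def S2_def using Qd finQ by (simp add: sum.union_disjoint)
    \<comment> \<open>Any two copies may be combined, because every transversal is light. Copies
      \<open>i\<close> and \<open>h + i\<close> of the first positions, each combined with copy
      \<open>i\<close> of the others, bound the weight of two edges by \<open>2 * w\<close>.\<close>
    have b1: "S0 x + (S1 i + S2 i) / 2 \<le> w" if "x < B" "i < B" for x i
    proof -
      have "(\<Sum>j<k - 2 * l. y (g j (if j < k - 2 * l then x else i))) + (\<Sum>j=k - 2 * l..<k. y (g j (if j < k - 2 * l then x else i))) / 2 \<le> w"
        using that by (intro trw) auto
      also have "(\<Sum>j<k - 2 * l. y (g j (if j < k - 2 * l then x else i))) = S0 x" by (simp add: S0_def)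
      also have "(\<Sum>j=k - 2 * l..<k. y (g j (if j < k - 2 * l then x else i))) = (\<Sum>j=k - 2 * l..<k. y (g j i))"
        by (intro sum.cong) auto
      finally show ?thesis by (simp add: half)
    qed
    have "(\<Sum>i<h. S0 i + S0 (h + i) + S1 i + S2 i) \<le> (\<Sum>i<h. 2 * w)"
    proof (intro sum_mono)
      fix i assume "i \<in> {..<h}"
      then have "i < B" "h + i < B" by (auto simp: B_def)
      then show "S0 i + S0 (h + i) + S1 i + S2 i \<le> 2 * w" using b1[of i i] b1[of "h + i" i] by (simp add: field_simps)
    qed
    \<comment> \<open>The surplus copy of \<open>Q\<close> is paid for by a whole transversal, in
      which it counts one half.\<close>
    moreover have "S1 h \<le> 2 * w"
    proof -
      have yn: "y (g j i) \<ge> 0" if "j < k" "i < B" for j i using a g[OF that] by auto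
      have hB: "h < B" using h by (simp add: B_def)
      have "S0 h \<ge> 0" "S2 h \<ge> 0" using yn hB Qk two_l by (auto simp: S0_def S2_def intro!: sum_nonneg)
      then show ?thesis using b1[OF hB hB] by argo
    qed
    ultimately have "sum y ?V \<le> real h * (2 * w) + 2 * w" unfolding total by simp
    also have "\<dots> = (2 * real h + 2) * w" by (simp add: algebra_simps)
    finally have "sum y ?V \<le> (2 * real h + 2) * w" .
    then show "\<exists>L W L'. pth E L (2 * h) W L' \<and> L \<union> W \<union> L' \<subseteq> U \<and>
        sum y (L \<union> W \<union> L') \<le> (2 * real h + 2) * (real (k - l) * (1 + \<epsilon>))"
      using p V VU unfolding w_def by metis
  qed
qed

end

section \<open>Covering almost all vertices\<close>

lemma card_tup_mem_le:
  assumes "finite U" "v \<in> U"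
  shows "real (card {xs \<in> tup U s. v \<in> set xs}) * card U \<le> s * real (card U) ^ s"
proof -
  have u: "card U > 0" using assms by (auto simp: card_gt_0_iff)
  have "{xs \<in> tup U s. \<not> v \<in> set xs} = tup (U - {v}) s" by (auto simp: tup_def)
  then have "card {xs \<in> tup U s. \<not> v \<in> set xs} = (card U - 1) ^ s" using assms by (simp add: card_tup)
  then have 1: "real (card {xs \<in> tup U s. v \<in> set xs}) = real (card U) ^ s - real (card U - 1) ^ s"
    using card_tup_compl[OF assms(1), of s "\<lambda>xs. v \<in> set xs"] by simp
  have "1 + real s * (- 1 / card U) \<le> (1 + - 1 / real (card U)) ^ s"
    using u by (intro Bernoulli_inequality) (simp add: field_simps)
  then have "(1 + real s * (- 1 / card U)) * real (card U) ^ s \<le> (1 + - 1 / real (card U)) ^ s * real (card U) ^ s"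
    by (intro mult_right_mono) auto
  also have "\<dots> = real (card U - 1) ^ s"
  proof -
    have eq: "(1 + - 1 / real (card U)) * real (card U) = real (card U - 1)"
      using u by (simp add: field_simps of_nat_diff)
    show ?thesis by (simp only: power_mult_distrib[symmetric] eq)
  qed
  finally have "(1 + real s * (- 1 / card U)) * real (card U) ^ s \<le> real (card U - 1) ^ s" .
  then have "real (card {xs \<in> tup U s. v \<in> set xs}) \<le> real s / card U * real (card U) ^ s"
    unfolding 1 by (simp add: algebra_simps)
  then have "real (card {xs \<in> tup U s. v \<in> set xs}) * card U \<le> real s / card U * real (card U) ^ s * card U"
    by (intro mult_right_mono) auto
  then show ?thesis using u by simp
qed

context loose
begin

section \<open>Degrees into the uncovered set and their exponential potential\<close>

definition dg :: "'a set set \<Rightarrow> 'a set \<Rightarrow> 'a set \<Rightarrow> real" where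
  "dg E U S = card {xs \<in> tup U (k - d). S \<union> set xs \<in> E}"

definition dgv :: "'a set set \<Rightarrow> 'a set \<Rightarrow> 'a set \<Rightarrow> 'a \<Rightarrow> real" where
  "dgv E U S v = card {xs \<in> tup U (k - d). S \<union> set xs \<in> E \<and> v \<in> set xs}"

definition rho :: "'a set set \<Rightarrow> 'a set \<Rightarrow> 'a set \<Rightarrow> real" where
  "rho E U S = dg E U S / real (card U) ^ (k - d)"

text \<open>By convexity, removing a path whose weight under \<open>v \<mapsto> \<Sum>S. exp (- \<mu> * rho E U S) * dgv E U S v\<close> is close to
  average does not increase this potential much; a single \<open>d\<close>-set of small \<open>rho\<close> would make it
  large.\<close>

definition Phi :: "'a set set \<Rightarrow> 'a set \<Rightarrow> real \<Rightarrow> 'a set \<Rightarrow> real" where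
  "Phi E V \<mu> U = (\<Sum>S | S \<subseteq> V \<and> card S = d. exp (- \<mu> * rho E U S))"

lemma dgv_sum: "finite U \<Longrightarrow> (\<Sum>v\<in>U. dgv E U S v) \<le> (k - d) * dg E U S"
proof -
  assume fin: "finite U"
  let ?X = "{xs \<in> tup U (k - d). S \<union> set xs \<in> E}"
  have "(\<Sum>v\<in>U. dgv E U S v) = (\<Sum>v\<in>U. real (card {xs \<in> ?X. v \<in> set xs}))"
    by (intro sum.cong refl) (auto simp: dgv_def intro!: arg_cong[where f = card])
  also have "\<dots> = real (\<Sum>v\<in>U. card {xs \<in> ?X. v \<in> set xs})" by simp
  also have "(\<Sum>v\<in>U. card {xs \<in> ?X. v \<in> set xs}) = (\<Sum>xs\<in>?X. card {v \<in> U. v \<in> set xs})"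
    using fin by (intro sum_card_swap) auto
  also have "\<dots> \<le> (\<Sum>xs\<in>?X. k - d)"
  proof (intro sum_mono)
    fix xs assume "xs \<in> ?X"
    then have "card (set xs) \<le> k - d" using card_length[of xs] by (simp add: tup_def)
    moreover have "card {v \<in> U. v \<in> set xs} \<le> card (set xs)" by (intro card_mono) auto
    ultimately show "card {v \<in> U. v \<in> set xs} \<le> k - d" by linarith
  qed
  also have "\<dots> = (k - d) * card ?X" by simp
  finally show ?thesis by (simp add: dg_def)
qed

lemma dgv_le:
  assumes "finite U" "v \<in> U"
  shows "dgv E U S v * card U \<le> (k - d) * real (card U) ^ (k - d)"
proof -
  have "dgv E U S v \<le> card {xs \<in> tup U (k - d). v \<in> set xs}"
    unfolding dgv_def using assms(1) by (intro of_nat_mono card_mono) auto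
  then have "dgv E U S v * card U \<le> real (card {xs \<in> tup U (k - d). v \<in> set xs}) * card U"
    by (intro mult_right_mono) auto
  then show ?thesis using card_tup_mem_le[OF assms, of "k - d"] by simp
qed

lemma dg_Diff:
  assumes "finite U"
  shows "dg E U S - (\<Sum>v\<in>R \<inter> U. dgv E U S v) \<le> dg E (U - R) S"
proof -
  let ?X = "\<lambda>v. {xs \<in> tup U (k - d). S \<union> set xs \<in> E \<and> v \<in> set xs}"
  have fR: "finite (R \<inter> U)" using assms by simp
  have "{xs \<in> tup U (k - d). S \<union> set xs \<in> E} \<subseteq> {xs \<in> tup (U - R) (k - d). S \<union> set xs \<in> E} \<union> (\<Union>v\<in>R \<inter> U. ?X v)"
    by (auto simp: tup_def)
  then have "card {xs \<in> tup U (k - d). S \<union> set xs \<in> E} \<le> card ({xs \<in> tup (U - R) (k - d). S \<union> set xs \<in> E} \<union> (\<Union>v\<in>R \<inter> U. ?X v))"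
    using assms fR by (intro card_mono) auto
  also have "\<dots> \<le> card {xs \<in> tup (U - R) (k - d). S \<union> set xs \<in> E} + card (\<Union>v\<in>R \<inter> U. ?X v)" by (rule card_Un_le)
  also have "card (\<Union>v\<in>R \<inter> U. ?X v) \<le> (\<Sum>v\<in>R \<inter> U. card (?X v))" by (rule card_UN_le[OF fR])
  finally have "real (card {xs \<in> tup U (k - d). S \<union> set xs \<in> E})
      \<le> real (card {xs \<in> tup (U - R) (k - d). S \<union> set xs \<in> E}) + real (\<Sum>v\<in>R \<inter> U. card (?X v))" by linarith
  then show ?thesis by (simp add: dg_def dgv_def)
qed

lemma dg_nonneg: "dg E U S \<ge> 0" by (simp add: dg_def)

lemma dgv_nonneg: "dgv E U S v \<ge> 0" by (simp add: dgv_def)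

lemma rho_le_1: assumes "finite U" shows "rho E U S \<le> 1"
proof -
  have "card {xs \<in> tup U (k - d). S \<union> set xs \<in> E} \<le> card (tup U (k - d))"
    using assms by (intro card_mono) auto
  then have "dg E U S \<le> real (card U) ^ (k - d)" using assms by (simp add: dg_def card_tup flip: of_nat_power)
  then show ?thesis unfolding rho_def by (auto simp: divide_le_eq_1 zero_less_power)
qed

lemma dg_Diff_le:
  assumes "finite U" "R \<subseteq> U"
  shows "(rho E U S - (k - d) * card R / card U) * real (card U) ^ (k - d) \<le> dg E (U - R) S"
proof (cases "card U = 0")
  case False
  then have u: "real (card U) > 0" by simp
  have RU: "R \<inter> U = R" using assms by auto
  have "(\<Sum>v\<in>R. dgv E U S v) \<le> (\<Sum>v\<in>R. (k - d) / card U * real (card U) ^ (k - d))"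
  proof (intro sum_mono)
    fix v assume "v \<in> R"
    then show "dgv E U S v \<le> (k - d) / card U * real (card U) ^ (k - d)"
      using dgv_le[OF assms(1), of v E S] assms(2) u by (auto simp: field_simps)
  qed
  then have "(\<Sum>v\<in>R. dgv E U S v) \<le> (k - d) * card R / card U * real (card U) ^ (k - d)" by (simp add: mult_ac)
  then show ?thesis using dg_Diff[OF assms(1), of E S R] u unfolding RU rho_def
    by (simp add: algebra_simps)
next
  case True
  then have "U = {}" using assms by simp
  moreover have "k - d > 0" using d_k by simp
  ultimately show ?thesis using dg_nonneg[of E "{}" S] by (simp add: power_0_left)
qed

lemma exp_quadratic: 
  fixes x :: real
  assumes "\<bar>x\<bar> \<le> 1" shows "exp x \<le> 1 + x + x\<^sup>2"
proof (cases "x \<ge> 0")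
  case True
  then show ?thesis using exp_bound[of x] assms by simp
next
  case False
  define z where "z = - x"
  have z: "0 \<le> z" "z \<le> 1" using False assms by (auto simp: z_def)
  have "1 + z \<le> exp z" by (rule exp_ge_add_one_self)
  then have "exp (- z) \<le> 1 / (1 + z)" using z by (simp add: exp_minus field_simps)
  also have "\<dots> \<le> 1 - z + z\<^sup>2"
  proof -
    have "(1 - z + z\<^sup>2) * (1 + z) = 1 + z ^ 3" by (simp add: algebra_simps power2_eq_square power3_eq_cube)
    then have "1 \<le> (1 - z + z\<^sup>2) * (1 + z)" using z by simp
    then show ?thesis using z by (simp add: pos_divide_le_eq)
  qed
  finally show ?thesis by (simp add: z_def)
qed

text \<open>Deleting vertices has two effects on \<open>rho\<close>. The shrinking denominator
  yields, by Bernoulli's inequality, a relative gain of at least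
  \<open>(k - d) * card P / card U\<close> up to second order; the numerator loses the tuples
  through \<open>P\<close>, and for \<open>C\<close> at most the trivial bound. If \<open>P\<close>
  meets the tuples about as often as an average set, gain and loss cancel.\<close>

lemma rho_step:
  assumes fin: "finite U" and P: "P \<subseteq> U" and C: "C \<subseteq> U - P" and r: "r = card P + card C"
    and ru: "r < card U"
  shows "rho E (U - (P \<union> C)) S \<ge> rho E U S +
    ((k - d) * card P / card U * rho E U S - (\<Sum>v\<in>P. dgv E U S v) / real (card U) ^ (k - d)
      - card C * (k - d) / card U - ((k - d) * r / card U)\<^sup>2)"
proof -
  define u where "u = real (card U)"
  define s where "s = k - d"
  define a where "a = (\<Sum>v\<in>P. dgv E U S v) / u ^ s + card C * s / u"
  define D' where "D' = dg E (U - (P \<union> C)) S"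
  define X where "X = rho E U S - a"
  have u: "u > 0" using ru by (simp add: u_def)
  have us: "u ^ s > 0" using u by simp
  have fPC: "finite P" "finite C" using P C fin by (auto intro: finite_subset)
  have PC: "P \<union> C \<subseteq> U" "P \<inter> C = {}" using P C by auto
  have cPC: "card (P \<union> C) = r" using r PC fPC by (simp add: card_Un_disjoint)
  have cU: "real (card (U - (P \<union> C))) = u - r"
    using PC fPC cPC ru fin by (simp add: card_Diff_subset u_def of_nat_diff)
  have bnd: "(\<Sum>v\<in>A. dgv E U S v) / u ^ s \<le> card A * s / u" if "A \<subseteq> U" for A
  proof -
    have "(\<Sum>v\<in>A. dgv E U S v) \<le> (\<Sum>v\<in>A. s / u * u ^ s)"
    proof (intro sum_mono)
      fix v assume "v \<in> A"
      then show "dgv E U S v \<le> s / u * u ^ s"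
        using dgv_le[OF fin, of v E S] that u by (auto simp: field_simps u_def s_def)
    qed
    also have "\<dots> = card A * s / u * u ^ s" by simp
    finally show ?thesis using us by (simp add: pos_divide_le_eq)
  qed
  have CU: "C \<subseteq> U" using C by auto
  have a_le: "a \<le> s * r / u"
    using bnd[OF P] by (simp add: a_def r field_simps add_divide_distrib)
  have a_ge: "a \<ge> 0" using u by (auto simp: a_def intro!: add_nonneg_nonneg divide_nonneg_pos sum_nonneg dgv_nonneg)
  have "dg E U S - (\<Sum>v\<in>P \<union> C. dgv E U S v) \<le> D'"
    using dg_Diff[OF fin, of E S "P \<union> C"] PC(1) by (simp add: Int_absorb2 D'_def)
  also have "(\<Sum>v\<in>P \<union> C. dgv E U S v) = (\<Sum>v\<in>P. dgv E U S v) + (\<Sum>v\<in>C. dgv E U S v)"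
    using fPC PC by (simp add: sum.union_disjoint)
  finally have "(dg E U S - ((\<Sum>v\<in>P. dgv E U S v) + (\<Sum>v\<in>C. dgv E U S v))) / u ^ s \<le> D' / u ^ s"
    using us by (intro divide_right_mono) auto
  then have XD: "X \<le> D' / u ^ s"
    using bnd[OF CU] by (simp add: X_def a_def rho_def diff_divide_distrib add_divide_distrib u_def s_def)
  have f1: "1 + s * r / u \<le> (u / (u - r)) ^ s"
  proof -
    have ur: "u - r > 0" using ru by (simp add: u_def)
    have "1 + real s * (r / u) \<le> (1 + r / u) ^ s" using u by (intro Bernoulli_inequality) (simp add: field_simps)
    also have "\<dots> \<le> (u / (u - r)) ^ s"
    proof (intro power_mono)
      have "(u + r) * (u - r) \<le> u * u" by (simp add: algebra_simps)
      then show "1 + r / u \<le> u / (u - r)" using u ur by (simp add: field_simps)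
      show "0 \<le> 1 + r / u" using u by simp
    qed
    finally show ?thesis by simp
  qed
  have "rho E (U - (P \<union> C)) S = D' / u ^ s * (u / (u - r)) ^ s"
    using u ru by (simp add: rho_def D'_def cU s_def power_divide)
  also have "\<dots> \<ge> D' / u ^ s * (1 + s * r / u)"
    using f1 us by (intro mult_left_mono) (auto simp: D'_def dg_nonneg)
  finally have 1: "D' / u ^ s * (1 + s * r / u) \<le> rho E (U - (P \<union> C)) S" .
  have "X * (1 + s * r / u) \<le> D' / u ^ s * (1 + s * r / u)"
    using XD u by (intro mult_right_mono) auto
  with 1 have 2: "X * (1 + s * r / u) \<le> rho E (U - (P \<union> C)) S" by linarith
  have rho0: "rho E U S \<ge> 0" by (simp add: rho_def dg_nonneg)
  have "a * (s * r / u) \<le> (s * r / u) * (s * r / u)" using a_le a_ge u by (intro mult_right_mono) auto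
  moreover have "rho E U S * (s * card P / u) \<le> rho E U S * (s * r / u)"
    using rho0 u r by (intro mult_left_mono) (auto simp: divide_right_mono mult_left_mono)
  moreover have "X * (1 + s * r / u) = rho E U S + rho E U S * (s * r / u) - a - a * (s * r / u)"
    by (simp add: X_def algebra_simps)
  ultimately have "rho E U S + rho E U S * (s * card P / u) - a - (s * r / u) * (s * r / u) \<le> rho E (U - (P \<union> C)) S"
    using 2 by linarith
  then show ?thesis by (simp add: a_def u_def s_def power2_eq_square mult_ac)
qed

text \<open>To first order, the potential changes by the changes of \<open>rho\<close>, weighted by
  \<open>w\<close>. Exchanging sums turns the loss through \<open>P\<close> into
  \<open>sum y P\<close>, which exceeds the average share by that of at most \<open>\<kappa>\<close>
  vertices. The main terms cancel, and what remains comes from \<open>\<kappa>\<close>, from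
  \<open>C\<close> and from quadratic terms.\<close>

lemma Phi_step:
  fixes \<mu> \<kappa> :: real
  assumes fin: "finite V" and U: "U \<subseteq> V" and P: "P \<subseteq> U" and C: "C \<subseteq> U - P" and r: "r = card P + card C"
    and ru: "r < card U" "(k - d) * r \<le> card U" and \<mu>: "\<mu> > 0" "\<mu> * (3 * ((k - d) * r / card U)) \<le> 1" and \<kappa>: "\<kappa> \<ge> 0"
    and y: "\<And>v. y v = (\<Sum>S | S \<subseteq> V \<and> card S = d. exp (- \<mu> * rho E U S) * dgv E U S v)"
    and yP: "sum y P \<le> (card P + \<kappa>) * sum y U / card U"
  shows "Phi E V \<mu> (U - (P \<union> C)) \<le> Phi E V \<mu> U *
    (1 + \<mu> * ((\<kappa> + card C) * (k - d) / card U + ((k - d) * r / card U)\<^sup>2) + (\<mu> * (3 * ((k - d) * r / card U)))\<^sup>2)"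
proof -
  define u where "u = real (card U)"
  define s where "s = k - d"
  define \<S> where "\<S> = {S. S \<subseteq> V \<and> card S = d}"
  define w where "w S = exp (- \<mu> * rho E U S)" for S
  define x where "x = s * r / u"
  define b where "b S = s * card P / u * rho E U S - (\<Sum>v\<in>P. dgv E U S v) / u ^ s - card C * s / u - x\<^sup>2" for S
  have finU: "finite U" using U fin finite_subset by auto
  have u: "u > 0" using ru by (simp add: u_def)
  have us: "u ^ s > 0" using u by simp
  have x: "0 \<le> x" "x \<le> 1" using u ru(2) by (auto simp: x_def s_def u_def divide_le_eq_1 simp flip: of_nat_mult)
  have xx: "x\<^sup>2 \<le> x" using x by (simp add: power2_eq_square mult_left_le_one_le)
  have rP: "s * card P / u \<le> x" "s * card P / u + card C * s / u = x"
    using u by (auto simp: x_def r divide_right_mono add_divide_distrib algebra_simps)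
  have rho01: "0 \<le> rho E U S" "rho E U S \<le> 1" for S
    using rho_le_1[OF finU, of E S] by (auto simp: rho_def dg_nonneg)
  have bndP: "0 \<le> (\<Sum>v\<in>P. dgv E U S v) / u ^ s" "(\<Sum>v\<in>P. dgv E U S v) / u ^ s \<le> s * card P / u" for S
  proof -
    show "0 \<le> (\<Sum>v\<in>P. dgv E U S v) / u ^ s" using us by (auto intro!: divide_nonneg_pos sum_nonneg dgv_nonneg)
    have "(\<Sum>v\<in>P. dgv E U S v) \<le> (\<Sum>v\<in>P. s / u * u ^ s)"
    proof (intro sum_mono)
      fix v assume "v \<in> P"
      then show "dgv E U S v \<le> s / u * u ^ s"
        using dgv_le[OF finU, of v E S] P u by (auto simp: field_simps u_def s_def)
    qed
    also have "\<dots> = s * card P / u * u ^ s" by simp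
    finally show "(\<Sum>v\<in>P. dgv E U S v) / u ^ s \<le> s * card P / u" using us by (simp add: pos_divide_le_eq)
  qed
  have b: "\<bar>b S\<bar> \<le> 3 * x" for S
  proof -
    have aux: "\<bar>a1 - a2 - a3 - a4\<bar> \<le> 3 * x" if "0 \<le> a1" "a1 \<le> t" "0 \<le> a2" "a2 \<le> t" "0 \<le> a3" "t + a3 = x" "0 \<le> a4" "a4 \<le> x"
      for a1 a2 a3 a4 t using that by linarith
    have "s * card P / u * rho E U S \<le> s * card P / u * 1" using u rho01 by (intro mult_left_mono) auto
    then show ?thesis unfolding b_def
      using u rho01 bndP[of S] xx by (intro aux[OF _ _ _ _ _ rP(2)]) auto
  qed
  have step: "exp (- \<mu> * rho E (U - (P \<union> C)) S) \<le> w S * (1 + (\<mu> * (3 * x))\<^sup>2) - \<mu> * (w S * b S)" for S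
  proof -
    have "rho E U S + b S \<le> rho E (U - (P \<union> C)) S"
      using rho_step[OF finU P C r ru(1), of E S] by (simp add: b_def u_def s_def x_def)
    then have "- \<mu> * rho E (U - (P \<union> C)) S \<le> - \<mu> * (rho E U S + b S)" using \<mu> by simp
    then have "exp (- \<mu> * rho E (U - (P \<union> C)) S) \<le> exp (- \<mu> * (rho E U S + b S))" by simp
    also have "\<dots> = w S * exp (- \<mu> * b S)" by (simp add: w_def algebra_simps flip: exp_add)
    also have "exp (- \<mu> * b S) \<le> 1 + (- \<mu> * b S) + (- \<mu> * b S)\<^sup>2"
    proof (rule exp_quadratic)
      have "\<bar>- \<mu> * b S\<bar> = \<mu> * \<bar>b S\<bar>" using \<mu> by (simp add: abs_mult)
      also have "\<dots> \<le> \<mu> * (3 * x)" using \<mu> b by (intro mult_left_mono) auto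
      also have "\<dots> \<le> 1" using \<mu>(2) by (simp add: x_def s_def u_def)
      finally show "\<bar>- \<mu> * b S\<bar> \<le> 1" .
    qed
    also have "(- \<mu> * b S)\<^sup>2 \<le> (\<mu> * (3 * x))\<^sup>2"
    proof -
      have "\<bar>- \<mu> * b S\<bar> \<le> \<bar>\<mu> * (3 * x)\<bar>" using \<mu> b[of S] x by (simp add: abs_mult)
      then show ?thesis by (rule abs_le_square_iff[THEN iffD1])
    qed
    finally have "exp (- \<mu> * rho E (U - (P \<union> C)) S) \<le> w S * (1 + - \<mu> * b S + (\<mu> * (3 * x))\<^sup>2)"
      by (simp add: w_def)
    then show ?thesis by (simp add: algebra_simps)
  qed
  define R where "R = (\<Sum>S\<in>\<S>. w S * rho E U S)"
  have Phi: "Phi E V \<mu> U = (\<Sum>S\<in>\<S>. w S)" by (simp add: Phi_def \<S>_def w_def)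
  have w0: "w S > 0" for S by (simp add: w_def)
  have RP: "R \<le> Phi E V \<mu> U"
    unfolding R_def Phi using rho01 w0 by (intro sum_mono) (simp add: less_imp_le mult_left_le)
  \<comment> \<open>Double counting: a tuple has at most \<open>k - d\<close> different entries. The
    gain in \<open>rho_step\<close> contains the same factor, so gain and loss match.\<close>
  have yU: "sum y U \<le> s * u ^ s * R"
  proof -
    have "sum y U = (\<Sum>S\<in>\<S>. \<Sum>v\<in>U. w S * dgv E U S v)"
      unfolding y \<S>_def w_def by (rule sum.swap)
    also have "\<dots> = (\<Sum>S\<in>\<S>. w S * (\<Sum>v\<in>U. dgv E U S v))" by (simp add: sum_distrib_left)
    also have "\<dots> \<le> (\<Sum>S\<in>\<S>. w S * (s * dg E U S))"
      using w0 dgv_sum[OF finU] by (intro sum_mono mult_left_mono) (auto simp: s_def less_imp_le)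
    also have "\<dots> = s * u ^ s * R"
      unfolding R_def sum_distrib_left using us by (intro sum.cong refl) (auto simp: rho_def u_def s_def)
    finally show ?thesis .
  qed
  have yPs: "(\<Sum>S\<in>\<S>. w S * ((\<Sum>v\<in>P. dgv E U S v) / u ^ s)) \<le> (card P + \<kappa>) * s / u * R"
  proof -
    have "(\<Sum>S\<in>\<S>. w S * ((\<Sum>v\<in>P. dgv E U S v) / u ^ s)) = (\<Sum>S\<in>\<S>. \<Sum>v\<in>P. w S * dgv E U S v) / u ^ s"
      by (simp add: sum_divide_distrib sum_distrib_left)
    also have "(\<Sum>S\<in>\<S>. \<Sum>v\<in>P. w S * dgv E U S v) = sum y P"
      unfolding y \<S>_def w_def by (rule sum.swap)
    also have "sum y P / u ^ s \<le> ((card P + \<kappa>) * (s * u ^ s * R) / u) / u ^ s"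
    proof (rule divide_right_mono)
      have "(card P + \<kappa>) * sum y U / u \<le> (card P + \<kappa>) * (s * u ^ s * R) / u"
        using yU u \<kappa> by (intro divide_right_mono mult_left_mono) auto
      then show "sum y P \<le> (card P + \<kappa>) * (s * u ^ s * R) / u" using yP by (simp add: u_def)
    qed (use us in simp)
    also have "\<dots> = (card P + \<kappa>) * s / u * R" using us u by (simp add: field_simps)
    finally show ?thesis .
  qed
  have sb: "(\<Sum>S\<in>\<S>. w S * b S) \<ge> - Phi E V \<mu> U * ((\<kappa> + card C) * s / u + x\<^sup>2)"
  proof -
    have "(\<Sum>S\<in>\<S>. w S * b S) = s * card P / u * R - (\<Sum>S\<in>\<S>. w S * ((\<Sum>v\<in>P. dgv E U S v) / u ^ s)) - (card C * s / u + x\<^sup>2) * Phi E V \<mu> U"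
      unfolding R_def Phi sum_distrib_left sum_subtractf[symmetric]
      by (intro sum.cong refl) (simp add: b_def algebra_simps)
    also have "\<dots> \<ge> s * card P / u * R - (card P + \<kappa>) * s / u * R - (card C * s / u + x\<^sup>2) * Phi E V \<mu> U"
      using yPs by simp
    finally have 1: "s * card P / u * R - (card P + \<kappa>) * s / u * R - (card C * s / u + x\<^sup>2) * Phi E V \<mu> U \<le> (\<Sum>S\<in>\<S>. w S * b S)" .
    have aux: "G \<le> T" if "X - Y = - Z" "Z \<le> D" "G = - D - F" "X - Y - F \<le> T" for G T X Y Z D F :: real
      using that by linarith
    have 2: "s * card P / u * R - (card P + \<kappa>) * s / u * R = - (\<kappa> * s / u * R)" by (simp add: add_divide_distrib algebra_simps)
    have 3: "\<kappa> * s / u * R \<le> \<kappa> * s / u * Phi E V \<mu> U" using RP \<kappa> u by (intro mult_left_mono) auto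
    have 4: "- Phi E V \<mu> U * ((\<kappa> + card C) * s / u + x\<^sup>2) = - (\<kappa> * s / u * Phi E V \<mu> U) - (card C * s / u + x\<^sup>2) * Phi E V \<mu> U"
      by (simp add: add_divide_distrib algebra_simps)
    show ?thesis by (rule aux[OF 2 3 4 1])
  qed
  have "Phi E V \<mu> (U - (P \<union> C)) = (\<Sum>S\<in>\<S>. exp (- \<mu> * rho E (U - (P \<union> C)) S))" by (simp add: Phi_def \<S>_def)
  also have "\<dots> \<le> (\<Sum>S\<in>\<S>. w S * (1 + (\<mu> * (3 * x))\<^sup>2) - \<mu> * (w S * b S))" by (intro sum_mono step)
  also have "\<dots> = Phi E V \<mu> U * (1 + (\<mu> * (3 * x))\<^sup>2) - \<mu> * (\<Sum>S\<in>\<S>. w S * b S)"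
    by (simp only: sum_subtractf sum_distrib_right[symmetric] sum_distrib_left[symmetric] Phi)
  also have "\<dots> \<le> Phi E V \<mu> U * (1 + (\<mu> * (3 * x))\<^sup>2) - \<mu> * (- Phi E V \<mu> U * ((\<kappa> + card C) * s / u + x\<^sup>2))"
    using sb \<mu> by (intro diff_left_mono mult_left_mono) auto
  also have "\<dots> = Phi E V \<mu> U * (1 + \<mu> * ((\<kappa> + card C) * s / u + x\<^sup>2) + (\<mu> * (3 * x))\<^sup>2)"
  proof -
    have "p * (1 + e) - m * (- p * q) = p * (1 + m * q + e)" for p e m q :: real by (simp add: algebra_simps)
    then show ?thesis .
  qed
  finally show ?thesis by (simp add: x_def s_def u_def)
qed


lemma delta_nonneg: "\<delta> \<ge> 0"
proof -
  have "(1 - 1 / (2 * real (k - l))) ^ (k - d) \<le> 1"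
    using two_l by (intro power_le_one) (auto simp: field_simps)
  then show ?thesis by (simp add: \<delta>_def)
qed

lemma cond_iff_rho:
  assumes "card U > 0"
  shows "cond E V U \<alpha> \<longleftrightarrow> (\<forall>S\<subseteq>V. card S = d \<longrightarrow> \<alpha> \<le> rho E U S)"
  using assms by (simp add: cond_def rho_def dg_def pos_le_divide_eq)

lemma cond_antimono: "cond E V U \<alpha> \<Longrightarrow> \<beta> \<le> \<alpha> \<Longrightarrow> V' \<subseteq> V \<Longrightarrow> cond E V' U \<beta>"
  unfolding cond_def
proof (intro allI impI)
  fix S
  assume c: "\<forall>S\<subseteq>V. card S = d \<longrightarrow> \<alpha> * card U ^ (k - d) \<le> card {xs \<in> tup U (k - d). S \<union> set xs \<in> E}"
    "\<beta> \<le> \<alpha>" "V' \<subseteq> V" and S: "S \<subseteq> V'" "card S = d"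
  have "\<beta> * card U ^ (k - d) \<le> \<alpha> * card U ^ (k - d)" using c(2) by (intro mult_right_mono) auto
  also have "\<dots> \<le> card {xs \<in> tup U (k - d). S \<union> set xs \<in> E}"
    using c(1) S order_trans[OF S(1) c(3)] by simp
  finally show "\<beta> * card U ^ (k - d) \<le> card {xs \<in> tup U (k - d). S \<union> set xs \<in> E}" .
qed

lemma cond_Diff:
  assumes "finite U" "R \<subseteq> U" "cond E V U \<alpha>" "card U > 0" "\<beta> \<le> \<alpha> - (k - d) * card R / card U" "\<beta> \<ge> 0"
  shows "cond E V (U - R) \<beta>"
  unfolding cond_def
proof (intro allI impI)
  fix S assume S: "S \<subseteq> V" "card S = d"
  have rho: "\<alpha> \<le> rho E U S" using assms(3) S cond_iff_rho[OF assms(4)] by auto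
  have "real (card (U - R) ^ (k - d)) \<le> real (card U ^ (k - d))"
    using assms(1) by (intro of_nat_mono power_mono card_mono) auto
  then have "\<beta> * card (U - R) ^ (k - d) \<le> \<beta> * real (card U ^ (k - d))"
    using assms(6) by (rule mult_left_mono)
  also have "\<dots> \<le> (rho E U S - (k - d) * card R / card U) * real (card U ^ (k - d))"
    using assms(5) rho by (intro mult_right_mono) auto
  also have "\<dots> \<le> dg E (U - R) S" using dg_Diff_le[OF assms(1,2), of E S] by simp
  finally show "\<beta> * card (U - R) ^ (k - d) \<le> card {xs \<in> tup (U - R) (k - d). S \<union> set xs \<in> E}"
    by (simp add: dg_def)
qed

text \<open>With \<open>\<epsilon> = 1 / h\<close> the excess over the number
  \<open>2 * h * (k - l) + l\<close> of vertices is at most \<open>6 * k\<close>, whatever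
  \<open>h\<close> is. The relative excess of long tiles is thus as small as desired.\<close>

lemma tile_weighted:
  fixes \<gamma> :: real
  assumes \<gamma>: "\<gamma> > 0" and h: "h \<ge> 1"
  shows "\<exists>n0::nat. \<forall>(E::'a set set) U (y::'a \<Rightarrow> real). finite U \<and> cond E U U (\<delta> + \<gamma>) \<and> card U \<ge> n0 \<and>
     (\<forall>x\<in>U. y x \<ge> 0) \<longrightarrow>
     (\<exists>L W L'. pth E L (2 * h) W L' \<and> L \<union> W \<union> L' \<subseteq> U \<and>
        sum y (L \<union> W \<union> L') \<le> (real (2 * h * (k - l) + l) + 6 * real k) * sum y U / card U)"
proof -
  have \<epsilon>: "0 < 1 / real h" "1 / real h \<le> 1" using h by auto
  obtain n0 where n0: "\<forall>(E::'a set set) U (y::'a \<Rightarrow> real). finite U \<and> cond E U U (\<delta> + \<gamma>) \<and> card U \<ge> n0 \<and>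
     (\<forall>x\<in>U. y x \<ge> 0) \<and> sum y U \<le> card U \<longrightarrow>
     (\<exists>L W L'. pth E L (2 * h) W L' \<and> L \<union> W \<union> L' \<subseteq> U \<and>
        sum y (L \<union> W \<union> L') \<le> (2 * real h + 2) * (real (k - l) * (1 + 1 / real h)))"
    using tile[OF \<epsilon> \<gamma> h] by blast
  show ?thesis
  proof (intro exI[of _ "n0 + 1"] allI impI)
    fix E :: "'a set set" and U :: "'a set" and y :: "'a \<Rightarrow> real"
    assume a: "finite U \<and> cond E U U (\<delta> + \<gamma>) \<and> n0 + 1 \<le> card U \<and> (\<forall>x\<in>U. y x \<ge> 0)"
    define Y where "Y = sum y U"
    define u where "u = real (card U)"
    have u: "u > 0" using a by (simp add: u_def)
    have Y0: "Y \<ge> 0" using a by (auto simp: Y_def intro: sum_nonneg)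
    \<comment> \<open>Weights rescaled to mean one. If \<open>Y = 0\<close>, division by zero makes
      \<open>y'\<close> vanish, so that a tile is still obtained.\<close>
    define y' where "y' x = y x * u / Y" for x
    have y'0: "\<forall>x\<in>U. y' x \<ge> 0" using a Y0 u by (auto simp: y'_def)
    have sumy': "sum y' A = sum y A * u / Y" for A
      by (simp add: y'_def sum_divide_distrib sum_distrib_right)
    have "sum y' U \<le> card U" using u by (simp add: sumy' flip: Y_def u_def)
    then obtain L W L' where p: "pth E L (2 * h) W L'" "L \<union> W \<union> L' \<subseteq> U"
      "sum y' (L \<union> W \<union> L') \<le> (2 * real h + 2) * (real (k - l) * (1 + 1 / real h))"
      using n0[rule_format, of U E y'] a y'0 by auto
    have num: "(2 * real h + 2) * (real (k - l) * (1 + 1 / real h)) \<le> real (2 * h * (k - l) + l) + 6 * real k"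
    proof -
      have "(2 * real h + 2) * (1 + 1 / real h) = 2 * real h + 4 + 2 * (1 / real h)" using h by (simp add: field_simps)
      also have "\<dots> \<le> 2 * real h + 6" using \<epsilon> by linarith
      finally have "real (k - l) * ((2 * real h + 2) * (1 + 1 / real h)) \<le> real (k - l) * (2 * real h + 6)"
        by (intro mult_left_mono) auto
      also have "\<dots> \<le> real (2 * h * (k - l) + l) + 6 * real k"
      proof -
        have "g * (2 * h + 6) \<le> 2 * h * g + l + 6 * k" if "g \<le> k" for g using that by (simp add: algebra_simps)
        then have "(k - l) * (2 * h + 6) \<le> 2 * h * (k - l) + l + 6 * k" by simp
        then have "real ((k - l) * (2 * h + 6)) \<le> real (2 * h * (k - l) + l + 6 * k)" by (rule of_nat_mono)
        then show ?thesis by simp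
      qed
      finally show ?thesis by (simp add: mult_ac)
    qed
    have "sum y (L \<union> W \<union> L') \<le> (real (2 * h * (k - l) + l) + 6 * real k) * Y / u"
    proof (cases "Y = 0")
      case True
      then have "\<And>x. x \<in> U \<Longrightarrow> y x = 0" using a by (simp add: Y_def sum_nonneg_eq_0_iff)
      then have "sum y (L \<union> W \<union> L') = 0" using p(2) by (intro sum.neutral) auto
      then show ?thesis using True by simp
    next
      case False
      then have Yp: "Y > 0" using Y0 by simp
      have "sum y (L \<union> W \<union> L') * u / Y \<le> real (2 * h * (k - l) + l) + 6 * real k"
        using p(3) num by (simp add: sumy')
      then have "sum y (L \<union> W \<union> L') * u \<le> (real (2 * h * (k - l) + l) + 6 * real k) * Y"
        using Yp by (simp add: pos_divide_le_eq)
      then show ?thesis using u by (simp add: pos_le_divide_eq)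
    qed
    then show "\<exists>L W L'. pth E L (2 * h) W L' \<and> L \<union> W \<union> L' \<subseteq> U \<and>
        sum y (L \<union> W \<union> L') \<le> (real (2 * h * (k - l) + l) + 6 * real k) * sum y U / card U"
      using p by (auto simp: Y_def u_def)
  qed
qed

text \<open>Each round removes a tile of \<open>p\<close> vertices and a connection of
  \<open>q\<close> vertices that appends it to the path so far. While at least \<open>e * n\<close>
  vertices are left, the potential grows by a factor of at most \<open>1 + \<theta>\<close> per
  round, hence by at most \<open>exp (\<mu> * \<gamma> / 8 + K2)\<close> over all rounds; a
  \<open>d\<close>-set with \<open>rho\<close> below \<open>\<delta> + \<gamma> / 2\<close> would
  contribute more than that allows.\<close>

lemma cover:
  fixes \<gamma> \<epsilon> :: real
  assumes \<gamma>: "\<gamma> > 0" and \<epsilon>: "\<epsilon> > 0" "\<epsilon> \<le> 1"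
  shows "\<exists>n0::nat. \<forall>(E::'a set set) V U0 L0 L1. finite V \<and> U0 \<subseteq> V \<and> card V \<le> 2 * card U0 \<and> cond E V U0 (\<delta> + \<gamma>) \<and>
     card U0 \<ge> n0 \<and> L0 \<subseteq> V - U0 \<and> L1 \<subseteq> V - U0 \<and> card L0 = l \<and> card L1 = l \<and> L0 \<inter> L1 = {} \<longrightarrow>
     (\<exists>W m. W \<subseteq> U0 \<and> pth E L0 m W L1 \<and> real (card (U0 - W)) \<le> \<epsilon> * card U0)"
proof -
  define e where "e = \<epsilon> / 2"
  have e: "e > 0" "e < 1" using \<epsilon> by (auto simp: e_def)
  define s where "s = k - d"
  define q where "q = (2 * l + 2) * (k - l) - l"
  define \<kappa> where "\<kappa> = 6 * real k"
  \<comment> \<open>The connection and the excess of the tile cost \<open>\<kappa> + q\<close> per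
    round. There are at most \<open>n / h\<close> rounds, so a large \<open>h\<close> keeps the
    total cost below \<open>\<gamma> / 8\<close>, up to the factor \<open>\<mu>\<close>.\<close>
  define h where "h = nat \<lceil>8 * (\<kappa> + q) * s / (e * \<gamma>)\<rceil> + 1"
  define p where "p = 2 * h * (k - l) + l"
  define r where "r = p + q"
  have h1: "h \<ge> 1" and r1: "r \<ge> 1" "r \<ge> h"
  proof -
    show "h \<ge> 1" by (simp add: h_def)
    have "2 * h * 1 \<le> 2 * h * (k - l)" using two_l by (intro mult_le_mono) auto
    then show "r \<ge> h" unfolding r_def p_def by linarith
    then show "r \<ge> 1" using \<open>h \<ge> 1\<close> by simp
  qed
  have hb: "8 * (\<kappa> + q) * s / (e * \<gamma>) \<le> h" unfolding h_def by linarith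
  have \<gamma>2: "\<gamma> / 2 > 0" "\<gamma> / 4 > 0" using \<gamma> by auto
  obtain nT where nT: "\<forall>(E::'a set set) U (y::'a \<Rightarrow> real). finite U \<and> cond E U U (\<delta> + \<gamma> / 2) \<and> card U \<ge> nT \<and>
     (\<forall>x\<in>U. y x \<ge> 0) \<longrightarrow>
     (\<exists>L W L'. pth E L (2 * h) W L' \<and> L \<union> W \<union> L' \<subseteq> U \<and>
        sum y (L \<union> W \<union> L') \<le> (real p + \<kappa>) * sum y U / card U)"
    using tile_weighted[OF \<gamma>2(1) h1] unfolding p_def \<kappa>_def by blast
  obtain nC where nC: "\<forall>(E::'a set set) V U L L'. finite V \<and> U \<subseteq> V \<and> cond E V U (\<gamma> / 4) \<and> card U \<ge> nC \<and>
     L \<subseteq> V \<and> L' \<subseteq> V \<and> card L = l \<and> card L' = l \<and> L \<inter> L' = {} \<longrightarrow>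
     (\<exists>W\<subseteq>U - (L \<union> L'). pth E L (2 * l + 2) W L')"
    using connector[OF \<gamma>2(2)] by blast
  \<comment> \<open>Bounds the sum of the quadratic error terms over at most \<open>n\<close>
    rounds.\<close>
  define K2 where "K2 = 10 * (s * r)\<^sup>2 / e\<^sup>2"
  have K2: "K2 \<ge> 0" by (simp add: K2_def)
  \<comment> \<open>\<open>n \<ge> M0 ^ 4\<close> makes \<open>\<gamma> / 4 * sqrt n\<close> at
    least \<open>K2 + d * ln (2 * n)\<close>.\<close>
  define M0 where "M0 = 4 / \<gamma> * (5 * d + K2) + 1"
  define c1 where "c1 = (real nT + real nC + 2 * r) / e"
  define c2 where "c2 = real s * r * (4 / \<gamma> + 1) / e"
  define c3 where "c3 = (3 * s * r / e)\<^sup>2"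
  define c4 where "c4 = M0 ^ 4"
  show ?thesis
  proof (intro exI[of _ "nat \<lceil>c1\<rceil> + nat \<lceil>c2\<rceil> + nat \<lceil>c3\<rceil> + nat \<lceil>c4\<rceil> + 1"] allI impI)
    fix E :: "'a set set" and V U0 L0 L1 :: "'a set"
    assume a: "finite V \<and> U0 \<subseteq> V \<and> card V \<le> 2 * card U0 \<and> cond E V U0 (\<delta> + \<gamma>) \<and>
     nat \<lceil>c1\<rceil> + nat \<lceil>c2\<rceil> + nat \<lceil>c3\<rceil> + nat \<lceil>c4\<rceil> + 1 \<le> card U0 \<and> L0 \<subseteq> V - U0 \<and> L1 \<subseteq> V - U0 \<and> card L0 = l \<and> card L1 = l \<and> L0 \<inter> L1 = {}"
    define n where "n = card U0"
    have nc: "c1 \<le> n" "c2 \<le> n" "c3 \<le> n" "c4 \<le> n" "n \<ge> 1" using a unfolding n_def by linarith+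
    have n1: "real nT + real nC + 2 * r \<le> e * n" using nc(1) e by (simp add: c1_def pos_divide_le_eq mult.commute)
    have n2: "real s * r * (4 / \<gamma> + 1) \<le> e * n" using nc(2) e by (simp add: c2_def pos_divide_le_eq mult.commute)
    have n2': "real s * r \<le> e * n" "real s * r * (4 / \<gamma>) \<le> e * n"
    proof -
      have "0 \<le> real s * r" "0 \<le> real s * r * (4 / \<gamma>)" using \<gamma> by auto
      moreover have "real s * r * (4 / \<gamma> + 1) = real s * r * (4 / \<gamma>) + real s * r" by (simp only: distrib_left mult_1_right)
      ultimately show "real s * r \<le> e * n" "real s * r * (4 / \<gamma>) \<le> e * n" using n2 by linarith+
    qed
    have finV: "finite V" and finU0: "finite U0" using a finite_subset by auto
    define \<mu> where "\<mu> = sqrt n"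
    have \<mu>1: "\<mu> \<ge> 1" using nc(5) by (simp add: \<mu>_def)
    have \<mu>n: "\<mu>\<^sup>2 = n" "\<mu> \<le> n"
    proof -
      show "\<mu>\<^sup>2 = n" by (simp add: \<mu>_def)
      then show "\<mu> \<le> n" using \<mu>1 by (metis mult_left_mono mult.right_neutral power2_eq_square order_trans zero_le_one)
    qed
    have n3: "3 * s * r / e \<le> \<mu>" using nc(3) unfolding c3_def \<mu>_def by (rule real_le_rsqrt)
    have n4: "K2 + d * ln (2 * n) \<le> \<gamma> / 4 * \<mu>"
    proof -
      \<comment> \<open>The fourth root of \<open>n\<close>: \<open>ln (2 * n)\<close> is at most
        linear in it, while \<open>\<mu>\<close> is its square.\<close>
      define m where "m = sqrt \<mu>"
      have m2: "m\<^sup>2 = \<mu>" using \<mu>1 by (simp add: m_def)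
      have M1: "M0 \<ge> 1" using \<gamma> K2 by (simp add: M0_def)
      have "(M0\<^sup>2)\<^sup>2 \<le> real n" using nc(4) by (simp add: c4_def flip: power_mult)
      then have "M0\<^sup>2 \<le> \<mu>" unfolding \<mu>_def by (rule real_le_rsqrt)
      then have mM: "M0 \<le> m" unfolding m_def by (rule real_le_rsqrt)
      then have m1: "m \<ge> 1" using M1 by linarith
      have "real n = m ^ 4" using m2 \<mu>n(1) by (metis power_mult numeral_Bit0 mult_2 numeral_times_numeral num_double)
      then have "ln (2 * real n) = ln 2 + 4 * ln m" using m1 by (simp add: ln_mult ln_realpow)
      also have "\<dots> \<le> 1 + 4 * m"
      proof -
        have "ln (2::real) \<le> 1" using ln_le_minus_one[of "2::real"] by simp
        moreover have "ln m \<le> m" using ln_le_minus_one[of m] m1 by simp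
        ultimately show ?thesis by linarith
      qed
      finally have "d * ln (2 * real n) \<le> d * (1 + 4 * m)" by (intro mult_left_mono) auto
      also have "\<dots> \<le> d * (5 * m)" using m1 by (intro mult_left_mono) auto
      finally have dl: "d * ln (2 * real n) \<le> d * (5 * m)" .
      have "K2 * 1 \<le> K2 * m" using K2 m1 by (intro mult_left_mono) auto
      then have "K2 + d * ln (2 * n) \<le> K2 * m + d * (5 * m)" using dl by simp
      also have "\<dots> = (5 * d + K2) * m" by (simp add: algebra_simps)
      also have "\<dots> \<le> (\<gamma> / 4 * m) * m"
      proof (intro mult_right_mono)
        have "4 / \<gamma> * (5 * d + K2) \<le> m" using mM by (simp add: M0_def)
        then show "5 * d + K2 \<le> \<gamma> / 4 * m" using \<gamma> by (simp add: field_simps)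
      qed (use m1 in simp)
      also have "\<dots> = \<gamma> / 4 * \<mu>" by (simp add: m2[symmetric] power2_eq_square)
      finally show ?thesis .
    qed
    define \<theta> where "\<theta> = \<mu> * ((\<kappa> + q) * s / (e * n)) + 10 * (s * r)\<^sup>2 / (e\<^sup>2 * n)"
    have en: "e * n > 0" using e nc(5) by simp
    have \<kappa>0: "\<kappa> \<ge> 0" by (simp add: \<kappa>_def)
    have \<theta>0: "\<theta> \<ge> 0" using \<mu>1 \<kappa>0 e by (auto simp: \<theta>_def intro!: add_nonneg_nonneg mult_nonneg_nonneg divide_nonneg_nonneg)
    \<comment> \<open>The largest number of rounds that leaves at least \<open>e * n\<close>
      vertices. Then at most \<open>e * n + r\<close> are left, and \<open>r \<le> e * n\<close>, so
      \<open>\<epsilon> = 2 * e\<close> suffices.\<close>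
    define J where "J = nat \<lfloor>(1 - e) * n / r\<rfloor>"
    have J1: "real J \<le> (1 - e) * n / r" unfolding J_def using e by (intro of_nat_floor) auto
    have J2: "(1 - e) * n / r < real J + 1" unfolding J_def by linarith
    have Jr: "J * real r \<le> (1 - e) * n" using J1 r1 by (simp add: pos_le_divide_eq)
    have Jr2: "(1 - e) * n \<le> (J + 1) * real r" using J2 r1
      by (simp add: pos_divide_less_eq add.commute less_imp_le)
    have J\<theta>: "J * \<theta> \<le> \<mu> * \<gamma> / 8 + K2"
    proof -
      have Jn: "real J * h \<le> n" 
      proof -
        have "real J * h \<le> J * real r" using r1 by (intro mult_left_mono) auto
        also have "\<dots> \<le> (1 - e) * n" by (rule Jr)
        also have "\<dots> \<le> 1 * real n" using e by (intro mult_right_mono) auto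
        finally show ?thesis by simp
      qed
      have Jn': "real J \<le> n"
      proof -
        have "real J * 1 \<le> real J * h" using h1 by (intro mult_left_mono) auto
        then show ?thesis using Jn by simp
      qed
      have "J * (10 * (s * r)\<^sup>2 / (e\<^sup>2 * n)) \<le> n * (10 * (s * r)\<^sup>2 / (e\<^sup>2 * n))"
        using Jn' e by (intro mult_right_mono) auto
      also have "\<dots> = K2" using nc(5) e by (simp add: K2_def)
      finally have 1: "J * (10 * (s * r)\<^sup>2 / (e\<^sup>2 * n)) \<le> K2" .
      have "(\<kappa> + q) * s \<le> h * (e * \<gamma>) / 8" using hb e \<gamma> by (simp add: pos_divide_le_eq algebra_simps)
      then have "(\<kappa> + q) * s / (e * n) \<le> h * (e * \<gamma>) / 8 / (e * n)" using en by (intro divide_right_mono) auto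
      also have "\<dots> = h * \<gamma> / (8 * n)" using e nc(5) by (simp add: field_simps)
      finally have "J * ((\<kappa> + q) * s / (e * n)) \<le> J * (h * \<gamma> / (8 * n))" by (intro mult_left_mono) auto
      also have "\<dots> = (real J * h) * (\<gamma> / (8 * n))" by simp
      also have "\<dots> \<le> n * (\<gamma> / (8 * n))" using Jn \<gamma> by (intro mult_right_mono) auto
      also have "\<dots> = \<gamma> / 8" using nc(5) by simp
      finally have 2: "\<mu> * (J * ((\<kappa> + q) * s / (e * n))) \<le> \<mu> * (\<gamma> / 8)" using \<mu>1 by (intro mult_left_mono) auto
      have "J * \<theta> = \<mu> * (J * ((\<kappa> + q) * s / (e * n))) + J * (10 * (s * r)\<^sup>2 / (e\<^sup>2 * n))"
        unfolding \<theta>_def by (simp only: distrib_left mult.left_commute[of "real J" \<mu>])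
      also have "\<dots> \<le> \<mu> * (\<gamma> / 8) + K2" by (rule add_mono[OF 2 1])
      finally show ?thesis by simp
    qed
    have cond0: "cond E V U0 (\<delta> + \<gamma>)" and cU0: "card U0 > 0" using a nc(5) by (simp_all add: n_def)
    have rho0: "\<forall>S\<subseteq>V. card S = d \<longrightarrow> \<delta> + \<gamma> \<le> rho E U0 S"
      using cond0 by (simp only: cond_iff_rho[OF cU0])
    have Phi0: "Phi E V \<mu> U0 \<le> exp (d * ln (2 * n) - \<mu> * (\<delta> + \<gamma>))"
    proof -
      have "card {S. S \<subseteq> V \<and> card S = d} = card V choose d" by (rule n_subsets[OF finV])
      also have "\<dots> \<le> card V ^ d" by (cases "d \<le> card V") (auto simp: binomial_le_pow binomial_eq_0 not_le)
      also have "\<dots> \<le> (2 * n) ^ d" using a by (intro power_mono) (auto simp: n_def)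
      finally have "real (card {S. S \<subseteq> V \<and> card S = d}) \<le> real ((2 * n) ^ d)" by (rule of_nat_mono)
      then have c: "real (card {S. S \<subseteq> V \<and> card S = d}) \<le> (2 * real n) ^ d" by simp
      have "Phi E V \<mu> U0 \<le> (\<Sum>S | S \<subseteq> V \<and> card S = d. exp (- \<mu> * (\<delta> + \<gamma>)))"
        unfolding Phi_def
      proof (intro sum_mono)
        fix S assume "S \<in> {S. S \<subseteq> V \<and> card S = d}"
        then have "\<delta> + \<gamma> \<le> rho E U0 S" using rho0 by blast
        then show "exp (- \<mu> * rho E U0 S) \<le> exp (- \<mu> * (\<delta> + \<gamma>))" using \<mu>1 by simp
      qed
      also have "\<dots> = card {S. S \<subseteq> V \<and> card S = d} * exp (- \<mu> * (\<delta> + \<gamma>))" by simp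
      also have "\<dots> \<le> (2 * real n) ^ d * exp (- \<mu> * (\<delta> + \<gamma>))" using c by (intro mult_right_mono) auto
      also have "(2 * real n) ^ d = exp (d * ln (2 * n))" using nc(5) by (simp add: exp_of_nat_mult)
      finally show ?thesis unfolding mult_exp_exp by simp
    qed
    have rho_ok: "\<delta> + \<gamma> / 2 \<le> rho E U S" if Phi: "Phi E V \<mu> U \<le> Phi E V \<mu> U0 * (1 + \<theta>) ^ j" and j: "j \<le> J"
      and S: "S \<subseteq> V" "card S = d" for U j S
    proof -
      have "exp (- \<mu> * rho E U S) \<le> Phi E V \<mu> U"
        unfolding Phi_def
        by (rule member_le_sum[where f = "\<lambda>S. exp (- \<mu> * rho E U S)"]) (use finV S in simp_all)
      also have "\<dots> \<le> Phi E V \<mu> U0 * (1 + \<theta>) ^ j" by (rule Phi)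
      also have "\<dots> \<le> exp (d * ln (2 * n) - \<mu> * (\<delta> + \<gamma>)) * exp (\<mu> * \<gamma> / 8 + K2)"
      proof (intro mult_mono Phi0)
        have "(1 + \<theta>) ^ j \<le> exp \<theta> ^ j" using \<theta>0 by (intro power_mono exp_ge_add_one_self) auto
        also have "\<dots> = exp (j * \<theta>)" by (simp add: exp_of_nat_mult)
        also have "j * \<theta> \<le> J * \<theta>" using j \<theta>0 by (intro mult_right_mono) auto
        then have "exp (j * \<theta>) \<le> exp (\<mu> * \<gamma> / 8 + K2)" using J\<theta> by simp
        finally show "(1 + \<theta>) ^ j \<le> exp (\<mu> * \<gamma> / 8 + K2)" .
      qed (use \<theta>0 in auto)
      finally have "- \<mu> * rho E U S \<le> d * ln (2 * n) - \<mu> * (\<delta> + \<gamma>) + (\<mu> * \<gamma> / 8 + K2)"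
        unfolding mult_exp_exp exp_le_cancel_iff .
      then have "\<mu> * (\<delta> + \<gamma>) - \<mu> * \<gamma> / 8 - \<gamma> / 4 * \<mu> \<le> \<mu> * rho E U S"
        using n4 unfolding mult_minus_left by linarith
      moreover have "\<mu> * (\<delta> + \<gamma> / 2) \<le> \<mu> * (\<delta> + \<gamma>) - \<mu> * \<gamma> / 8 - \<gamma> / 4 * \<mu>"
      proof -
        have "m * (x + y) - m * y / 8 - y / 4 * m - m * (x + y / 2) = m * y / 8" for m x y :: real
          by (simp add: field_simps)
        then have "\<mu> * (\<delta> + \<gamma>) - \<mu> * \<gamma> / 8 - \<gamma> / 4 * \<mu> - \<mu> * (\<delta> + \<gamma> / 2) = \<mu> * \<gamma> / 8" .
        moreover have "0 \<le> \<mu> * \<gamma> / 8" using \<mu>1 \<gamma> by simp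
        ultimately show ?thesis by (metis diff_ge_0_iff_ge)
      qed
      ultimately have "\<mu> * (\<delta> + \<gamma> / 2) \<le> \<mu> * rho E U S" by (rule order_trans[rotated])
      then show ?thesis using \<mu>1 by simp
    qed
    \<comment> \<open>\<open>X\<close> is the current end of the path, which starts in
      \<open>L0\<close>. The first alternative describes the start, as there is no path without
      edges.\<close>
    define Inv where "Inv j U X \<longleftrightarrow> U \<subseteq> U0 \<and> card U + j * r = n \<and> X \<subseteq> V - U \<and> card X = l \<and> X \<inter> L1 = {} \<and>
       Phi E V \<mu> U \<le> Phi E V \<mu> U0 * (1 + \<theta>) ^ j \<and>
       (X = L0 \<and> U = U0 \<or> (\<exists>m W. pth E L0 m W X \<and> W \<union> X = U0 - U))" for j U X
    have u_ge: "e * n \<le> card U" if "Inv j U X" "j \<le> J" for j U X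
    proof -
      have "real (card U) + j * real r = n" using that(1) by (simp add: Inv_def flip: of_nat_mult of_nat_add)
      moreover have "j * real r \<le> J * real r" using that(2) by (intro mult_right_mono) auto
      moreover have "(1 - e) * n = n - e * n" by (simp add: algebra_simps)
      ultimately show ?thesis using Jr by linarith
    qed
    have "j \<le> J \<Longrightarrow> \<exists>U X. Inv j U X" for j
    proof (induction j)
      case 0
      have "Inv 0 U0 L0" using a by (auto simp: Inv_def n_def)
      then show ?case by blast
    next
      case (Suc j)
      then obtain U X where I: "Inv j U X" by auto
      have jJ: "j \<le> J" using Suc.prems by simp
      define u where "u = real (card U)"
      have u: "e * n \<le> u" using u_ge[OF I jJ] by (simp add: u_def)
      have up: "u > 0" using u en by linarith
      have UX: "U \<subseteq> U0" "card U + j * r = n" "X \<subseteq> V - U" "card X = l" "X \<inter> L1 = {}"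
       "Phi E V \<mu> U \<le> Phi E V \<mu> U0 * (1 + \<theta>) ^ j" using I by (auto simp: Inv_def)
      have path: "X = L0 \<and> U = U0 \<or> (\<exists>m W. pth E L0 m W X \<and> W \<union> X = U0 - U)" using I by (simp add: Inv_def)
      have finU: "finite U" using UX finU0 finite_subset by auto
      have UV: "U \<subseteq> V" using UX a by auto
      have cU: "card U > 0" using up by (simp add: u_def)
      have rho: "\<delta> + \<gamma> / 2 \<le> rho E U S" if "S \<subseteq> V" "card S = d" for S by (rule rho_ok[OF UX(6) jJ that])
      then have cond: "cond E V U (\<delta> + \<gamma> / 2)" by (simp add: cond_iff_rho[OF cU])
      define y where "y v = (\<Sum>S | S \<subseteq> V \<and> card S = d. exp (- \<mu> * rho E U S) * dgv E U S v)" for v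
      have y0: "\<forall>x\<in>U. y x \<ge> 0" unfolding y_def by (intro ballI sum_nonneg mult_nonneg_nonneg dgv_nonneg) simp
      have "nT \<le> card U" using n1 u by (simp add: u_def)
      then obtain L W L' where P: "pth E L (2 * h) W L'" "L \<union> W \<union> L' \<subseteq> U"
        "sum y (L \<union> W \<union> L') \<le> (real p + \<kappa>) * sum y U / card U"
        using nT[rule_format, of U E y] finU y0 cond_antimono[OF cond order_refl UV] by auto
      note pf = pth_facts[OF P(1)]
      define PP where "PP = L \<union> W \<union> L'"
      have PP: "PP \<subseteq> U" using P by (simp add: PP_def)
      have cP: "card PP = p"
        using pf unfolding PP_def p_def by (subst card_Un_disjoint; (subst card_Un_disjoint)?) auto
      have pr: "p \<le> r" by (simp add: r_def)
      have cond2: "cond E V (U - PP) (\<gamma> / 4)"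
      proof (rule cond_Diff[OF finU PP cond cU])
        have "real s * p * (4 / \<gamma>) \<le> real s * r * (4 / \<gamma>)" using pr \<gamma> by (intro mult_right_mono mult_left_mono) auto
        also have "\<dots> \<le> u" using n2'(2) u by linarith
        finally have "real s * p / u \<le> \<gamma> / 4" using up \<gamma> by (simp add: field_simps)
        then show "\<gamma> / 4 \<le> \<delta> + \<gamma> / 2 - (k - d) * card PP / card U"
          using delta_nonneg by (simp add: cP s_def u_def)
      qed (use \<gamma> in simp)
      have finP: "finite PP" using PP finU finite_subset by auto
      have "card (U - PP) = card U - p" using PP finP cP by (simp add: card_Diff_subset)
      moreover have "real nC + p \<le> u" using n1 u pr by linarith
      then have "nC + p \<le> card U" unfolding u_def by linarith
      ultimately have "nC \<le> card (U - PP)" by linarith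
      moreover have "X \<inter> L = {}" "X \<subseteq> V" "L \<subseteq> V" using UX P UV by auto
      ultimately obtain C where C: "C \<subseteq> U - PP - (X \<union> L)" "pth E X (2 * l + 2) C L"
        using nC[rule_format, of V "U - PP" E X L] finV UV cond2 UX(4) pf(4) by (meson Diff_subset subset_trans)
      have cC: "card C = q" using pth_facts(10)[OF C(2)] by (simp add: q_def)
      define U' where "U' = U - (PP \<union> C)"
      have PC: "card PP + card C = r" using cP cC by (simp add: r_def)
      have CU: "C \<subseteq> U - PP" using C by auto
      have ru: "r < card U"
      proof -
        have "real r < u" using n1 u r1 by linarith
        then show ?thesis by (simp add: u_def)
      qed
      have sru: "real s * r \<le> u" using n2' u by linarith
      have step: "Phi E V \<mu> U' \<le> Phi E V \<mu> U *
        (1 + \<mu> * ((\<kappa> + card C) * (k - d) / card U + ((k - d) * r / card U)\<^sup>2) + (\<mu> * (3 * ((k - d) * r / card U)))\<^sup>2)"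
        unfolding U'_def
      proof (rule Phi_step[OF finV UV PP CU PC[symmetric] ru])
        show "(k - d) * r \<le> card U" using sru by (simp add: s_def u_def flip: of_nat_mult)
        show "0 < \<mu>" using \<mu>1 by linarith
        show "\<mu> * (3 * (real ((k - d) * r) / card U)) \<le> 1"
        proof -
          have "3 * real s * r / u \<le> 3 * real s * r / (e * n)" using u en by (intro divide_left_mono) auto
          also have "\<dots> = (3 * s * r / e) / n" by simp
          also have "\<dots> \<le> \<mu> / n" using n3 by (intro divide_right_mono) auto
          finally have "\<mu> * (3 * real s * r / u) \<le> \<mu> * (\<mu> / n)" using \<mu>1 by (intro mult_left_mono) auto
          also have "\<dots> = 1" using \<mu>n(1) nc(5) by (simp add: power2_eq_square)
          finally show ?thesis by (simp add: s_def u_def)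
        qed
        show "0 \<le> \<kappa>" by (rule \<kappa>0)
        show "sum y PP \<le> (card PP + \<kappa>) * sum y U / card U" using P(3) cP by (simp add: PP_def)
      qed (simp add: y_def)
      have fac: "1 + \<mu> * ((\<kappa> + card C) * (k - d) / card U + ((k - d) * r / card U)\<^sup>2) + (\<mu> * (3 * ((k - d) * r / card U)))\<^sup>2 \<le> 1 + \<theta>"
      proof -
        define x where "x = real s * r / u"
        have x0: "x \<ge> 0" using up by (simp add: x_def)
        have "x \<le> real s * r / (e * n)" unfolding x_def using u en by (intro divide_left_mono) auto
        then have x2: "x\<^sup>2 \<le> (real s * r / (e * n))\<^sup>2" using x0 by (intro power_mono) auto
        have "\<mu> * x\<^sup>2 + (\<mu> * (3 * x))\<^sup>2 = (\<mu> + 9 * \<mu>\<^sup>2) * x\<^sup>2" by (simp add: algebra_simps power2_eq_square)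
        also have "\<dots> \<le> (10 * n) * (real s * r / (e * n))\<^sup>2"
          using \<mu>n x2 by (intro mult_mono) auto
        also have "\<dots> = 10 * (s * r)\<^sup>2 / (e\<^sup>2 * n)" using nc(5) by (simp add: power2_eq_square)
        finally have 1: "\<mu> * x\<^sup>2 + (\<mu> * (3 * x))\<^sup>2 \<le> 10 * (s * r)\<^sup>2 / (e\<^sup>2 * n)" .
        have "(\<kappa> + q) * s / u \<le> (\<kappa> + q) * s / (e * n)" using u en \<kappa>0 by (intro divide_left_mono) auto
        then have "\<mu> * ((\<kappa> + q) * s / u) \<le> \<mu> * ((\<kappa> + q) * s / (e * n))" using \<mu>1 by (intro mult_left_mono) auto
        with 1 have "1 + \<mu> * ((\<kappa> + q) * s / u + x\<^sup>2) + (\<mu> * (3 * x))\<^sup>2 \<le> 1 + \<theta>" by (simp add: \<theta>_def distrib_left)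
        then show ?thesis by (simp add: x_def u_def s_def cC)
      qed
      have Phi_pos: "Phi E V \<mu> U \<ge> 0" unfolding Phi_def by (intro sum_nonneg) auto
      have "Phi E V \<mu> U' \<le> Phi E V \<mu> U * (1 + \<theta>)"
        using step mult_left_mono[OF fac Phi_pos] by linarith
      also have "\<dots> \<le> (Phi E V \<mu> U0 * (1 + \<theta>) ^ j) * (1 + \<theta>)" using UX(6) \<theta>0 by (intro mult_right_mono) auto
      finally have Phi': "Phi E V \<mu> U' \<le> Phi E V \<mu> U0 * (1 + \<theta>) ^ Suc j" by (simp add: mult_ac)
      have finC: "finite C" using C finU finite_subset by (metis finite_Diff)
      have "card (PP \<union> C) = r" using PC CU finP finC by (subst card_Un_disjoint) auto
      then have cU': "card U' + r = card U"
        using ru PP CU finP finC unfolding U'_def by (subst card_Diff_subset) auto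
      have p1: "pth E X (2 * l + 2 + 2 * h) (C \<union> L \<union> W) L'"
      proof (rule comp[OF C(2) P(1)])
        show "(X \<union> C) \<inter> (W \<union> L') = {}" using UX(3) C(1) PP unfolding PP_def by blast
      qed
      have ends: "L' \<subseteq> V - U'" "L' \<inter> L1 = {}" "card L' = l"
        using P(2) UV UX(1) a pf(5) by (auto simp: U'_def PP_def)
      have new: "\<exists>m W. pth E L0 m W L' \<and> W \<union> L' = U0 - U'"
      proof (cases "X = L0 \<and> U = U0")
        case True
        moreover have "C \<union> L \<union> W \<union> L' = U0 - U'" using True C(1) PP unfolding U'_def PP_def by blast
        ultimately show ?thesis using p1 by blast
      next
        case False
        then obtain m W0 where W0: "pth E L0 m W0 X" "W0 \<union> X = U0 - U" using path by blast
        have "pth E L0 (m + (2 * l + 2 + 2 * h)) (W0 \<union> X \<union> (C \<union> L \<union> W)) L'"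
        proof (rule comp[OF W0(1) p1])
          show "(L0 \<union> W0) \<inter> (C \<union> L \<union> W \<union> L') = {}"
            using W0(2) UX(1) a C(1) PP unfolding PP_def by blast
        qed
        moreover have "W0 \<union> X \<union> (C \<union> L \<union> W) \<union> L' = U0 - U'"
          using W0(2) C(1) PP UX(1) unfolding U'_def PP_def by blast
        ultimately show ?thesis by blast
      qed
      have "Inv (Suc j) U' L'"
        unfolding Inv_def using new ends Phi' cU' UX(1,2) by (auto simp: U'_def)
      then show ?case by blast
    qed
    then obtain U X where I: "Inv J U X" by blast
    have UX: "U \<subseteq> U0" "card U + J * r = n" "X \<subseteq> V - U" "card X = l" "X \<inter> L1 = {}"
       "Phi E V \<mu> U \<le> Phi E V \<mu> U0 * (1 + \<theta>) ^ J" using I by (auto simp: Inv_def)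
    have path: "X = L0 \<and> U = U0 \<or> (\<exists>m W. pth E L0 m W X \<and> W \<union> X = U0 - U)" using I by (simp add: Inv_def)
    have finU: "finite U" using UX finU0 finite_subset by auto
    have ug: "e * n \<le> card U" by (rule u_ge[OF I order_refl])
    then have cU: "card U > 0" using en by linarith
    have "\<gamma> / 4 \<le> rho E U S" if "S \<subseteq> V" "card S = d" for S
      using rho_ok[OF UX(6) order_refl that] delta_nonneg \<gamma> by linarith
    then have cond: "cond E V U (\<gamma> / 4)" by (simp add: cond_iff_rho[OF cU])
    have "nC \<le> card U" using n1 ug by linarith
    \<comment> \<open>The last connection, from the current end to \<open>L1\<close>, takes its
      vertices from the leftover, where the degree condition still holds.\<close>
    then obtain C where C: "C \<subseteq> U - (X \<union> L1)" "pth E X (2 * l + 2) C L1"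
      using nC[rule_format, of V U E X L1] finV cond UX a by (meson Diff_subset subset_trans)
    have small: "real (card U) \<le> \<epsilon> * n"
    proof -
      have "real (card U) + J * real r = n" using UX(2) by (simp flip: of_nat_mult of_nat_add)
      moreover have "(1 - e) * n = n - e * n" "(J + 1) * real r = J * real r + r" by (simp_all add: algebra_simps)
      ultimately have "real (card U) \<le> e * n + r" using Jr2 by linarith
      also have "\<dots> \<le> e * n + e * n" using n1 by linarith
      finally show ?thesis by (simp add: e_def)
    qed
    show "\<exists>W m. W \<subseteq> U0 \<and> pth E L0 m W L1 \<and> real (card (U0 - W)) \<le> \<epsilon> * card U0"
    proof (cases "X = L0 \<and> U = U0")
      case True
      have "card (U0 - C) \<le> card U" using True finU by (intro card_mono) auto
      then show ?thesis using C True small by (intro exI[of _ C] exI[of _ "2 * l + 2"]) (auto simp: n_def)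
    next
      case False
      then obtain m W0 where W0: "pth E L0 m W0 X" "W0 \<union> X = U0 - U" using path by blast
      have "pth E L0 (m + (2 * l + 2)) (W0 \<union> X \<union> C) L1"
      proof (rule comp[OF W0(1) C(2)])
        show "(L0 \<union> W0) \<inter> (C \<union> L1) = {}" using W0(2) UX(1) a C(1) by blast
      qed
      moreover have "W0 \<union> X \<union> C \<subseteq> U0" using W0(2) C(1) UX(1) by blast
      moreover have "U0 - (W0 \<union> X \<union> C) \<subseteq> U" using W0(2) by blast
      then have "card (U0 - (W0 \<union> X \<union> C)) \<le> card U" using finU by (intro card_mono) auto
      then have "real (card (U0 - (W0 \<union> X \<union> C))) \<le> \<epsilon> * card U0" using small by (simp add: n_def)
      ultimately show ?thesis by blast
    qed
  qed
qed


section \<open>Absorbers\<close>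

text \<open>Two walks \<open>ws\<close>, \<open>ws'\<close> from \<open>{..<l}\<close> to a disjoint \<open>l\<close>-set, consecutive members being disjoint, such that
  \<open>ws'\<close> has one step more and uses each of the last \<open>l\<close> classes once more than \<open>ws\<close>. In a blow-up of an
  edge they yield paths with the same ends, the second of which needs one more vertex from each of
  the classes \<open>{..<k - l}\<close>.\<close>

definition gb :: "nat \<Rightarrow> nat" where
  "gb m = (if m = l - 1 then l else k - l + m)"

text \<open>\<open>ws'\<close> exchanges class \<open>m\<close> for \<open>gb m\<close>, one
  \<open>m\<close> at a time, and \<open>gA i\<close> is its state after \<open>i\<close> exchanges.
  \<open>gC i\<close> avoids both \<open>gA i\<close> and \<open>gA (Suc i)\<close>, so it can stand
  between them.\<close>

definition gA :: "nat \<Rightarrow> nat set" where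
  "gA i = gb ` {..<i} \<union> {i..<l}"

definition gC :: "nat \<Rightarrow> nat set" where
  "gC i = {..<i} \<union> gb ` {Suc i..<l} \<union> {k - 1}"

text \<open>Each \<open>gB i\<close> omits \<open>gb i\<close>. Hence \<open>ws\<close> visits every
  \<open>gb m\<close> with \<open>m < l - 1\<close> once less than \<open>ws'\<close> does; it also
  visits \<open>k - 1\<close> once less, having only \<open>l - 1\<close> sets \<open>gB i\<close>
  against \<open>l\<close> sets \<open>gC i\<close>.\<close>

definition gB :: "nat \<Rightarrow> nat set" where
  "gB i = insert (k - 1) (gb ` ({..<l} - {i}))"

fun long_walk :: "nat \<Rightarrow> nat set list" where
  "long_walk 0 = [gA 0]"
| "long_walk (Suc i) = long_walk i @ [gC i, gA (Suc i)]"

fun short_walk :: "nat \<Rightarrow> nat set list" where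
  "short_walk 0 = [gA 0]"
| "short_walk (Suc i) = short_walk i @ [gB i, gA 0]"

definition ws :: "nat set list" where "ws = short_walk (l - 1) @ [gA l]"

definition ws' :: "nat set list" where "ws' = long_walk l"

section \<open>How often the two walks visit each class\<close>

lemma gb_inj: "inj_on gb {..<l}"
  using two_l by (auto simp: inj_on_def gb_def split: if_splits)

lemma gb_range: "m < l \<Longrightarrow> l \<le> gb m \<and> gb m < k - 1"
  using two_l l_pos by (auto simp: gb_def)

lemma card_gb: "X \<subseteq> {..<l} \<Longrightarrow> card (gb ` X) = card X"
  using inj_on_subset[OF gb_inj] by (simp add: card_image)

lemma gb_image: "y \<in> gb ` X \<Longrightarrow> X \<subseteq> {..<l} \<Longrightarrow> l \<le> y \<and> y < k - 1"
  using gb_range by auto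

lemma gb_mem_image: "m < l \<Longrightarrow> X \<subseteq> {..<l} \<Longrightarrow> gb m \<in> gb ` X \<longleftrightarrow> m \<in> X"
  using inj_on_image_mem_iff[OF gb_inj] by simp

lemma gA_props: assumes "i \<le> l" shows "gA i \<subseteq> {..<k}" "card (gA i) = l"
proof -
  have r: "gb m < k" if "m < i" for m using gb_range[of m] that assms by linarith
  then show "gA i \<subseteq> {..<k}" using two_l by (auto simp: gA_def)
  have "l \<le> y" if "y \<in> gb ` {..<i}" for y using gb_image[OF that] assms by simp
  then have "gb ` {..<i} \<inter> {i..<l} = {}" by (meson atLeastLessThan_iff disjoint_iff not_le)
  then show "card (gA i) = l" unfolding gA_def using assms card_gb[of "{..<i}"]
    by (subst card_Un_disjoint) auto
qed

lemma gC_props: assumes "i < l" shows "gC i \<subseteq> {..<k}" "card (gC i) = l"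
proof -
  have r: "l \<le> gb m" "gb m < k - 1" if "m < l" for m using gb_range[of m] that by auto
  have sub: "{Suc i..<l} \<subseteq> {..<l}" by auto
  have "y < k" if "y \<in> gb ` {Suc i..<l}" for y using gb_image[OF that sub] by auto
  then show "gC i \<subseteq> {..<k}" using assms two_l unfolding gC_def by auto
  have d1: "{..<i} \<inter> gb ` {Suc i..<l} = {}" 
  proof -
    have "y \<notin> gb ` {Suc i..<l}" if "y < i" for y using gb_image[of y, OF _ sub] that assms by linarith
    then show ?thesis by blast
  qed
  have d2: "({..<i} \<union> gb ` {Suc i..<l}) \<inter> {k - 1} = {}" using gb_image[OF _ sub, of "k - 1"] assms two_l by auto
  have c: "card (gb ` {Suc i..<l}) = l - Suc i" by (subst card_gb) auto
  have "card (gC i) = i + (l - Suc i) + 1"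
    unfolding gC_def using d1 d2 c by (subst card_Un_disjoint; (subst card_Un_disjoint)?) auto
  then show "card (gC i) = l" using assms by simp
qed

lemma gB_props: assumes "i < l" shows "gB i \<subseteq> {..<k}" "card (gB i) = l"
proof -
  have r: "gb m < k - 1" if "m < l" for m using gb_range[of m] that by auto
  have "y < k" if "y \<in> gb ` ({..<l} - {i})" for y using gb_image[OF that] by auto
  then show "gB i \<subseteq> {..<k}" using two_l unfolding gB_def by auto
  have "k - 1 \<notin> gb ` ({..<l} - {i})" using gb_image[of "k - 1" "{..<l} - {i}"] by auto
  then have "card (gB i) = Suc (card (gb ` ({..<l} - {i})))" by (simp add: gB_def)
  also have "card (gb ` ({..<l} - {i})) = l - 1" using card_gb[of "{..<l} - {i}"] assms by simp
  finally show "card (gB i) = l" using l_pos by simp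
qed

lemma gA_gC_disjoint: assumes "i < l" shows "gA i \<inter> gC i = {}" "gC i \<inter> gA (Suc i) = {}"
proof -
  have r: "l \<le> gb m" "gb m < k - 1" if "m < l" for m using gb_range[of m] that by auto
  have kl: "l < k - 1" using two_l l_pos by simp
  have "x \<notin> gA i \<and> x \<notin> gA (Suc i)" if x: "x \<in> gC i" for x
  proof -
    consider "x < i" | m where "Suc i \<le> m" "m < l" "x = gb m" | "x = k - 1"
      using x by (auto simp: gC_def)
    then show ?thesis
    proof cases
      case 1
      have "x \<notin> gb ` {..<Suc i}"
      proof
        assume "x \<in> gb ` {..<Suc i}"
        then obtain m where "m < Suc i" "x = gb m" by auto
        then show False using r(1)[of m] 1 assms by linarith
      qed
      then show ?thesis using 1 unfolding gA_def lessThan_Suc by simp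
    next
      case 2
      have "x \<notin> gb ` {..<Suc i}"
        unfolding 2(3) by (subst gb_mem_image) (use 2 assms in auto)
      moreover have "x \<ge> l" using r(1)[OF 2(2)] 2(3) by simp
      ultimately show ?thesis unfolding gA_def lessThan_Suc by simp
    next
      case 3
      have "x \<notin> gb ` {..<Suc i}"
      proof
        assume "x \<in> gb ` {..<Suc i}"
        then obtain m where "m < Suc i" "x = gb m" by auto
        then show False using r(2)[of m] 3 assms by linarith
      qed
      then show ?thesis using 3 kl unfolding gA_def lessThan_Suc by simp
    qed
  qed
  then show "gA i \<inter> gC i = {}" "gC i \<inter> gA (Suc i) = {}" by auto
qed

lemma gA0_gB_disjoint: "i < l \<Longrightarrow> gA 0 \<inter> gB i = {}"
proof -
  have "y \<ge> l" if "y \<in> gB i" for y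
    using that gb_image[of y "{..<l} - {i}"] two_l l_pos unfolding gB_def by auto
  then show ?thesis unfolding gA_def by force
qed

lemma gA0_gAl_disjoint: "gA 0 \<inter> gA l = {}"
proof -
  have "y \<ge> l" if "y \<in> gA l" for y using that gb_image[of y "{..<l}"] unfolding gA_def by auto
  then show ?thesis unfolding gA_def by force
qed

lemma long_walk_props:
  "i \<le> l \<Longrightarrow> length (long_walk i) = Suc (2 * i) \<and> hd (long_walk i) = gA 0 \<and> last (long_walk i) = gA i \<and>
    (\<forall>Q\<in>set (long_walk i). Q \<subseteq> {..<k} \<and> card Q = l) \<and> successively (\<lambda>Q Q'. Q \<inter> Q' = {}) (long_walk i) \<and> long_walk i \<noteq> []"
proof (induction i)
  case (Suc i)
  then show ?case using gA_props[of "Suc i"] gC_props[of i] gA_gC_disjoint[of i]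
    by (auto simp: successively_append_iff)
qed (use gA_props[of 0] in auto)

lemma short_walk_props:
  "i < l \<Longrightarrow> length (short_walk i) = Suc (2 * i) \<and> hd (short_walk i) = gA 0 \<and> last (short_walk i) = gA 0 \<and>
    (\<forall>Q\<in>set (short_walk i). Q \<subseteq> {..<k} \<and> card Q = l) \<and> successively (\<lambda>Q Q'. Q \<inter> Q' = {}) (short_walk i) \<and> short_walk i \<noteq> []"
proof (induction i)
  case (Suc i)
  then show ?case using gA_props[of 0] gB_props[of i] gA0_gB_disjoint[of i]
    by (auto simp: successively_append_iff)
qed (use gA_props[of 0] in auto)

lemma walk_props:
  "length ws = Suc (2 * l - 1)" "hd ws = gA 0" "last ws = gA l" "\<forall>Q\<in>set ws. Q \<subseteq> {..<k} \<and> card Q = l"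
  "successively (\<lambda>Q Q'. Q \<inter> Q' = {}) ws"
  "length ws' = Suc (2 * l)" "hd ws' = gA 0" "last ws' = gA l" "\<forall>Q\<in>set ws'. Q \<subseteq> {..<k} \<and> card Q = l"
  "successively (\<lambda>Q Q'. Q \<inter> Q' = {}) ws'"
  using short_walk_props[of "l - 1"] long_walk_props[of l] gA_props[of l] gA0_gAl_disjoint l_pos
  by (auto simp: ws_def ws'_def successively_append_iff)

lemma mem_gA: "j < l \<Longrightarrow> i \<le> l \<Longrightarrow> j \<in> gA i \<longleftrightarrow> i \<le> j"
  "m < l \<Longrightarrow> i \<le> l \<Longrightarrow> gb m \<in> gA i \<longleftrightarrow> m < i"
  "i \<le> l \<Longrightarrow> k - 1 \<notin> gA i"
  "i \<le> l \<Longrightarrow> j \<ge> l \<Longrightarrow> j \<notin> gb ` {..<l} \<Longrightarrow> j \<notin> gA i"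
proof -
  have r: "l \<le> gb m" "gb m < k - 1" if "m < l" for m using gb_range[of m] that by auto
  show "j \<in> gA i \<longleftrightarrow> i \<le> j" if "j < l" "i \<le> l"
    using r(1) that unfolding gA_def by (auto dest!: r(1)[OF order_less_le_trans])
  show "gb m \<in> gA i \<longleftrightarrow> m < i" if "m < l" "i \<le> l"
  proof -
    have "gb m \<in> gb ` {..<i} \<longleftrightarrow> m < i" using gb_mem_image[of m "{..<i}"] that by simp
    then show ?thesis using r(1)[OF that(1)] unfolding gA_def by auto
  qed
  show "k - 1 \<notin> gA i" if "i \<le> l"
  proof -
    have "k - 1 \<notin> gb ` {..<i}" using gb_image[of "k - 1" "{..<i}"] that by auto
    then show ?thesis using two_l unfolding gA_def by auto
  qed
  show "j \<notin> gA i" if "i \<le> l" "j \<ge> l" "j \<notin> gb ` {..<l}"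
    using that unfolding gA_def by auto
qed

lemma mem_gC: "j < l \<Longrightarrow> i < l \<Longrightarrow> j \<in> gC i \<longleftrightarrow> j < i"
  "m < l \<Longrightarrow> i < l \<Longrightarrow> gb m \<in> gC i \<longleftrightarrow> i < m"
  "k - 1 \<in> gC i"
  "i < l \<Longrightarrow> j \<ge> l \<Longrightarrow> j \<notin> gb ` {..<l} \<Longrightarrow> j \<noteq> k - 1 \<Longrightarrow> j \<notin> gC i"
proof -
  have r: "l \<le> gb m" "gb m < k - 1" if "m < l" for m using gb_range[of m] that by auto
  have kl: "l < k - 1" using two_l l_pos by simp
  show "j \<in> gC i \<longleftrightarrow> j < i" if "j < l" "i < l"
  proof -
    have sub: "{Suc i..<l} \<subseteq> {..<l}" by auto
    have "j \<notin> gb ` {Suc i..<l}" using gb_image[of j, OF _ sub] that by auto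
    then show ?thesis using that kl unfolding gC_def by auto
  qed
  show "gb m \<in> gC i \<longleftrightarrow> i < m" if "m < l" "i < l"
  proof -
    have "gb m \<in> gb ` {Suc i..<l} \<longleftrightarrow> i < m" 
      by (subst gb_mem_image) (use that in auto)
    then show ?thesis using r[OF that(1)] that unfolding gC_def by auto
  qed
  show "k - 1 \<in> gC i" by (simp add: gC_def)
  show "j \<notin> gC i" if "i < l" "j \<ge> l" "j \<notin> gb ` {..<l}" "j \<noteq> k - 1"
    using that unfolding gC_def by auto
qed

lemma mem_gB: "j < l \<Longrightarrow> j \<notin> gB i"
  "m < l \<Longrightarrow> gb m \<in> gB i \<longleftrightarrow> i \<noteq> m"
  "k - 1 \<in> gB i"
  "j \<notin> gb ` {..<l} \<Longrightarrow> j \<noteq> k - 1 \<Longrightarrow> j \<notin> gB i"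
proof -
  have r: "l \<le> gb m" "gb m < k - 1" if "m < l" for m using gb_range[of m] that by auto
  have kl: "l < k - 1" using two_l l_pos by simp
  show "j \<notin> gB i" if "j < l" 
    using gb_image[of j "{..<l} - {i}"] that kl unfolding gB_def by auto
  show "gb m \<in> gB i \<longleftrightarrow> i \<noteq> m" if "m < l"
  proof -
    have "gb m \<in> gb ` ({..<l} - {i}) \<longleftrightarrow> i \<noteq> m" 
      by (subst gb_mem_image) (use that in auto)
    then show ?thesis using r[OF that] unfolding gB_def by auto
  qed
qed (auto simp: gB_def)

lemma cnt_long: assumes "i \<le> l"
  shows "j < l \<Longrightarrow> cnt j (long_walk i) = (if i \<le> j then Suc i else i)"
    "m < l \<Longrightarrow> cnt (gb m) (long_walk i) = i"
    "cnt (k - 1) (long_walk i) = i"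
    "j \<ge> l \<Longrightarrow> j \<notin> gb ` {..<l} \<Longrightarrow> j \<noteq> k - 1 \<Longrightarrow> cnt j (long_walk i) = 0"
proof -
  show "cnt j (long_walk i) = (if i \<le> j then Suc i else i)" if "j < l"
    using assms by (induction i) (auto simp: mem_gA(1)[OF that] mem_gC(1)[OF that])
  show "cnt (gb m) (long_walk i) = i" if "m < l"
    using assms by (induction i) (auto simp: mem_gA(2)[OF that] mem_gC(2)[OF that])
  show "cnt (k - 1) (long_walk i) = i"
    using assms by (induction i) (auto simp: mem_gA(3)[simplified] mem_gC(3)[simplified])
  show "cnt j (long_walk i) = 0" if "j \<ge> l" "j \<notin> gb ` {..<l}" "j \<noteq> k - 1"
    using assms by (induction i) (use that in \<open>auto simp: mem_gA(4) mem_gC(4)\<close>)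
qed

lemma cnt_short: assumes "i < l"
  shows "j < l \<Longrightarrow> cnt j (short_walk i) = Suc i"
    "m < l \<Longrightarrow> cnt (gb m) (short_walk i) = (if m < i then i - 1 else i)"
    "cnt (k - 1) (short_walk i) = i"
    "j \<ge> l \<Longrightarrow> j \<notin> gb ` {..<l} \<Longrightarrow> j \<noteq> k - 1 \<Longrightarrow> cnt j (short_walk i) = 0"
proof -
  show "cnt j (short_walk i) = Suc i" if "j < l"
    using assms by (induction i) (use that in \<open>auto simp: mem_gA(1) mem_gB(1)\<close>)
  show "cnt (gb m) (short_walk i) = (if m < i then i - 1 else i)" if "m < l"
    using assms by (induction i) (use that in \<open>auto simp: mem_gA(2) mem_gB(2)\<close>)
  show "cnt (k - 1) (short_walk i) = i"
    using assms by (induction i) (auto simp: mem_gA(3)[simplified] mem_gB(3)[simplified])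
  show "cnt j (short_walk i) = 0" if "j \<ge> l" "j \<notin> gb ` {..<l}" "j \<noteq> k - 1"
    using assms by (induction i) (use that in \<open>auto simp: mem_gA(4) mem_gB(4)\<close>)
qed

text \<open>A class met \<open>c\<close> times by a walk along \<open>m\<close> edges has
  \<open>m - c\<close> interior vertices. From \<open>ws\<close> to \<open>ws'\<close>,
  \<open>m\<close> grows by one, and \<open>c\<close> grows by one just for the last
  \<open>l\<close> classes: one more vertex is needed in each of the first \<open>k - l\<close>
  classes and none in the others. As \<open>k - 1\<close> is reserved for the sets in between,
  \<open>gb\<close> sends \<open>l - 1\<close> to the class \<open>l\<close> instead.\<close>

lemma cnt_walks:
  assumes "j < k"
  shows "cnt j ws' = cnt j ws + of_bool (k - l \<le> j)" "cnt j ws \<le> 2 * l - 1"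
proof -
  have l1: "l - 1 < l" "Suc (l - 1) = l" using l_pos by auto
  have lk: "l < k - l" using two_l by simp
  have "cnt j ws' = cnt j ws + of_bool (k - l \<le> j) \<and> cnt j ws \<le> l"
  proof -
    consider "j < l" | m where "m < l" "j = gb m" | "j = k - 1" | "j \<ge> l" "j \<notin> gb ` {..<l}" "j \<noteq> k - 1"
      by (cases "j < l") auto
    then show ?thesis
    proof cases
      case 1
      then show ?thesis using lk l1 by (simp add: ws_def ws'_def cnt_long(1) cnt_short(1) mem_gA(1))
    next
      case 2
      have "k - l \<le> gb m \<longleftrightarrow> m < l - 1" using 2(1) lk by (auto simp: gb_def)
      then show ?thesis using 2 lk l1 by (auto simp: ws_def ws'_def cnt_long(2) cnt_short(2) mem_gA(2))
    next
      case 3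
      moreover have "k - l \<le> k - 1" using l_pos by simp
      ultimately show ?thesis using lk l1 by (simp add: ws_def ws'_def cnt_long(3)[simplified] cnt_short(3)[simplified] mem_gA(3)[simplified])
    next
      case 4
      have "j < k - l"
      proof (rule ccontr)
        assume "\<not> j < k - l"
        then have "j - (k - l) < l - 1" "gb (j - (k - l)) = j" using 4(3) assms l_pos by (auto simp: gb_def)
        then show False using 4(2) by (metis image_eqI lessThan_iff less_trans l1(1))
      qed
      then show ?thesis using 4 lk l1 by (simp add: ws_def ws'_def cnt_long(4) cnt_short(4) mem_gA(4))
    qed
  qed
  then show "cnt j ws' = cnt j ws + of_bool (k - l \<le> j)" "cnt j ws \<le> 2 * l - 1" using l_pos by auto
qed


text \<open>Let \<open>v\<close> be the list of \<open>k - l\<close> vertices to be absorbed. For each \<open>r < k - l\<close> the template has a block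
  of \<open>k\<close> positions starting at \<open>r * k\<close>: its first vertex \<open>u\<close> can be exchanged for \<open>v ! r\<close> in the edge
  spanned by the block. The \<open>k - l\<close> vertices \<open>u\<close> form another edge together with the last \<open>l\<close> positions.
  The pair \<open>(i, c)\<close> stands for the copy \<open>c\<close> of position \<open>i\<close> in a blow-up, and \<open>(aq + r, 0)\<close> for \<open>v ! r\<close>.
  Piece \<open>r < k - l\<close> of the absorber is a single edge on block \<open>r\<close>, piece \<open>k - l\<close> is the walk \<open>ws\<close>. To
  absorb \<open>v\<close>, the edges take in the vertices \<open>v ! r\<close>, and the copies of \<open>u\<close> thereby released extend
  \<open>ws\<close> to \<open>ws'\<close>.\<close>

definition aq :: nat where "aq = k * (k - l) + l"

definition pos :: "nat \<Rightarrow> nat" where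
  "pos j = (if j < k - l then j * k else k * (k - l) + (j - (k - l)))"

text \<open>The number of interior vertices of class \<open>j\<close> on the path along
  \<open>ws\<close>, which has \<open>2 * l - 1\<close> edges. Copy 0 of \<open>pos j\<close> is for
  the ends, copies 1 to \<open>aZ j\<close> are for the interior, and copy \<open>aZ j + 1\<close>
  is the one released by block \<open>j\<close> if \<open>j < k - l\<close>.\<close>

definition aZ :: "nat \<Rightarrow> nat" where "aZ j = 2 * l - 1 - cnt j ws"

definition lA :: "nat \<Rightarrow> (nat \<times> nat) set" where
  "lA r = (if r < k - l then (\<lambda>i. (i, 0)) ` {r * k + 1..<r * k + 1 + l} else (\<lambda>j. (pos j, 0)) ` gA 0)"

definition lB :: "nat \<Rightarrow> (nat \<times> nat) set" where
  "lB r = (if r < k - l then (\<lambda>i. (i, 0)) ` {r * k + 1 + l..<r * k + 1 + 2 * l} else (\<lambda>j. (pos j, 0)) ` gA l)"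

definition lT :: "nat \<Rightarrow> (nat \<times> nat) set" where
  "lT r = (\<lambda>i. (i, 0)) ` {r * k + 1 + 2 * l..<r * k + k}"

definition lM :: "(nat \<times> nat) set" where
  "lM = (\<Union>j<k. Pair (pos j) ` {1..aZ j})"

definition lW :: "nat \<Rightarrow> (nat \<times> nat) set" where
  "lW r = (if r < k - l then insert (r * k, aZ r + 1) (lT r) else lM)"

definition lW' :: "nat \<Rightarrow> (nat \<times> nat) set" where
  "lW' r = (if r < k - l then insert (aq + r, 0) (lT r) else lM \<union> (\<lambda>j. (j * k, aZ j + 1)) ` {..<k - l})"

definition gl :: "(nat \<Rightarrow> nat \<Rightarrow> 'a) \<Rightarrow> 'a list \<Rightarrow> nat \<times> nat \<Rightarrow> 'a" where
  "gl g vs x = (if fst x < aq then g (fst x) (snd x) else vs ! (fst x - aq))"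

definition absF :: "'a set set \<Rightarrow> 'a set \<Rightarrow> 'a list \<Rightarrow> 'a list set" where
  "absF E V vs = {zs \<in> tup V aq. (\<forall>r<k - l. insert (vs ! r) ((!) zs ` {r * k + 1..<r * k + k}) \<in> E \<and>
      (!) zs ` {r * k..<r * k + k} \<in> E) \<and> (\<lambda>j. zs ! pos j) ` {..<k} \<in> E}"

section \<open>The labels of an absorber and their distribution to the pieces\<close>

lemma block_le: "r < k - l \<Longrightarrow> r * k + k \<le> k * (k - l)"
proof -
  assume "r < k - l"
  then have "Suc r * k \<le> (k - l) * k" by (intro mult_le_mono1) auto
  then show ?thesis by (simp add: mult.commute)
qed

lemma pos_less: "j < k \<Longrightarrow> pos j < aq"
  using block_le[of j] two_l by (auto simp: pos_def aq_def)

lemma pos_inj: "inj_on pos {..<k}"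
proof (rule inj_onI)
  fix i j assume ij: "i \<in> {..<k}" "j \<in> {..<k}" "pos i = pos j"
  have k0: "k > 0" using two_l by simp
  have lt: "x * k < k * (k - l)" if "x < k - l" for x using block_le[OF that] k0 by linarith
  show "i = j"
  proof (cases "i < k - l"; cases "j < k - l")
    assume "i < k - l" "j < k - l" then show ?thesis using ij k0 by (simp add: pos_def)
  next
    assume a: "i < k - l" "\<not> j < k - l"
    then have "pos i = i * k" "pos j \<ge> k * (k - l)" by (simp_all add: pos_def)
    then show ?thesis using ij lt[OF a(1)] by linarith
  next
    assume a: "\<not> i < k - l" "j < k - l"
    then have "pos j = j * k" "pos i \<ge> k * (k - l)" by (simp_all add: pos_def)
    then show ?thesis using ij lt[OF a(2)] by linarith
  next
    assume "\<not> i < k - l" "\<not> j < k - l" then show ?thesis using ij by (simp add: pos_def)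
  qed
qed

lemma aZ_less: "aZ j + 1 < 2 * l + 2" by (simp add: aZ_def)

text \<open>The piece to which a label belongs before (\<open>own\<close>) and after (\<open>own'\<close>) absorption.\<close>

definition own :: "nat \<times> nat \<Rightarrow> nat" where
  "own x = (if fst x < k * (k - l) \<and> \<not> (fst x mod k = 0 \<and> snd x \<noteq> aZ (fst x div k) + 1) then fst x div k else k - l)"

definition own' :: "nat \<times> nat \<Rightarrow> nat" where
  "own' x = (if fst x \<ge> aq then fst x - aq else if fst x < k * (k - l) \<and> fst x mod k \<noteq> 0 then fst x div k else k - l)"

lemma block_pos:
  assumes "r < k - l" "i \<in> {r * k + 1..<r * k + k}"
  shows "i < k * (k - l)" "i mod k \<noteq> 0" "i div k = r" "i < aq"
proof -
  show lt: "i < k * (k - l)" using assms block_le[of r] by auto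
  then show "i < aq" by (simp add: aq_def)
  obtain m where m: "i = m + r * k" "0 < m" "m < k" using assms(2) that[of "i - r * k"] by fastforce
  then show "i mod k \<noteq> 0" "i div k = r" by auto
qed

lemma block_pos0: "r < k - l \<Longrightarrow> r * k < k * (k - l) \<and> r * k mod k = 0 \<and> r * k div k = r \<and> r * k < aq"
proof -
  assume r: "r < k - l"
  have "k > 0" using two_l by simp
  moreover from this have lt: "r * k < k * (k - l)" using block_le[OF r] by linarith
  moreover have "r * k < aq" unfolding aq_def using lt by linarith
  ultimately show ?thesis by simp
qed

lemma pos_cases:
  assumes "j < k"
  shows "pos j = j * k \<and> j < k - l \<or> pos j \<ge> k * (k - l) \<and> pos j < aq"
  using pos_less[OF assms] by (auto simp: pos_def)

lemma gA_sub: "gA 0 \<subseteq> {..<k}" "gA l \<subseteq> {..<k}" using gA_props(1)[of 0] gA_props(1)[of l] by auto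

lemma block_labels: "r < k - l \<Longrightarrow> lA r \<union> lT r \<union> lB r = (\<lambda>i. (i, 0)) ` {r * k + 1..<r * k + k}"
proof -
  assume r: "r < k - l"
  have "{r * k + 1..<r * k + k} = {r * k + 1..<r * k + 1 + l} \<union> {r * k + 1 + 2 * l..<r * k + k} \<union> {r * k + 1 + l..<r * k + 1 + 2 * l}"
    using two_l by auto
  then show ?thesis using r by (simp add: lA_def lT_def lB_def image_Un)
qed

lemma main_own: 
  assumes "j < k" "c \<noteq> aZ j + 1" shows "own (pos j, c) = k - l"
  using pos_cases[OF assms(1)] block_pos0[of j] assms(2) by (auto simp: own_def)

lemma main_own': assumes "j < k" shows "own' (pos j, c) = k - l"
  using pos_cases[OF assms(1)] block_pos0[of j] by (auto simp: own'_def)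

lemma own_labels:
  assumes "r \<le> k - l" "x \<in> lA r \<union> lW r \<union> lB r"
  shows "own x = r" "fst x < aq" "snd x < 2 * l + 2"
proof -
  have "own x = r \<and> fst x < aq \<and> snd x < 2 * l + 2"
  proof (cases "r < k - l")
    case True
    then have "x \<in> (\<lambda>i. (i, 0)) ` {r * k + 1..<r * k + k} \<or> x = (r * k, aZ r + 1)"
      using assms(2) block_labels[OF True] by (auto simp: lW_def)
    then show ?thesis
    proof
      assume "x \<in> (\<lambda>i. (i, 0)) ` {r * k + 1..<r * k + k}"
      then obtain i where "i \<in> {r * k + 1..<r * k + k}" "x = (i, 0)" by auto
      then show ?thesis using block_pos[OF True, of i] by (simp add: own_def)
    next
      assume "x = (r * k, aZ r + 1)"
      then show ?thesis using block_pos0[OF True] aZ_less[of r] by (simp add: own_def)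
    qed
  next
    case False
    then have r: "r = k - l" using assms(1) by simp
    have "\<exists>j c. j < k \<and> c \<le> aZ j \<and> x = (pos j, c)"
      using assms(2) gA_sub r by (auto simp: lA_def lB_def lW_def lM_def subset_iff)
    then obtain j c where j: "j < k" "c \<le> aZ j" "x = (pos j, c)" by blast
    then show ?thesis using main_own[of j c] pos_less[of j] aZ_less[of j] r by simp
  qed
  then show "own x = r" "fst x < aq" "snd x < 2 * l + 2" by auto
qed

lemma own'_labels:
  assumes "r \<le> k - l" "x \<in> lA r \<union> lW' r \<union> lB r"
  shows "own' x = r" "fst x < aq \<and> snd x < 2 * l + 2 \<or> (\<exists>i<k - l. x = (aq + i, 0))"
proof -
  have "own' x = r \<and> (fst x < aq \<and> snd x < 2 * l + 2 \<or> (\<exists>i<k - l. x = (aq + i, 0)))"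
  proof (cases "r < k - l")
    case True
    then have "x \<in> (\<lambda>i. (i, 0)) ` {r * k + 1..<r * k + k} \<or> x = (aq + r, 0)"
      using assms(2) block_labels[OF True] by (auto simp: lW'_def)
    then show ?thesis
    proof
      assume "x \<in> (\<lambda>i. (i, 0)) ` {r * k + 1..<r * k + k}"
      then obtain i where "i \<in> {r * k + 1..<r * k + k}" "x = (i, 0)" by auto
      then show ?thesis using block_pos[OF True, of i] by (simp add: own'_def)
    next
      assume "x = (aq + r, 0)"
      then show ?thesis using True by (simp add: own'_def)
    qed
  next
    case False
    then have r: "r = k - l" using assms(1) by simp
    have "\<exists>j c. j < k \<and> c \<le> aZ j + 1 \<and> x = (pos j, c)"
    proof -
      have "(j * k, aZ j + 1) = (pos j, aZ j + 1) \<and> j < k" if "j < k - l" for j using that by (simp add: pos_def)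
      then show ?thesis using assms(2) gA_sub r
        by (auto simp: lA_def lB_def lW'_def lM_def subset_iff)
    qed
    then obtain j c where j: "j < k" "c \<le> aZ j + 1" "x = (pos j, c)" by blast
    then show ?thesis using main_own'[of j c] pos_less[of j] aZ_less[of j] r by simp
  qed
  then show "own' x = r" "fst x < aq \<and> snd x < 2 * l + 2 \<or> (\<exists>i<k - l. x = (aq + i, 0))" by auto
qed

text \<open>Absorption adds just the labels of the absorbed vertices, because the released copies
  \<open>(j * k, aZ j + 1)\<close> only move from block \<open>j\<close> to the main walk.\<close>

lemma labels_Un:
  "(\<Union>r\<le>k - l. lA r \<union> lW' r \<union> lB r) = (\<Union>r\<le>k - l. lA r \<union> lW r \<union> lB r) \<union> (\<lambda>r. (aq + r, 0)) ` {..<k - l}"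
proof -
  have eq: "{..k - l} = insert (k - l) {..<k - l}" by auto
  have "(\<Union>r<k - l. lA r \<union> lW' r \<union> lB r) = (\<Union>r<k - l. lA r \<union> lT r \<union> lB r) \<union> (\<lambda>r. (aq + r, 0)) ` {..<k - l}"
    by (auto simp: lW'_def)
  moreover have "(\<Union>r<k - l. lA r \<union> lW r \<union> lB r) = (\<Union>r<k - l. lA r \<union> lT r \<union> lB r) \<union> (\<lambda>j. (j * k, aZ j + 1)) ` {..<k - l}"
    by (auto simp: lW_def)
  moreover have "lW' (k - l) = lW (k - l) \<union> (\<lambda>j. (j * k, aZ j + 1)) ` {..<k - l}" by (simp add: lW_def lW'_def)
  ultimately show ?thesis unfolding eq by (simp only: UN_insert) blast
qed

lemma edge_labels:
  assumes "inj_on f (X \<union> Z \<union> Y)" "f ` (X \<union> Z \<union> Y) \<in> E" "finite X" "finite Z" "finite Y"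
    "card X = l" "card Z = k - 2 * l" "card Y = l" "X \<inter> Z = {}" "X \<inter> Y = {}" "Z \<inter> Y = {}"
  shows "pth E (f ` X) 1 (f ` Z) (f ` Y)"
proof (rule edge)
  show "f ` X \<union> f ` Z \<union> f ` Y \<in> E" using assms(2) by (simp add: image_Un)
  have i: "inj_on f X" "inj_on f Z" "inj_on f Y" using assms(1) by (auto simp: inj_on_def)
  then show "card (f ` X) = l" "card (f ` Z) = k - 2 * l" "card (f ` Y) = l" using assms by (simp_all add: card_image)
  have "f ` S \<inter> f ` T = {}" if "S \<subseteq> X \<union> Z \<union> Y" "T \<subseteq> X \<union> Z \<union> Y" "S \<inter> T = {}" for S T
    using inj_on_image_Int[OF assms(1) that(1,2)] that(3) by simp
  then show "f ` X \<inter> f ` Z = {}" "f ` X \<inter> f ` Y = {}" "f ` Z \<inter> f ` Y = {}"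
    using assms(9-11) by (simp_all add: Un_assoc le_supI2)
qed (use assms in auto)

lemma absorber:
  fixes g :: "nat \<Rightarrow> nat \<Rightarrow> 'a"
  assumes inj: "\<And>i j i' j'. \<lbrakk>i < aq; j < 2 * l + 2; i' < aq; j' < 2 * l + 2; g i j = g i' j'\<rbrakk> \<Longrightarrow> i = i' \<and> j = j'"
    and tr: "\<And>\<sigma>. (\<And>i. i < aq \<Longrightarrow> \<sigma> i < 2 * l + 2) \<Longrightarrow> map (\<lambda>i. g i (\<sigma> i)) [0..<aq] \<in> absF E V vs"
    and vs: "distinct vs" "length vs = k - l" "\<And>i j. \<lbrakk>i < aq; j < 2 * l + 2\<rbrakk> \<Longrightarrow> g i j \<notin> set vs"
    and r: "r \<le> k - l"
  shows "\<exists>m. pth E (gl g vs ` lA r) m (gl g vs ` lW r) (gl g vs ` lB r)"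
    and "\<exists>m. pth E (gl g vs ` lA r) m (gl g vs ` lW' r) (gl g vs ` lB r)"
    and "inj_on (gl g vs) ({..<aq} \<times> {..<2 * l + 2} \<union> (\<lambda>r. (aq + r, 0)) ` {..<k - l})"
proof -
  let ?D = "{..<aq} \<times> {..<2 * l + 2} \<union> (\<lambda>r. (aq + r, 0)) ` {..<k - l}"
  show injD: "inj_on (gl g vs) ?D"
  proof (rule inj_onI)
    fix x y assume xy: "x \<in> ?D" "y \<in> ?D" "gl g vs x = gl g vs y"
    have new: "gl g vs z \<in> set vs" if "z \<in> (\<lambda>r. (aq + r, 0)) ` {..<k - l}" for z
      using that vs(2) by (auto simp: gl_def)
    have old: "gl g vs z \<notin> set vs" if "z \<in> {..<aq} \<times> {..<2 * l + 2}" for z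
      using that vs(3) by (auto simp: gl_def)
    consider "x \<in> {..<aq} \<times> {..<2 * l + 2}" "y \<in> {..<aq} \<times> {..<2 * l + 2}"
      | "x \<in> (\<lambda>r. (aq + r, 0)) ` {..<k - l}" "y \<in> (\<lambda>r. (aq + r, 0)) ` {..<k - l}"
      using xy(1,2)
    proof (elim UnE)
      assume "x \<in> {..<aq} \<times> {..<2 * l + 2}" "y \<in> (\<lambda>r. (aq + r, 0)) ` {..<k - l}"
      then show thesis using old[of x] new[of y] xy(3) by simp
    next
      assume "x \<in> (\<lambda>r. (aq + r, 0)) ` {..<k - l}" "y \<in> {..<aq} \<times> {..<2 * l + 2}"
      then show thesis using old[of y] new[of x] xy(3) by simp
    qed (use that in blast)+
    then show "x = y"
    proof cases
      case 1
      then have "g (fst x) (snd x) = g (fst y) (snd y)" using xy(3) by (auto simp: gl_def)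
      then have "fst x = fst y \<and> snd x = snd y" using 1 by (intro inj) auto
      then show ?thesis by (simp add: prod_eq_iff)
    next
      case 2
      then obtain i j where ij: "x = (aq + i, 0)" "y = (aq + j, 0)" "i < k - l" "j < k - l" by auto
      then have "vs ! i = vs ! j" using xy(3) by (simp add: gl_def)
      then have "i = j" using vs(1,2) ij by (simp add: nth_eq_iff_index_eq)
      then show ?thesis using ij by simp
    qed
  qed
  have subD: "lA r \<union> lW r \<union> lB r \<subseteq> ?D"
  proof
    fix x assume x: "x \<in> lA r \<union> lW r \<union> lB r"
    have "x \<in> {..<aq} \<times> {..<2 * l + 2}" using own_labels(2,3)[OF r x] by (simp add: mem_Times_iff)
    then show "x \<in> ?D" by (rule UnI1)
  qed
  have subD': "lA r \<union> lW' r \<union> lB r \<subseteq> ?D"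
  proof
    fix x assume x: "x \<in> lA r \<union> lW' r \<union> lB r"
    show "x \<in> ?D" using own'_labels(2)[OF r x]
    proof
      assume "fst x < aq \<and> snd x < 2 * l + 2"
      then have "x \<in> {..<aq} \<times> {..<2 * l + 2}" by (simp add: mem_Times_iff)
      then show ?thesis by (rule UnI1)
    next
      assume "\<exists>i<k - l. x = (aq + i, 0)"
      then have "x \<in> (\<lambda>r. (aq + r, 0)) ` {..<k - l}" by blast
      then show ?thesis by (rule UnI2)
    qed
  qed
  have nthI: "(!) (map (\<lambda>i. g i (\<sigma> i)) [0..<aq]) ` I = (\<lambda>i. g i (\<sigma> i)) ` I" if "I \<subseteq> {..<aq}" for I \<sigma>
    using that by (intro image_cong) auto
  have trE: "(\<lambda>i. g i (\<sigma> i)) ` {r * k..<r * k + k} \<in> E"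
     "insert (vs ! r) ((\<lambda>i. g i (\<sigma> i)) ` {r * k + 1..<r * k + k}) \<in> E"
    if s: "\<And>i. i < aq \<Longrightarrow> \<sigma> i < 2 * l + 2" and rr: "r < k - l" for \<sigma>
  proof -
    have "{r * k..<r * k + k} \<subseteq> {..<aq}" using block_le[OF rr] by (auto simp: aq_def)
    moreover have "{r * k + 1..<r * k + k} \<subseteq> {..<aq}" using block_le[OF rr] by (auto simp: aq_def)
    ultimately show "(\<lambda>i. g i (\<sigma> i)) ` {r * k..<r * k + k} \<in> E"
     "insert (vs ! r) ((\<lambda>i. g i (\<sigma> i)) ` {r * k + 1..<r * k + k}) \<in> E"
      using tr[of \<sigma>, OF s] rr nthI[of _ \<sigma>] unfolding absF_def by auto
  qed
  have trM: "(\<lambda>j. g (pos j) (\<sigma> j)) ` {..<k} \<in> E" if s: "\<And>j. j < k \<Longrightarrow> \<sigma> j < 2 * l + 2" for \<sigma>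
  proof -
    \<comment> \<open>Extends a choice of copies on the positions of the main edge to the whole
      template, with copy 0 as the default.\<close>
    define \<tau> where "\<tau> i = (if i \<in> pos ` {..<k} then \<sigma> (inv_into {..<k} pos i) else 0)" for i
    have "\<tau> i < 2 * l + 2" for i using s inv_into_into[of i pos "{..<k}"] by (auto simp: \<tau>_def)
    then have "map (\<lambda>i. g i (\<tau> i)) [0..<aq] \<in> absF E V vs" by (rule tr)
    then have "(\<lambda>j. map (\<lambda>i. g i (\<tau> i)) [0..<aq] ! pos j) ` {..<k} \<in> E" unfolding absF_def by blast
    also have "(\<lambda>j. map (\<lambda>i. g i (\<tau> i)) [0..<aq] ! pos j) ` {..<k} = (\<lambda>j. g (pos j) (\<sigma> j)) ` {..<k}"
      using pos_less by (intro image_cong refl) (simp add: \<tau>_def inv_into_f_f[OF pos_inj])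
    finally show ?thesis .
  qed
  have glp: "gl g vs (pos j, c) = g (pos j) c" if "j < k" for j c using pos_less[OF that] by (simp add: gl_def)
  have endA: "gl g vs ` (\<lambda>j. (pos j, 0)) ` gA i = (\<lambda>j. g (pos j) 0) ` gA i" if "i = 0 \<or> i = l" for i
    using gA_sub that glp by (auto simp: image_image subset_iff intro!: image_cong)
  have l1: "2 * l - 1 \<ge> 1" "2 * l \<ge> 1" using l_pos by auto
  have injp: "i = i' \<and> j = j'" if "i < k" "j < 2 * l + 2" "i' < k" "j' < 2 * l + 2" "g (pos i) j = g (pos i') j'" for i j i' j'
  proof -
    have "pos i = pos i' \<and> j = j'" using that pos_less by (intro inj) auto
    then show ?thesis using inj_onD[OF pos_inj, of i i'] that by simp
  qed
  have main1: "pth E ((\<lambda>j. g (pos j) 0) ` gA 0) (2 * l - 1) (\<Union>j<k. g (pos j) ` {1..aZ j}) ((\<lambda>j. g (pos j) 0) ` gA l)"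
  proof (rule blow_walk_pth[where B = "2 * l + 2" and Qs = ws and g = "\<lambda>j. g (pos j)", OF injp trM walk_props(1) l1(1) walk_props(4,5,2,3)])
    show "gA 0 \<inter> gA l = {} \<or> (0::nat) \<noteq> 0" using gA0_gAl_disjoint by simp
    fix j assume j: "j < k"
    show "{1..aZ j} \<subseteq> {..<2 * l + 2}" using aZ_less[of j] by auto
    show "card {1..aZ j} + cnt j ws = 2 * l - 1" using cnt_walks(2)[OF j] by (simp add: aZ_def)
  qed auto
  have main2: "pth E ((\<lambda>j. g (pos j) 0) ` gA 0) (2 * l) (\<Union>j<k. g (pos j) ` {1..aZ j + of_bool (j < k - l)}) ((\<lambda>j. g (pos j) 0) ` gA l)"
  proof (rule blow_walk_pth[where B = "2 * l + 2" and Qs = ws' and g = "\<lambda>j. g (pos j)", OF injp trM walk_props(6) l1(2) walk_props(9,10,7,8)])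
    show "gA 0 \<inter> gA l = {} \<or> (0::nat) \<noteq> 0" using gA0_gAl_disjoint by simp
    fix j assume j: "j < k"
    show "{1..aZ j + of_bool (j < k - l)} \<subseteq> {..<2 * l + 2}" using aZ_less[of j] by auto
    show "card {1..aZ j + of_bool (j < k - l)} + cnt j ws' = 2 * l"
      using cnt_walks[OF j] l_pos by (auto simp: aZ_def)
  qed auto
  show "\<exists>m. pth E (gl g vs ` lA r) m (gl g vs ` lW r) (gl g vs ` lB r)"
  proof (cases "r < k - l")
    case True
    \<comment> \<open>Copy \<open>aZ r + 1\<close> of the first vertex of the block is distinct from
      the copies 0 to \<open>aZ r\<close>, which the main walk may use.\<close>
    define \<sigma> where "\<sigma> i = (if i = r * k then aZ r + 1 else 0)" for i
    have "lA r \<union> lW r \<union> lB r = insert (r * k, aZ r + 1) (lA r \<union> lT r \<union> lB r)" using True by (auto simp: lW_def)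
    also have "\<dots> = (\<lambda>i. (i, \<sigma> i)) ` {r * k..<r * k + k}"
    proof -
      have "{r * k..<r * k + k} = insert (r * k) {r * k + 1..<r * k + k}" using two_l by auto
      then show ?thesis unfolding block_labels[OF True] by (auto simp: \<sigma>_def image_iff)
    qed
    finally have lab: "lA r \<union> lW r \<union> lB r = (\<lambda>i. (i, \<sigma> i)) ` {r * k..<r * k + k}" .
    have "{r * k..<r * k + k} \<subseteq> {..<aq}" using block_le[OF True] by (auto simp: aq_def)
    then have "gl g vs ` (lA r \<union> lW r \<union> lB r) = (\<lambda>i. g i (\<sigma> i)) ` {r * k..<r * k + k}"
      unfolding lab image_image by (intro image_cong refl) (auto simp: gl_def)
    moreover have "\<sigma> i < 2 * l + 2" for i using aZ_less[of r] by (simp add: \<sigma>_def)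
    ultimately have E1: "gl g vs ` (lA r \<union> lW r \<union> lB r) \<in> E" using trE(1)[OF _ True, of \<sigma>] by simp
    have rT: "(r * k, aZ r + 1) \<notin> lT r" by (auto simp: lT_def)
    have "pth E (gl g vs ` lA r) 1 (gl g vs ` lW r) (gl g vs ` lB r)"
    proof (rule edge_labels[OF inj_on_subset[OF injD subD] E1])
      have "card (lT r) = k - 1 - 2 * l" unfolding lT_def by (subst card_image) (auto simp: inj_on_def)
      moreover have "finite (lT r)" by (simp add: lT_def)
      ultimately show "card (lW r) = k - 2 * l" using True rT two_l by (simp add: lW_def)
      show "card (lA r) = l" "card (lB r) = l"
        using True by (simp_all add: lA_def lB_def card_image inj_on_def)
      show "finite (lA r)" "finite (lW r)" "finite (lB r)" using True by (simp_all add: lA_def lW_def lB_def lT_def)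
      show "lA r \<inter> lW r = {}" "lA r \<inter> lB r = {}" "lW r \<inter> lB r = {}"
        using True by (auto simp: lA_def lW_def lB_def lT_def)
    qed
    then show ?thesis by blast
  next
    case False
    then have rr: "r = k - l" using r by simp
    have "gl g vs ` lM = (\<Union>j<k. g (pos j) ` {1..aZ j})"
      unfolding lM_def image_UN image_image using glp by (intro SUP_cong image_cong) auto
    then show ?thesis using main1 endA[of 0] endA[of l] rr by (auto simp: lA_def lB_def lW_def)
  qed
  show "\<exists>m. pth E (gl g vs ` lA r) m (gl g vs ` lW' r) (gl g vs ` lB r)"
  proof (cases "r < k - l")
    case True
    have lab: "lA r \<union> lW' r \<union> lB r = insert (aq + r, 0) ((\<lambda>i. (i, 0)) ` {r * k + 1..<r * k + k})"
      using True block_labels[OF True] by (auto simp: lW'_def)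
    have "{r * k + 1..<r * k + k} \<subseteq> {..<aq}" using block_le[OF True] by (auto simp: aq_def)
    then have "gl g vs ` (\<lambda>i. (i, 0)) ` {r * k + 1..<r * k + k} = (\<lambda>i. g i 0) ` {r * k + 1..<r * k + k}"
      unfolding image_image by (intro image_cong refl) (auto simp: gl_def)
    moreover have "gl g vs (aq + r, 0) = vs ! r" by (simp add: gl_def)
    ultimately have "gl g vs ` (lA r \<union> lW' r \<union> lB r) = insert (vs ! r) ((\<lambda>i. g i 0) ` {r * k + 1..<r * k + k})"
      unfolding lab by simp
    then have E1: "gl g vs ` (lA r \<union> lW' r \<union> lB r) \<in> E" using trE(2)[OF _ True, of "\<lambda>_. 0"] by simp
    have ra: "i < aq" if "i \<in> {r * k + 1..<r * k + k}" for i using block_pos(4)[OF True that] .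
    have rT: "(aq + r, 0) \<notin> lT r" using ra[of "aq + r"] by (auto simp: lT_def)
    have "pth E (gl g vs ` lA r) 1 (gl g vs ` lW' r) (gl g vs ` lB r)"
    proof (rule edge_labels[OF inj_on_subset[OF injD subD'] E1])
      have "card (lT r) = k - 1 - 2 * l" unfolding lT_def by (subst card_image) (auto simp: inj_on_def)
      moreover have "finite (lT r)" by (simp add: lT_def)
      ultimately show "card (lW' r) = k - 2 * l" using True rT two_l by (simp add: lW'_def)
      show "card (lA r) = l" "card (lB r) = l"
        using True by (simp_all add: lA_def lB_def card_image inj_on_def)
      show "finite (lA r)" "finite (lW' r)" "finite (lB r)" using True by (simp_all add: lA_def lW'_def lB_def lT_def)
      have "aq + r \<notin> {r * k + 1..<r * k + 1 + l}" "aq + r \<notin> {r * k + 1 + l..<r * k + 1 + 2 * l}"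
        using ra[of "aq + r"] two_l by auto
      then show "lA r \<inter> lW' r = {}" "lA r \<inter> lB r = {}" "lW' r \<inter> lB r = {}"
        using True by (auto simp: lA_def lW'_def lB_def lT_def)
    qed
    then show ?thesis by blast
  next
    case False
    then have rr: "r = k - l" using r by simp
    have st: "(\<lambda>j. (j * k, aZ j + 1)) ` {..<k - l} = (\<Union>j<k. if j < k - l then {(pos j, aZ j + 1)} else {})"
      by (auto simp: pos_def split: if_splits)
    have lW'_eq: "lW' r = (\<Union>j<k. Pair (pos j) ` {1..aZ j + of_bool (j < k - l)})"
    proof -
      have "Pair (pos j) ` {1..aZ j + of_bool (j < k - l)} = Pair (pos j) ` {1..aZ j} \<union> (if j < k - l then {(pos j, aZ j + 1)} else {})" for j
        by (simp add: atLeastAtMostSuc_conv)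
      then show ?thesis using rr st by (simp add: lW'_def lM_def UN_Un_distrib)
    qed
    have "gl g vs ` lW' r = (\<Union>j<k. g (pos j) ` {1..aZ j + of_bool (j < k - l)})"
      unfolding lW'_eq image_UN image_image using glp by (intro SUP_cong image_cong) auto
    then show ?thesis using main2 endA[of 0] endA[of l] rr by (auto simp: lA_def lB_def)
  qed
qed

end

section \<open>Choosing many disjoint absorbers and linking them\<close>

lemma nth_image_drop:
  assumes "length xs = p + q"
  shows "(!) (drop p xs) ` {a..<q} = (!) xs ` {p + a..<p + q}"
proof -
  have "(!) (drop p xs) ` {a..<q} = (\<lambda>i. xs ! (p + i)) ` {a..<q}" using assms by (intro image_cong) auto
  also have "\<dots> = (!) xs ` ((+) p ` {a..<q})" by (simp only: image_image)
  also have "(+) p ` {a..<q} = {p + a..<p + q}" by (simp add: add.commute)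
  finally show ?thesis .
qed

text \<open>Conditional expectations: choose the next \<open>X\<close> so that the sum of \<open>2\<close> to the power minus the number of
  selected partners, taken over all \<open>v\<close>, shrinks by a constant factor.\<close>

lemma greedy_selection:
  fixes Rel :: "'v \<Rightarrow> 'x \<Rightarrow> bool" and vert :: "'x \<Rightarrow> 'a set" and c T :: real
  assumes fS: "finite \<S>" "\<S> \<noteq> {}" and fX: "finite \<X>" and cX: "real (card \<X>) \<le> T" and T: "T > 0"
    and vert: "\<And>X. X \<in> \<X> \<Longrightarrow> vert X \<subseteq> V \<and> finite (vert X) \<and> card (vert X) \<le> Q" and c: "c > 0"
    and dense: "\<And>v R. \<lbrakk>v \<in> \<S>; R \<subseteq> V; finite R; card R \<le> Q * M\<rbrakk> \<Longrightarrow> c * T \<le> card {X \<in> \<X>. Rel v X \<and> vert X \<inter> R = {}}"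
  shows "m \<le> M \<Longrightarrow> \<exists>X :: nat \<Rightarrow> 'x. (\<forall>i<m. X i \<in> \<X> \<and> (\<exists>v\<in>\<S>. Rel v (X i))) \<and>
     (\<forall>i<m. \<forall>j<m. i \<noteq> j \<longrightarrow> vert (X i) \<inter> vert (X j) = {}) \<and>
     (\<Sum>v\<in>\<S>. (1 / 2 :: real) ^ card {i. i < m \<and> Rel v (X i)}) \<le> card \<S> * (1 - c / 2) ^ m"
proof (induction m)
  case (Suc m)
  then obtain X :: "nat \<Rightarrow> 'x" where X0: "\<forall>i<m. X i \<in> \<X> \<and> (\<exists>v\<in>\<S>. Rel v (X i))"
     "\<forall>i<m. \<forall>j<m. i \<noteq> j \<longrightarrow> vert (X i) \<inter> vert (X j) = {}"
     "(\<Sum>v\<in>\<S>. (1 / 2 :: real) ^ card {i. i < m \<and> Rel v (X i)}) \<le> card \<S> * (1 - c / 2) ^ m" by (meson Suc_leD)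
  have X: "\<And>i. i < m \<Longrightarrow> X i \<in> \<X> \<and> (\<exists>v\<in>\<S>. Rel v (X i))"
     "\<And>i j. \<lbrakk>i < m; j < m; i \<noteq> j\<rbrakk> \<Longrightarrow> vert (X i) \<inter> vert (X j) = {}"
     "(\<Sum>v\<in>\<S>. (1 / 2 :: real) ^ card {i. i < m \<and> Rel v (X i)}) \<le> card \<S> * (1 - c / 2) ^ m"
    using X0 by blast+
  define R where "R = (\<Union>i<m. vert (X i))"
  have R: "R \<subseteq> V" "finite R" using X(1) vert unfolding R_def by blast+
  have "card R \<le> (\<Sum>i<m. card (vert (X i)))" unfolding R_def by (rule card_UN_le) simp
  also have "\<dots> \<le> (\<Sum>i<m. Q)" using X(1) vert by (intro sum_mono) auto
  also have "\<dots> \<le> Q * M" using Suc.prems by simp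
  finally have cR: "card R \<le> Q * M" .
  define w where "w v = (1 / 2 :: real) ^ card {i. i < m \<and> Rel v (X i)}" for v
  define G where "G = {Y \<in> \<X>. vert Y \<inter> R = {}}"
  define W where "W = (\<Sum>v\<in>\<S>. w v)"
  have w0: "w v > 0" for v by (simp add: w_def)
  have Wp: "W > 0" unfolding W_def using fS w0 by (intro sum_pos) auto
  have fG: "finite G" using fX by (simp add: G_def)
  have "card G \<le> card \<X>" using fX by (intro card_mono) (auto simp: G_def)
  then have cG: "real (card G) \<le> T" using cX by linarith
  \<comment> \<open>Averaging over the candidates: every \<open>v\<close> has at least
    \<open>c * T\<close> partners among the at most \<open>T\<close> members of
    \<open>G\<close>.\<close>
  have "\<exists>Y\<in>G. (\<Sum>v\<in>\<S>. w v * of_bool (Rel v Y)) \<ge> c * W"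
  proof (rule ccontr)
    assume "\<not> ?thesis"
    then have lt: "(\<Sum>v\<in>\<S>. w v * of_bool (Rel v Y)) < c * W" if "Y \<in> G" for Y using that by force
    have "c * T * W \<le> (\<Sum>v\<in>\<S>. w v * card {Y \<in> G. Rel v Y})"
    proof -
      have "c * T * W = (\<Sum>v\<in>\<S>. w v * (c * T))" by (simp add: W_def sum_distrib_left mult_ac)
      also have "\<dots> \<le> (\<Sum>v\<in>\<S>. w v * card {Y \<in> G. Rel v Y})"
      proof (intro sum_mono mult_left_mono)
        fix v assume v: "v \<in> \<S>"
        have "{Y \<in> G. Rel v Y} = {Y \<in> \<X>. Rel v Y \<and> vert Y \<inter> R = {}}" by (auto simp: G_def)
        then show "c * T \<le> card {Y \<in> G. Rel v Y}" using dense[OF v R cR] by simp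
        show "0 \<le> w v" using w0[of v] by simp
      qed
      finally show ?thesis .
    qed
    also have "\<dots> = (\<Sum>v\<in>\<S>. \<Sum>Y\<in>G. w v * of_bool (Rel v Y))"
      using card_filter_eq_sum[OF fG] by (simp add: sum_distrib_left)
    also have "\<dots> = (\<Sum>Y\<in>G. \<Sum>v\<in>\<S>. w v * of_bool (Rel v Y))" by (rule sum.swap)
    finally have 1: "c * T * W \<le> (\<Sum>Y\<in>G. \<Sum>v\<in>\<S>. w v * of_bool (Rel v Y))" .
    have "c * T * W > 0" using c T Wp by simp
    then have "G \<noteq> {}" using 1 by auto
    then have "(\<Sum>Y\<in>G. \<Sum>v\<in>\<S>. w v * of_bool (Rel v Y)) < (\<Sum>Y\<in>G. c * W)"
      using fG lt by (intro sum_strict_mono) auto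
    also have "\<dots> = card G * (c * W)" by simp
    also have "\<dots> \<le> T * (c * W)" using cG c Wp by (intro mult_right_mono) auto
    finally show False using 1 by (simp add: mult_ac)
  qed
  then obtain Y where Y: "Y \<in> G" "(\<Sum>v\<in>\<S>. w v * of_bool (Rel v Y)) \<ge> c * W" by blast
  have "c * W > 0" using c Wp by simp
  have "\<exists>v\<in>\<S>. Rel v Y"
  proof (rule ccontr)
    assume "\<not> ?thesis"
    then have "(\<Sum>v\<in>\<S>. w v * of_bool (Rel v Y)) = 0" by (intro sum.neutral) auto
    then show False using Y(2) \<open>c * W > 0\<close> by simp
  qed
  define X' where "X' i = (if i = m then Y else X i)" for i
  have "(\<Sum>v\<in>\<S>. (1 / 2 :: real) ^ card {i. i < Suc m \<and> Rel v (X' i)}) = (\<Sum>v\<in>\<S>. w v - 1 / 2 * (w v * of_bool (Rel v Y)))"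
  proof (intro sum.cong refl)
    fix v
    have "{i. i < Suc m \<and> Rel v (X' i)} = {i. i < m \<and> Rel v (X i)} \<union> (if Rel v Y then {m} else {})"
      by (auto simp: X'_def less_Suc_eq)
    then have "card {i. i < Suc m \<and> Rel v (X' i)} = card {i. i < m \<and> Rel v (X i)} + of_bool (Rel v Y)" by simp
    then show "(1 / 2 :: real) ^ card {i. i < Suc m \<and> Rel v (X' i)} = w v - 1 / 2 * (w v * of_bool (Rel v Y))"
      by (simp add: w_def power_add)
  qed
  also have "\<dots> = W - 1 / 2 * (\<Sum>v\<in>\<S>. w v * of_bool (Rel v Y))"
    by (simp only: sum_subtractf sum_distrib_left W_def)
  also have "\<dots> \<le> W - 1 / 2 * (c * W)" using Y(2) by simp
  also have "\<dots> = W * (1 - c / 2)" by (simp add: algebra_simps)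
  also have "\<dots> \<le> card \<S> * (1 - c / 2) ^ m * (1 - c / 2)"
  proof (rule mult_right_mono)
    show "W \<le> card \<S> * (1 - c / 2) ^ m" using X(3) by (simp add: W_def w_def)
    \<comment> \<open>The selected weight cannot exceed the total, which forces
      \<open>c \<le> 1\<close>.\<close>
    have "(\<Sum>v\<in>\<S>. w v * of_bool (Rel v Y)) \<le> W" unfolding W_def using w0 by (intro sum_mono) (auto simp: less_imp_le)
    then have "c * W \<le> 1 * W" using Y(2) by simp
    then show "0 \<le> 1 - c / 2" using Wp by (simp only: mult_le_cancel_right_pos)
  qed
  finally have sum: "(\<Sum>v\<in>\<S>. (1 / 2 :: real) ^ card {i. i < Suc m \<and> Rel v (X' i)}) \<le> card \<S> * (1 - c / 2) ^ Suc m"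
    by (simp add: mult_ac)
  have YR: "vert Y \<inter> vert (X i) = {}" if "i < m" for i using Y(1) that by (auto simp: G_def R_def)
  show ?case
  proof (intro exI[of _ X'] conjI allI impI)
    fix i assume "i < Suc m"
    then show "X' i \<in> \<X>" "\<exists>v\<in>\<S>. Rel v (X' i)"
      using X(1) Y(1) \<open>\<exists>v\<in>\<S>. Rel v Y\<close> by (auto simp: X'_def G_def less_Suc_eq)
    fix j assume "j < Suc m" "i \<noteq> j"
    then show "vert (X' i) \<inter> vert (X' j) = {}"
      using X(2) YR \<open>i < Suc m\<close> by (auto simp: X'_def less_Suc_eq)
  qed (rule sum)
qed (simp add: exI)

text \<open>Greedy choice: fewer than \<open>p\<close> earlier choices cannot exhaust
  \<open>p\<close> candidates.\<close>

lemma inj_choice: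
  assumes "\<And>i. i < p \<Longrightarrow> p \<le> card {j. j < M \<and> P i j}"
  shows "\<exists>f. inj_on f {..<p} \<and> (\<forall>i<p. f i < M \<and> P i (f i))"
proof -
  have "r \<le> p \<Longrightarrow> \<exists>f. inj_on f {..<r} \<and> (\<forall>i<r. f i < M \<and> P i (f i))" for r
  proof (induction r)
    case (Suc r)
    then obtain f where f: "inj_on f {..<r}" "\<forall>i<r. f i < M \<and> P i (f i)" by auto
    have "card (f ` {..<r}) \<le> r" using card_image_le[of "{..<r}" f] by simp
    also have "r < card {j. j < M \<and> P r j}" using assms[of r] Suc.prems by simp
    finally have "\<not> {j. j < M \<and> P r j} \<subseteq> f ` {..<r}"
      using card_mono[of "f ` {..<r}" "{j. j < M \<and> P r j}"] by auto
    then obtain j where j: "j < M" "P r j" "j \<notin> f ` {..<r}" by auto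
    have "inj_on (f(r := j)) {..<Suc r}" using f(1) j(3) by (auto simp: inj_on_def lessThan_Suc)
    moreover have "\<forall>i<Suc r. (f(r := j)) i < M \<and> P i ((f(r := j)) i)" using f(2) j by (auto simp: less_Suc_eq)
    ultimately show ?case by blast
  qed auto
  then show ?thesis by blast
qed

context loose
begin

text \<open>The blocks are dense because each vertex of \<open>vs\<close> has many exchange
  partners, which is the assumption with \<open>c1\<close>. The final edge contains the first
  vertices of all blocks; these are \<open>k - l \<le> d\<close> vertices, so the degree condition
  gives many completions.\<close>

lemma absF_dense:
  fixes \<alpha> c1 :: real
  assumes \<alpha>: "\<alpha> > 0" and c1: "c1 > 0"
  shows "\<exists>c>0::real. \<exists>n0::nat. \<forall>(E::'a set set) V vs. finite V \<and> cond E V V \<alpha> \<and> card V \<ge> n0 \<and>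
     (\<forall>r<k - l. c1 * card V ^ k \<le> card {ys \<in> tup V k. insert (vs ! r) ((!) ys ` {1..<k}) \<in> E \<and> (!) ys ` {0..<k} \<in> E}) \<longrightarrow>
     c * card V ^ aq \<le> card (absF E V vs)"
proof -
  define absG where "absG E V vs j = {zs \<in> tup V (j * k). distinct zs \<and> (\<forall>r<j. insert (vs ! r) ((!) zs ` {r * k + 1..<r * k + k}) \<in> E \<and>
      (!) zs ` {r * k..<r * k + k} \<in> E)}" for E V and vs :: "'a list" and j
  have stage: "j \<le> k - l \<Longrightarrow> \<exists>c>0::real. \<exists>n0::nat. \<forall>(E::'a set set) V vs. finite V \<and> card V \<ge> n0 \<and>
     (\<forall>r<k - l. c1 * card V ^ k \<le> card {ys \<in> tup V k. insert (vs ! r) ((!) ys ` {1..<k}) \<in> E \<and> (!) ys ` {0..<k} \<in> E}) \<longrightarrow>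
     c * card V ^ (j * k) \<le> card (absG E V vs j)" for j
  proof (induction j)
    case 0
    have "absG E V vs 0 = {[]}" for E V vs by (auto simp: absG_def)
    then show ?case by (intro exI[of _ "1::real"]) auto
  next
    case (Suc j)
    then obtain c :: real and n0 :: nat where c: "c > 0" and IH: "\<And>(E::'a set set) V vs. finite V \<and> card V \<ge> n0 \<and>
     (\<forall>r<k - l. c1 * card V ^ k \<le> card {ys \<in> tup V k. insert (vs ! r) ((!) ys ` {1..<k}) \<in> E \<and> (!) ys ` {0..<k} \<in> E}) \<Longrightarrow>
     c * card V ^ (j * k) \<le> card (absG E V vs j)" by (meson Suc_leD)
    define K where "K = real ((j * k + k) * (j * k + k + 0))"
    let ?c = "c * c1 / 2"
    show ?case
    proof (intro exI[of _ ?c] conjI exI[of _ "n0 + nat \<lceil>K / ?c\<rceil> + 1"] allI impI)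
      show cp: "?c > 0" using c c1 by simp
      fix E :: "'a set set" and V vs
      assume a: "finite V \<and> n0 + nat \<lceil>K / ?c\<rceil> + 1 \<le> card V \<and>
       (\<forall>r<k - l. c1 * card V ^ k \<le> card {ys \<in> tup V k. insert (vs ! r) ((!) ys ` {1..<k}) \<in> E \<and> (!) ys ` {0..<k} \<in> E})"
      have "K / ?c \<le> card V" using a by linarith
      then have big: "real ((j * k + k) * (j * k + k + card ({}::'a set))) \<le> c * c1 / 2 * card V"
        using cp by (simp add: K_def field_simps)
      have fin: "finite V" and ne: "V \<noteq> {}" using a by auto
      let ?F = "absG E V vs j"
      let ?Q = "\<lambda>ys zs. insert (vs ! j) ((!) zs ` {1..<k}) \<in> E \<and> (!) zs ` {0..<k} \<in> E"
      let ?H = "{xs \<in> tup V (j * k + k). take (j * k) xs \<in> ?F \<and> ?Q (take (j * k) xs) (drop (j * k) xs) \<and> distinct xs \<and> set xs \<inter> {} = {}}"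
      have F: "c * card V ^ (j * k) \<le> card ?F" by (rule IH) (use a in auto)
      have "?c * card V ^ (j * k + k) \<le> card ?H"
      proof (rule dense_extend[OF fin finite.emptyI ne _ F])
        show "?F \<subseteq> tup V (j * k)" by (auto simp: absG_def)
        show "real ((j * k + k) * (j * k + k + card ({}::'a set))) \<le> c * c1 / 2 * card V" by (rule big)
      qed (use a Suc.prems c c1 in auto)
      also have "?H \<subseteq> absG E V vs (Suc j)"
      proof
        fix xs assume xs: "xs \<in> ?H"
        then have len: "length xs = j * k + k" by (simp add: tup_def)
        have F': "take (j * k) xs \<in> ?F" using xs by simp
        have 1: "insert (vs ! r) ((!) xs ` {r * k + 1..<r * k + k}) \<in> E \<and> (!) xs ` {r * k..<r * k + k} \<in> E" if r: "r < j" for r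
        proof -
          have "Suc r * k \<le> j * k" using r by (intro mult_le_mono1) auto
          then have "{r * k..<r * k + k} \<subseteq> {..<j * k}" "{r * k + 1..<r * k + k} \<subseteq> {..<j * k}" by auto
          then show ?thesis using F' r nth_image_take[of _ "j * k" xs] unfolding absG_def by auto
        qed
        have 2: "insert (vs ! j) ((!) xs ` {j * k + 1..<j * k + k}) \<in> E \<and> (!) xs ` {j * k..<j * k + k} \<in> E"
          using xs nth_image_drop[OF len, of 1] nth_image_drop[OF len, of 0] by auto
        have "insert (vs ! r) ((!) xs ` {r * k + 1..<r * k + k}) \<in> E \<and> (!) xs ` {r * k..<r * k + k} \<in> E" if "r < Suc j" for r
          using 1 2 that less_Suc_eq by blast
        then show "xs \<in> absG E V vs (Suc j)" using xs by (simp add: absG_def add.commute)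
      qed
      then have "card ?H \<le> card (absG E V vs (Suc j))" using fin by (intro card_mono) (auto simp: absG_def)
      finally show "?c * card V ^ (Suc j * k) \<le> card (absG E V vs (Suc j))" by (simp add: add.commute)
    qed
  qed
  obtain c :: real and n0 :: nat where c: "c > 0" and st: "\<And>(E::'a set set) V vs. finite V \<and> card V \<ge> n0 \<and>
     (\<forall>r<k - l. c1 * card V ^ k \<le> card {ys \<in> tup V k. insert (vs ! r) ((!) ys ` {1..<k}) \<in> E \<and> (!) ys ` {0..<k} \<in> E}) \<Longrightarrow>
     c * card V ^ ((k - l) * k) \<le> card (absG E V vs (k - l))"
    using stage[OF order_refl] by meson
  let ?p = "(k - l) * k"
  define K where "K = real ((?p + l) * (?p + l + 0))"
  let ?b = "\<alpha> / 2"
  let ?c = "c * ?b / 2"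
  have aq: "aq = ?p + l" by (simp add: aq_def mult.commute)
  show ?thesis
  proof (intro exI[of _ ?c] conjI exI[of _ "2 * d * d + n0 + nat \<lceil>K / ?c\<rceil> + 1"] allI impI)
    show cp: "?c > 0" using c \<alpha> by simp
    fix E :: "'a set set" and V vs
    assume a: "finite V \<and> cond E V V \<alpha> \<and> 2 * d * d + n0 + nat \<lceil>K / ?c\<rceil> + 1 \<le> card V \<and>
     (\<forall>r<k - l. c1 * card V ^ k \<le> card {ys \<in> tup V k. insert (vs ! r) ((!) ys ` {1..<k}) \<in> E \<and> (!) ys ` {0..<k} \<in> E})"
    have "K / ?c \<le> card V" using a by linarith
    then have big: "real ((?p + l) * (?p + l + card ({}::'a set))) \<le> c * ?b / 2 * card V"
      using cp by (simp add: K_def field_simps)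
    have fin: "finite V" and ne: "V \<noteq> {}" and du: "2 * d * d \<le> card V" using a by auto
    let ?F = "absG E V vs (k - l)"
    let ?S = "\<lambda>ys. (\<lambda>r. ys ! (r * k)) ` {..<k - l}"
    let ?H = "{xs \<in> tup V (?p + l). take ?p xs \<in> ?F \<and> ?S (take ?p xs) \<union> set (drop ?p xs) \<in> E \<and> distinct xs \<and> set xs \<inter> {} = {}}"
    have F: "c * card V ^ ?p \<le> card ?F" by (rule st) (use a in auto)
    have rk: "r * k < ?p" if "r < k - l" for r using block_pos0[OF that] by (simp add: mult.commute)
    have G: "?b * card V ^ l \<le> card {zs \<in> tup V l. ?S ys \<union> set zs \<in> E}" if ys: "ys \<in> ?F" for ys
    proof -
      have ys': "length ys = ?p" "distinct ys" "set ys \<subseteq> V" using ys by (auto simp: absG_def tup_def)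
      have "inj_on (\<lambda>r. ys ! (r * k)) {..<k - l}"
      proof (rule inj_onI)
        fix x y assume "x \<in> {..<k - l}" "y \<in> {..<k - l}" "ys ! (x * k) = ys ! (y * k)"
        then have "x * k = y * k" using ys' rk by (simp add: nth_eq_iff_index_eq)
        then show "x = y" using two_l by simp
      qed
      then have "card (?S ys) = k - l" by (simp add: card_image)
      moreover have "?S ys \<subseteq> V"
      proof (intro image_subsetI)
        fix r assume "r \<in> {..<k - l}"
        then have "ys ! (r * k) \<in> set ys" using rk[of r] ys'(1) by (intro nth_mem) auto
        then show "ys ! (r * k) \<in> V" using ys'(3) by auto
      qed
      moreover have "k - (k - l) = l" using two_l by simp
      ultimately show ?thesis
        using cond_lower[of V V E \<alpha> "?S ys" "k - l"] a \<alpha> du kl_d by simp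
    qed
    have "?c * card V ^ (?p + l) \<le> card ?H"
    proof (rule dense_extend[OF fin finite.emptyI ne _ F, where Q = "\<lambda>ys zs. ?S ys \<union> set zs \<in> E"])
      show "?F \<subseteq> tup V ?p" by (auto simp: absG_def)
      show "real ((?p + l) * (?p + l + card ({}::'a set))) \<le> c * ?b / 2 * card V" by (rule big)
    qed (use a c \<alpha> G in auto)
    also have "?H \<subseteq> absF E V vs"
    proof
      fix xs assume xs: "xs \<in> ?H"
      then have len: "length xs = ?p + l" by (simp add: tup_def)
      have F': "take ?p xs \<in> ?F" using xs by simp
      have 1: "insert (vs ! r) ((!) xs ` {r * k + 1..<r * k + k}) \<in> E \<and> (!) xs ` {r * k..<r * k + k} \<in> E" if r: "r < k - l" for r
      proof -
        have "Suc r * k \<le> ?p" using r by (intro mult_le_mono1) auto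
        then have "{r * k..<r * k + k} \<subseteq> {..<?p}" "{r * k + 1..<r * k + k} \<subseteq> {..<?p}" by auto
        then show ?thesis using F' r nth_image_take[of _ ?p xs] unfolding absG_def by auto
      qed
      have "?S (take ?p xs) = (\<lambda>j. xs ! pos j) ` {..<k - l}"
        using rk by (intro image_cong) (auto simp: pos_def)
      moreover have "set (drop ?p xs) = (\<lambda>j. xs ! pos j) ` {k - l..<k}"
      proof -
        have "(\<lambda>j. xs ! pos j) ` {k - l..<k} = (!) xs ` (pos ` {k - l..<k})" by (simp add: image_image)
        also have "pos ` {k - l..<k} = (\<lambda>j. ?p + (j - (k - l))) ` {k - l..<k}"
          by (intro image_cong) (auto simp: pos_def mult.commute)
        also have "\<dots> = {?p..<?p + l}"
        proof
          show "{?p..<?p + l} \<subseteq> (\<lambda>j. ?p + (j - (k - l))) ` {k - l..<k}"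
          proof
            fix x assume "x \<in> {?p..<?p + l}"
            then show "x \<in> (\<lambda>j. ?p + (j - (k - l))) ` {k - l..<k}"
              using two_l by (intro image_eqI[of _ _ "x - ?p + (k - l)"]) auto
          qed
        qed (use two_l in auto)
        finally show ?thesis using set_drop_nth[OF len] by simp
      qed
      moreover have "{..<k} = {..<k - l} \<union> {k - l..<k}" by auto
      ultimately have "(\<lambda>j. xs ! pos j) ` {..<k} = ?S (take ?p xs) \<union> set (drop ?p xs)" by (simp only: image_Un)
      then have "(\<lambda>j. xs ! pos j) ` {..<k} \<in> E" using xs by simp
      then show "xs \<in> absF E V vs" using xs 1 by (simp add: absF_def aq)
    qed
    then have "card ?H \<le> card (absF E V vs)" using fin by (intro card_mono) (auto simp: absF_def)
    finally show "?c * card V ^ aq \<le> card (absF E V vs)" by (simp add: aq)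
  qed
qed

text \<open>The connecting vertices \<open>K\<close> are chosen from the ends \<open>A\<close> and
  \<open>B\<close> alone, before the interiors \<open>W\<close> are given. The same \<open>K\<close>
  thus links the pieces both in their original form and in their form after absorption.\<close>

lemma join:
  fixes A B :: "'i \<Rightarrow> 'a set"
  assumes conn: "\<And>R L L'. \<lbrakk>R \<subseteq> V; card R \<le> N0; L \<subseteq> V; L' \<subseteq> V; card L = l; card L' = l; L \<inter> L' = {}\<rbrakk> \<Longrightarrow>
      \<exists>W\<subseteq>V - R - (L \<union> L'). pth E L cm W L'"
    and finV: "finite V" and q: "cm * (k - l) \<le> q"
  shows "\<lbrakk>finite I; I \<noteq> {}; R0 \<subseteq> V; card R0 + q * card I \<le> N0; \<forall>i\<in>I. A i \<subseteq> R0 \<and> B i \<subseteq> R0 \<and> card (A i) = l \<and> card (B i) = l;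
      \<forall>i\<in>I. \<forall>j\<in>I. i \<noteq> j \<longrightarrow> B i \<inter> A j = {}\<rbrakk> \<Longrightarrow>
    \<exists>K i0 i1. i0 \<in> I \<and> i1 \<in> I \<and> K \<subseteq> V - R0 \<and> card K \<le> q * card I \<and>
      (\<forall>W. (\<forall>i\<in>I. \<exists>m. pth E (A i) m (W i) (B i)) \<and> (\<forall>i\<in>I. W i \<inter> K = {}) \<and>
         (\<forall>i\<in>I. \<forall>j\<in>I. i \<noteq> j \<longrightarrow> (A i \<union> W i \<union> B i) \<inter> (A j \<union> W j \<union> B j) = {}) \<longrightarrow>
         (\<exists>m. pth E (A i0) m ((\<Union>i\<in>I. A i \<union> W i \<union> B i) \<union> K - A i0 - B i1) (B i1)))"
proof (induction I rule: finite_ne_induct)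
  case (singleton x)
  have "\<exists>m. pth E (A x) m ((\<Union>i\<in>{x}. A i \<union> W i \<union> B i) \<union> {} - A x - B x) (B x)" if "\<exists>m. pth E (A x) m (W x) (B x)" for W
  proof -
    obtain m where m: "pth E (A x) m (W x) (B x)" using \<open>\<exists>m. pth E (A x) m (W x) (B x)\<close> by blast
    have "(\<Union>i\<in>{x}. A i \<union> W i \<union> B i) \<union> {} - A x - B x = W x" using pth_facts[OF m] by auto
    then show ?thesis using m by auto
  qed
  then show ?case by (intro exI[of _ "{}"] exI[of _ x]) auto
next
  case (insert x F)
  obtain K i0 i1 where K: "i0 \<in> F" "i1 \<in> F" "K \<subseteq> V - R0" "card K \<le> q * card F"
     "\<And>W. \<lbrakk>\<forall>i\<in>F. \<exists>m. pth E (A i) m (W i) (B i); \<forall>i\<in>F. W i \<inter> K = {};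
         \<forall>i\<in>F. \<forall>j\<in>F. i \<noteq> j \<longrightarrow> (A i \<union> W i \<union> B i) \<inter> (A j \<union> W j \<union> B j) = {}\<rbrakk> \<Longrightarrow>
         \<exists>m. pth E (A i0) m ((\<Union>i\<in>F. A i \<union> W i \<union> B i) \<union> K - A i0 - B i1) (B i1)"
    using insert.IH insert.prems insert.hyps(1,3) by auto
  have ne: "x \<noteq> i1" using K(2) insert.hyps(3) by auto
  have "card (R0 \<union> K) \<le> card R0 + q * card F" using card_Un_le[of R0 K] K(4) by linarith
  also have "\<dots> \<le> N0" using insert.prems(2) insert.hyps by simp
  finally have cRK: "card (R0 \<union> K) \<le> N0" .
  have AB: "A x \<subseteq> R0" "B i1 \<subseteq> R0" "card (A x) = l" "card (B i1) = l" "B i1 \<inter> A x = {}"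
    using insert.prems(3,4) K(2) ne by auto
  obtain C where C: "C \<subseteq> V - (R0 \<union> K) - (B i1 \<union> A x)" "pth E (B i1) cm C (A x)"
  proof -
    have "R0 \<union> K \<subseteq> V" "B i1 \<subseteq> V" "A x \<subseteq> V" using insert.prems(1) K(3) AB(1,2) by auto
    then have "\<exists>W\<subseteq>V - (R0 \<union> K) - (B i1 \<union> A x). pth E (B i1) cm W (A x)" using cRK AB(3-5) by (intro conn)
    then show ?thesis using that by (elim exE conjE)
  qed
  have "card C \<le> cm * (k - l)" using pth_facts(10)[OF C(2)] by linarith
  then have cC: "card C \<le> q" using q by linarith
  show ?case
  proof (rule exI[of _ "K \<union> C"], rule exI[of _ i0], rule exI[of _ x], intro conjI allI impI)
    show "i0 \<in> insert x F" "x \<in> insert x F" using K by auto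
    show "K \<union> C \<subseteq> V - R0" using K C by auto
    show "card (K \<union> C) \<le> q * card (insert x F)"
      using card_Un_le[of K C] K(4) cC insert.hyps by simp
    fix W
    assume W: "(\<forall>i\<in>insert x F. \<exists>m. pth E (A i) m (W i) (B i)) \<and> (\<forall>i\<in>insert x F. W i \<inter> (K \<union> C) = {}) \<and>
         (\<forall>i\<in>insert x F. \<forall>j\<in>insert x F. i \<noteq> j \<longrightarrow> (A i \<union> W i \<union> B i) \<inter> (A j \<union> W j \<union> B j) = {})"
    note Wc = W[THEN conjunct1] W[THEN conjunct2, THEN conjunct1] W[THEN conjunct2, THEN conjunct2]
    have W1: "\<exists>m. pth E (A i) m (W i) (B i)" "W i \<inter> (K \<union> C) = {}" if "i \<in> insert x F" for i
      by (rule bspec[OF Wc(1) that], rule bspec[OF Wc(2) that])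
    note W2 = W1(2)
    have W3: "(A i \<union> W i \<union> B i) \<inter> (A j \<union> W j \<union> B j) = {}" if "i \<in> insert x F" "j \<in> insert x F" "i \<noteq> j" for i j
      by (rule mp[OF bspec[OF bspec[OF Wc(3) that(1)] that(2)] that(3)])
    let ?U = "\<Union>i\<in>F. A i \<union> W i \<union> B i"
    have "\<forall>i\<in>F. \<exists>m. pth E (A i) m (W i) (B i)" using W1(1) by simp
    moreover have "\<forall>i\<in>F. W i \<inter> K = {}"
    proof
      fix i assume "i \<in> F"
      then have "W i \<inter> (K \<union> C) = {}" using W2 by simp
      then show "W i \<inter> K = {}" by blast
    qed
    moreover have "\<forall>i\<in>F. \<forall>j\<in>F. i \<noteq> j \<longrightarrow> (A i \<union> W i \<union> B i) \<inter> (A j \<union> W j \<union> B j) = {}"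
      using W3 by (meson insertI2)
    ultimately obtain m where m: "pth E (A i0) m (?U \<union> K - A i0 - B i1) (B i1)"
      using K(5)[of W] by meson
    obtain m' where m': "pth E (A x) m' (W x) (B x)" using W1(1)[of x] by auto
    note f1 = pth_facts[OF m] and f2 = pth_facts[OF m'] and f3 = pth_facts[OF C(2)]
    have UC: "?U \<inter> C = {}"
    proof -
      have "(A i \<union> W i \<union> B i) \<inter> C = {}" if "i \<in> F" for i
      proof -
        have "W i \<inter> (K \<union> C) = {}" "A i \<subseteq> R0" "B i \<subseteq> R0" using W2[of i] insert.prems(3) that by simp_all
        then show ?thesis using C(1) by blast
      qed
      then show ?thesis by blast
    qed
    have Ux: "?U \<inter> (A x \<union> W x \<union> B x) = {}"
    proof -
      have "(A i \<union> W i \<union> B i) \<inter> (A x \<union> W x \<union> B x) = {}" if "i \<in> F" for i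
        by (rule W3) (use that insert.hyps(3) in auto)
      then show ?thesis by blast
    qed
    have sub: "A i0 \<subseteq> ?U" "B i1 \<subseteq> ?U" using K(1,2) by auto
    have AxR: "A x \<inter> K = {}" "B x \<inter> K = {}" "W x \<inter> K = {}" "W x \<inter> C = {}" "B x \<inter> C = {}" "A x \<inter> C = {}"
    proof -
      have "W x \<inter> (K \<union> C) = {}" "A x \<subseteq> R0" "B x \<subseteq> R0" using W2[of x] insert.prems(3) by simp_all
      then show "A x \<inter> K = {}" "B x \<inter> K = {}" "W x \<inter> K = {}" "W x \<inter> C = {}" "B x \<inter> C = {}" "A x \<inter> C = {}"
        using K(3) C(1) by blast+
    qed
    have KC: "K \<inter> C = {}" using C(1) by blast
    define Y where "Y = ?U"
    have Y: "A i0 \<subseteq> Y" "B i1 \<subseteq> Y" "Y \<inter> C = {}" "Y \<inter> (A x \<union> W x \<union> B x) = {}"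
      using sub UC Ux by (simp_all only: Y_def)
    have p1: "pth E (A i0) (m + cm) ((Y \<union> K - A i0 - B i1) \<union> B i1 \<union> C) (A x)"
    proof (rule comp[OF m[folded Y_def] C(2)])
      show "(A i0 \<union> (Y \<union> K - A i0 - B i1)) \<inter> (C \<union> A x) = {}" using Y AxR KC by blast
    qed
    have p2: "pth E (A i0) (m + cm + m') (((Y \<union> K - A i0 - B i1) \<union> B i1 \<union> C) \<union> A x \<union> W x) (B x)"
    proof (rule comp[OF p1 m'])
      show "(A i0 \<union> ((Y \<union> K - A i0 - B i1) \<union> B i1 \<union> C)) \<inter> (W x \<union> B x) = {}"
        using Y AxR by blast
    qed
    have BA: "B i1 \<inter> A i0 = {}" using f1(7) by blast
    have "((Y \<union> K - A i0 - B i1) \<union> B i1 \<union> C) \<union> A x \<union> W x = Y \<union> (A x \<union> W x \<union> B x) \<union> (K \<union> C) - A i0 - B x"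
      using Y AxR(2,5) BA f2(7,8) by blast
    moreover have "(\<Union>i\<in>insert x F. A i \<union> W i \<union> B i) = Y \<union> (A x \<union> W x \<union> B x)"
      by (simp add: Y_def Un_commute)
    ultimately show "\<exists>m. pth E (A i0) m ((\<Union>i\<in>insert x F. A i \<union> W i \<union> B i) \<union> (K \<union> C) - A i0 - B x) (B x)"
      using p2 by (simp only:) (rule exI)
  qed
qed


text \<open>The connector is applied inside \<open>V - R\<close>; \<open>\<kappa>\<close> is so
  small that at least half of the vertices and half of the degree survive the removal of
  \<open>R\<close>.\<close>

lemma connect_avoid:
  fixes \<alpha> :: real
  assumes \<alpha>: "\<alpha> > 0"
  shows "\<exists>\<kappa>>0::real. \<exists>n0::nat. \<forall>(E::'a set set) V R L L'. finite V \<and> cond E V V \<alpha> \<and> n0 \<le> card V \<and> R \<subseteq> V \<and>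
     real (card R) \<le> \<kappa> * card V \<and> L \<subseteq> V \<and> L' \<subseteq> V \<and> card L = l \<and> card L' = l \<and> L \<inter> L' = {} \<longrightarrow>
     (\<exists>W\<subseteq>V - R - (L \<union> L'). pth E L (2 * l + 2) W L')"
proof -
  have a2: "\<alpha> / 2 > 0" using \<alpha> by simp
  obtain nC where nC: "\<forall>(E::'a set set) V U L L'. finite V \<and> U \<subseteq> V \<and> cond E V U (\<alpha> / 2) \<and> card U \<ge> nC \<and>
     L \<subseteq> V \<and> L' \<subseteq> V \<and> card L = l \<and> card L' = l \<and> L \<inter> L' = {} \<longrightarrow>
     (\<exists>W\<subseteq>U - (L \<union> L'). pth E L (2 * l + 2) W L')"
    using connector[OF a2] by blast
  have s: "real (k - d) > 0" using d_k by simp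
  define \<kappa> where "\<kappa> = min (1 / 2) (\<alpha> / (2 * real (k - d)))"
  have \<kappa>: "\<kappa> > 0" "\<kappa> \<le> 1 / 2" "(k - d) * \<kappa> \<le> \<alpha> / 2"
  proof -
    show "\<kappa> > 0" using \<alpha> s by (simp only: \<kappa>_def min_less_iff_conj) simp
    show "\<kappa> \<le> 1 / 2" unfolding \<kappa>_def by (rule min.cobounded1)
    have "(k - d) * \<kappa> \<le> (k - d) * (\<alpha> / (2 * real (k - d)))" by (intro mult_left_mono) (auto simp: \<kappa>_def)
    also have "c * (\<alpha> / (2 * c)) = \<alpha> / 2" if "c > 0" for c :: real using that by simp
    from this[OF s] have "(k - d) * (\<alpha> / (2 * real (k - d))) = \<alpha> / 2" .
    finally show "(k - d) * \<kappa> \<le> \<alpha> / 2" .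
  qed
  show ?thesis
  proof (rule exI[of _ \<kappa>], rule conjI[OF \<kappa>(1)], rule exI[of _ "2 * nC + 1"], intro allI impI)
    fix E :: "'a set set" and V R L L' :: "'a set"
    assume a: "finite V \<and> cond E V V \<alpha> \<and> 2 * nC + 1 \<le> card V \<and> R \<subseteq> V \<and>
     real (card R) \<le> \<kappa> * card V \<and> L \<subseteq> V \<and> L' \<subseteq> V \<and> card L = l \<and> card L' = l \<and> L \<inter> L' = {}"
    have finV: "finite V" and RV: "R \<subseteq> V" and cV: "card V > 0" and cd: "cond E V V \<alpha>" using a by auto
    have finR: "finite R" using RV finV finite_subset by blast
    have "real (card R) \<le> 1 / 2 * card V"
      using a mult_right_mono[OF \<kappa>(2), of "real (card V)"] by linarith
    then have "nC \<le> card V - card R" using a by linarith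
    then have big: "nC \<le> card (V - R)" using RV finR by (simp add: card_Diff_subset)
    have "real (k - d) * card R / card V \<le> (k - d) * \<kappa>"
    proof -
      have "real (card R) / card V \<le> \<kappa>" using a cV by (simp add: pos_divide_le_eq)
      then have "real (k - d) * (real (card R) / card V) \<le> (k - d) * \<kappa>" by (intro mult_left_mono) auto
      then show ?thesis by simp
    qed
    then have "\<alpha> / 2 \<le> \<alpha> - (k - d) * card R / card V" using \<kappa>(3) unfolding of_nat_mult by linarith
    then have "cond E V (V - R) (\<alpha> / 2)" using a2 by (intro cond_Diff[OF finV RV cd cV]) auto
    then show "\<exists>W\<subseteq>V - R - (L \<union> L'). pth E L (2 * l + 2) W L'"
      using a big by (intro nC[rule_format]) auto
  qed
qed

section \<open>Vertices with few exchange partners\<close>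

definition cl :: "'a set set \<Rightarrow> 'a set \<Rightarrow> 'a \<Rightarrow> 'a list set" where
  "cl E V v = {ys \<in> tup V k. insert v ((!) ys ` {1..<k}) \<in> E \<and> (!) ys ` {0..<k} \<in> E}"

text \<open>The first entry of a tuple in \<open>cl\<close> is an exchange partner \<open>u\<close>
  of \<open>v\<close>, the other entries form a set \<open>T\<close> that both complete to an edge.
  Grouping by \<open>T\<close> prepares the second moment argument.\<close>

lemma card_cl:
  assumes "finite V"
  shows "card (cl E V v) = (\<Sum>T\<in>tup V (k - 1). of_bool (insert v (set T) \<in> E) * card {u \<in> V. insert u (set T) \<in> E})"
proof -
  have k: "k = Suc (k - 1)" using two_l by simp
  have eq: "insert v ((!) (u # T) ` {1..<k}) = insert v (set T)" "(!) (u # T) ` {0..<k} = insert u (set T)"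
    if "T \<in> tup V (k - 1)" for u T
  proof -
    have len: "length (u # T) = 1 + (k - 1)" "length (u # T) = k" using that k by (auto simp: tup_def)
    show "insert v ((!) (u # T) ` {1..<k}) = insert v (set T)"
      using set_drop_nth[OF len(1)] k by simp
    show "(!) (u # T) ` {0..<k} = insert u (set T)"
      using nth_image_lessThan[OF len(2)] by (simp add: atLeast0LessThan)
  qed
  have "card (cl E V v) = card {ys \<in> tup V (Suc (k - 1)). insert v ((!) ys ` {1..<k}) \<in> E \<and> (!) ys ` {0..<k} \<in> E}"
    unfolding cl_def using k by simp
  also have "\<dots> = (\<Sum>u\<in>V. card {T \<in> tup V (k - 1). insert v ((!) (u # T) ` {1..<k}) \<in> E \<and> (!) (u # T) ` {0..<k} \<in> E})"
    by (rule card_tup_Suc[OF assms])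
  also have "\<dots> = (\<Sum>u\<in>V. card {T \<in> tup V (k - 1). insert v (set T) \<in> E \<and> insert u (set T) \<in> E})"
  proof (intro sum.cong refl arg_cong[where f = card])
    fix u
    show "{T \<in> tup V (k - 1). insert v ((!) (u # T) ` {1..<k}) \<in> E \<and> (!) (u # T) ` {0..<k} \<in> E}
        = {T \<in> tup V (k - 1). insert v (set T) \<in> E \<and> insert u (set T) \<in> E}"
      by (rule Collect_cong) (metis eq)
  qed
  also have "\<dots> = (\<Sum>T\<in>tup V (k - 1). card {u \<in> V. insert v (set T) \<in> E \<and> insert u (set T) \<in> E})"
    using assms by (intro sum_card_swap) auto
  also have "\<dots> = (\<Sum>T\<in>tup V (k - 1). of_bool (insert v (set T) \<in> E) * card {u \<in> V. insert u (set T) \<in> E})"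
    by (intro sum.cong refl) auto
  finally show ?thesis .
qed

text \<open>Counting the pairs of bad vertices with a common neighbour in two ways (Cauchy--Schwarz).\<close>

lemma bad_small:
  fixes \<alpha> c1 :: real
  assumes fin: "finite V" and cd: "cond E V V \<alpha>" and \<alpha>: "\<alpha> > 0" and n: "card V \<ge> 2 * d * d" "card V > 0"
    and D: "D \<subseteq> V" "\<And>v. v \<in> D \<Longrightarrow> card (cl E V v) \<le> c1 * card V ^ k" and c1: "c1 \<ge> 0"
  shows "card D * (\<alpha> / 2)\<^sup>2 \<le> c1 * card V"
proof (cases "card D = 0")
  case False
  define f where "f T = card {v \<in> D. insert v (set T) \<in> E}" for T
  define deg where "deg T = card {u \<in> V. insert u (set T) \<in> E}" for T
  let ?T = "tup V (k - 1)"
  have finD: "finite D" using D fin finite_subset by auto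
  have d1: "1 \<le> d" using kl_d two_l by linarith
  have link: "\<alpha> / 2 * card V ^ (k - 1) \<le> card {T \<in> ?T. insert v (set T) \<in> E}" if "v \<in> D" for v
    using cond_lower[OF fin order_refl cd less_imp_le[OF \<alpha>] n(1), of "{v}" 1] D(1) that d1 by auto
  have "card D * (\<alpha> / 2 * card V ^ (k - 1)) = (\<Sum>v\<in>D. \<alpha> / 2 * card V ^ (k - 1))" by simp
  also have "\<dots> \<le> (\<Sum>v\<in>D. real (card {T \<in> ?T. insert v (set T) \<in> E}))" using link by (intro sum_mono)
  also have "\<dots> = real (\<Sum>v\<in>D. card {T \<in> ?T. insert v (set T) \<in> E})" by simp
  also have "(\<Sum>v\<in>D. card {T \<in> ?T. insert v (set T) \<in> E}) = (\<Sum>T\<in>?T. f T)"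
    unfolding f_def using finD fin by (intro sum_card_swap) auto
  finally have "(card D * (\<alpha> / 2)) * card ?T \<le> (\<Sum>T\<in>?T. real (f T))" by (simp add: card_tup fin mult_ac)
  then have 1: "real (card ?T) * (card D * (\<alpha> / 2))\<^sup>2 \<le> (\<Sum>T\<in>?T. real (f T) ^ 2)"
    using \<alpha> by (intro sum_power_ge) auto
  \<comment> \<open>One vertex of the bad pair is replaced by an arbitrary one, since
    \<open>cl\<close> counts all exchange partners.\<close>
  also have "\<dots> \<le> (\<Sum>T\<in>?T. real (f T * deg T))"
  proof (intro sum_mono)
    fix T
    have "f T \<le> deg T" unfolding f_def deg_def using D fin by (intro card_mono) auto
    then have "f T * f T \<le> f T * deg T" by simp
    then show "real (f T) ^ 2 \<le> real (f T * deg T)" by (simp add: power2_eq_square flip: of_nat_mult)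
  qed
  also have "\<dots> = real (\<Sum>T\<in>?T. f T * deg T)" by simp
  also have "(\<Sum>T\<in>?T. f T * deg T) = (\<Sum>T\<in>?T. \<Sum>v\<in>D. of_bool (insert v (set T) \<in> E) * deg T)"
  proof (intro sum.cong refl)
    fix T
    have "f T = (\<Sum>v\<in>D. of_bool (insert v (set T) \<in> E))"
      using finD by (simp add: f_def of_bool_def sum.If_cases Int_def)
    then show "f T * deg T = (\<Sum>v\<in>D. of_bool (insert v (set T) \<in> E) * deg T)" by (simp add: sum_distrib_right)
  qed
  also have "\<dots> = (\<Sum>v\<in>D. \<Sum>T\<in>?T. of_bool (insert v (set T) \<in> E) * deg T)" by (rule sum.swap)
  also have "\<dots> = (\<Sum>v\<in>D. card (cl E V v))" by (simp add: card_cl[OF fin] deg_def)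
  also have "real \<dots> \<le> card D * (c1 * card V ^ k)"
    using sum_mono[of D "\<lambda>v. real (card (cl E V v))" "\<lambda>_. c1 * card V ^ k"] D(2) by simp
  finally have 2: "real (card ?T) * (card D * (\<alpha> / 2))\<^sup>2 \<le> card D * (c1 * card V ^ k)" .
  have "k = Suc (k - 1)" using two_l by simp
  then have "real (card V ^ k) = card V * real (card V) ^ (k - 1)" by (metis of_nat_power power_Suc)
  then have "(real (card V) ^ (k - 1) * card D) * (card D * (\<alpha> / 2)\<^sup>2) \<le> (real (card V) ^ (k - 1) * card D) * (c1 * card V)"
    using 2 by (simp add: card_tup fin power2_eq_square mult_ac)
  moreover have "real (card V) ^ (k - 1) * card D > 0" using n(2) False by simp
  ultimately show ?thesis by (simp only: mult_le_cancel_left_pos)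
qed (use c1 in simp)

text \<open>A vertex with few exchange partners may not be absorbable, so it is put into the
  absorbing path at once, inside an edge of its own. The edges are chosen greedily, each avoiding
  \<open>R\<close> and the earlier ones.\<close>

lemma bad_pieces:
  fixes \<alpha> :: real
  assumes fin: "finite V" and cd: "cond E V V \<alpha>" and \<alpha>: "\<alpha> > 0" and n: "card V \<ge> 2 * d * d"
    and R: "R \<subseteq> V" and big: "real (k * (k + card R + k * N)) < \<alpha> / 2 * card V"
  shows "finite D \<Longrightarrow> D \<subseteq> R \<Longrightarrow> card D \<le> N \<Longrightarrow> \<exists>A W B. \<forall>v\<in>D. pth E (A v) 1 (W v) (B v) \<and> v \<in> W v \<and>
     A v \<union> W v \<union> B v \<subseteq> V \<and> (A v \<union> W v \<union> B v) \<inter> R = {v} \<and> card (A v \<union> W v \<union> B v) = k \<and>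
     (\<forall>v'\<in>D. v \<noteq> v' \<longrightarrow> (A v \<union> W v \<union> B v) \<inter> (A v' \<union> W v' \<union> B v') = {})"
proof (induction D rule: finite_induct)
  case (insert x D)
  obtain A W B where IH: "\<forall>v\<in>D. pth E (A v) 1 (W v) (B v) \<and> v \<in> W v \<and>
     A v \<union> W v \<union> B v \<subseteq> V \<and> (A v \<union> W v \<union> B v) \<inter> R = {v} \<and> card (A v \<union> W v \<union> B v) = k \<and>
     (\<forall>v'\<in>D. v \<noteq> v' \<longrightarrow> (A v \<union> W v \<union> B v) \<inter> (A v' \<union> W v' \<union> B v') = {})"
    using insert by auto
  define Y where "Y v = A v \<union> W v \<union> B v" for v
  have Y: "\<And>v. v \<in> D \<Longrightarrow> Y v \<subseteq> V \<and> Y v \<inter> R = {v} \<and> card (Y v) = k" using IH by (simp add: Y_def)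
  define R' where "R' = R \<union> (\<Union>v\<in>D. Y v)"
  have "R' \<subseteq> V" unfolding R'_def using R Y by (intro Un_least UN_least) blast+
  then have finR': "finite R'" using fin finite_subset by auto
  have "card R' \<le> card R + card (\<Union>v\<in>D. Y v)" unfolding R'_def by (rule card_Un_le)
  also have "card (\<Union>v\<in>D. Y v) \<le> (\<Sum>v\<in>D. card (Y v))" by (rule card_UN_le[OF insert.hyps(1)])
  also have "\<dots> = k * card D" using Y by simp
  also have "\<dots> \<le> k * N" using insert.prems insert.hyps by simp
  finally have cR': "card R' \<le> card R + k * N" by simp
  have xR: "x \<in> R" using insert.prems by simp
  have d1: "1 \<le> d" using kl_d two_l by linarith
  let ?F = "{xs \<in> tup V (k - 1). {x} \<union> set xs \<in> E}"
  have F: "\<alpha> / 2 * card V ^ (k - 1) \<le> card ?F"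
    using cond_lower[OF fin order_refl cd less_imp_le[OF \<alpha>] n, of "{x}" 1] R xR d1 by auto
  have "(k - 1) * (k - 1 + card R') \<le> k * (k + card R + k * N)" using cR' by (intro mult_le_mono) auto
  then have "real ((k - 1) * (k - 1 + card R')) \<le> real (k * (k + card R + k * N))" by (rule of_nat_mono)
  then have "real ((k - 1) * (k - 1 + card R')) < \<alpha> / 2 * card V" using big by linarith
  then obtain ys where ys: "ys \<in> ?F" "distinct ys" "set ys \<inter> R' = {}"
    using dense_pick[OF fin finR' _ F] by auto
  have len: "length ys = k - 1" and yE: "insert x (set ys) \<in> E" and yV: "set ys \<subseteq> V" using ys(1) by (auto simp: tup_def)
  define a where "a = set (take l ys)"
  define b where "b = set (take l (drop l ys))"
  define w where "w = insert x (set (drop (2 * l) ys))"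
  have split: "ys = take l ys @ take l (drop l ys) @ drop (2 * l) ys"
    by (metis append_take_drop_id drop_drop mult_2)
  then have sys: "set ys = a \<union> b \<union> set (drop (2 * l) ys)" unfolding a_def b_def by (metis Un_assoc set_append)
  have dist: "distinct (take l ys @ take l (drop l ys) @ drop (2 * l) ys)" using split ys(2) by simp
  have xy: "x \<notin> set ys" using ys(3) xR by (auto simp: R'_def)
  have un: "a \<union> w \<union> b = insert x (set ys)" using sys by (auto simp: w_def)
  have p: "pth E a 1 w b"
  proof (rule edge)
    show "a \<union> w \<union> b \<in> E" using yE un by simp
    show "finite a" "finite w" "finite b" by (auto simp: a_def b_def w_def)
    have l1: "length (take l ys) = l" "length (take l (drop l ys)) = l" "length (drop (2 * l) ys) = k - 1 - 2 * l"
      using len two_l by auto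
    show "card a = l" "card b = l" using dist l1 distinct_card[of "take l ys"] distinct_card[of "take l (drop l ys)"]
      by (simp_all add: a_def b_def)
    have "card (set (drop (2 * l) ys)) = k - 1 - 2 * l"
      using dist l1(3) distinct_card[of "drop (2 * l) ys"] by simp
    moreover have "x \<notin> set (drop (2 * l) ys)" using xy sys by auto
    ultimately show "card w = k - 2 * l" using two_l by (simp add: w_def)
    have "set (take l ys) \<inter> set (take l (drop l ys)) = {}" "set (take l ys) \<inter> set (drop (2 * l) ys) = {}"
      "set (take l (drop l ys)) \<inter> set (drop (2 * l) ys) = {}" using dist by (auto simp only: distinct_append set_append)
    then show "a \<inter> w = {}" "a \<inter> b = {}" "w \<inter> b = {}"
      using xy sys by (auto simp: a_def b_def w_def)
  qed
  have new: "insert x (set ys) \<subseteq> V" "insert x (set ys) \<inter> R = {x}" "card (insert x (set ys)) = k"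
  proof -
    show "insert x (set ys) \<subseteq> V" using yV R xR by auto
    show "insert x (set ys) \<inter> R = {x}" using ys(3) xR by (auto simp: R'_def)
    show "card (insert x (set ys)) = k" using xy len distinct_card[OF ys(2)] two_l by simp
  qed
  have disj: "insert x (set ys) \<inter> Y v = {}" if "v \<in> D" for v
  proof -
    have "x \<notin> Y v" using Y[OF that] xR insert.hyps(2) that by auto
    moreover have "Y v \<subseteq> R'" using that by (auto simp: R'_def)
    ultimately show ?thesis using ys(3) by auto
  qed
  define A' where "A' = A(x := a)"
  define W' where "W' = W(x := w)"
  define B' where "B' = B(x := b)"
  have Yx: "A' x \<union> W' x \<union> B' x = insert x (set ys)" using un by (simp add: A'_def W'_def B'_def)
  have Yv: "A' v = A v" "W' v = W v" "B' v = B v" "A' v \<union> W' v \<union> B' v = Y v" if "v \<in> D" for v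
    using that insert.hyps(2) by (auto simp: A'_def W'_def B'_def Y_def)
  show ?case
  proof (rule exI[of _ A'], rule exI[of _ W'], rule exI[of _ B'], rule ballI)
    fix v assume v: "v \<in> insert x D"
    show "pth E (A' v) 1 (W' v) (B' v) \<and> v \<in> W' v \<and> A' v \<union> W' v \<union> B' v \<subseteq> V \<and> (A' v \<union> W' v \<union> B' v) \<inter> R = {v} \<and>
      card (A' v \<union> W' v \<union> B' v) = k \<and>
      (\<forall>v'\<in>insert x D. v \<noteq> v' \<longrightarrow> (A' v \<union> W' v \<union> B' v) \<inter> (A' v' \<union> W' v' \<union> B' v') = {})"
    proof (cases "v = x")
      case True
      have "pth E (A' x) 1 (W' x) (B' x)" "x \<in> W' x" using p by (auto simp: A'_def W'_def B'_def w_def)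
      moreover have "(A' x \<union> W' x \<union> B' x) \<inter> (A' v' \<union> W' v' \<union> B' v') = {}" if "v' \<in> insert x D" "x \<noteq> v'" for v'
        using that disj[of v'] Yv(4)[of v'] unfolding Yx by auto
      ultimately show ?thesis using new unfolding True Yx by simp
    next
      case False
      then have vD: "v \<in> D" using v by simp
      have "(A' v \<union> W' v \<union> B' v) \<inter> (A' v' \<union> W' v' \<union> B' v') = {}" if "v' \<in> insert x D" "v \<noteq> v'" for v'
      proof (cases "v' = x")
        case True
        then show ?thesis using disj[OF vD] unfolding True Yx Yv(4)[OF vD] by (simp only: Int_commute)
      next
        case False
        then have "v' \<in> D" using that by simp
        then show ?thesis using IH vD that(2) unfolding Yv(4)[OF vD] Yv(4)[OF \<open>v' \<in> D\<close>] Y_def by blast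
      qed
      moreover have "pth E (A' v) 1 (W' v) (B' v)" "v \<in> W' v" using IH vD Yv[OF vD] by auto
      ultimately show ?thesis using Y[OF vD] unfolding Yv(4)[OF vD] by simp
    qed
  qed
qed simp

section \<open>The pieces of one absorber\<close>

definition absorbs :: "'a set set \<Rightarrow> 'a set \<Rightarrow> 'a list \<Rightarrow> 'a list list \<Rightarrow> bool" where
  "absorbs E V vs X \<longleftrightarrow> transv X \<subseteq> absF E V vs \<and> set (concat X) \<inter> set vs = {}"

definition absX :: "'a set \<Rightarrow> 'a list list set" where
  "absX V = {X \<in> tup (tup V (2 * l + 2)) aq. distinct (concat X)}"

definition apiece :: "(nat \<Rightarrow> (nat \<times> nat) set) \<Rightarrow> 'a list list \<Rightarrow> 'a list \<Rightarrow> nat \<Rightarrow> 'a set" where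
  "apiece lab X vs r = gl (\<lambda>i c. X ! i ! c) vs ` lab r"

text \<open>The pieces before absorption are formed with \<open>[]\<close> in place of
  \<open>vs\<close>, as their labels never refer to absorbed vertices. They are thus independent of
  \<open>vs\<close>, and one absorber serves every \<open>vs\<close> that it absorbs, always with
  the same ends.\<close>

lemma absorber_pieces:
  fixes X :: "'a list list"
  assumes X: "X \<in> absX V" and ab: "absorbs E V vs X" and vs: "distinct vs" "length vs = k - l"
  defines "a \<equiv> apiece lA X []" and "w \<equiv> apiece lW X []" and "b \<equiv> apiece lB X []" and "w' \<equiv> apiece lW' X vs"
  shows "\<And>r. r \<le> k - l \<Longrightarrow> \<exists>m. pth E (a r) m (w r) (b r)"
    and "\<And>r. r \<le> k - l \<Longrightarrow> \<exists>m. pth E (a r) m (w' r) (b r)"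
    and "\<And>r r'. \<lbrakk>r \<le> k - l; r' \<le> k - l; r \<noteq> r'\<rbrakk> \<Longrightarrow> (a r \<union> w r \<union> b r) \<inter> (a r' \<union> w r' \<union> b r') = {}"
    and "\<And>r r'. \<lbrakk>r \<le> k - l; r' \<le> k - l; r \<noteq> r'\<rbrakk> \<Longrightarrow> (a r \<union> w' r \<union> b r) \<inter> (a r' \<union> w' r' \<union> b r') = {}"
    and "\<And>r. r \<le> k - l \<Longrightarrow> a r \<union> w r \<union> b r \<subseteq> set (concat X)"
    and "(\<Union>r\<le>k - l. a r \<union> w' r \<union> b r) = (\<Union>r\<le>k - l. a r \<union> w r \<union> b r) \<union> set vs"
proof -
  define g where "g i c = X ! i ! c" for i c
  have X': "X \<in> tup (tup V (2 * l + 2)) aq" "distinct (concat X)" "transv X \<subseteq> absF E V vs"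
    using X ab by (auto simp: absX_def absorbs_def)
  have mem: "g i j \<in> set (concat X)" if "i < aq" "j < 2 * l + 2" for i j
    unfolding g_def by (rule blow_up_nth(1)[OF X' that])
  have inj: "i = i' \<and> j = j'" if "i < aq" "j < 2 * l + 2" "i' < aq" "j' < 2 * l + 2" "g i j = g i' j'" for i j i' j'
    using blow_up_nth(3)[OF X' that(1-4)] that(5) by (simp add: g_def)
  have tr: "map (\<lambda>i. g i (\<sigma> i)) [0..<aq] \<in> absF E V vs" if "\<And>i. i < aq \<Longrightarrow> \<sigma> i < 2 * l + 2" for \<sigma>
    using blow_up_nth(4)[OF X', of \<sigma>] that by (simp add: g_def)
  have nvs: "g i j \<notin> set vs" if "i < aq" "j < 2 * l + 2" for i j
    using mem[OF that] ab by (auto simp: absorbs_def)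
  have P: "(\<exists>m. pth E (gl g vs ` lA r) m (gl g vs ` lW r) (gl g vs ` lB r)) \<and>
     (\<exists>m. pth E (gl g vs ` lA r) m (gl g vs ` lW' r) (gl g vs ` lB r)) \<and>
     inj_on (gl g vs) ({..<aq} \<times> {..<2 * l + 2} \<union> (\<lambda>r. (aq + r, 0)) ` {..<k - l})" if r: "r \<le> k - l" for r
  proof (intro conjI)
    show "\<exists>m. pth E (gl g vs ` lA r) m (gl g vs ` lW r) (gl g vs ` lB r)"
      by (rule absorber(1)[of g, OF _ _ vs _ r]) (rule inj tr nvs; assumption)+
    show "\<exists>m. pth E (gl g vs ` lA r) m (gl g vs ` lW' r) (gl g vs ` lB r)"
      by (rule absorber(2)[of g, OF _ _ vs _ r]) (rule inj tr nvs; assumption)+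
    show "inj_on (gl g vs) ({..<aq} \<times> {..<2 * l + 2} \<union> (\<lambda>r. (aq + r, 0)) ` {..<k - l})"
      by (rule absorber(3)[of g, OF _ _ vs _ r]) (rule inj tr nvs; assumption)+
  qed
  let ?D = "{..<aq} \<times> {..<2 * l + 2} \<union> (\<lambda>r. (aq + r, 0)) ` {..<k - l}"
  have injD: "inj_on (gl g vs) ?D" using P[OF le0] by blast
  have same: "gl g [] x = gl g vs x" if "fst x < aq" for x using that by (simp add: gl_def)
  have a: "a r = gl g vs ` lA r" "w r = gl g vs ` lW r" "b r = gl g vs ` lB r" if r: "r \<le> k - l" for r
  proof -
    have im: "gl g [] ` S = gl g vs ` S" if "S \<subseteq> lA r \<union> lW r \<union> lB r" for S
      using that by (intro image_cong refl same own_labels(2)[OF r]) (erule subsetD)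
    show "a r = gl g vs ` lA r" unfolding a_def apiece_def g_def[symmetric] by (rule im) (simp only: Un_assoc Un_upper1)
    show "w r = gl g vs ` lW r" unfolding w_def apiece_def g_def[symmetric] by (rule im) (simp only: Un_upper1 Un_upper2 le_supI1)
    show "b r = gl g vs ` lB r" unfolding b_def apiece_def g_def[symmetric] by (rule im) (rule Un_upper2)
  qed
  have w': "w' r = gl g vs ` lW' r" for r by (simp add: w'_def apiece_def g_def[symmetric])
  show "\<exists>m. pth E (a r) m (w r) (b r)" if "r \<le> k - l" for r
    unfolding a[OF that] by (rule P[OF that, THEN conjunct1])
  show "\<exists>m. pth E (a r) m (w' r) (b r)" if "r \<le> k - l" for r
    unfolding a[OF that] w' by (rule P[OF that, THEN conjunct2, THEN conjunct1])
  have L: "lA r \<union> lW r \<union> lB r \<subseteq> ?D" if "r \<le> k - l" for r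
  proof
    fix x assume "x \<in> lA r \<union> lW r \<union> lB r"
    then show "x \<in> ?D" using own_labels(2,3)[OF that] by (intro UnI1) (simp add: mem_Times_iff)
  qed
  have L': "lA r \<union> lW' r \<union> lB r \<subseteq> ?D" if "r \<le> k - l" for r
  proof
    fix x assume "x \<in> lA r \<union> lW' r \<union> lB r"
    from own'_labels(2)[OF that this] show "x \<in> ?D"
    proof
      assume "fst x < aq \<and> snd x < 2 * l + 2"
      then show ?thesis by (intro UnI1) (simp add: mem_Times_iff)
    next
      assume "\<exists>i<k - l. x = (aq + i, 0)"
      then have "x \<in> (\<lambda>r. (aq + r, 0)) ` {..<k - l}" by blast
      then show ?thesis by (rule UnI2)
    qed
  qed
  have t: "a r \<union> w r \<union> b r = gl g vs ` (lA r \<union> lW r \<union> lB r)" if "r \<le> k - l" for r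
    by (simp only: a[OF that] image_Un)
  have t': "a r \<union> w' r \<union> b r = gl g vs ` (lA r \<union> lW' r \<union> lB r)" if "r \<le> k - l" for r
    by (simp only: a[OF that] w' image_Un)
  show "(a r \<union> w r \<union> b r) \<inter> (a r' \<union> w r' \<union> b r') = {}" if "r \<le> k - l" "r' \<le> k - l" "r \<noteq> r'" for r r'
  proof -
    have "(lA r \<union> lW r \<union> lB r) \<inter> (lA r' \<union> lW r' \<union> lB r') = {}"
      using own_labels(1)[OF that(1)] own_labels(1)[OF that(2)] that(3) by blast
    then show ?thesis unfolding t[OF that(1)] t[OF that(2)]
      using inj_on_image_Int[OF injD L[OF that(1)] L[OF that(2)]] by simp
  qed
  show "(a r \<union> w' r \<union> b r) \<inter> (a r' \<union> w' r' \<union> b r') = {}" if "r \<le> k - l" "r' \<le> k - l" "r \<noteq> r'" for r r'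
  proof -
    have "(lA r \<union> lW' r \<union> lB r) \<inter> (lA r' \<union> lW' r' \<union> lB r') = {}"
      using own'_labels(1)[OF that(1)] own'_labels(1)[OF that(2)] that(3) by blast
    then show ?thesis unfolding t'[OF that(1)] t'[OF that(2)]
      using inj_on_image_Int[OF injD L'[OF that(1)] L'[OF that(2)]] by simp
  qed
  show "a r \<union> w r \<union> b r \<subseteq> set (concat X)" if "r \<le> k - l" for r
    unfolding t[OF that]
  proof (rule image_subsetI)
    fix x assume "x \<in> lA r \<union> lW r \<union> lB r"
    then show "gl g vs x \<in> set (concat X)"
      using own_labels(2,3)[OF that] mem by (simp add: gl_def)
  qed
  have "(\<Union>r\<le>k - l. a r \<union> w' r \<union> b r) = gl g vs ` (\<Union>r\<le>k - l. lA r \<union> lW' r \<union> lB r)"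
    unfolding image_UN by (intro SUP_cong refl t') simp
  also have "\<dots> = gl g vs ` (\<Union>r\<le>k - l. lA r \<union> lW r \<union> lB r) \<union> gl g vs ` (\<lambda>r. (aq + r, 0)) ` {..<k - l}"
    by (simp only: labels_Un image_Un)
  also have "gl g vs ` (\<Union>r\<le>k - l. lA r \<union> lW r \<union> lB r) = (\<Union>r\<le>k - l. a r \<union> w r \<union> b r)"
    unfolding image_UN by (intro SUP_cong refl t[symmetric]) simp
  also have "gl g vs ` (\<lambda>r. (aq + r, 0)) ` {..<k - l} = set vs"
  proof -
    have "gl g vs ` (\<lambda>r. (aq + r, 0)) ` {..<k - l} = (!) vs ` {..<k - l}"
      unfolding image_image by (intro image_cong refl) (simp add: gl_def)
    then show ?thesis using nth_image_lessThan[OF vs(2)] by simp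
  qed
  finally show "(\<Union>r\<le>k - l. a r \<union> w' r \<union> b r) = (\<Union>r\<le>k - l. a r \<union> w r \<union> b r) \<union> set vs" .
qed

end

section \<open>The absorbing path\<close>

lemma split_blocks:
  assumes "finite R" "card R = p * c"
  shows "\<exists>vs. (\<forall>i<p. distinct (vs i) \<and> length (vs i) = c) \<and> (\<Union>i<p. set (vs i)) = R \<and>
     (\<forall>i<p. \<forall>j<p. i \<noteq> j \<longrightarrow> set (vs i) \<inter> set (vs j) = {})"
  using assms
proof (induction p arbitrary: R)
  case (Suc p)
  have "c \<le> card R" using Suc.prems by simp
  then obtain S where S: "S \<subseteq> R" "card S = c" "finite S" using obtain_subset_with_card_n by metis
  obtain ys where ys: "set ys = S" "distinct ys" using finite_distinct_list S(3) by blast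
  have "card (R - S) = p * c" using S Suc.prems by (simp add: card_Diff_subset)
  with Suc.IH[of "R - S"] obtain vs where vs: "\<forall>i<p. distinct (vs i) \<and> length (vs i) = c" "(\<Union>i<p. set (vs i)) = R - S"
     "\<forall>i<p. \<forall>j<p. i \<noteq> j \<longrightarrow> set (vs i) \<inter> set (vs j) = {}" using Suc.prems by auto
  have new: "set (vs i) \<inter> S = {}" if "i < p" for i using vs(2) that by blast
  show ?case
  proof (intro exI[of _ "vs(p := ys)"] conjI allI impI)
    fix i assume i: "i < Suc p"
    show "distinct ((vs(p := ys)) i)" using vs(1) ys i by (auto simp: less_Suc_eq)
    show "length ((vs(p := ys)) i) = c" using vs(1) distinct_card[OF ys(2)] ys(1) S(2) i by (auto simp: less_Suc_eq)
    fix j assume "j < Suc p" "i \<noteq> j"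
    then show "set ((vs(p := ys)) i) \<inter> set ((vs(p := ys)) j) = {}"
      using vs(3) new[of i] new[of j] ys(1) i unfolding less_Suc_eq
      by (elim disjE) (simp_all add: Int_commute)
  next
    have "(\<Union>i<Suc p. set ((vs(p := ys)) i)) = (\<Union>i<p. set (vs i)) \<union> S"
      using ys(1) by (simp add: lessThan_Suc Un_commute)
    then show "(\<Union>i<Suc p. set ((vs(p := ys)) i)) = R" using vs(2) S(1) by auto
  qed
qed auto

context loose
begin

definition apieces :: "'a list list \<Rightarrow> 'a set" where
  "apieces X = (\<Union>r\<le>k - l. apiece lA X [] r \<union> apiece lW X [] r \<union> apiece lB X [] r)"

text \<open>All pieces of all absorbers and the edges through bad vertices are joined once. A
  function \<open>\<sigma>\<close> then tells which block of vertices each absorber takes in,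
  \<open>[]\<close> meaning none; the ends of the pieces are the same for every
  \<open>\<sigma>\<close>, so the connections fit all of them.\<close>

lemma absorbing_assemble:
  fixes X :: "nat \<Rightarrow> 'a list list"
  assumes finV: "finite V"
    and conn: "\<And>R L L'. \<lbrakk>R \<subseteq> V; card R \<le> N0; L \<subseteq> V; L' \<subseteq> V; card L = l; card L' = l; L \<inter> L' = {}\<rbrakk> \<Longrightarrow>
      \<exists>W\<subseteq>V - R - (L \<union> L'). pth E L cm W L'"
    and q: "cm * (k - l) \<le> q" and M: "M > 0"
    and X: "\<And>j. j < M \<Longrightarrow> X j \<in> absX V \<and> (\<exists>vs. distinct vs \<and> length vs = k - l \<and> absorbs E V vs (X j))"
    and disX: "\<And>i j. \<lbrakk>i < M; j < M; i \<noteq> j\<rbrakk> \<Longrightarrow> set (concat (X i)) \<inter> set (concat (X j)) = {}"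
    and absV: "absV = (\<Union>j<M. set (concat (X j)))"
    and D: "D = Bad - (\<Union>j<M. apieces (X j))" "Bad \<subseteq> V"
    and pieces: "\<forall>v\<in>D. pth E (Ab v) 1 (Wb v) (Bb v) \<and> v \<in> Wb v \<and> Ab v \<union> Wb v \<union> Bb v \<subseteq> V \<and>
      (Ab v \<union> Wb v \<union> Bb v) \<inter> (absV \<union> D) = {v} \<and> card (Ab v \<union> Wb v \<union> Bb v) = k \<and>
      (\<forall>v'\<in>D. v \<noteq> v' \<longrightarrow> (Ab v \<union> Wb v \<union> Bb v) \<inter> (Ab v' \<union> Wb v' \<union> Bb v') = {})"
    and good: "\<And>vs. \<lbrakk>distinct vs; length vs = k - l; set vs \<subseteq> V - Bad\<rbrakk> \<Longrightarrow> P \<le> card {j. j < M \<and> absorbs E V vs (X j)}"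
    and size: "((2 * l + 2) * aq) * M + k * card D + q * (M * (k - l + 1) + card D) \<le> N0"
  shows "\<exists>L m W L'. pth E L m W L' \<and> L \<union> W \<union> L' \<subseteq> V \<and> card (L \<union> W \<union> L') \<le> N0 \<and>
     (\<forall>R p. R \<subseteq> V - (L \<union> W \<union> L') \<and> card R = p * (k - l) \<and> p \<le> P \<longrightarrow> (\<exists>m'. pth E L m' (W \<union> R) L'))"
proof -
  define I where "I = ({..<M} \<times> {..k - l}) <+> D"
  define A where "A = case_sum (\<lambda>(j, r). apiece lA (X j) [] r) Ab"
  define B where "B = case_sum (\<lambda>(j, r). apiece lB (X j) [] r) Bb"
  define W where "W \<sigma> = case_sum (\<lambda>(j, r). if \<sigma> j = [] then apiece lW (X j) [] r else apiece lW' (X j) (\<sigma> j) r) Wb" for \<sigma>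
  define Z where "Z v = Ab v \<union> Wb v \<union> Bb v" for v
  have Z: "pth E (Ab v) 1 (Wb v) (Bb v)" "v \<in> Wb v" "Z v \<subseteq> V" "Z v \<inter> (absV \<union> D) = {v}" "card (Z v) = k"
    "\<And>v'. v' \<in> D \<Longrightarrow> v \<noteq> v' \<Longrightarrow> Z v \<inter> Z v' = {}" if "v \<in> D" for v
    using pieces that by (simp_all add: Z_def)
  have finD: "finite D" using D finV finite_subset by blast
  have X1: "X j \<in> absX V" if "j < M" for j using X that by blast
  have P1: "\<exists>m. pth E (apiece lA (X j) [] r) m (apiece lW (X j) [] r) (apiece lB (X j) [] r)"
    "apiece lA (X j) [] r \<union> apiece lW (X j) [] r \<union> apiece lB (X j) [] r \<subseteq> set (concat (X j))"
    "\<And>r'. r' \<le> k - l \<Longrightarrow> r \<noteq> r' \<Longrightarrow> (apiece lA (X j) [] r \<union> apiece lW (X j) [] r \<union> apiece lB (X j) [] r) \<inter>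
       (apiece lA (X j) [] r' \<union> apiece lW (X j) [] r' \<union> apiece lB (X j) [] r') = {}"
    if "j < M" "r \<le> k - l" for j r
  proof -
    obtain vs where vs: "absorbs E V vs (X j)" "distinct vs" "length vs = k - l" using X \<open>j < M\<close> by blast
    note ap = absorber_pieces[OF X1[OF \<open>j < M\<close>] vs]
    show "\<exists>m. pth E (apiece lA (X j) [] r) m (apiece lW (X j) [] r) (apiece lB (X j) [] r)" by (rule ap(1)[OF that(2)])
    show "apiece lA (X j) [] r \<union> apiece lW (X j) [] r \<union> apiece lB (X j) [] r \<subseteq> set (concat (X j))" by (rule ap(5)[OF that(2)])
    show "(apiece lA (X j) [] r \<union> apiece lW (X j) [] r \<union> apiece lB (X j) [] r) \<inter>
       (apiece lA (X j) [] r' \<union> apiece lW (X j) [] r' \<union> apiece lB (X j) [] r') = {}" if "r' \<le> k - l" "r \<noteq> r'" for r'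
      by (rule ap(3)[OF \<open>r \<le> k - l\<close> that])
  qed
  have apX: "apieces (X j) \<subseteq> set (concat (X j))" if "j < M" for j
    unfolding apieces_def by (rule UN_least) (rule P1(2)[OF that], simp)
  have XV: "set (concat (X j)) \<subseteq> V" "card (set (concat (X j))) = (2 * l + 2) * aq" if "j < M" for j
  proof -
    have "X j \<in> tup (tup V (2 * l + 2)) aq" "distinct (concat (X j))" using X1[OF that] by (auto simp: absX_def)
    then show "set (concat (X j)) \<subseteq> V" by (auto simp: tup_def)
    have "length (concat (X j)) = (2 * l + 2) * aq" by (rule length_concat_tup) fact
    then show "card (set (concat (X j))) = (2 * l + 2) * aq"
      using distinct_card[OF \<open>distinct (concat (X j))\<close>] by simp
  qed
  define R0 where "R0 = absV \<union> (\<Union>v\<in>D. Z v)"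
  have R0V: "R0 \<subseteq> V" unfolding R0_def absV using XV(1) Z(3) by (intro Un_least UN_least) blast+
  have cR0: "card R0 \<le> ((2 * l + 2) * aq) * M + k * card D"
  proof -
    have "card R0 \<le> card absV + card (\<Union>v\<in>D. Z v)" unfolding R0_def by (rule card_Un_le)
    also have "card absV \<le> (\<Sum>j<M. card (set (concat (X j))))" unfolding absV by (rule card_UN_le) simp
    also have "\<dots> = ((2 * l + 2) * aq) * M" using XV(2) by simp
    also have "card (\<Union>v\<in>D. Z v) \<le> (\<Sum>v\<in>D. card (Z v))" by (rule card_UN_le[OF finD])
    also have "\<dots> = k * card D" using Z(5) by simp
    finally show ?thesis by simp
  qed
  have cI: "card I = M * (k - l + 1) + card D" using finD by (simp add: I_def card_Plus)
  have finI: "finite I" "I \<noteq> {}" using finD M by (auto simp: I_def)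
  have I_cases: "(\<exists>j r. i = Inl (j, r) \<and> j < M \<and> r \<le> k - l) \<or> (\<exists>v. i = Inr v \<and> v \<in> D)" if "i \<in> I" for i
    using that by (auto simp: I_def)
  define T where "T \<sigma> i = A i \<union> W \<sigma> i \<union> B i" for \<sigma> i

  define U where "U = (\<Union>j<M. apieces (X j)) \<union> (\<Union>v\<in>D. Z v)"
  have apU: "apieces (X j) \<subseteq> U" if "j < M" for j using that by (auto simp: U_def)
  have ZU: "Z v \<subseteq> U" if "v \<in> D" for v using that by (auto simp: U_def)
  have UR0: "U \<subseteq> R0" unfolding U_def R0_def absV using apX by (intro Un_mono UN_mono) auto
  \<comment> \<open>A bad vertex may be a vertex of an absorber that lies on no piece. It then has
    an edge of its own, which meets \<open>absV\<close> in that vertex only.\<close>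
  have Zap: "Z v \<inter> apieces (X j) = {}" if "v \<in> D" "j < M" for v j
  proof -
    have "v \<notin> apieces (X j)" using that D by blast
    moreover have "apieces (X j) \<subseteq> absV" using apX[OF that(2)] that(2) by (auto simp: absV)
    moreover have "Z v \<inter> absV \<subseteq> {v}" using Z(4)[OF that(1)] by blast
    ultimately show ?thesis by blast
  qed
  have apdis: "apieces (X i) \<inter> apieces (X j) = {}" if "i < M" "j < M" "i \<noteq> j" for i j
    using disX[OF that] apX that by blast
  define ok where "ok \<sigma> \<longleftrightarrow> (\<forall>j<M. \<sigma> j \<noteq> [] \<longrightarrow> distinct (\<sigma> j) \<and> length (\<sigma> j) = k - l \<and> absorbs E V (\<sigma> j) (X j)) \<and>
     (\<forall>j<M. set (\<sigma> j) \<inter> U = {}) \<and> (\<forall>i<M. \<forall>j<M. i \<noteq> j \<longrightarrow> set (\<sigma> i) \<inter> set (\<sigma> j) = {})" for \<sigma>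
  have Q: "\<exists>m. pth E (A (Inl (j, r))) m (W \<sigma> (Inl (j, r))) (B (Inl (j, r)))"
    "\<And>r'. r' \<le> k - l \<Longrightarrow> r \<noteq> r' \<Longrightarrow> T \<sigma> (Inl (j, r)) \<inter> T \<sigma> (Inl (j, r')) = {}"
    "(\<Union>r\<le>k - l. T \<sigma> (Inl (j, r))) = apieces (X j) \<union> set (\<sigma> j)"
    if "ok \<sigma>" "j < M" "r \<le> k - l" for \<sigma> j r
  proof -
    have "(\<exists>m. pth E (A (Inl (j, r))) m (W \<sigma> (Inl (j, r))) (B (Inl (j, r)))) \<and>
      (\<forall>r'. r' \<le> k - l \<longrightarrow> r \<noteq> r' \<longrightarrow> T \<sigma> (Inl (j, r)) \<inter> T \<sigma> (Inl (j, r')) = {}) \<and>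
      (\<Union>r\<le>k - l. T \<sigma> (Inl (j, r))) = apieces (X j) \<union> set (\<sigma> j)"
    proof (cases "\<sigma> j = []")
      case True
      show ?thesis
      proof (intro conjI allI impI)
        show "\<exists>m. pth E (A (Inl (j, r))) m (W \<sigma> (Inl (j, r))) (B (Inl (j, r)))"
          using P1(1)[OF that(2,3)] by (simp add: A_def W_def B_def True)
        show "T \<sigma> (Inl (j, r)) \<inter> T \<sigma> (Inl (j, r')) = {}" if "r' \<le> k - l" "r \<noteq> r'" for r'
          using P1(3)[OF \<open>j < M\<close> \<open>r \<le> k - l\<close> that] by (simp only: T_def A_def W_def B_def True sum.case prod.case simp_thms if_True)
        show "(\<Union>r\<le>k - l. T \<sigma> (Inl (j, r))) = apieces (X j) \<union> set (\<sigma> j)"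
          by (simp add: T_def A_def W_def B_def True apieces_def)
      qed
    next
      case False
      then have vs: "absorbs E V (\<sigma> j) (X j)" "distinct (\<sigma> j)" "length (\<sigma> j) = k - l"
        using that by (auto simp: ok_def)
      note ap = absorber_pieces[OF X1[OF \<open>j < M\<close>] vs]
      have e: "T \<sigma> (Inl (j, r)) = apiece lA (X j) [] r \<union> apiece lW' (X j) (\<sigma> j) r \<union> apiece lB (X j) [] r" for r
        using False by (simp add: T_def A_def W_def B_def)
      show ?thesis
      proof (intro conjI allI impI)
        show "\<exists>m. pth E (A (Inl (j, r))) m (W \<sigma> (Inl (j, r))) (B (Inl (j, r)))"
          using ap(2)[OF that(3)] by (simp add: A_def W_def B_def False)
        show "T \<sigma> (Inl (j, r)) \<inter> T \<sigma> (Inl (j, r')) = {}" if "r' \<le> k - l" "r \<noteq> r'" for r'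
          unfolding e by (rule ap(4)[OF \<open>r \<le> k - l\<close> that])
        show "(\<Union>r\<le>k - l. T \<sigma> (Inl (j, r))) = apieces (X j) \<union> set (\<sigma> j)"
          unfolding e apieces_def by (rule ap(6))
      qed
    qed
    then show "\<exists>m. pth E (A (Inl (j, r))) m (W \<sigma> (Inl (j, r))) (B (Inl (j, r)))"
      "\<And>r'. r' \<le> k - l \<Longrightarrow> r \<noteq> r' \<Longrightarrow> T \<sigma> (Inl (j, r)) \<inter> T \<sigma> (Inl (j, r')) = {}"
      "(\<Union>r\<le>k - l. T \<sigma> (Inl (j, r))) = apieces (X j) \<union> set (\<sigma> j)" by blast+
  qed
  have T_Inr: "T \<sigma> (Inr v) = Z v" for \<sigma> v by (simp add: T_def A_def W_def B_def Z_def)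
  have T_sub: "T \<sigma> (Inl (j, r)) \<subseteq> apieces (X j) \<union> set (\<sigma> j)" if "ok \<sigma>" "j < M" "r \<le> k - l" for \<sigma> j r
    using Q(3)[OF that] that(3) by blast
  have UT: "(\<Union>i\<in>I. T \<sigma> i) = U \<union> (\<Union>j<M. set (\<sigma> j))" if "ok \<sigma>" for \<sigma>
  proof -
    have "(\<Union>i\<in>I. T \<sigma> i) = (\<Union>j<M. \<Union>r\<le>k - l. T \<sigma> (Inl (j, r))) \<union> (\<Union>v\<in>D. T \<sigma> (Inr v))"
      by (auto simp: I_def)
    also have "(\<Union>j<M. \<Union>r\<le>k - l. T \<sigma> (Inl (j, r))) = (\<Union>j<M. apieces (X j) \<union> set (\<sigma> j))"
      by (intro SUP_cong refl Q(3)[OF that, of _ 0]) auto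
    finally show ?thesis by (simp only: T_Inr U_def UN_Un_distrib Un_ac)
  qed
  have ok_ad: "set (\<sigma> j) \<inter> U = {}" "\<And>i. i < M \<Longrightarrow> i \<noteq> j \<Longrightarrow> set (\<sigma> i) \<inter> set (\<sigma> j) = {}" if "ok \<sigma>" "j < M" for \<sigma> j
    using that by (simp_all add: ok_def)
  have Tdis: "T \<sigma> i \<inter> T \<sigma> i' = {}" if "ok \<sigma>" "i \<in> I" "i' \<in> I" "i \<noteq> i'" for \<sigma> i i'
  proof -
    have mixed: "T \<sigma> (Inl (j, r)) \<inter> T \<sigma> (Inr v) = {}" if j: "j < M" "r \<le> k - l" and v: "v \<in> D" for j r v
      unfolding T_Inr using T_sub[OF \<open>ok \<sigma>\<close> j] Zap[OF v j(1)] ok_ad(1)[OF \<open>ok \<sigma>\<close> j(1)] ZU[OF v] by blast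
    have old: "T \<sigma> (Inl (j, r)) \<inter> T \<sigma> (Inl (j', r')) = {}"
      if j: "j < M" "r \<le> k - l" and j': "j' < M" "r' \<le> k - l" and ne: "(j, r) \<noteq> (j', r')" for j r j' r'
    proof (cases "j = j'")
      case True
      then show ?thesis using Q(2)[OF \<open>ok \<sigma>\<close> j j'(2)] ne by auto
    next
      case False
      show ?thesis using T_sub[OF \<open>ok \<sigma>\<close> j] T_sub[OF \<open>ok \<sigma>\<close> j'] apdis[OF j(1) j'(1) False]
          ok_ad(1)[OF \<open>ok \<sigma>\<close> j(1)] ok_ad(1)[OF \<open>ok \<sigma>\<close> j'(1)] ok_ad(2)[OF \<open>ok \<sigma>\<close> j'(1) j(1) False] apU[OF j(1)] apU[OF j'(1)]
        by blast
    qed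
    from I_cases[OF \<open>i \<in> I\<close>] show ?thesis
    proof (elim disjE exE conjE)
      fix j r assume i: "i = Inl (j, r)" "j < M" "r \<le> k - l"
      from I_cases[OF \<open>i' \<in> I\<close>] show ?thesis
      proof (elim disjE exE conjE)
        fix j' r' assume i': "i' = Inl (j', r')" "j' < M" "r' \<le> k - l"
        show ?thesis unfolding i(1) i'(1) by (rule old) (use i i' \<open>i \<noteq> i'\<close> in auto)
      next
        fix v assume i': "i' = Inr v" "v \<in> D"
        show ?thesis unfolding i(1) i'(1) by (rule mixed[OF i(2,3) i'(2)])
      qed
    next
      fix v assume i: "i = Inr v" "v \<in> D"
      from I_cases[OF \<open>i' \<in> I\<close>] show ?thesis
      proof (elim disjE exE conjE)
        fix j r assume i': "i' = Inl (j, r)" "j < M" "r \<le> k - l"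
        show ?thesis unfolding i(1) i'(1) by (subst Int_commute) (rule mixed[OF i'(2,3) i(2)])
      next
        fix v' assume i': "i' = Inr v'" "v' \<in> D"
        show ?thesis unfolding i(1) i'(1) T_Inr by (rule Z(6)[OF i(2) i'(2)]) (use i i' \<open>i \<noteq> i'\<close> in auto)
      qed
    qed
  qed
  have pth_I: "\<exists>m. pth E (A i) m (W \<sigma> i) (B i)" if "ok \<sigma>" "i \<in> I" for \<sigma> i
    using I_cases[OF that(2)]
  proof (elim disjE exE conjE)
    fix j r assume i: "i = Inl (j, r)" "j < M" "r \<le> k - l"
    show ?thesis unfolding i(1) by (rule Q(1)[OF that(1) i(2,3)])
  next
    fix v assume i: "i = Inr v" "v \<in> D"
    then show ?thesis using Z(1)[OF i(2)] by (auto simp: A_def W_def B_def)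
  qed
  define \<sigma>0 :: "nat \<Rightarrow> 'a list" where "\<sigma>0 = (\<lambda>_. [])"
  have ok0: "ok \<sigma>0" by (simp add: ok_def \<sigma>0_def)
  have UT0: "(\<Union>i\<in>I. T \<sigma>0 i) = U" using UT[OF ok0] by (simp add: \<sigma>0_def)
  have AB: "A i \<subseteq> U" "B i \<subseteq> U" "card (A i) = l" "card (B i) = l" if "i \<in> I" for i
  proof -
    have "T \<sigma>0 i \<subseteq> U" using UT0 that by blast
    then show "A i \<subseteq> U" "B i \<subseteq> U" by (auto simp: T_def)
    obtain m where "pth E (A i) m (W \<sigma>0 i) (B i)" using pth_I[OF ok0 \<open>i \<in> I\<close>] by blast
    then show "card (A i) = l" "card (B i) = l" using pth_facts(4,5) by blast+
  qed
  have sz: "card R0 + q * card I \<le> N0" unfolding cI by (rule order_trans[OF add_right_mono[OF cR0] size])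
  have endsR0: "\<forall>i\<in>I. A i \<subseteq> R0 \<and> B i \<subseteq> R0 \<and> card (A i) = l \<and> card (B i) = l"
    by (intro ballI conjI subset_trans[OF AB(1) UR0] subset_trans[OF AB(2) UR0] AB(3,4))
  have BA: "\<forall>i\<in>I. \<forall>j\<in>I. i \<noteq> j \<longrightarrow> B i \<inter> A j = {}"
  proof (intro ballI impI)
    fix i j assume "i \<in> I" "j \<in> I" "i \<noteq> j"
    from Tdis[OF ok0 this] show "B i \<inter> A j = {}" unfolding T_def by blast
  qed
  have "\<exists>K i0 i1. i0 \<in> I \<and> i1 \<in> I \<and> K \<subseteq> V - R0 \<and> card K \<le> q * card I \<and>
      (\<forall>W. (\<forall>i\<in>I. \<exists>m. pth E (A i) m (W i) (B i)) \<and> (\<forall>i\<in>I. W i \<inter> K = {}) \<and>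
         (\<forall>i\<in>I. \<forall>j\<in>I. i \<noteq> j \<longrightarrow> (A i \<union> W i \<union> B i) \<inter> (A j \<union> W j \<union> B j) = {}) \<longrightarrow>
         (\<exists>m. pth E (A i0) m ((\<Union>i\<in>I. A i \<union> W i \<union> B i) \<union> K - A i0 - B i1) (B i1)))"
    by (rule join[OF _ finV q finI R0V sz endsR0 BA]) (rule conn; assumption)
  then obtain K i0 i1 where K: "i0 \<in> I" "i1 \<in> I" "K \<subseteq> V - R0" "card K \<le> q * card I"
    and J: "\<forall>W. (\<forall>i\<in>I. \<exists>m. pth E (A i) m (W i) (B i)) \<and> (\<forall>i\<in>I. W i \<inter> K = {}) \<and>
         (\<forall>i\<in>I. \<forall>j\<in>I. i \<noteq> j \<longrightarrow> (A i \<union> W i \<union> B i) \<inter> (A j \<union> W j \<union> B j) = {}) \<longrightarrow>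
         (\<exists>m. pth E (A i0) m ((\<Union>i\<in>I. A i \<union> W i \<union> B i) \<union> K - A i0 - B i1) (B i1))"
    by (elim exE conjE) (rule that; assumption)
  have route: "\<exists>m. pth E (A i0) m (U \<union> (\<Union>j<M. set (\<sigma> j)) \<union> K - A i0 - B i1) (B i1)"
    if ok: "ok \<sigma>" and sK: "\<And>j. j < M \<Longrightarrow> set (\<sigma> j) \<inter> K = {}" for \<sigma>
  proof -
    have "\<forall>i\<in>I. \<exists>m. pth E (A i) m (W \<sigma> i) (B i)" using pth_I[OF ok] by blast
    moreover have "\<forall>i\<in>I. W \<sigma> i \<inter> K = {}"
    proof
      fix i assume i: "i \<in> I"
      have "W \<sigma> i \<subseteq> T \<sigma> i" by (auto simp: T_def)
      also have "\<dots> \<subseteq> U \<union> (\<Union>j<M. set (\<sigma> j))" using UT[OF ok] i by blast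
      finally show "W \<sigma> i \<inter> K = {}" using K(3) UR0 sK by blast
    qed
    moreover have "\<forall>i\<in>I. \<forall>j\<in>I. i \<noteq> j \<longrightarrow> (A i \<union> W \<sigma> i \<union> B i) \<inter> (A j \<union> W \<sigma> j \<union> B j) = {}"
      using Tdis[OF ok] unfolding T_def by blast
    ultimately have "\<exists>m. pth E (A i0) m ((\<Union>i\<in>I. A i \<union> W \<sigma> i \<union> B i) \<union> K - A i0 - B i1) (B i1)" by (intro J[THEN spec, THEN mp] conjI)
    then show ?thesis using UT[OF ok] by (simp only: T_def)
  qed
  define W0 where "W0 = U \<union> K - A i0 - B i1"
  have un: "A i0 \<union> W0 \<union> B i1 = U \<union> K" using AB[OF K(1)] AB[OF K(2)] by (auto simp: W0_def)
  obtain m where m: "pth E (A i0) m W0 (B i1)" using route[OF ok0] by (auto simp: \<sigma>0_def W0_def)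
  have UV: "U \<union> K \<subseteq> V" using UR0 R0V K(3) by blast
  have "card (U \<union> K) \<le> card U + card K" by (rule card_Un_le)
  also have "card U \<le> card R0" using UR0 R0V finV by (meson card_mono finite_subset)
  finally have cUK: "card (U \<union> K) \<le> N0" using K(4) sz by linarith
  \<comment> \<open>Every bad vertex lies on the path, so what is left to be absorbed consists of
    good vertices.\<close>
  have BadU: "Bad \<subseteq> U"
  proof
    fix v assume v: "v \<in> Bad"
    show "v \<in> U"
    proof (cases "v \<in> D")
      case True
      then show ?thesis using Z(2)[OF True] ZU[OF True] by (auto simp: Z_def)
    next
      case False
      then show ?thesis using v by (auto simp: D U_def)
    qed
  qed
  show ?thesis
  proof (rule exI[of _ "A i0"], rule exI[of _ m], rule exI[of _ W0], rule exI[of _ "B i1"], unfold un,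
      intro conjI m UV cUK allI impI)
    fix R p assume a: "R \<subseteq> V - (U \<union> K) \<and> card R = p * (k - l) \<and> p \<le> P"
    have finR: "finite R" using a finV finite_subset by blast
    obtain vs where vs: "\<forall>i<p. distinct (vs i) \<and> length (vs i) = k - l" "(\<Union>i<p. set (vs i)) = R"
       "\<forall>i<p. \<forall>j<p. i \<noteq> j \<longrightarrow> set (vs i) \<inter> set (vs j) = {}"
      using split_blocks[OF finR, of p "k - l"] a by blast
    have vsR: "set (vs i) \<subseteq> R" if "i < p" for i using vs(2) that by blast
    \<comment> \<open>Each block has at least \<open>P \<ge> p\<close> absorbers, enough to give the
      \<open>p\<close> blocks different ones.\<close>
    have "p \<le> card {j. j < M \<and> absorbs E V (vs i) (X j)}" if "i < p" for i
    proof -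
      have "set (vs i) \<subseteq> V - Bad" using vsR[OF that] a BadU by blast
      then show ?thesis using good[of "vs i"] vs(1) that a by auto
    qed
    from inj_choice[of p M "\<lambda>i j. absorbs E V (vs i) (X j)", OF this] obtain f where
      f: "inj_on f {..<p}" "\<And>i. i < p \<Longrightarrow> f i < M" "\<And>i. i < p \<Longrightarrow> absorbs E V (vs i) (X (f i))" by blast
    define \<sigma> where "\<sigma> j = (if j \<in> f ` {..<p} then vs (the_inv_into {..<p} f j) else [])" for j
    have \<sigma>f: "\<sigma> (f i) = vs i" if "i < p" for i using that f(1) by (simp add: \<sigma>_def the_inv_into_f_f)
    have \<sigma>c: "(\<exists>i<p. j = f i) \<or> \<sigma> j = []" for j by (auto simp: \<sigma>_def)
    have sR: "set (\<sigma> j) \<subseteq> R" for j using \<sigma>c[of j] \<sigma>f vsR by force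
    have ok: "ok \<sigma>"
      unfolding ok_def
    proof (intro conjI allI impI)
      fix j assume "j < M"
      show "set (\<sigma> j) \<inter> U = {}" using sR[of j] a by blast
      show "distinct (\<sigma> j)" "length (\<sigma> j) = k - l" "absorbs E V (\<sigma> j) (X j)" if "\<sigma> j \<noteq> []"
        using \<sigma>c[of j] that \<sigma>f vs(1) f(3) by auto
    next
      fix i j assume "i < M" "j < M" "i \<noteq> j"
      show "set (\<sigma> i) \<inter> set (\<sigma> j) = {}"
      proof (cases "\<sigma> i = [] \<or> \<sigma> j = []")
        case False
        then obtain i' j' where "i' < p" "i = f i'" "j' < p" "j = f j'" using \<sigma>c by meson
        then show ?thesis using vs(3) \<sigma>f \<open>i \<noteq> j\<close> by metis
      qed auto
    qed
    have "(\<Union>j<M. set (\<sigma> j)) = R"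
    proof
      show "(\<Union>j<M. set (\<sigma> j)) \<subseteq> R" using sR by (intro UN_least)
      have "set (vs i) \<subseteq> (\<Union>j<M. set (\<sigma> j))" if "i < p" for i
        using \<sigma>f[OF that] f(2)[OF that] by (metis UN_upper lessThan_iff)
      then show "R \<subseteq> (\<Union>j<M. set (\<sigma> j))" using vs(2) by blast
    qed
    moreover have "set (\<sigma> j) \<inter> K = {}" for j using sR[of j] a by blast
    ultimately have "\<exists>m. pth E (A i0) m (U \<union> R \<union> K - A i0 - B i1) (B i1)" using route[OF ok] by simp
    moreover have "U \<union> R \<union> K - A i0 - B i1 = W0 \<union> R"
      using a AB[OF K(1)] AB[OF K(2)] unfolding W0_def by blast
    ultimately show "\<exists>m'. pth E (A i0) m' (W0 \<union> R) (B i1)" by simp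
  qed
qed

end

lemma ln_linear_bound:
  fixes a b c :: real
  assumes "a > 0" "b \<ge> 0"
  shows "\<exists>N::nat. \<forall>n\<ge>N. c + b * ln (real n) \<le> a * n"
proof -
  define r where "r = 4 * b / a"
  show ?thesis
  proof (intro exI[of _ "nat \<lceil>r\<^sup>2\<rceil> + nat \<lceil>2 * c / a\<rceil> + 1"] allI impI)
    fix n :: nat assume n: "nat \<lceil>r\<^sup>2\<rceil> + nat \<lceil>2 * c / a\<rceil> + 1 \<le> n"
    have n0: "real n > 0" using n by simp
    have "r\<^sup>2 \<le> n" using n by linarith
    then have "r \<le> sqrt n" by (rule real_le_rsqrt)
    then have "4 * b \<le> a * sqrt n" using assms by (simp add: r_def field_simps)
    then have "4 * b * sqrt n \<le> a * sqrt n * sqrt n" by (rule mult_right_mono) simp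
    then have 1: "2 * b * sqrt n \<le> a / 2 * n" using n0 by (simp add: mult.assoc)
    have "2 * c / a \<le> n" using n by linarith
    then have 2: "c \<le> a / 2 * n" using assms by (simp add: field_simps)
    have "ln (sqrt n) \<le> sqrt n - 1" using n0 by (intro ln_le_minus_one) simp
    then have "ln n \<le> 2 * sqrt n" using n0 by (simp add: ln_sqrt)
    then have "b * ln n \<le> b * (2 * sqrt n)" using assms by (intro mult_left_mono)
    then show "c + b * ln n \<le> a * n" using 1 2 by simp
  qed
qed

context loose
begin

text \<open>The tolerated proportion of bad vertices decides which vertices count as bad. This fixes
  the density of absorbers, then the number of absorbers to be selected, and last the number of
  vertices that can be absorbed; hence the order \<open>\<eta>\<close>, \<open>c1\<close>,
  \<open>c0\<close>, \<open>\<beta>\<close>, \<open>\<tau>\<close>.\<close>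

lemma absorbing:
  fixes \<alpha> \<zeta> :: real
  assumes \<alpha>: "\<alpha> > 0" and \<zeta>: "\<zeta> > 0"
  shows "\<exists>\<tau>>0::real. \<exists>n0::nat. \<forall>(E::'a set set) V. finite V \<and> cond E V V \<alpha> \<and> n0 \<le> card V \<longrightarrow>
     (\<exists>L m W L'. pth E L m W L' \<and> L \<union> W \<union> L' \<subseteq> V \<and> real (card (L \<union> W \<union> L')) \<le> \<zeta> * card V \<and>
       (\<forall>R. R \<subseteq> V - (L \<union> W \<union> L') \<and> real (card R) \<le> \<tau> * card V \<and> (k - l) dvd card R \<longrightarrow>
         (\<exists>m'. pth E L m' (W \<union> R) L')))"
proof -
  have k0: "real k > 0" using two_l by simp
  have kl: "k - l > 0" using two_l by simp
  obtain \<kappa> :: real and nJ :: nat where \<kappa>: "\<kappa> > 0" and conn: "\<And>(E::'a set set) V R L L'. finite V \<and> cond E V V \<alpha> \<and> nJ \<le> card V \<and> R \<subseteq> V \<and>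
     real (card R) \<le> \<kappa> * card V \<and> L \<subseteq> V \<and> L' \<subseteq> V \<and> card L = l \<and> card L' = l \<and> L \<inter> L' = {} \<Longrightarrow>
     (\<exists>W\<subseteq>V - R - (L \<union> L'). pth E L (2 * l + 2) W L')"
    using connect_avoid[OF \<alpha>] by meson
  \<comment> \<open>The path must also be short enough for \<open>connect_avoid\<close> to work
    until it is complete.\<close>
  define \<zeta>' where "\<zeta>' = min \<zeta> \<kappa>"
  define q where "q = (2 * l + 2) * (k - l)"
  define B where "B = 2 * l + 2"
  define Q where "Q = B * aq"
  define C1 where "C1 = real (Q + q * (k - l + 1) + 1)"
  define C2 where "C2 = real (k + q + 1)"
  \<comment> \<open>In turn: enough good vertices to form a block, a short path, and room for the
    edges through bad vertices.\<close>
  define \<eta> where "\<eta> = Min {1 / 2, \<zeta>' / (2 * C2), \<alpha> / (8 * real k * (real k + 1))}"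
  have \<zeta>': "\<zeta>' > 0" "\<zeta>' \<le> \<zeta>" "\<zeta>' \<le> \<kappa>" using \<zeta> \<kappa> by (auto simp: \<zeta>'_def)
  have C: "C1 > 0" "C2 > 0" unfolding C1_def C2_def of_nat_0_less_iff by simp_all
  have \<eta>: "\<eta> > 0" "\<eta> \<le> 1 / 2" "\<eta> \<le> \<zeta>' / (2 * C2)" "\<eta> \<le> \<alpha> / (8 * real k * (real k + 1))"
  proof -
    have "\<alpha> / (8 * real k * (real k + 1)) > 0" using \<alpha> k0 by simp
    moreover have "\<zeta>' / (2 * C2) > 0" using \<zeta>' C by simp
    ultimately show "\<eta> > 0" by (simp add: \<eta>_def)
    show "\<eta> \<le> 1 / 2" "\<eta> \<le> \<zeta>' / (2 * C2)" "\<eta> \<le> \<alpha> / (8 * real k * (real k + 1))" unfolding \<eta>_def by (intro Min_le; simp)+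
  qed
  \<comment> \<open>With this threshold, \<open>bad_small\<close> yields at most
    \<open>\<eta> * n\<close> bad vertices.\<close>
  define c1 where "c1 = \<eta> * (\<alpha> / 2)\<^sup>2"
  have c1: "c1 > 0" using \<eta> \<alpha> by (simp add: c1_def)
  obtain c :: real and nF :: nat where c: "c > 0" and dns: "\<forall>(E::'a set set) V vs. finite V \<and> cond E V V \<alpha> \<and> card V \<ge> nF \<and>
     (\<forall>r<k - l. c1 * card V ^ k \<le> card {ys \<in> tup V k. insert (vs ! r) ((!) ys ` {1..<k}) \<in> E \<and> (!) ys ` {0..<k} \<in> E}) \<longrightarrow>
     c * card V ^ aq \<le> card (absF E V vs)"
    using absF_dense[OF \<alpha> c1] by (elim exE conjE) (rule that; assumption)
  define c0 where "c0 = c ^ (B ^ aq)"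
  define c2 where "c2 = min (c0 / 2) 1"
  have c0: "c0 > 0" using c by (simp add: c0_def)
  have c2: "c2 > 0" "c2 \<le> 1" "c2 \<le> c0 / 2" using c0 by (auto simp: c2_def)
  \<comment> \<open>In turn: a short path, room for the edges through bad vertices, and many
    absorbers disjoint from those already selected.\<close>
  define \<beta> where "\<beta> = Min {\<zeta>' / (2 * C1), \<alpha> / (8 * real k * (real Q + 1)), c0 / (4 * (real Q * real Q + 1))}"
  have \<beta>: "\<beta> > 0" "\<beta> \<le> \<zeta>' / (2 * C1)" "\<beta> \<le> \<alpha> / (8 * real k * (real Q + 1))" "\<beta> \<le> c0 / (4 * (real Q * real Q + 1))"
  proof -
    have Q1: "real Q + 1 > 0" "real Q * real Q + 1 > 0" by (auto simp: add_nonneg_pos)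
    have "\<alpha> / (8 * real k * (real Q + 1)) > 0" using \<alpha> k0 Q1 by simp
    moreover have "\<zeta>' / (2 * C1) > 0" using \<zeta>' C by simp
    moreover have "c0 / (4 * (real Q * real Q + 1)) > 0" using c0 Q1 by simp
    ultimately show "\<beta> > 0" by (simp add: \<beta>_def)
    show "\<beta> \<le> \<zeta>' / (2 * C1)" "\<beta> \<le> \<alpha> / (8 * real k * (real Q + 1))" "\<beta> \<le> c0 / (4 * (real Q * real Q + 1))"
      unfolding \<beta>_def by (intro Min_le; simp)+
  qed
  have \<beta>m: "\<beta> * C1 \<le> \<zeta>' / 2" "\<eta> * C2 \<le> \<zeta>' / 2" "real k * (real Q + 1) * \<beta> \<le> \<alpha> / 8" "real k * (real k + 1) * \<eta> \<le> \<alpha> / 8"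
    "(real Q * real Q + 1) * \<beta> \<le> c0 / 4"
  proof -
    have aux: "z * x \<le> y / t" if "z \<le> y / (t * x)" "x > 0" "t > 0" for x y z t :: real
      using that by (simp add: field_simps)
    show "\<beta> * C1 \<le> \<zeta>' / 2" by (rule aux[OF \<beta>(2) C(1)]) simp
    show "\<eta> * C2 \<le> \<zeta>' / 2" by (rule aux[OF \<eta>(3) C(2)]) simp
    have "\<beta> * (real k * (real Q + 1)) \<le> \<alpha> / 8" by (rule aux) (use \<beta>(3) k0 in \<open>simp_all add: mult.assoc add_nonneg_pos\<close>)
    then show "real k * (real Q + 1) * \<beta> \<le> \<alpha> / 8" by (simp only: mult.commute)
    have "\<eta> * (real k * (real k + 1)) \<le> \<alpha> / 8" by (rule aux) (use \<eta>(4) k0 in \<open>simp_all add: mult.assoc add_nonneg_pos\<close>)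
    then show "real k * (real k + 1) * \<eta> \<le> \<alpha> / 8" by (simp only: mult.commute)
    have "\<beta> * (real Q * real Q + 1) \<le> c0 / 4" by (rule aux[OF \<beta>(4)]) (simp_all add: add_nonneg_pos)
    then show "(real Q * real Q + 1) * \<beta> \<le> c0 / 4" by (simp only: mult.commute)
  qed
  \<comment> \<open>The greedy selection gives each block a number \<open>N\<close> of absorbers
    with \<open>N * ln 2 \<ge> M * c2 / 2 - (k - l) * ln n\<close>, where the first term is about
    \<open>2 * \<tau> * n\<close>. One half of it pays for the logarithm.\<close>
  define \<tau> where "\<tau> = c2 * \<beta> / 4"
  have \<tau>: "\<tau> > 0" using c2 \<beta> by (simp add: \<tau>_def)
  obtain N1 :: nat where N1: "\<And>n. n \<ge> N1 \<Longrightarrow> c2 / 2 + real (k - l) * ln (real n) \<le> \<tau> * n"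
    using ln_linear_bound[OF \<tau>, of "real (k - l)" "c2 / 2"] by auto
  define n0 where "n0 = nJ + nF + 2 * d * d + N1 + nat \<lceil>8 * (real k * real k) / \<alpha>\<rceil> + nat \<lceil>4 * (real Q * (real Q + real k)) / c0\<rceil> + nat \<lceil>1 / \<beta>\<rceil> + 2 * k + 1"
  show ?thesis
  proof (rule exI[of _ \<tau>], rule conjI[OF \<tau>], rule exI[of _ n0], intro allI impI)
    fix E :: "'a set set" and V :: "'a set"
    assume a: "finite V \<and> cond E V V \<alpha> \<and> n0 \<le> card V"
    define n where "n = real (card V)"
    have finV: "finite V" and cd: "cond E V V \<alpha>" using a by auto
    have nn: "nJ \<le> card V" "nF \<le> card V" "2 * d * d \<le> card V" "N1 \<le> card V" "2 * k \<le> card V" "card V > 0"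
      using a by (auto simp: n0_def)
    have nV: "n > 0" "V \<noteq> {}" using nn(6) by (auto simp: n_def)
    have nr: "real k * real k \<le> \<alpha> / 8 * n" "real Q * (real Q + real k) \<le> c0 / 4 * n" "1 \<le> \<beta> * n"
    proof -
      have "8 * (real k * real k) / \<alpha> \<le> n" "4 * (real Q * (real Q + real k)) / c0 \<le> n" "1 / \<beta> \<le> n"
        using a unfolding n0_def n_def by linarith+
      then show "real k * real k \<le> \<alpha> / 8 * n" "real Q * (real Q + real k) \<le> c0 / 4 * n" "1 \<le> \<beta> * n"
        using \<alpha> c0 \<beta>(1) by (simp_all add: field_simps)
    qed
    define M where "M = nat \<lfloor>\<beta> * n\<rfloor>"
    have M: "real M \<le> \<beta> * n" "\<beta> * n - 1 \<le> M" "M > 0" using nr(3) unfolding M_def by linarith+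
    define Bad where "Bad = {v \<in> V. card (cl E V v) < c1 * card V ^ k}"
    have BadV: "Bad \<subseteq> V" by (auto simp: Bad_def)
    have finBad: "finite Bad" using BadV finV finite_subset by blast
    have "card Bad * (\<alpha> / 2)\<^sup>2 \<le> c1 * card V"
      by (rule bad_small[OF finV cd \<alpha> nn(3,6) BadV _ less_imp_le[OF c1]]) (simp add: Bad_def)
    then have "card Bad * (\<alpha> / 2)\<^sup>2 \<le> (\<eta> * n) * (\<alpha> / 2)\<^sup>2" by (simp add: c1_def n_def mult_ac)
    then have cBad: "card Bad \<le> \<eta> * n" using \<alpha> by (simp only: mult_le_cancel_right_pos zero_less_power half_gt_zero)
    define \<S> where "\<S> = {vs. distinct vs \<and> length vs = k - l \<and> set vs \<subseteq> V - Bad}"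
    have S_tup: "\<S> \<subseteq> tup V (k - l)" by (auto simp: \<S>_def tup_def)
    have finS: "finite \<S>" using S_tup finite_tup[OF finV] finite_subset by blast
    have "real (card \<S>) \<le> real (card (tup V (k - l)))" using card_mono[OF finite_tup[OF finV] S_tup] by simp
    then have cS: "real (card \<S>) \<le> n ^ (k - l)" by (simp add: card_tup[OF finV] n_def)
    have neS: "\<S> \<noteq> {}"
    proof -
      have "\<eta> * n \<le> 1 / 2 * n" using \<eta>(2) nV by (intro mult_right_mono) auto
      then have "real (2 * card Bad) \<le> card V" using cBad by (simp add: n_def)
      then have "2 * card Bad \<le> card V" by linarith
      then have "k - l \<le> card (V - Bad)" using nn(5) by (simp add: card_Diff_subset finBad BadV)
      then obtain Y where Y: "Y \<subseteq> V - Bad" "card Y = k - l" "finite Y" using obtain_subset_with_card_n by metis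
      obtain ys where "set ys = Y" "distinct ys" using finite_distinct_list Y(3) by blast
      then have "ys \<in> \<S>" using Y distinct_card[of ys] by (simp add: \<S>_def)
      then show ?thesis by blast
    qed
    define T where "T = n ^ Q"
    have T0: "T > 0" using nV by (simp add: T_def)
    have absX_sub: "absX V \<subseteq> tup (tup V B) aq" by (auto simp: absX_def B_def)
    have fin2: "finite (tup (tup V B) aq)" using finV by simp
    have finX: "finite (absX V)" using absX_sub fin2 finite_subset by blast
    have "real (card (absX V)) \<le> real (card (tup (tup V B) aq))" using card_mono[OF fin2 absX_sub] by simp
    also have "\<dots> = T" by (simp add: card_tup finV T_def n_def Q_def power_mult)
    finally have cX: "real (card (absX V)) \<le> T" .
    have vert: "set (concat X) \<subseteq> V \<and> finite (set (concat X)) \<and> card (set (concat X)) \<le> Q" if X: "X \<in> absX V" for X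
    proof -
      have "length (concat X) = Q" using length_concat_tup[of X V B aq] absX_sub X by (auto simp: Q_def)
      then have "card (set (concat X)) \<le> Q" using card_length[of "concat X"] by simp
      moreover have "set (concat X) \<subseteq> V" using X by (auto simp: absX_def tup_def)
      ultimately show ?thesis by simp
    qed
    have dense: "c2 * T \<le> card {X \<in> absX V. absorbs E V vs X \<and> set (concat X) \<inter> R = {}}"
      if vs: "vs \<in> \<S>" and R: "R \<subseteq> V" "finite R" "card R \<le> Q * M" for vs R
    proof -
      have "c1 * card V ^ k \<le> card {ys \<in> tup V k. insert (vs ! r) ((!) ys ` {1..<k}) \<in> E \<and> (!) ys ` {0..<k} \<in> E}" if "r < k - l" for r
      proof -
        have "length vs = k - l" "set vs \<subseteq> V - Bad" using vs by (simp_all add: \<S>_def)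
        then have "vs ! r \<in> V - Bad" using that nth_mem by (metis subsetD)
        then show ?thesis by (auto simp: Bad_def cl_def)
      qed
      then have F: "c * card V ^ aq \<le> card (absF E V vs)" using finV cd nn(2) by (intro dns[rule_format] conjI allI impI)
      define R' where "R' = R \<union> set vs"
      have finR': "finite R'" using R by (simp add: R'_def)
      have "card R' \<le> card R + card (set vs)" unfolding R'_def by (rule card_Un_le)
      also have "card (set vs) \<le> k" using card_length[of vs] vs by (simp add: \<S>_def)
      finally have cR': "card R' \<le> Q * M + k" using R(3) by simp
      have "real (B * aq * (B * aq + card R')) \<le> real (Q * (Q + (Q * M + k)))"
        unfolding Q_def[symmetric] using cR' by (intro of_nat_mono mult_le_mono) auto
      also have "\<dots> = real Q * (real Q + real k) + real Q * real Q * M" by (simp add: algebra_simps)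
      also have "real Q * real Q * M \<le> (real Q * real Q + 1) * (\<beta> * n)"
        using M(1) by (intro mult_mono) auto
      also have "\<dots> = (real Q * real Q + 1) * \<beta> * n" by simp
      also have "\<dots> \<le> c0 / 4 * n" using \<beta>m(5) nV by (intro mult_right_mono) auto
      finally have "real (B * aq * (B * aq + card R')) \<le> c0 / 2 * n" using nr(2) by linarith
      then have "real (B * aq * (B * aq + card R')) / card V \<le> c0 / 2" using nV by (simp add: n_def field_simps)
      then have "c2 \<le> c0 - real (B * aq * (B * aq + card R')) / card V" using c2(3) by linarith
      then have "c2 * T \<le> (c0 - real (B * aq * (B * aq + card R')) / card V) * T" using T0 by (intro mult_right_mono) auto
      also have "\<dots> \<le> card {xss \<in> tup (tup V B) aq. transv xss \<subseteq> absF E V vs \<and> distinct (concat xss) \<and> set (concat xss) \<inter> R' = {}}"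
        using blow_up_distinct_count[OF finV finR' nV(2) _ F less_imp_le[OF c], of B]
        by (simp add: absF_def c0_def T_def n_def Q_def)
      also have "{xss \<in> tup (tup V B) aq. transv xss \<subseteq> absF E V vs \<and> distinct (concat xss) \<and> set (concat xss) \<inter> R' = {}}
          = {X \<in> absX V. absorbs E V vs X \<and> set (concat X) \<inter> R = {}}"
        unfolding absX_def absorbs_def B_def R'_def by (simp only: Int_Un_distrib Un_empty mem_Collect_eq conj_ac)
      finally show ?thesis .
    qed
    have "\<exists>X :: nat \<Rightarrow> 'a list list. (\<forall>i<M. X i \<in> absX V \<and> (\<exists>vs\<in>\<S>. absorbs E V vs (X i))) \<and>
      (\<forall>i<M. \<forall>j<M. i \<noteq> j \<longrightarrow> set (concat (X i)) \<inter> set (concat (X j)) = {}) \<and>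
      (\<Sum>vs\<in>\<S>. (1 / 2 :: real) ^ card {i. i < M \<and> absorbs E V vs (X i)}) \<le> card \<S> * (1 - c2 / 2) ^ M"
      by (rule greedy_selection[OF finS neS finX cX T0 _ c2(1) _ order_refl]) (rule vert dense; assumption)+
    then obtain X :: "nat \<Rightarrow> 'a list list" where X0: "\<forall>i<M. X i \<in> absX V \<and> (\<exists>vs\<in>\<S>. absorbs E V vs (X i))"
      and X1: "\<forall>i<M. \<forall>j<M. i \<noteq> j \<longrightarrow> set (concat (X i)) \<inter> set (concat (X j)) = {}"
      and X2: "(\<Sum>vs\<in>\<S>. (1 / 2 :: real) ^ card {i. i < M \<and> absorbs E V vs (X i)}) \<le> card \<S> * (1 - c2 / 2) ^ M"
      by (elim exE conjE) (rule that; assumption)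
    define P where "P = nat \<lfloor>\<tau> * n\<rfloor>"
    have many: "P \<le> card {i. i < M \<and> absorbs E V vs (X i)}" if vs: "vs \<in> \<S>" for vs
    proof -
      define N where "N = card {i. i < M \<and> absorbs E V vs (X i)}"
      \<comment> \<open>A single term of the final sum is at most the whole sum, so no block can
        have few absorbers.\<close>
      have "(1 / 2 :: real) ^ N \<le> (\<Sum>vs\<in>\<S>. (1 / 2 :: real) ^ card {i. i < M \<and> absorbs E V vs (X i)})"
        unfolding N_def by (rule member_le_sum[OF vs _ finS]) simp
      also note X2
      also have "card \<S> * (1 - c2 / 2) ^ M \<le> n ^ (k - l) * (1 - c2 / 2) ^ M"
        using cS c2 by (intro mult_right_mono) auto
      finally have le: "(1 / 2 :: real) ^ N \<le> n ^ (k - l) * (1 - c2 / 2) ^ M" .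
      have p: "1 - c2 / 2 > 0" using c2 by linarith
      have "ln ((1 / 2 :: real) ^ N) \<le> ln (n ^ (k - l) * (1 - c2 / 2) ^ M)"
        using le p nV by (subst ln_le_cancel_iff) auto
      moreover have "ln (n ^ (k - l) * (1 - c2 / 2) ^ M) = real (k - l) * ln n + real M * ln (1 - c2 / 2)"
        using p nV(1) by (subst ln_mult) (simp_all add: ln_realpow del: of_nat_diff)
      moreover have "ln ((1 / 2 :: real) ^ N) = - (real N * ln 2)"
        by (simp add: ln_realpow ln_div)
      moreover have "real M * ln (1 - c2 / 2) \<le> real M * (- (c2 / 2))"
        using ln_le_minus_one[OF p] by (intro mult_left_mono) auto
      moreover have "real N * ln 2 \<le> real N * 1" using ln_le_minus_one[of "2::real"] by (intro mult_left_mono) auto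
      moreover have "(\<beta> * n - 1) * (c2 / 2) \<le> real M * (c2 / 2)" using M(2) c2 by (intro mult_right_mono) auto
      moreover have "(\<beta> * n - 1) * (c2 / 2) = 2 * (\<tau> * n) - c2 / 2" by (simp add: \<tau>_def algebra_simps diff_divide_distrib)
      moreover have "c2 / 2 + real (k - l) * ln n \<le> \<tau> * n" using N1[OF nn(4)] by (simp only: n_def)
      ultimately have "\<tau> * n \<le> N" by linarith
      then show ?thesis unfolding P_def N_def[symmetric] by linarith
    qed
    define D where "D = Bad - (\<Union>j<M. apieces (X j))"
    define absV where "absV = (\<Union>j<M. set (concat (X j)))"
    have DB: "D \<subseteq> Bad" by (auto simp: D_def)
    have finD: "finite D" using DB finBad finite_subset by blast
    have "card D \<le> card Bad" by (rule card_mono[OF finBad DB])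
    then have cD: "card D \<le> \<eta> * n" using cBad by linarith
    have XV: "set (concat (X j)) \<subseteq> V" "card (set (concat (X j))) \<le> Q" if "j < M" for j
      using vert X0 that by blast+
    have absV_V: "absV \<subseteq> V" unfolding absV_def using XV(1) by (intro UN_least) auto
    have "card absV \<le> (\<Sum>j<M. card (set (concat (X j))))" unfolding absV_def by (rule card_UN_le) simp
    also have "\<dots> \<le> (\<Sum>j<M. Q)" using XV(2) by (intro sum_mono) auto
    finally have cabs: "card absV \<le> M * Q" by simp
    have RV: "absV \<union> D \<subseteq> V" using absV_V DB BadV by blast
    have "\<exists>A W B. \<forall>v\<in>D. pth E (A v) 1 (W v) (B v) \<and> v \<in> W v \<and>
       A v \<union> W v \<union> B v \<subseteq> V \<and> (A v \<union> W v \<union> B v) \<inter> (absV \<union> D) = {v} \<and> card (A v \<union> W v \<union> B v) = k \<and>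
       (\<forall>v'\<in>D. v \<noteq> v' \<longrightarrow> (A v \<union> W v \<union> B v) \<inter> (A v' \<union> W v' \<union> B v') = {})"
    proof (rule bad_pieces[OF finV cd \<alpha> nn(3) RV _ finD Un_upper2 order_refl])
      have "card (absV \<union> D) \<le> M * Q + card D" using card_Un_le[of absV D] cabs by linarith
      then have "real (k * (k + card (absV \<union> D) + k * card D)) \<le> real (k * (k + (M * Q + card D) + k * card D))"
        by (intro of_nat_mono mult_le_mono2 add_le_mono) auto
      also have "\<dots> = real k * real k + real k * real Q * M + real k * (real k + 1) * card D" by (simp add: algebra_simps)
      also have "\<dots> \<le> \<alpha> / 8 * n + \<alpha> / 8 * n + \<alpha> / 8 * n"
      proof (intro add_mono nr(1))
        have "real k * real Q * M \<le> real k * (real Q + 1) * (\<beta> * n)" using M(1) by (intro mult_mono) auto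
        also have "\<dots> = real k * (real Q + 1) * \<beta> * n" by simp
        also have "\<dots> \<le> \<alpha> / 8 * n" using \<beta>m(3) nV by (intro mult_right_mono) auto
        finally show "real k * real Q * M \<le> \<alpha> / 8 * n" .
        have "real k * (real k + 1) * card D \<le> real k * (real k + 1) * (\<eta> * n)" using cD by (intro mult_left_mono) auto
        also have "\<dots> = real k * (real k + 1) * \<eta> * n" by simp
        also have "\<dots> \<le> \<alpha> / 8 * n" using \<beta>m(4) nV by (intro mult_right_mono) auto
        finally show "real k * (real k + 1) * card D \<le> \<alpha> / 8 * n" .
      qed
      also have "\<dots> < \<alpha> / 2 * n"
      proof -
        have "\<alpha> * n > 0" using \<alpha> nV by simp
        then show ?thesis by simp
      qed
      finally show "real (k * (k + card (absV \<union> D) + k * card D)) < \<alpha> / 2 * card V" by (simp only: n_def)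
    qed
    then obtain Ab Wb Bb where pc: "\<forall>v\<in>D. pth E (Ab v) 1 (Wb v) (Bb v) \<and> v \<in> Wb v \<and>
       Ab v \<union> Wb v \<union> Bb v \<subseteq> V \<and> (Ab v \<union> Wb v \<union> Bb v) \<inter> (absV \<union> D) = {v} \<and> card (Ab v \<union> Wb v \<union> Bb v) = k \<and>
       (\<forall>v'\<in>D. v \<noteq> v' \<longrightarrow> (Ab v \<union> Wb v \<union> Bb v) \<inter> (Ab v' \<union> Wb v' \<union> Bb v') = {})"
      by (elim exE) (rule that)
    define N0 where "N0 = nat \<lfloor>\<zeta>' * n\<rfloor>"
    have "\<zeta>' * n \<ge> 0" using \<zeta>'(1) nV by simp
    then have N0: "real N0 \<le> \<zeta>' * n" unfolding N0_def by linarith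
    have size: "((2 * l + 2) * aq) * M + k * card D + q * (M * (k - l + 1) + card D) \<le> N0"
    proof -
      have "((2 * l + 2) * aq) * M + k * card D + q * (M * (k - l + 1) + card D)
          \<le> M * (Q + q * (k - l + 1) + 1) + card D * (k + q + 1)" by (simp add: Q_def B_def algebra_simps)
      then have "real (((2 * l + 2) * aq) * M + k * card D + q * (M * (k - l + 1) + card D))
          \<le> real (M * (Q + q * (k - l + 1) + 1) + card D * (k + q + 1))" by (rule of_nat_mono)
      also have "\<dots> = M * C1 + card D * C2" unfolding C1_def C2_def of_nat_add of_nat_mult ..
      also have "\<dots> \<le> (\<beta> * n) * C1 + (\<eta> * n) * C2" using M(1) cD C by (intro add_mono mult_right_mono) auto
      also have "\<dots> = (\<beta> * C1 + \<eta> * C2) * n" by (simp add: algebra_simps)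
      also have "\<dots> \<le> \<zeta>' * n" using \<beta>m(1,2) nV by (intro mult_right_mono) auto
      finally show ?thesis unfolding N0_def by linarith
    qed
    have X': "X j \<in> absX V \<and> (\<exists>vs. distinct vs \<and> length vs = k - l \<and> absorbs E V vs (X j))" if "j < M" for j
      using X0 that unfolding \<S>_def by blast
    have conn': "\<exists>W\<subseteq>V - R - (L \<union> L'). pth E L (2 * l + 2) W L'"
      if "R \<subseteq> V" "card R \<le> N0" "L \<subseteq> V" "L' \<subseteq> V" "card L = l" "card L' = l" "L \<inter> L' = {}" for R L L'
    proof -
      have "real (card R) \<le> \<zeta>' * n" using that(2) N0 by linarith
      also have "\<dots> \<le> \<kappa> * n" using \<zeta>'(3) nV by (intro mult_right_mono) auto
      finally show ?thesis using that cd finV nn(1) by (intro conn conjI) (simp_all only: n_def)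
    qed
    have q': "(2 * l + 2) * (k - l) \<le> q" by (simp add: q_def)
    have good': "P \<le> card {j. j < M \<and> absorbs E V vs (X j)}" if "distinct vs" "length vs = k - l" "set vs \<subseteq> V - Bad" for vs
      using that by (intro many) (simp add: \<S>_def)
    have "\<exists>L m W L'. pth E L m W L' \<and> L \<union> W \<union> L' \<subseteq> V \<and> card (L \<union> W \<union> L') \<le> N0 \<and>
      (\<forall>R p. R \<subseteq> V - (L \<union> W \<union> L') \<and> card R = p * (k - l) \<and> p \<le> P \<longrightarrow> (\<exists>m'. pth E L m' (W \<union> R) L'))"
      by (rule absorbing_assemble[OF finV _ q' M(3) _ _ absV_def D_def BadV pc _ size])
        (rule conn' X' X1[rule_format] good'; assumption)+
    then obtain L m W L' where res: "pth E L m W L'" "L \<union> W \<union> L' \<subseteq> V" "card (L \<union> W \<union> L') \<le> N0"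
      "\<forall>R p. R \<subseteq> V - (L \<union> W \<union> L') \<and> card R = p * (k - l) \<and> p \<le> P \<longrightarrow> (\<exists>m'. pth E L m' (W \<union> R) L')"
      by (elim exE conjE) (rule that; assumption)
    show "\<exists>L m W L'. pth E L m W L' \<and> L \<union> W \<union> L' \<subseteq> V \<and> real (card (L \<union> W \<union> L')) \<le> \<zeta> * card V \<and>
       (\<forall>R. R \<subseteq> V - (L \<union> W \<union> L') \<and> real (card R) \<le> \<tau> * card V \<and> (k - l) dvd card R \<longrightarrow>
         (\<exists>m'. pth E L m' (W \<union> R) L'))"
    proof (rule exI[of _ L], rule exI[of _ m], rule exI[of _ W], rule exI[of _ L'], intro conjI res(1,2) allI impI)
      have "real (card (L \<union> W \<union> L')) \<le> \<zeta>' * n" using res(3) N0 by linarith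
      also have "\<dots> \<le> \<zeta> * n" using \<zeta>'(2) nV by (intro mult_right_mono) auto
      finally show "real (card (L \<union> W \<union> L')) \<le> \<zeta> * card V" by (simp only: n_def)
      fix R assume R: "R \<subseteq> V - (L \<union> W \<union> L') \<and> real (card R) \<le> \<tau> * card V \<and> (k - l) dvd card R"
      then obtain p where p: "card R = p * (k - l)" by (metis dvdE mult.commute)
      have "p \<le> card R" unfolding p using kl by (cases "k - l") auto
      moreover have "real (card R) \<le> \<tau> * n" using R by (simp add: n_def)
      ultimately have "real p \<le> \<tau> * n" by linarith
      then have "p \<le> P" unfolding P_def by linarith
      then show "\<exists>m'. pth E L m' (W \<union> R) L'" using res(4) R p by blast
    qed
  qed
qed

end

section \<open>Hamilton cycles above the threshold\<close>

lemma card_distinct_tup: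
  assumes "finite V"
  shows "card {xs \<in> tup V s. distinct xs \<and> P (set xs)} = fact s * card {T \<in> nsets V s. P T}"
proof -
  let ?F = "{T \<in> nsets V s. P T}"
  have "finite (nsets V s)" using assms by (rule finite_imp_finite_nsets)
  then have finF: "finite ?F" by simp
  have eq: "{xs \<in> tup V s. distinct xs \<and> P (set xs)} = (\<Union>T\<in>?F. {xs. length xs = s \<and> distinct xs \<and> set xs \<subseteq> T})"
    (is "?L = ?R")
  proof
    show "?L \<subseteq> ?R"
    proof
      fix xs assume "xs \<in> ?L"
      then have "set xs \<in> ?F" "xs \<in> {xs. length xs = s \<and> distinct xs \<and> set xs \<subseteq> set xs}"
        using distinct_card[of xs] by (auto simp: tup_def nsets_def)
      then show "xs \<in> ?R" by blast
    qed
    show "?R \<subseteq> ?L"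
    proof (intro UN_least subsetI)
      fix T xs assume T: "T \<in> ?F" and xs: "xs \<in> {xs. length xs = s \<and> distinct xs \<and> set xs \<subseteq> T}"
      then have "set xs = T" using distinct_card[of xs] by (intro card_subset_eq) (auto simp: nsets_def)
      then show "xs \<in> ?L" using T xs by (auto simp: tup_def nsets_def)
    qed
  qed
  have c: "card {xs. length xs = s \<and> distinct xs \<and> set xs \<subseteq> T} = fact s" if "T \<in> ?F" for T
    using that card_lists_distinct_length_eq[of T s] by (simp add: nsets_def fact_prod)
  have "card ?R = (\<Sum>T\<in>?F. card {xs. length xs = s \<and> distinct xs \<and> set xs \<subseteq> T})"
  proof (rule card_UN_disjoint[OF finF])
    show "\<forall>T\<in>?F. finite {xs. length xs = s \<and> distinct xs \<and> set xs \<subseteq> T}"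
    proof
      fix T assume "T \<in> ?F"
      then have "finite {xs. set xs \<subseteq> T \<and> length xs = s}" by (intro finite_lists_length_eq) (simp add: nsets_def)
      then show "finite {xs. length xs = s \<and> distinct xs \<and> set xs \<subseteq> T}" by (rule rev_finite_subset) auto
    qed
    show "\<forall>T\<in>?F. \<forall>T'\<in>?F. T \<noteq> T' \<longrightarrow>
       {xs. length xs = s \<and> distinct xs \<and> set xs \<subseteq> T} \<inter> {xs. length xs = s \<and> distinct xs \<and> set xs \<subseteq> T'} = {}"
    proof (intro ballI impI equals0I)
      fix T T' xs assume T: "T \<in> ?F" "T' \<in> ?F" "T \<noteq> T'"
        and xs: "xs \<in> {xs. length xs = s \<and> distinct xs \<and> set xs \<subseteq> T} \<inter> {xs. length xs = s \<and> distinct xs \<and> set xs \<subseteq> T'}"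
      have "set xs = T" using T(1) xs distinct_card[of xs] by (intro card_subset_eq) (auto simp: nsets_def)
      moreover have "set xs = T'" using T(2) xs distinct_card[of xs] by (intro card_subset_eq) (auto simp: nsets_def)
      ultimately show False using T(3) by simp
    qed
  qed
  also have "\<dots> = fact s * card ?F" using c by simp
  finally show ?thesis unfolding eq .
qed

lemma card_distinct_tup_ge:
  assumes "finite V" "V \<noteq> {}"
  shows "(1 - real (s * s) / card V) * card V ^ s \<le> fact s * (card V choose s)"
proof -
  have "{T \<in> nsets V s. True} = {B. B \<subseteq> V \<and> card B = s}" using assms finite_subset by (auto simp: nsets_def)
  then have "card {xs \<in> tup V s. distinct xs} = fact s * (card V choose s)"
    using card_distinct_tup[OF assms(1), of s "\<lambda>_. True"] n_subsets[OF assms(1), of s] by simp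
  moreover have "(1 - real (s * s) / card V) * card V ^ s \<le> card {xs \<in> tup V s. distinct xs}"
    using dense_filter[OF assms(1) finite.emptyI assms(2) order_refl, of 1 s] by (simp add: card_tup assms(1))
  ultimately show ?thesis by simp
qed

context loose
begin

text \<open>Passing from sets to tuples loses the tuples with repeated entries, a proportion of
  order \<open>1 / card V\<close>; the gap between \<open>\<alpha>\<close> and
  \<open>\<beta>\<close> pays for it.\<close>

lemma cond_of_min_deg:
  fixes \<alpha> \<beta> :: real
  assumes g: "kgraph k V E" and deg: "\<alpha> * (card V choose (k - d)) \<le> min_deg k d V E"
    and \<alpha>: "\<alpha> \<ge> 0" and n: "card V > 0" "\<alpha> * ((k - d) * (k - d)) \<le> (\<alpha> - \<beta>) * card V"
  shows "cond E V V \<beta>"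
  unfolding cond_def
proof (intro allI impI)
  fix S assume S: "S \<subseteq> V" "card S = d"
  let ?s = "k - d"
  have finV: "finite V" and E: "E \<subseteq> nsets V k" using g by (auto simp: kgraph_def)
  have ne: "V \<noteq> {}" using n by auto
  have finS: "finite S" using S finV finite_subset by auto
  have Sn: "S \<in> nsets V d" using S finS by (auto simp: nsets_def)
  have "min_deg k d V E \<le> hdeg k V E S"
    unfolding min_deg_def using finV Sn by (intro Min_le) (auto intro: finite_imp_finite_nsets)
  then have 1: "\<alpha> * (card V choose ?s) \<le> hdeg k V E S" using deg by linarith
  have "\<beta> * card V \<le> (\<alpha> * (1 - real (?s * ?s) / card V)) * card V"
    using n by (simp add: algebra_simps)
  then have "\<beta> \<le> \<alpha> * (1 - real (?s * ?s) / card V)" using n by (simp add: mult_le_cancel_right)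
  then have "\<beta> * card V ^ ?s \<le> \<alpha> * (1 - real (?s * ?s) / card V) * card V ^ ?s" by (intro mult_right_mono) auto
  also have "\<dots> = \<alpha> * ((1 - real (?s * ?s) / card V) * card V ^ ?s)" by simp
  also have "\<dots> \<le> \<alpha> * (fact ?s * (card V choose ?s))"
    using card_distinct_tup_ge[OF finV ne, of ?s] \<alpha> by (intro mult_left_mono) auto
  also have "\<dots> = fact ?s * (\<alpha> * (card V choose ?s))" by simp
  also have "\<dots> \<le> fact ?s * real (hdeg k V E S)" using 1 by (intro mult_left_mono) auto
  also have "\<dots> = real (card {xs \<in> tup V ?s. distinct xs \<and> set xs \<union> S \<in> E})"
    using card_distinct_tup[OF finV, of ?s "\<lambda>T. T \<union> S \<in> E"] S(2) by (simp add: hdeg_def)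
  also have "card {xs \<in> tup V ?s. distinct xs \<and> set xs \<union> S \<in> E} \<le> card {xs \<in> tup V ?s. S \<union> set xs \<in> E}"
    using finV by (intro card_mono) (auto simp: Un_commute)
  finally show "\<beta> * card V ^ ?s \<le> card {xs \<in> tup V ?s. S \<union> set xs \<in> E}" by simp
qed

text \<open>The absorbing path goes from \<open>L\<close> to \<open>L'\<close> and the covering path
  back from \<open>L'\<close> to \<open>L\<close>. The two close to a Hamilton cycle once the first
  has swallowed what the second leaves over.\<close>

theorem hamilton_above_threshold:
  fixes \<gamma> :: real
  assumes \<gamma>: "\<gamma> > 0"
  shows "\<exists>n0::nat. \<forall>(V::'a set) E. kgraph k V E \<and> card V \<ge> n0 \<and> (k - l) dvd card V \<and>
     (\<delta> + \<gamma>) * (card V choose (k - d)) \<le> min_deg k d V E \<longrightarrow> has_ham_ell_cycle k l V E"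
proof -
  define \<alpha> where "\<alpha> = \<delta> + \<gamma> / 2"
  have \<alpha>: "\<alpha> > 0" using \<gamma> delta_nonneg by (simp add: \<alpha>_def)
  have s: "real (k - d) > 0" using d_k by simp
  have kl: "k - l > 0" using two_l by simp
  \<comment> \<open>Off the absorbing path there remain at least half of the vertices, and the
    degree there is still \<open>\<delta> + \<gamma> / 4\<close>.\<close>
  define \<zeta> where "\<zeta> = min (1 / 2) (\<gamma> / (4 * real (k - d)))"
  have \<zeta>: "\<zeta> > 0" "\<zeta> \<le> 1 / 2" "real (k - d) * \<zeta> \<le> \<gamma> / 4"
  proof -
    have "\<gamma> / (4 * real (k - d)) > 0" using \<gamma> s by (intro divide_pos_pos) auto
    then show "\<zeta> > 0" by (simp add: \<zeta>_def)
    show "\<zeta> \<le> 1 / 2" unfolding \<zeta>_def by (rule min.cobounded1)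
    have aux: "c * z \<le> \<gamma> / 4" if "c > 0" "z \<le> \<gamma> / (4 * c)" for c z :: real using that by (simp add: field_simps)
    show "real (k - d) * \<zeta> \<le> \<gamma> / 4" by (rule aux[OF s]) (simp only: \<zeta>_def min.cobounded2)
  qed
  obtain \<tau> :: real and nA :: nat where \<tau>: "\<tau> > 0" and ab: "\<forall>(E::'a set set) V. finite V \<and> cond E V V \<alpha> \<and> nA \<le> card V \<longrightarrow>
     (\<exists>L m W L'. pth E L m W L' \<and> L \<union> W \<union> L' \<subseteq> V \<and> real (card (L \<union> W \<union> L')) \<le> \<zeta> * card V \<and>
       (\<forall>R. R \<subseteq> V - (L \<union> W \<union> L') \<and> real (card R) \<le> \<tau> * card V \<and> (k - l) dvd card R \<longrightarrow>
         (\<exists>m'. pth E L m' (W \<union> R) L')))"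
    using absorbing[OF \<alpha> \<zeta>(1)] by (elim exE conjE) (rule that; assumption)
  define \<epsilon> where "\<epsilon> = min \<tau> 1"
  have \<epsilon>: "\<epsilon> > 0" "\<epsilon> \<le> 1" "\<epsilon> \<le> \<tau>" using \<tau> by (auto simp: \<epsilon>_def)
  have \<gamma>4: "\<gamma> / 4 > 0" using \<gamma> by simp
  obtain nC :: nat where cov: "\<forall>(E::'a set set) V U0 L0 L1. finite V \<and> U0 \<subseteq> V \<and> card V \<le> 2 * card U0 \<and> cond E V U0 (\<delta> + \<gamma> / 4) \<and>
     card U0 \<ge> nC \<and> L0 \<subseteq> V - U0 \<and> L1 \<subseteq> V - U0 \<and> card L0 = l \<and> card L1 = l \<and> L0 \<inter> L1 = {} \<longrightarrow>
     (\<exists>W m. W \<subseteq> U0 \<and> pth E L0 m W L1 \<and> real (card (U0 - W)) \<le> \<epsilon> * card U0)"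
    using cover[OF \<gamma>4 \<epsilon>(1,2)] by (elim exE) (rule that)
  define n1 where "n1 = nat \<lceil>(\<delta> + \<gamma>) * ((k - d) * (k - d)) / (\<gamma> / 2)\<rceil>"
  show ?thesis
  proof (rule exI[of _ "nA + 2 * nC + n1 + 3 * k + 1"], intro allI impI)
    fix V :: "'a set" and E
    assume a: "kgraph k V E \<and> card V \<ge> nA + 2 * nC + n1 + 3 * k + 1 \<and> (k - l) dvd card V \<and>
     (\<delta> + \<gamma>) * (card V choose (k - d)) \<le> min_deg k d V E"
    have finV: "finite V" and E: "E \<subseteq> nsets V k" using a by (auto simp: kgraph_def)
    have n: "card V > 0" "nA \<le> card V" "2 * nC \<le> card V" "3 * k \<le> card V" using a by auto
    have "(\<delta> + \<gamma>) * ((k - d) * (k - d)) / (\<gamma> / 2) \<le> card V" using a unfolding n1_def by linarith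
    then have "(\<delta> + \<gamma>) * ((k - d) * (k - d)) \<le> ((\<delta> + \<gamma>) - \<alpha>) * card V"
      using \<gamma> unfolding \<alpha>_def by (simp add: divide_le_eq mult.commute)
    then have cd: "cond E V V \<alpha>"
      using a delta_nonneg \<gamma> by (intro cond_of_min_deg[of V E "\<delta> + \<gamma>"]) (auto simp only: n)
    obtain L m W L' where p: "pth E L m W L'" "L \<union> W \<union> L' \<subseteq> V" "real (card (L \<union> W \<union> L')) \<le> \<zeta> * card V"
      and absorb: "\<forall>R. R \<subseteq> V - (L \<union> W \<union> L') \<and> real (card R) \<le> \<tau> * card V \<and> (k - l) dvd card R \<longrightarrow>
         (\<exists>m'. pth E L m' (W \<union> R) L')"
      using ab[rule_format, OF conjI[OF finV conjI[OF cd n(2)]]] by (elim exE conjE) (rule that; assumption)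
    define Y where "Y = L \<union> W \<union> L'"
    define U0 where "U0 = V - Y"
    have YV: "Y \<subseteq> V" using p(2) by (simp add: Y_def)
    have finY: "finite Y" using YV finV finite_subset by blast
    have cY: "real (card Y) \<le> \<zeta> * card V" using p(3) by (simp add: Y_def)
    have cU0: "card U0 = card V - card Y" using YV finY by (simp add: U0_def card_Diff_subset)
    have "\<zeta> * card V \<le> 1 / 2 * card V" using \<zeta>(2) by (intro mult_right_mono) auto
    then have half: "card V \<le> 2 * card U0" using cY cU0 by linarith
    have "real (k - d) * card Y / card V \<le> real (k - d) * \<zeta>"
    proof -
      have "real (card Y) / card V \<le> \<zeta>" using cY n(1) by (simp add: pos_divide_le_eq)
      then have "real (k - d) * (real (card Y) / card V) \<le> (k - d) * \<zeta>" by (intro mult_left_mono) auto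
      then show ?thesis by simp
    qed
    then have "\<delta> + \<gamma> / 4 \<le> \<alpha> - (k - d) * card Y / card V" using \<zeta>(3) unfolding of_nat_mult \<alpha>_def by linarith
    then have cd0: "cond E V U0 (\<delta> + \<gamma> / 4)"
      unfolding U0_def using \<gamma> delta_nonneg by (intro cond_Diff[OF finV YV cd n(1)]) auto
    note f = pth_facts[OF p(1)]
    have LU: "L' \<subseteq> V - U0" "L \<subseteq> V - U0" "L' \<inter> L = {}" "U0 \<subseteq> V" using YV f(7) by (auto simp: U0_def Y_def)
    have nU: "nC \<le> card U0" using n(3) half by linarith
    obtain W' m' where p': "W' \<subseteq> U0" "pth E L' m' W' L" "real (card (U0 - W')) \<le> \<epsilon> * card U0"
      using cov[rule_format, OF conjI[OF finV conjI[OF LU(4) conjI[OF half conjI[OF cd0 conjI[OF nU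
        conjI[OF LU(1) conjI[OF LU(2) conjI[OF f(5) conjI[OF f(4) LU(3)]]]]]]]]]]
      by (elim exE conjE) (rule that; assumption)
    note f' = pth_facts[OF p'(2)]
    define R where "R = U0 - W'"
    have RV: "R \<subseteq> V - (L \<union> W \<union> L')" by (auto simp: R_def U0_def Y_def)
    have finU0: "finite U0" using finV by (simp add: U0_def)
    have cYeq: "card Y = l + card W + l"
    proof -
      have "card (L \<union> W) = l + card W" using f by (simp add: card_Un_disjoint)
      moreover have "(L \<union> W) \<inter> L' = {}" using f(7,8) by blast
      ultimately show ?thesis using f by (simp add: Y_def card_Un_disjoint)
    qed
    have "card U0 = card W' + card R" using p'(1) finU0 unfolding R_def
      by (metis card_Diff_subset card_mono finite_subset le_add_diff_inverse)
    moreover have "card V = card U0 + card Y" using cU0 YV finV card_mono by fastforce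
    \<comment> \<open>The edges of the two paths account for a multiple of \<open>k - l\<close>
      vertices, so the leftover has a size that can be absorbed.\<close>
    ultimately have tot: "card V = card R + (m + m') * (k - l)" using cYeq f(10) f'(10) by (simp add: algebra_simps)
    have dv: "(k - l) dvd card R" using a tot by (metis dvd_add_left_iff dvd_triv_right)
    have "real (card R) \<le> \<epsilon> * card U0" using p'(3) by (simp add: R_def)
    also have "\<dots> \<le> \<tau> * card V" using \<epsilon> card_mono[OF finV LU(4)] \<tau> by (intro mult_mono) auto
    finally obtain m'' where p'': "pth E L m'' (W \<union> R) L'" using absorb[rule_format, of R] RV dv by blast
    have "card (W \<union> R) = card W + card R"
    proof (rule card_Un_disjoint)
      show "finite W" "finite R" using f finU0 by (auto simp: R_def)
      show "W \<inter> R = {}" using RV by blast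
    qed
    then have tot2: "card V = (m'' + m') * (k - l)"
      using tot f(10) pth_facts(10)[OF p''] f'(10) by (simp add: algebra_simps)
    have "3 * (k - l) \<le> 3 * k" by simp
    then have "3 * (k - l) \<le> (m'' + m') * (k - l)" using n(4) tot2 by linarith
    then have m3: "m'' + m' \<ge> 3" using kl by (simp only: mult_le_cancel2)
    show "has_ham_ell_cycle k l V E"
    proof (rule ham_cycle_of_pths[OF p'' p'(2) _ _ E m3])
      show "(W \<union> R) \<inter> W' = {}" using p'(1) by (auto simp: R_def U0_def Y_def)
      show "V = L \<union> (W \<union> R) \<union> L' \<union> W'" using p'(1) YV by (auto simp: R_def U0_def Y_def)
    qed
  qed
qed

end

section \<open>The extremal construction\<close>

lemma card_window_Int:
  assumes v: "inj_on v {..<n}" and n: "0 < n" "k \<le> n" and pg: "(p + g) mod n = p' mod n"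
  shows "k - g \<le> card (cyclic_window k n v p \<inter> cyclic_window k n v p')"
proof -
  let ?f = "\<lambda>j. v ((p' + j) mod n)"
  have "inj_on (v \<circ> (\<lambda>j. (p' + j) mod n)) {..<n}"
    using n v by (intro comp_inj_on inj_on_add_mod) (auto elim: inj_on_subset)
  then have "inj_on ?f {..<k - g}" unfolding comp_def by (rule inj_on_subset) (use n in auto)
  then have "k - g = card (?f ` {..<k - g})" by (simp add: card_image)
  also have "\<dots> \<le> card (cyclic_window k n v p \<inter> cyclic_window k n v p')"
  proof (rule card_mono)
    show "finite (cyclic_window k n v p \<inter> cyclic_window k n v p')" by (simp add: cyclic_window_def)
    show "?f ` {..<k - g} \<subseteq> cyclic_window k n v p \<inter> cyclic_window k n v p'"
    proof (rule image_subsetI)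
      fix j assume j: "j \<in> {..<k - g}"
      have "(p' + j) mod n = (p + (g + j)) mod n" using pg by (metis add.assoc mod_add_left_eq)
      moreover have "g + j \<in> {..<k}" using j by auto
      ultimately have "?f j \<in> cyclic_window k n v p" unfolding cyclic_window_def by (intro image_eqI[of _ _ "g + j"]) simp
      moreover have "?f j \<in> cyclic_window k n v p'" unfolding cyclic_window_def using j by (intro imageI) auto
      ultimately show "?f j \<in> cyclic_window k n v p \<inter> cyclic_window k n v p'" by blast
    qed
  qed
  finally show ?thesis .
qed

text \<open>Consecutive windows share only \<open>l\<close> vertices, so each gap between starts,
  including the one around the end, is at least \<open>k - l\<close>. The \<open>m\<close> gaps add
  up to \<open>n = m * (k - l)\<close>, so all are equal.\<close>

lemma window_starts:
  assumes v: "inj_on v {..<n}" and n: "k \<le> n" "m * (k - l) = n" and lk: "l < k" and m: "0 < m"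
    and s: "strict_mono_on {..<m} s" "s ` {..<m} \<subseteq> {..<n}"
    and I: "\<forall>i<m. card (cyclic_window k n v (s i) \<inter> cyclic_window k n v (s (Suc i mod m))) = l"
    and i: "i < m"
  shows "s i = s 0 + i * (k - l)"
proof -
  have n0: "0 < n" using n lk by linarith
  have sn: "s i < n" if "i < m" for i using s(2) that by auto
  have step: "s i + (k - l) \<le> s (Suc i)" if i: "Suc i < m" for i
  proof -
    have lt: "s i < s (Suc i)" using s(1) i by (intro strict_mono_onD[OF s(1)]) auto
    have "(s i + (s (Suc i) - s i)) mod n = s (Suc i) mod n" using lt by simp
    from card_window_Int[OF v n0 n(1) this] have "k - (s (Suc i) - s i) \<le> l" using I[rule_format, of i] i by simp
    then show ?thesis using lt lk by linarith
  qed
  have wrap: "s (m - 1) + (k - l) \<le> s 0 + n"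
  proof -
    have "s (m - 1) < n" using sn m by simp
    then have "(s (m - 1) + (s 0 + n - s (m - 1))) mod n = s 0 mod n" by simp
    from card_window_Int[OF v n0 n(1) this] have "k - (s 0 + n - s (m - 1)) \<le> l" using I[rule_format, of "m - 1"] m by simp
    then show ?thesis using \<open>s (m - 1) < n\<close> lk by linarith
  qed
  have up: "s i + j * (k - l) \<le> s (i + j)" if "i + j < m" for i j
    using that
  proof (induction j)
    case (Suc j)
    then have "s i + j * (k - l) \<le> s (i + j)" "s (i + j) + (k - l) \<le> s (Suc (i + j))" using step[of "i + j"] by auto
    then show ?case by simp
  qed simp
  have "s 0 + i * (k - l) \<le> s i" using up[of 0 i] i by simp
  moreover have "s i + (m - 1 - i) * (k - l) \<le> s (m - 1)" using up[of i "m - 1 - i"] i by simp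
  moreover have "n = i * (k - l) + (m - 1 - i) * (k - l) + (k - l)"
  proof -
    have "m = i + (m - 1 - i) + 1" using i by simp
    then show ?thesis using n(2) by (metis add_mult_distrib mult_1)
  qed
  ultimately show ?thesis using wrap by linarith
qed

text \<open>Measured from the first start in units of \<open>k - l\<close>, the vertex lies in unit
  \<open>q\<close>. A window begins with a unit and reaches into at most two, so it begins with unit
  \<open>q\<close> or, cyclically, with the one before.\<close>

lemma vertex_in_two_windows:
  assumes v: "bij_betw v {..<n} V" and n: "k \<le> n" "m * (k - l) = n" and lk: "2 * l \<le> k" "l < k" and m: "0 < m"
    and s: "strict_mono_on {..<m} s" "s ` {..<m} \<subseteq> {..<n}"
    and I: "\<forall>i<m. card (cyclic_window k n v (s i) \<inter> cyclic_window k n v (s (Suc i mod m))) = l"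
    and x: "x \<in> V"
  shows "card {i. i < m \<and> x \<in> cyclic_window k n v (s i)} \<le> 2"
proof -
  define c where "c = k - l"
  have c: "c > 0" "k \<le> 2 * c" "n = c * m" using lk n by (auto simp: c_def)
  have v_inj: "inj_on v {..<n}" using v by (rule bij_betw_imp_inj_on)
  obtain p where p: "p < n" "x = v p" using x bij_betw_imp_surj_on[OF v] by auto
  have s0: "s 0 < n" using s(2) m by auto
  define q where "q = ((p + (n - s 0)) mod n) div c"
  have q: "i = q \<or> (1 + i) mod m = q" if i: "i < m" and xi: "x \<in> cyclic_window k n v (s i)" for i
  proof -
    obtain j where j: "j < k" "x = v ((s i + j) mod n)" using xi by (auto simp: cyclic_window_def)
    have "(s i + j) mod n < n" using p by simp
    then have "p = (s i + j) mod n" using inj_onD[OF v_inj, of p "(s i + j) mod n"] p j(2) by auto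
    also have "s i = s 0 + i * c" unfolding c_def by (rule window_starts[OF v_inj n lk(2) m s I i])
    finally have pe: "p = (s 0 + i * c + j) mod n" .
    have "(p + (n - s 0)) mod n = (s 0 + i * c + j + (n - s 0)) mod n" unfolding pe by (simp add: mod_add_left_eq)
    also have "s 0 + i * c + j + (n - s 0) = i * c + j + n" using s0 by simp
    finally have "q = ((i * c + j) mod n) div c" by (simp add: q_def)
    also have "\<dots> = ((i * c + j) div c) mod m" using c by (simp add: mod_mult2_eq)
    also have "(i * c + j) div c = i + j div c" using c by simp
    finally have qi: "q = (i + j div c) mod m" .
    have "j div c < 2" using j(1) c by (simp add: div_less_iff_less_mult)
    then have "j div c = 0 \<or> j div c = 1" by linarith
    then show ?thesis using qi i by (auto simp: add.commute)
  qed
  let ?S = "{i. i < m \<and> (1 + i) mod m = q}"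
  have "card ?S \<le> 1"
  proof -
    have "inj_on (\<lambda>i. (1 + i) mod m) ?S" by (rule inj_on_subset[OF inj_on_add_mod]) auto
    moreover have "(\<lambda>i. (1 + i) mod m) ` ?S \<subseteq> {q}" by auto
    ultimately show ?thesis using card_inj_on_le[of _ ?S "{q}"] by simp
  qed
  have "card {i. i < m \<and> x \<in> cyclic_window k n v (s i)} \<le> card (insert q ?S)"
    using q by (intro card_mono) auto
  also have "\<dots> \<le> Suc (card ?S)" by (simp add: card_insert_if)
  finally show ?thesis using \<open>card ?S \<le> 1\<close> by linarith
qed

text \<open>Counting incidences: each of the \<open>m\<close> edges has to meet \<open>A\<close>,
  and a vertex of \<open>A\<close> serves at most two edges.\<close>

lemma no_ham_ell_cycle:
  assumes lk: "2 * l \<le> k" "l < k" and V: "card V = (k - l) * m" "k \<le> card V" "m > 0"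
    and A: "A \<subseteq> V" "2 * card A < m" and E: "\<And>e. e \<in> E \<Longrightarrow> e \<inter> A \<noteq> {}"
  shows "\<not> has_ham_ell_cycle k l V E"
proof
  assume "has_ham_ell_cycle k l V E"
  then obtain C where C: "C \<subseteq> E" "is_ell_cycle k l V C" by (auto simp: has_ham_ell_cycle_def)
  then have finV: "finite V" by (simp add: is_ell_cycle_def kgraph_def)
  define n where "n = card V"
  obtain v s m' where v: "bij_betw v {..<n} V" and s: "strict_mono_on {..<m'} s" "s ` {..<m'} \<subseteq> {..<n}"
    and Ceq: "C = (\<lambda>i. cyclic_window k n v (s i)) ` {..<m'}"
    and I: "\<forall>i<m'. card (cyclic_window k n v (s i) \<inter> cyclic_window k n v (s (Suc i mod m'))) = l"
    and m': "m' * (k - l) = n"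
    using C(2) unfolding is_ell_cycle_def n_def by blast
  have "m' = m" using m' V lk by (simp add: n_def mult.commute)
  have finA: "finite A" using A finV finite_subset by auto
  have kn: "k \<le> n" using V by (simp add: n_def)
  have "(\<Sum>i<m. (1::nat)) \<le> (\<Sum>i\<in>{..<m}. card {x \<in> A. x \<in> cyclic_window k n v (s i)})"
  proof (intro sum_mono)
    fix i assume "i \<in> {..<m}"
    then have "cyclic_window k n v (s i) \<inter> A \<noteq> {}" using C(1) Ceq E \<open>m' = m\<close> by blast
    then have "{x \<in> A. x \<in> cyclic_window k n v (s i)} \<noteq> {}" by blast
    then have "card {x \<in> A. x \<in> cyclic_window k n v (s i)} > 0" using finA by (simp add: card_gt_0_iff)
    then show "(1::nat) \<le> card {x \<in> A. x \<in> cyclic_window k n v (s i)}" by simp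
  qed
  also have "\<dots> = (\<Sum>x\<in>A. card {i \<in> {..<m}. x \<in> cyclic_window k n v (s i)})" using finA by (intro sum_card_swap) auto
  also have "\<dots> \<le> (\<Sum>x\<in>A. 2)"
  proof (intro sum_mono)
    fix x assume "x \<in> A"
    then have "x \<in> V" using A by auto
    from vertex_in_two_windows[OF v kn m' lk _ s I this]
    show "card {i \<in> {..<m}. x \<in> cyclic_window k n v (s i)} \<le> 2" using V(3) \<open>m' = m\<close> by simp
  qed
  finally show False using A(2) by simp
qed

section \<open>Degrees of the construction and the limit\<close>

lemma min_deg_le_binomial:
  assumes "kgraph k V E" "d \<le> card V" "d \<le> k"
  shows "min_deg k d V E \<le> card V choose (k - d)"
proof -
  have finV: "finite V" using assms by (simp add: kgraph_def)
  obtain S where S: "S \<subseteq> V" "card S = d" "finite S" using obtain_subset_with_card_n[OF assms(2)] by metis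
  then have "S \<in> nsets V d" by (auto simp: nsets_def)
  then have "min_deg k d V E \<le> hdeg k V E S"
    unfolding min_deg_def using finV by (intro Min_le) (auto intro: finite_imp_finite_nsets)
  also have "\<dots> \<le> card {B. B \<subseteq> V \<and> card B = k - d}"
    unfolding hdeg_def using S finV by (intro card_mono) (auto simp: nsets_def)
  also have "\<dots> = card V choose (k - d)" by (rule n_subsets[OF finV])
  finally show ?thesis .
qed

text \<open>A \<open>d\<close>-set that meets \<open>A\<close> can be extended arbitrarily; one that
  avoids \<open>A\<close> loses the extensions that avoid \<open>A\<close> too. The bound is
  additive so that no truncated subtraction occurs.\<close>

lemma min_deg_meeting:
  assumes finV: "finite V" and A: "A \<subseteq> V" and d: "d \<le> k" "d \<le> card V"
  defines "E \<equiv> {e \<in> nsets V k. e \<inter> A \<noteq> {}}"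
  shows "((card V - d) choose (k - d)) \<le> min_deg k d V E + ((card V - d - card A) choose (k - d))"
proof -
  obtain S0 where "S0 \<subseteq> V" "card S0 = d" "finite S0" using obtain_subset_with_card_n[OF d(2)] by metis
  then have "nsets V d \<noteq> {}" by (auto simp: nsets_def)
  then have "min_deg k d V E \<in> hdeg k V E ` nsets V d"
    unfolding min_deg_def using finV by (intro Min_in) (auto intro: finite_imp_finite_nsets)
  then obtain S where S: "S \<in> nsets V d" "min_deg k d V E = hdeg k V E S" by auto
  have SV: "S \<subseteq> V" "card S = d" "finite S" using S(1) by (auto simp: nsets_def)
  let ?s = "k - d"
  let ?X = "{B. B \<subseteq> V - S \<and> card B = ?s}"
  let ?H = "{T \<in> nsets V ?s. T \<union> S \<in> E}"
  let ?Y = "{B. B \<subseteq> V - S - A \<and> card B = ?s}"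
  have cX: "card ?X = (card V - d) choose ?s" using SV finV by (simp add: n_subsets card_Diff_subset)
  have finA: "finite A" using A finV finite_subset by auto
  have finH: "finite ?H" using finite_imp_finite_nsets[OF finV] by simp
  have finY: "finite ?Y" by (rule finite_subset[of _ "Pow V"]) (use finV in auto)
  have join: "B \<union> S \<in> nsets V k" "B \<in> nsets V ?s" if "B \<in> ?X" for B
  proof -
    have B: "B \<subseteq> V - S" "card B = ?s" using that by auto
    have fB: "finite B" using B(1) finV by (meson finite_Diff finite_subset)
    have "card (B \<union> S) = card B + card S" using B(1) fB SV(3) by (intro card_Un_disjoint) auto
    then have "card (B \<union> S) = k" using B(2) SV(2) d(1) by linarith
    then show "B \<union> S \<in> nsets V k" "B \<in> nsets V ?s" using B fB SV by (auto simp: nsets_def)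
  qed
  show ?thesis
  proof (cases "S \<inter> A = {}")
    case True
    have "?X \<subseteq> ?H \<union> ?Y"
    proof
      fix B assume B: "B \<in> ?X"
      show "B \<in> ?H \<union> ?Y"
      proof (cases "B \<inter> A = {}")
        case False
        then have "(B \<union> S) \<inter> A \<noteq> {}" by blast
        then have "B \<in> ?H" using join[OF B] by (simp only: E_def mem_Collect_eq simp_thms)
        then show ?thesis by (rule UnI1)
      next
        case True
        then have "B \<in> ?Y" using B by blast
        then show ?thesis by (rule UnI2)
      qed
    qed
    then have "card ?X \<le> card (?H \<union> ?Y)" using finH finY by (intro card_mono finite_UnI)
    also have "\<dots> \<le> card ?H + card ?Y" by (rule card_Un_le)
    also have "card ?Y = (card V - d - card A) choose ?s"
    proof -
      have "A \<subseteq> V - S" using A True by blast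
      then have "card (V - S - A) = card V - d - card A" using SV finA by (simp add: card_Diff_subset)
      then show ?thesis using finV by (simp add: n_subsets)
    qed
    finally show ?thesis using cX S(2) SV(2) by (simp add: hdeg_def)
  next
    case False
    have "?X \<subseteq> ?H"
    proof
      fix B assume B: "B \<in> ?X"
      have "(B \<union> S) \<inter> A \<noteq> {}" using False by blast
      then show "B \<in> ?H" using join[OF B] by (simp only: E_def mem_Collect_eq simp_thms)
    qed
    then have "card ?X \<le> card ?H" using finH by (intro card_mono)
    then show ?thesis using cX S(2) SV(2) by (simp add: hdeg_def)
  qed
qed

lemma ham_threshold_le:
  assumes "\<And>(V::nat set) E. \<lbrakk>kgraph k V E; card V = n; h \<le> min_deg k d V E\<rbrakk> \<Longrightarrow> has_ham_ell_cycle k l V E"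
  shows "ham_threshold d l k n \<le> h"
  unfolding ham_threshold_def using assms by (intro Least_le) blast

text \<open>A valid threshold exists, because a value above \<open>n choose (k - d)\<close> is never
  attained by the minimum degree. So the least one is itself valid, and a graph without Hamilton
  cycle must stay below it.\<close>

lemma ham_threshold_gt:
  fixes V :: "nat set"
  assumes g: "kgraph k V E" "card V = n" "\<not> has_ham_ell_cycle k l V E" and d: "d \<le> k" "d \<le> n"
  shows "min_deg k d V E < ham_threshold d l k n"
proof -
  have "\<forall>(V::nat set) E. kgraph k V E \<and> card V = n \<and> ham_threshold d l k n \<le> min_deg k d V E \<longrightarrow> has_ham_ell_cycle k l V E"
    unfolding ham_threshold_def
  proof (rule LeastI[of _ "(n choose (k - d)) + 1"], intro allI impI)
    fix V :: "nat set" and E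
    assume "kgraph k V E \<and> card V = n \<and> (n choose (k - d)) + 1 \<le> min_deg k d V E"
    then have False using min_deg_le_binomial[of k V E d] d by auto
    then show "has_ham_ell_cycle k l V E" ..
  qed
  then have "\<not> ham_threshold d l k n \<le> min_deg k d V E" using g by blast
  then show ?thesis by (rule not_le_imp_less)
qed

text \<open>Binomial coefficients are compared with powers, the first from below and the others from
  above. The \<open>- 1\<close> in the bound on \<open>a\<close> allows for rounding and becomes the
  term \<open>1 / N\<close>.\<close>

lemma binomial_diff_ratio_ge:
  fixes \<theta> :: real
  assumes N: "N > d" and a: "real a \<ge> \<theta> * N - 1" "d + a \<le> N" and s: "s \<le> N"
  shows "(1 - real (s * s) / (real N - real d)) * (1 - real d / real N) ^ s - (1 - \<theta> + 1 / N) ^ s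
     \<le> (real ((N - d) choose s) - real ((N - d - a) choose s)) / real (N choose s)"
proof -
  have N0: "real N > 0" using N by simp
  define F where "F = (fact s :: real)"
  have F: "F > 0" by (simp add: F_def)
  have C: "real (N choose s) > 0" using s by simp
  have up: "F * real (M choose s) \<le> real M ^ s" for M
  proof -
    have "real ((M choose s) * fact s) \<le> real (M ^ s)" by (intro of_nat_mono binomial_fact_pow)
    then show ?thesis by (simp add: F_def mult.commute)
  qed
  have low: "(1 - real (s * s) / real (N - d)) * real (N - d) ^ s \<le> F * real ((N - d) choose s)"
    using card_distinct_tup_ge[of "{..<N - d}" s] N by (simp add: F_def lessThan_empty_iff)
  have mono: "((N - d - a) choose s) \<le> ((N - d) choose s)" by (intro binomial_right_mono) simp
  have num: "real ((N - d) choose s) - real ((N - d - a) choose s) \<ge> 0" using mono by simp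
  have "(1 - real (s * s) / (real N - real d)) * (1 - real d / real N) ^ s = (1 - real (s * s) / real (N - d)) * real (N - d) ^ s / real N ^ s"
  proof -
    have "1 - real d / real N = real (N - d) / real N" using N by (simp add: of_nat_diff field_simps)
    then show ?thesis using N by (simp add: power_divide of_nat_diff)
  qed
  also have "\<dots> \<le> F * real ((N - d) choose s) / real N ^ s" using low by (intro divide_right_mono) auto
  finally have 1: "(1 - real (s * s) / (real N - real d)) * (1 - real d / real N) ^ s \<le> F * real ((N - d) choose s) / real N ^ s" .
  have "F * real ((N - d - a) choose s) / real N ^ s \<le> real (N - d - a) ^ s / real N ^ s" using up by (intro divide_right_mono) auto
  also have "\<dots> = (real (N - d - a) / real N) ^ s" by (simp add: power_divide)
  also have "\<dots> \<le> (1 - \<theta> + 1 / N) ^ s"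
  proof (intro power_mono)
    have "real (N - d - a) \<le> (1 - \<theta> + 1 / N) * N" using a N0 by (simp add: of_nat_diff algebra_simps)
    then show "real (N - d - a) / real N \<le> 1 - \<theta> + 1 / N" using N0 by (simp add: pos_divide_le_eq)
  qed simp
  finally have 2: "F * real ((N - d - a) choose s) / real N ^ s \<le> (1 - \<theta> + 1 / N) ^ s" .
  have "(1 - real (s * s) / (real N - real d)) * (1 - real d / real N) ^ s - (1 - \<theta> + 1 / N) ^ s
     \<le> F * (real ((N - d) choose s) - real ((N - d - a) choose s)) / real N ^ s"
    using 1 2 by (simp add: right_diff_distrib diff_divide_distrib)
  also have "\<dots> \<le> F * (real ((N - d) choose s) - real ((N - d - a) choose s)) / (F * real (N choose s))"
  proof (rule divide_left_mono[OF up])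
    show "0 \<le> F * (real ((N - d) choose s) - real ((N - d - a) choose s))" using num F by (intro mult_nonneg_nonneg) auto
    show "0 < real N ^ s * (F * real (N choose s))" by (intro mult_pos_pos zero_less_power N0 F C)
  qed
  also have "\<dots> = (real ((N - d) choose s) - real ((N - d - a) choose s)) / real (N choose s)" using F by simp
  finally show ?thesis .
qed

context loose
begin

lemma threshold_ratio_lower:
  "\<exists>g :: nat \<Rightarrow> real. g \<longlonglongrightarrow> \<delta> \<and> (\<forall>\<^sub>F m in sequentially.
     g m \<le> real (ham_threshold d l k ((k - l) * m)) / real (((k - l) * m) choose (k - d)))"
proof -
  define c where "c = k - l"
  define s where "s = k - d"
  define \<theta> where "\<theta> = 1 / (2 * real c)"
  have c: "c > 0" using two_l by (simp add: c_def)
  define N where "N m = c * m" for m :: nat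
  define g where "g m = (1 - real (s * s) / (real (N m) - real d)) * (1 - real d / real (N m)) ^ s
     - (1 - \<theta> + 1 / real (N m)) ^ s" for m
  have Ninf: "filterlim (\<lambda>m. real (N m)) at_top sequentially"
  proof -
    have "filterlim (\<lambda>m. real c * real m) at_top sequentially"
      using c by (intro filterlim_tendsto_pos_mult_at_top[OF tendsto_const] filterlim_real_sequentially) auto
    then show ?thesis by (simp add: N_def)
  qed
  have Nd: "filterlim (\<lambda>m. real (N m) - real d) at_top sequentially"
    using filterlim_tendsto_add_at_top[OF tendsto_const[of "- real d"] Ninf] by (simp add: algebra_simps)
  have "g \<longlonglongrightarrow> (1 - 0) * (1 - 0) ^ s - (1 - \<theta> + 0) ^ s"
    unfolding g_def
    by (intro tendsto_intros tendsto_divide_0[OF tendsto_const] filterlim_at_top_imp_at_infinity Ninf Nd)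
  then have lim: "g \<longlonglongrightarrow> \<delta>" by (simp add: \<delta>_def s_def \<theta>_def c_def)
  have "eventually (\<lambda>m. m \<ge> 3 * k + 3) sequentially" by (rule eventually_ge_at_top)
  then have "\<forall>\<^sub>F m in sequentially. g m \<le> real (ham_threshold d l k (N m)) / real (N m choose s)"
  proof eventually_elim
    case (elim m)
    have "1 * m \<le> c * m" using c by (intro mult_le_mono1) simp
    then have Nm: "3 * k + 3 \<le> N m" "m \<le> N m" using elim unfolding N_def by linarith+
    \<comment> \<open>The largest size with \<open>2 * a < m\<close>; it is
      \<open>N m / (2 * c)\<close> up to rounding.\<close>
    define a where "a = (m - 1) div 2"
    have a2: "2 * a < m" "m \<le> 2 * a + 2" using elim by (auto simp: a_def)
    define V where "V = {..<N m}"
    define A where "A = {..<a}"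
    define E where "E = {e \<in> nsets V k. e \<inter> A \<noteq> {}}"
    have cV: "finite V" "card V = N m" by (auto simp: V_def)
    have AV: "A \<subseteq> V" "card A = a" using a2 Nm by (auto simp: A_def V_def)
    have "\<not> has_ham_ell_cycle k l V E"
      using two_l Nm elim a2 cV AV by (intro no_ham_ell_cycle[where m = m and A = A]) (auto simp: E_def N_def c_def)
    moreover have "kgraph k V E" using cV by (auto simp: kgraph_def E_def)
    ultimately have 1: "min_deg k d V E < ham_threshold d l k (N m)"
      using cV d_k Nm by (intro ham_threshold_gt) auto
    have "((card V - d) choose (k - d)) \<le> min_deg k d V E + ((card V - d - card A) choose (k - d))"
      unfolding E_def using cV AV d_k Nm by (intro min_deg_meeting) auto
    then have "real ((N m - d) choose s) - real ((N m - d - a) choose s) \<le> real (min_deg k d V E)"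
      unfolding cV AV s_def by linarith
    also have "\<dots> \<le> real (ham_threshold d l k (N m))" using 1 by simp
    finally have 2: "(real ((N m - d) choose s) - real ((N m - d - a) choose s)) / real (N m choose s)
       \<le> real (ham_threshold d l k (N m)) / real (N m choose s)" by (intro divide_right_mono) auto
    have "g m \<le> (real ((N m - d) choose s) - real ((N m - d - a) choose s)) / real (N m choose s)"
      unfolding g_def
    proof (rule binomial_diff_ratio_ge)
      show "d < N m" "s \<le> N m" using Nm d_k by (auto simp: s_def)
      have "\<theta> * real (N m) = real m / 2" using c by (simp add: \<theta>_def N_def)
      then show "\<theta> * real (N m) - 1 \<le> real a" using a2(2) by linarith
      show "d + a \<le> N m" using Nm a2 elim d_k by linarith
    qed
    then show ?case using 2 by linarith
  qed
  then show ?thesis using lim unfolding N_def c_def s_def by blast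
qed

lemma threshold_ratio_upper:
  fixes y :: real
  assumes "\<delta> < y"
  shows "\<forall>\<^sub>F m in sequentially. real (ham_threshold d l k ((k - l) * m)) / real (((k - l) * m) choose (k - d)) < y"
proof -
  define \<gamma> where "\<gamma> = (y - \<delta>) / 2"
  have \<gamma>: "\<gamma> > 0" using assms by (simp add: \<gamma>_def)
  define s where "s = k - d"
  have s: "s > 0" using d_k by (simp add: s_def)
  obtain n0 :: nat where n0: "\<forall>(V::nat set) E. kgraph k V E \<and> card V \<ge> n0 \<and> (k - l) dvd card V \<and>
     (\<delta> + \<gamma>) * (card V choose (k - d)) \<le> min_deg k d V E \<longrightarrow> has_ham_ell_cycle k l V E"
    using hamilton_above_threshold[OF \<gamma>] by (elim exE) (rule that)
  have "eventually (\<lambda>m. m \<ge> n0 + s + nat \<lceil>s / \<gamma>\<rceil> + 1) sequentially" by (rule eventually_ge_at_top)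
  then show ?thesis
  proof eventually_elim
    case (elim m)
    define N where "N = (k - l) * m"
    have "1 * m \<le> N" unfolding N_def using two_l by (intro mult_le_mono1) auto
    then have N: "n0 \<le> N" "s \<le> N" "nat \<lceil>s / \<gamma>\<rceil> + 1 \<le> N" using elim by auto
    have C0: "real (N choose s) > 0" using N by simp
    define h where "h = nat \<lceil>(\<delta> + \<gamma>) * real (N choose s)\<rceil>"
    have h: "(\<delta> + \<gamma>) * real (N choose s) \<le> h" "real h < (\<delta> + \<gamma>) * real (N choose s) + 1"
    proof -
      have "(\<delta> + \<gamma>) * real (N choose s) \<ge> 0" using delta_nonneg \<gamma> by simp
      then show "(\<delta> + \<gamma>) * real (N choose s) \<le> h" "real h < (\<delta> + \<gamma>) * real (N choose s) + 1"
        unfolding h_def by linarith+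
    qed
    have "ham_threshold d l k N \<le> h"
    proof (rule ham_threshold_le)
      fix V :: "nat set" and E
      assume V: "kgraph k V E" "card V = N" "h \<le> min_deg k d V E"
      have "(\<delta> + \<gamma>) * real (N choose s) \<le> min_deg k d V E" using h(1) V(3) by linarith
      then show "has_ham_ell_cycle k l V E"
        using n0[rule_format, of V E] V(1,2) N(1) by (simp add: s_def N_def)
    qed
    then have "real (ham_threshold d l k N) < (\<delta> + \<gamma>) * real (N choose s) + 1" using h(2) by linarith
    \<comment> \<open>Rounding the threshold up to an integer costs less than one, which a second
      \<open>\<gamma>\<close> covers; hence \<open>\<gamma>\<close> is half of
      \<open>y - \<delta>\<close>.\<close>
    also have "1 \<le> \<gamma> * real (N choose s)"
    proof -
      have "s / \<gamma> \<le> N" using N(3) by linarith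
      then have "1 \<le> \<gamma> * (real N / real s)" using \<gamma> s by (simp add: field_simps)
      also have "real N / real s \<le> (real N / real s) ^ s" using s N by (intro self_le_power) auto
      also have "\<dots> \<le> real (N choose s)" using binomial_ge_n_over_k_pow_k[of s N, where 'a = real] N by simp
      finally show ?thesis using \<gamma> by simp
    qed
    finally have "real (ham_threshold d l k N) < (\<delta> + 2 * \<gamma>) * real (N choose s)" by (simp add: algebra_simps)
    moreover have "\<delta> + 2 * \<gamma> = y" by (simp add: \<gamma>_def diff_divide_distrib)
    ultimately show ?case using C0 by (simp add: pos_divide_less_eq N_def s_def)
  qed
qed

theorem ham_threshold_density_eq: "ham_threshold_density d l k = ereal \<delta>"
proof -
  let ?f = "\<lambda>m. real (ham_threshold d l k ((k - l) * m)) / real (((k - l) * m) choose (k - d))"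
  obtain g :: "nat \<Rightarrow> real" where g: "g \<longlonglongrightarrow> \<delta>" "\<forall>\<^sub>F m in sequentially. g m \<le> ?f m"
    using threshold_ratio_lower by blast
  have "?f \<longlonglongrightarrow> \<delta>"
  proof (rule order_tendstoI)
    fix y assume "y < \<delta>"
    then have "\<forall>\<^sub>F m in sequentially. y < g m" by (rule order_tendstoD(1)[OF g(1)])
    with g(2) show "\<forall>\<^sub>F m in sequentially. y < ?f m" by eventually_elim simp
  qed (rule threshold_ratio_upper)
  then have "(\<lambda>m. ereal (?f m)) \<longlonglongrightarrow> ereal \<delta>" by (rule tendsto_ereal)
  then show ?thesis unfolding ham_threshold_density_def by (intro lim_imp_Limsup) simp_all
qed

end

theorem theorem1p7:
  fixes k l d :: nat
  assumes "k > 0" and "l > 0" and "d > 0"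
    and "(k \<ge> 3 \<and> k - l \<le> d \<and> d < 2 * l \<and> 2 * l \<le> k - 1 \<and>
          2 * int k - 2 * int l \<ge>
            (2 * (2 * int k - 2 * int l - int d)\<^sup>2 + 1) * (int k - int d - 1) + 1)
       \<or> (odd k \<and> k \<ge> 7 \<and> l = (k - 1) div 2 \<and> d = k - 3)"
  shows "ham_threshold_density d l k =
           ereal (1 - (1 - 1 / (2 * (real k - real l))) ^ (k - d))"
proof -
  \<comment> \<open>In the second case \<open>k = 2 * j + 1\<close>, \<open>l = j\<close> and
    \<open>d = 2 * j - 2\<close>; \<open>k \<ge> 7\<close> means \<open>j \<ge> 3\<close>, which is
    what makes \<open>k - l = j + 1\<close> at most \<open>d\<close>.\<close>
  have "2 * l < k \<and> k - l \<le> d \<and> d < k"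
  proof (rule disjE[OF assms(4)])
    assume "odd k \<and> k \<ge> 7 \<and> l = (k - 1) div 2 \<and> d = k - 3"
    then show ?thesis by (auto elim!: oddE)
  qed (use assms(1) in linarith)
  then interpret loose k l d using assms(2) by unfold_locales auto
  show ?thesis using ham_threshold_density_eq two_l by (simp add: \<delta>_def of_nat_diff)
qed

end
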